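(* Let $n\ge 2$ and let $b\in L_1(\mathbb R,L_\infty(\mathbb R^n))\cap L_\infty(\mathbb R^{1+n})$. Then there exist isomorphisms $W_+,W_-:E\to E$ of the energy space $E=\dot H^1(\mathbb R^n)\times L_2(\mathbb R^n)$ with the following property. For $(u_1,u_2)\in E$ let $u$ be the (energy) solution of the Cauchy problem $$\partial_t^2u-\Delta u+b(t,x)\,\partial_t u=0,\qquad u(0,\cdot)=u_1,\qquad \mathrm D_tu(0,\cdot)=u_2,$$ and, for the choice of sign $\pm$, let $(\tilde u_1,\tilde u_2)=W_\pm(u_1,u_2)$ and let $\tilde u$ be the solution of the free wave equation $\partial_t^2\tilde u-\Delta\tilde u=0$ with $\tilde u(0,\cdot)=\tilde u_1$, $\mathrm D_t\tilde u(0,\cdot)=\tilde u_2$. Then $$\|(u(t,\cdot),\mathrm D_tu(t,\cdot))-(\tilde u(t,\cdot),\mathrm D_t\tilde u(t,\cdot))\|_E\to0\qquad\text{as } t\to\pm\infty.$$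
   Context: $\mathrm D_t=-i\partial_t$. $\dot H^1(\mathbb R^n)$ is the homogeneous Sobolev space $|\mathrm D|^{-1}L_2(\mathbb R^n)$, where $|\mathrm D|=\sqrt{-\Delta}$ and $|\mathrm D|^{-1}$ is the Riesz potential of order 1; the energy space $E=\dot H^1\times L_2$ carries the norm $\|(v_1,v_2)\|_E=(\||\mathrm D|v_1\|_{L_2}^2+\|v_2\|_{L_2}^2)^{1/2}$. Solutions are understood as energy solutions, i.e. $t\mapsto(u(t,\cdot),\mathrm D_tu(t,\cdot))$ is a continuous curve in $E$. *)

theory Defs
  imports "HOL-Analysis.Analysis"
begin

text \<open>Test functions: real-valued, compactly supported, continuously differentiable
  (C^1 test functions give the same weak derivatives of first order as C^infinity ones).\<close>
definition test_fun :: "('a::euclidean_space \<Rightarrow> real) \<Rightarrow> bool" where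
  "test_fun \<phi> \<longleftrightarrow> (\<exists>K. compact K \<and> (\<forall>x. x \<notin> K \<longrightarrow> \<phi> x = 0))
     \<and> (\<forall>x. \<phi> differentiable (at x))
     \<and> (\<forall>v. continuous_on UNIV (\<lambda>x. frechet_derivative \<phi> (at x) v))"

definition pd :: "('a::euclidean_space \<Rightarrow> real) \<Rightarrow> 'a \<Rightarrow> 'a \<Rightarrow> real" where
  "pd \<phi> v x = frechet_derivative \<phi> (at x) v"

definition locally_integrable :: "('a::euclidean_space \<Rightarrow> complex) \<Rightarrow> bool" where
  "locally_integrable f \<longleftrightarrow> f \<in> borel_measurable lborel
     \<and> (\<forall>K. compact K \<longrightarrow> set_integrable lborel K f)"

definition L2fun :: "('a::euclidean_space \<Rightarrow> complex) \<Rightarrow> bool" where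
  "L2fun f \<longleftrightarrow> f \<in> borel_measurable lborel \<and> integrable lborel (\<lambda>x. (cmod (f x))\<^sup>2)"

definition weak_grad :: "(real^'n \<Rightarrow> complex) \<Rightarrow> (real^'n \<Rightarrow> complex^'n) \<Rightarrow> bool" where
  "weak_grad f g \<longleftrightarrow> locally_integrable f \<and> (\<forall>j. locally_integrable (\<lambda>x. g x $ j))
     \<and> (\<forall>\<phi> j. test_fun \<phi> \<longrightarrow>
          (\<integral>x. f x * complex_of_real (pd \<phi> (axis j 1) x) \<partial>lborel)
           = - (\<integral>x. g x $ j * complex_of_real (\<phi> x) \<partial>lborel))"

text \<open>Homogeneous Sobolev space \<dot>H^1: locally integrable functions with L2 weak gradient
  (elements are identified modulo constants through the seminorm).\<close>
definition Hdot1 :: "(real^'n \<Rightarrow> complex) \<Rightarrow> bool" where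
  "Hdot1 f \<longleftrightarrow> (\<exists>g. weak_grad f g \<and> (\<forall>j. L2fun (\<lambda>x. g x $ j)))"

definition gradf :: "(real^'n \<Rightarrow> complex) \<Rightarrow> (real^'n \<Rightarrow> complex^'n)" where
  "gradf f = (SOME g. weak_grad f g \<and> (\<forall>j. L2fun (\<lambda>x. g x $ j)))"

type_synonym 'n epair = "(real^('n) \<Rightarrow> complex) \<times> (real^'n \<Rightarrow> complex)"

definition in_E :: "('n::finite) epair \<Rightarrow> bool" where
  "in_E p \<longleftrightarrow> Hdot1 (fst p) \<and> L2fun (snd p)"

text \<open>Energy norm (||\<nabla>v1||^2 + ||v2||^2)^(1/2); note || |D| v ||_2 = || \<nabla> v ||_2.\<close>
definition enorm :: "('n::finite) epair \<Rightarrow> real" where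
  "enorm p = sqrt ((\<integral>x. (\<Sum>j\<in>UNIV. (cmod (gradf (fst p) x $ j))\<^sup>2) \<partial>lborel)
                 + (\<integral>x. (cmod (snd p x))\<^sup>2 \<partial>lborel))"

definition elin :: "complex \<Rightarrow> ('n::finite) epair \<Rightarrow> complex \<Rightarrow> 'n epair \<Rightarrow> 'n epair" where
  "elin a p c q = ((\<lambda>x. a * fst p x + c * fst q x), (\<lambda>x. a * snd p x + c * snd q x))"

definition ediff :: "('n::finite) epair \<Rightarrow> 'n epair \<Rightarrow> 'n epair" where
  "ediff p q = elin 1 p (-1) q"

text \<open>Isomorphism of the energy space (maps on representatives; equality in E means
  zero energy-norm distance): complex linear, bounded, bounded below, surjective.\<close>
definition E_iso :: "(('n::finite) epair \<Rightarrow> 'n epair) \<Rightarrow> bool" where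
  "E_iso W \<longleftrightarrow> (\<forall>p. in_E p \<longrightarrow> in_E (W p))
    \<and> (\<forall>p q a c. in_E p \<longrightarrow> in_E q \<longrightarrow> enorm (ediff (W (elin a p c q)) (elin a (W p) c (W q))) = 0)
    \<and> (\<exists>C. \<forall>p. in_E p \<longrightarrow> enorm (W p) \<le> C * enorm p)
    \<and> (\<exists>c>0. \<forall>p. in_E p \<longrightarrow> c * enorm p \<le> enorm (W p))
    \<and> (\<forall>q. in_E q \<longrightarrow> (\<exists>p. in_E p \<and> enorm (ediff (W p) q) = 0))"

text \<open>Energy solution of  \<partial>_t^2 u - \<Delta> u + b \<partial>_t u = 0  with Cauchy data p = (u1,u2):
  u t = u(t,.), w t = D_t u(t,.) = -i \<partial>_t u(t,.), G t = \<nabla>_x u(t,.).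
  The curve t \<mapsto> (u t, w t) is continuous in E, D_t u = w and the equation hold in the
  sense of distributions on R^{1+n}, and (u 0, w 0) = p in E.
  Weak form: \<partial>_t u = i w, and  i \<partial>_t w - \<Delta> u + i b w = 0.\<close>
definition energy_sol :: "(real \<times> (real^('n::finite)) \<Rightarrow> complex) \<Rightarrow> (real \<Rightarrow> real^'n \<Rightarrow> complex)
    \<Rightarrow> (real \<Rightarrow> real^'n \<Rightarrow> complex) \<Rightarrow> 'n epair \<Rightarrow> bool" where
  "energy_sol b u w p \<longleftrightarrow> (\<exists>G :: real \<Rightarrow> real^'n \<Rightarrow> complex^'n.
     (\<lambda>z. u (fst z) (snd z)) \<in> borel_measurable lborel
   \<and> (\<lambda>z. w (fst z) (snd z)) \<in> borel_measurable lborel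
   \<and> (\<lambda>z. G (fst z) (snd z)) \<in> borel_measurable lborel
   \<and> locally_integrable (\<lambda>z. u (fst z) (snd z))
   \<and> (\<forall>t. in_E (u t, w t) \<and> weak_grad (u t) (G t) \<and> (\<forall>j. L2fun (\<lambda>x. G t x $ j)))
   \<and> (\<forall>t0. ((\<lambda>t. enorm (ediff (u t, w t) (u t0, w t0))) \<longlongrightarrow> 0) (at t0))
   \<and> (\<forall>\<psi>. test_fun \<psi> \<longrightarrow>
        (\<integral>z. u (fst z) (snd z) * complex_of_real (pd \<psi> (1, 0) z) \<partial>lborel)
        = - (\<integral>z. \<i> * w (fst z) (snd z) * complex_of_real (\<psi> z) \<partial>lborel))
   \<and> (\<forall>\<psi>. test_fun \<psi> \<longrightarrow>
        (\<integral>z. - \<i> * w (fst z) (snd z) * complex_of_real (pd \<psi> (1, 0) z)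
             + (\<Sum>j\<in>UNIV. G (fst z) (snd z) $ j * complex_of_real (pd \<psi> (0, axis j 1) z))
             + \<i> * b z * w (fst z) (snd z) * complex_of_real (\<psi> z) \<partial>lborel) = 0)
   \<and> enorm (ediff (u 0, w 0) p) = 0)"

end

theory Submission
  imports Defs
begin

text \<open>With \<open>g = \<nabla>u\<close> and \<open>z = \<partial>\<^sub>t u\<close> the equation becomes a first order symmetric system for the state
  \<open>F = (g, z)\<close> in the closed subspace of \<open>L\<^sub>2\<close> where \<open>g\<close> is a gradient. The free evolution is a group of
  isometries, obtained as the limit of the exponentials of bounded skew-adjoint difference
  operators. In the interaction picture \<open>V(t) = U(- t) F(t)\<close> a weak solution satisfies
  \<open>V(t) - V(s) = - \<integral> U(- r) (b(r) (U(r) V(r))\<^sub>z) dr\<close>, whose generator has operator norm at most \<open>\<beta>(r)\<close>.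
  Since \<open>\<beta>\<close> is integrable, the time axis splits into finitely many intervals on which this equation
  is solved by a contraction, the solution at each end being an invertible function of the other;
  hence \<open>V(t)\<close> converges to the value of an isomorphism at \<open>V(0)\<close>. For a free solution \<open>V\<close> is constant,
  so the limit of \<open>V\<close> is the datum of the free solution to which \<open>u\<close> is asymptotic.\<close>

text \<open>The energy sees u(t) only up to a constant that may depend on t. Hence the state keeps
  the gradient instead of u, the gradients have to be shown to form a closed subspace (a Poincare
  inequality on balls supplies convergent potentials), and the relation between u and its time
  derivative can be exploited only through test functions of mean zero. A weak solution may be
  tested with compactly supported functions only, while the interaction picture tests it with states
  \<open>U(r) q\<close>. The weak equation therefore has to be extended to these states, which is
  the purpose of the core argument. As both factors of the pairing are merely continuous in norm,
  the product rule is then proved by comparing increments. Vector valued integrals are understood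
  weakly: scalar integrals define a bounded functional, and Riesz representation returns a vector,
  so that only scalar functions have to be measurable. Complex values are treated as real vectors;
  complex linearity is recovered from commutation with multiplication by i. Negative times are
  reduced to positive ones by reversing time in the abstract equation.\<close>

section \<open>Hilbert space preliminaries\<close>

text \<open>Chaining steps of length at most \<open>\<delta>\<close> makes a local comparison of
  increments global. Applied with a \<open>\<mu>\<close> of arbitrarily small total increment it
  shows that R takes equal values at a and b, with no differentiability of R involved.\<close>

lemma norm_increment_bound:
  fixes R :: "real \<Rightarrow> 'a::real_normed_vector" and \<mu> :: "real \<Rightarrow> real"
  assumes "\<delta> > 0" "a \<le> b"
    and loc: "\<And>s t. a \<le> s \<Longrightarrow> s \<le> t \<Longrightarrow> t \<le> b \<Longrightarrow> t \<le> s + \<delta> \<Longrightarrow> norm (R t - R s) \<le> \<mu> t - \<mu> s"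
  shows "norm (R b - R a) \<le> \<mu> b - \<mu> a"
proof -
  have *: "norm (R t - R a) \<le> \<mu> t - \<mu> a" if "a \<le> t" "t \<le> b" "t \<le> a + real n * \<delta>" for n t
    using that
  proof (induction n arbitrary: t)
    case 0
    then show ?case by simp
  next
    case (Suc n)
    define s where "s = max a (t - \<delta>)"
    have s: "a \<le> s" "s \<le> t" "t \<le> s + \<delta>" "s \<le> b" "s \<le> a + real n * \<delta>"
      using Suc.prems \<open>\<delta> > 0\<close> by (auto simp: s_def algebra_simps)
    have "norm (R t - R s) \<le> \<mu> t - \<mu> s" using loc s Suc.prems by auto
    moreover have "norm (R s - R a) \<le> \<mu> s - \<mu> a" using Suc.IH s by auto
    moreover have "norm (R t - R a) \<le> norm (R t - R s) + norm (R s - R a)"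
      by (metis add_diff_cancel_left' add_diff_eq diff_add_cancel norm_triangle_ineq)
    ultimately show ?case by linarith
  qed
  obtain n :: nat where "(b - a) / \<delta> \<le> real n" using real_arch_simple by blast
  then have "b \<le> a + real n * \<delta>" using \<open>\<delta> > 0\<close> by (simp add: field_simps)
  then show ?thesis using *[of b n] assms by auto
qed

text \<open>The representing vector is the minimiser over S of the quadratic functional
  \<open>J z = z \<bullet> z - 2 * f z\<close>. All assumptions on f concern S only, which suits
  functionals that are given by weak integrals.\<close>

lemma riesz_subspace:
  fixes S :: "'a::{real_inner,complete_space} set" and f :: "'a \<Rightarrow> real"
  assumes S: "subspace S" "closed S"
    and add: "\<And>x y. x \<in> S \<Longrightarrow> y \<in> S \<Longrightarrow> f (x + y) = f x + f y"
    and scale: "\<And>c x. x \<in> S \<Longrightarrow> f (c *\<^sub>R x) = c * f x"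
    and bound: "\<And>x. x \<in> S \<Longrightarrow> \<bar>f x\<bar> \<le> C * norm x"
  shows "\<exists>y\<in>S. \<forall>z\<in>S. y \<bullet> z = f z"
proof -
  define J where "J z = z \<bullet> z - 2 * f z" for z
  have 0: "0 \<in> S" using S subspace_0 by blast
  have low: "J z \<ge> - C\<^sup>2" if "z \<in> S" for z
  proof -
    have "f z \<le> C * norm z" using bound[OF that] by auto
    moreover have "0 \<le> (norm z - C)\<^sup>2" by simp
    ultimately show ?thesis
      unfolding J_def by (simp add: power2_diff power2_norm_eq_inner algebra_simps)
  qed
  define m where "m = Inf (J ` S)"
  have bdd: "bdd_below (J ` S)" using low by (auto simp: bdd_below_def)
  have mle: "m \<le> J z" if "z \<in> S" for z unfolding m_def using bdd that by (auto intro: cInf_lower)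
  have "\<exists>z\<in>S. J z < m + inverse (real (Suc n))" for n
  proof -
    have "Inf (J ` S) < m + inverse (real (Suc n))"
      unfolding m_def using inverse_positive_iff_positive of_nat_0_less_iff by (metis less_add_same_cancel1 zero_less_Suc)
    then show ?thesis using cInf_lessD[of "J ` S"] 0 by blast
  qed
  then obtain z where z: "\<And>n. z n \<in> S" "\<And>n. J (z n) < m + inverse (real (Suc n))" by metis
  \<comment> \<open>Parallelogram law: the midpoint w lies in S, so \<open>J w\<close> is at least
    the infimum m, and this forces every minimising sequence to be Cauchy.\<close>
  have dist: "(norm (z n - z k))\<^sup>2 \<le> 2 * inverse (real (Suc n)) + 2 * inverse (real (Suc k))" for n k
  proof -
    define w where "w = (1/2) *\<^sub>R (z n + z k)"
    have w: "w \<in> S" unfolding w_def using z S by (simp add: subspace_add subspace_scale)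
    have fw: "f w = (f (z n) + f (z k)) / 2"
      unfolding w_def using z S by (subst scale) (auto simp: add subspace_add)
    have "(norm (z n - z k))\<^sup>2 = 2 * J (z n) + 2 * J (z k) - 4 * J w"
      unfolding J_def fw unfolding w_def power2_norm_eq_inner
      by (simp add: inner_simps inner_commute algebra_simps)
    also have "\<dots> \<le> 2 * inverse (real (Suc n)) + 2 * inverse (real (Suc k))"
      using z(2)[of n] z(2)[of k] mle[OF w] by linarith
    finally show ?thesis .
  qed
  have "Cauchy z"
  proof (rule metric_CauchyI)
    fix e :: real assume e: "e > 0"
    then obtain N where N: "inverse (real (Suc N)) < e\<^sup>2 / 4"
      using reals_Archimedean[of "e\<^sup>2/4"] by auto
    have "dist (z n) (z k) < e" if "n \<ge> N" "k \<ge> N" for n k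
    proof -
      have "inverse (real (Suc n)) \<le> inverse (real (Suc N))" "inverse (real (Suc k)) \<le> inverse (real (Suc N))"
        using that by (auto simp: le_imp_inverse_le)
      then have "(norm (z n - z k))\<^sup>2 < e\<^sup>2" using dist[of n k] N by linarith
      then show ?thesis using e by (simp add: dist_norm power_less_imp_less_base)
    qed
    then show "\<exists>M. \<forall>n\<ge>M. \<forall>k\<ge>M. dist (z n) (z k) < e" by blast
  qed
  then obtain y where y: "z \<longlonglongrightarrow> y" using Cauchy_convergent_iff convergent_def by blast
  have yS: "y \<in> S" using S y z closed_sequentially by blast
  have fd: "f (z n - y) = f (z n) - f y" for n
    using add[of "z n" "- 1 *\<^sub>R y"] scale[of y "-1"] z yS S
    by (metis (no_types, opaque_lifting) subspace_scale ab_group_add_class.ab_diff_conv_add_uminus mult_minus1 scaleR_minus1_left)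
  have "(\<lambda>n. f (z n)) \<longlonglongrightarrow> f y"
  proof (rule LIM_zero_cancel, rule tendsto_norm_zero_cancel, rule tendsto_sandwich)
    show "\<forall>\<^sub>F n in sequentially. 0 \<le> norm (f (z n) - f y)" by simp
    show "\<forall>\<^sub>F n in sequentially. norm (f (z n) - f y) \<le> C * norm (z n - y)"
      using bound[of "z _ - y"] z yS S by (auto simp: fd[symmetric] subspace_diff)
    show "(\<lambda>n. C * norm (z n - y)) \<longlonglongrightarrow> 0"
      using y by (auto intro!: tendsto_mult_right_zero tendsto_norm_zero LIM_zero)
  qed simp
  then have Jlim: "(\<lambda>n. J (z n)) \<longlonglongrightarrow> J y"
    unfolding J_def using y by (intro tendsto_intros)
  have "(\<lambda>n. m + inverse (real (Suc n))) \<longlonglongrightarrow> m + 0"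
    by (intro tendsto_add tendsto_const LIMSEQ_inverse_real_of_nat)
  then have "J y \<le> m + 0"
    by (rule LIMSEQ_le[OF Jlim]) (use z(2) less_imp_le in blast)
  then have Jy: "J y \<le> J w" if "w \<in> S" for w using mle[OF that] by simp
  have "y \<bullet> w = f w" if w: "w \<in> S" for w
  proof -
    \<comment> \<open>First variation: a quadratic in t without constant term that is never negative
      has zero linear coefficient. Below, \<open>t = - d / N\<close> extracts this; the summand 1 in
      \<open>N\<close> excludes division by zero.\<close>
    have q: "0 \<le> 2 * t * (y \<bullet> w - f w) + t\<^sup>2 * (w \<bullet> w)" for t
    proof -
      have "y + t *\<^sub>R w \<in> S" using yS w S by (simp add: subspace_add subspace_scale)
      from Jy[OF this] have "J y \<le> J (y + t *\<^sub>R w)" .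
      moreover have "f (y + t *\<^sub>R w) = f y + t * f w"
        using yS w S by (simp add: add scale subspace_scale)
      ultimately show ?thesis unfolding J_def
        by (simp add: inner_simps inner_commute algebra_simps power2_eq_square)
    qed
    define d where "d = y \<bullet> w - f w"
    define N where "N = w \<bullet> w + 1"
    have N: "N > 0" unfolding N_def by (simp add: add_nonneg_pos)
    have "0 \<le> 2 * (- d / N) * d + (- d / N)\<^sup>2 * (w \<bullet> w)" using q[of "- d / N"] by (simp add: d_def)
    also have "\<dots> \<le> 2 * (- d / N) * d + (- d / N)\<^sup>2 * N"
      unfolding N_def by (intro add_left_mono mult_left_mono) auto
    also have "\<dots> = - (d\<^sup>2 / N)" using N by (simp add: field_simps power2_eq_square)
    finally have "d\<^sup>2 \<le> 0" using N by (simp add: field_simps)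
    then show ?thesis by (simp add: d_def)
  qed
  then show ?thesis using yS by blast
qed

text \<open>The Riesz representative on S of the functional \<open>z \<mapsto> x \<bullet> z\<close>
  is the orthogonal projection of x, and x minus its projection is orthogonal to S.\<close>

lemma closed_subspace_eq_UNIV:
  fixes S :: "'a::{real_inner,complete_space} set"
  assumes S: "subspace S" "closed S" and orth: "\<And>y. (\<forall>z\<in>S. y \<bullet> z = 0) \<Longrightarrow> y = 0"
  shows "S = UNIV"
proof -
  have "x \<in> S" for x
  proof -
    obtain y where y: "y \<in> S" "\<forall>z\<in>S. y \<bullet> z = x \<bullet> z"
      using riesz_subspace[OF S, of "\<lambda>z. x \<bullet> z" "norm x"]
      by (auto simp: inner_simps Cauchy_Schwarz_ineq2)
    have "x - y = 0" by (rule orth) (use y in \<open>auto simp: inner_simps\<close>)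
    then show ?thesis using y by simp
  qed
  then show ?thesis by blast
qed

subsection \<open>The exponential of a bounded operator\<close>

definition opexp :: "('a::banach \<Rightarrow> 'a) \<Rightarrow> real \<Rightarrow> 'a \<Rightarrow> 'a" where
  "opexp A t x = (\<Sum>k. (t ^ k /\<^sub>R fact k) *\<^sub>R (A ^^ k) x)"

lemma norm_funpow_le:
  fixes A :: "'a::real_normed_vector \<Rightarrow> 'a"
  assumes "bounded_linear A"
  shows "norm ((A ^^ k) x) \<le> onorm A ^ k * norm x"
proof (induction k)
  case (Suc k)
  have "norm (A ((A ^^ k) x)) \<le> onorm A * norm ((A ^^ k) x)" using onorm[OF assms] by blast
  also have "\<dots> \<le> onorm A * (onorm A ^ k * norm x)"
    using Suc onorm_pos_le[OF assms] by (rule mult_left_mono)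
  finally show ?case by simp
qed simp

lemma bounded_linear_funpow:
  fixes A :: "'a::real_normed_vector \<Rightarrow> 'a"
  assumes "bounded_linear A"
  shows "bounded_linear (A ^^ k)"
proof (induction k)
  case 0
  then show ?case using bounded_linear_ident by (simp add: id_def)
next
  case (Suc k)
  then show ?case using bounded_linear_compose[OF assms Suc] by (simp add: comp_def)
qed

context
  fixes A :: "'a::banach \<Rightarrow> 'a"
  assumes A: "bounded_linear A"
begin

lemma opexp_sums: "(\<lambda>k. (t ^ k /\<^sub>R fact k) *\<^sub>R (A ^^ k) x) sums opexp A t x"
proof -
  have s: "summable (\<lambda>k. norm x * ((\<bar>t\<bar> * onorm A) ^ k /\<^sub>R fact k))"
    by (intro summable_mult summable_exp_generic)
  have "summable (\<lambda>k. (t ^ k /\<^sub>R fact k) *\<^sub>R (A ^^ k) x)"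
  proof (rule summable_comparison_test'[OF s])
    fix k
    have "norm ((t ^ k /\<^sub>R fact k) *\<^sub>R (A ^^ k) x) = (\<bar>t\<bar> ^ k / fact k) * norm ((A ^^ k) x)"
      by (simp add: power_abs divide_inverse mult.commute abs_mult)
    also have "\<dots> \<le> (\<bar>t\<bar> ^ k / fact k) * (onorm A ^ k * norm x)"
      by (intro mult_left_mono norm_funpow_le A) auto
    also have "\<dots> = norm x * ((\<bar>t\<bar> * onorm A) ^ k /\<^sub>R fact k)"
      by (simp add: power_mult_distrib divide_inverse mult_ac)
    finally show "norm ((t ^ k /\<^sub>R fact k) *\<^sub>R (A ^^ k) x) \<le> norm x * ((\<bar>t\<bar> * onorm A) ^ k /\<^sub>R fact k)" .
  qed
  then show ?thesis unfolding opexp_def by (rule summable_sums)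
qed

lemma opexp_add: "opexp A t (x + y) = opexp A t x + opexp A t y"
proof -
  have "(A ^^ k) (x + y) = (A ^^ k) x + (A ^^ k) y" for k
    using bounded_linear_funpow[OF A] by (simp add: linear_add bounded_linear.linear)
  then have "(\<lambda>k. (t ^ k /\<^sub>R fact k) *\<^sub>R (A ^^ k) (x + y)) sums (opexp A t x + opexp A t y)"
    using sums_add[OF opexp_sums[of t x] opexp_sums[of t y]] by (simp add: scaleR_add_right)
  then show ?thesis using opexp_sums sums_unique2 by blast
qed

text \<open>Commutation with A passes to every term of the series, and the continuous operator B may
  be applied termwise.\<close>

lemma opexp_commute:
  assumes B: "bounded_linear B" and comm: "\<And>x. B (A x) = A (B x)"
  shows "B (opexp A t x) = opexp A t (B x)"
proof -
  have "B ((A ^^ k) x) = (A ^^ k) (B x)" for k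
    by (induction k) (auto simp: comm)
  then have "(\<lambda>k. (t ^ k /\<^sub>R fact k) *\<^sub>R (A ^^ k) (B x)) sums B (opexp A t x)"
    using bounded_linear.sums[OF B opexp_sums[of t x]]
    by (simp add: linear_cmul[OF bounded_linear.linear[OF B]])
  then show ?thesis using opexp_sums sums_unique2 by blast
qed

lemma opexp_0 [simp]: "opexp A 0 x = x"
proof -
  have "(\<lambda>k. (0 ^ k /\<^sub>R fact k) *\<^sub>R (A ^^ k) x) sums ((0 ^ 0 /\<^sub>R fact 0) *\<^sub>R (A ^^ 0) x)"
    by (rule sums_finite[where N = "{0}", simplified]) auto
  then show ?thesis using opexp_sums[of 0 x] sums_unique2 by force
qed

lemma opexp_scaleR: "opexp A t (c *\<^sub>R x) = c *\<^sub>R opexp A t x"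
  by (rule opexp_commute[OF bounded_linear_scaleR_right, symmetric])
     (rule linear_cmul[OF bounded_linear.linear[OF A], symmetric])

text \<open>Termwise differentiation on a ball around 0 that contains t: there the series of
  derivatives is dominated by an exponential series in \<open>r * onorm A\<close>, so it converges
  uniformly.\<close>

lemma opexp_deriv: "((\<lambda>t. opexp A t x) has_vector_derivative A (opexp A t x)) (at t)"
proof -
  define r where "r = \<bar>t\<bar> + 1"
  define S where "S = ball (0::real) r"
  define f where "f k s = (s ^ k /\<^sub>R fact k) *\<^sub>R (A ^^ k) x" for k s
  \<comment> \<open>The constant term has derivative 0; after the shift of the index by one the
    remaining derivatives are A applied to the terms of the exponential series.\<close>
  define f' where "f' k s = (case k of 0 \<Rightarrow> 0 | Suc j \<Rightarrow> (s ^ j /\<^sub>R fact j) *\<^sub>R (A ^^ Suc j) x)" for k s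
  have sumA: "(\<lambda>k. f' k s) sums A (opexp A s x)" for s
  proof -
    have "(\<lambda>k. f' (Suc k) s) sums A (opexp A s x)"
      using bounded_linear.sums[OF A opexp_sums[of s x]]
      by (simp add: f'_def linear_cmul[OF bounded_linear.linear[OF A]])
    then have "(\<lambda>k. f' k s) sums (A (opexp A s x) + f' 0 s)" by (rule sums_Suc)
    then show ?thesis by (simp add: f'_def)
  qed
  have ev: "uniform_limit S (\<lambda>n s. \<Sum>i<n. f' i s) (\<lambda>s. \<Sum>i. f' i s) sequentially"
  proof (rule Weierstrass_m_test)
    define M where "M k = (case k of 0 \<Rightarrow> 0 | Suc j \<Rightarrow> onorm A * norm x * ((r * onorm A) ^ j /\<^sub>R fact j))" for k
    show "summable M"
    proof -
      have "summable (\<lambda>j. M (Suc j))"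
        unfolding M_def by (simp only: nat.case) (intro summable_mult summable_exp_generic)
      then show ?thesis by (simp only: summable_Suc_iff)
    qed
    show "norm (f' k s) \<le> M k" if "s \<in> S" for k s
    proof (cases k)
      case (Suc j)
      have s: "\<bar>s\<bar> \<le> r" using that by (auto simp: S_def)
      have "norm (f' k s) = (\<bar>s\<bar> ^ j / fact j) * norm ((A ^^ Suc j) x)"
        unfolding f'_def Suc by (simp add: power_abs divide_inverse mult.commute abs_mult)
      also have "\<dots> \<le> (r ^ j / fact j) * (onorm A ^ Suc j * norm x)"
        by (intro mult_mono norm_funpow_le[OF A] divide_right_mono power_mono s) (use s in auto)
      also have "\<dots> = M k" by (simp add: M_def Suc power_mult_distrib divide_inverse mult_ac)
      finally show ?thesis .
    qed (simp add: M_def f'_def)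
  qed
  have "\<exists>g. \<forall>s\<in>S. (\<lambda>n. f n s) sums g s \<and> (g has_derivative (\<lambda>h. h *\<^sub>R A (opexp A s x))) (at s within S)"
  proof (rule has_derivative_series[where f' = "\<lambda>n s h. h *\<^sub>R f' n s"])
    show "convex S" by (simp add: S_def)
    show "(f n has_derivative (\<lambda>h. h *\<^sub>R f' n s)) (at s within S)" for n s
    proof (cases n)
      case 0
      then show ?thesis by (simp add: f_def[abs_def] f'_def)
    next
      case (Suc j)
      define c where "c = inverse (fact (Suc j)) *\<^sub>R (A ^^ Suc j) x"
      have "((\<lambda>s. s ^ Suc j) has_vector_derivative real (Suc j) * s ^ j) (at s within S)"
        using DERIV_pow[of "Suc j" s S] by (simp add: has_real_derivative_iff_has_vector_derivative)
      then have d: "((\<lambda>s. s ^ Suc j) has_derivative (\<lambda>h. h * (real (Suc j) * s ^ j))) (at s within S)"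
        by (simp add: has_vector_derivative_def)
      have "((\<lambda>s. s ^ Suc j *\<^sub>R c) has_derivative (\<lambda>h. (h * (real (Suc j) * s ^ j)) *\<^sub>R c)) (at s within S)"
        by (rule has_derivative_scaleR_left[OF d])
      moreover have "f n = (\<lambda>s. s ^ Suc j *\<^sub>R c)"
        by (rule ext) (simp add: f_def Suc c_def mult.commute del: fact_Suc power_Suc funpow.simps)
      moreover have "(h * (real (Suc j) * s ^ j)) *\<^sub>R c = h *\<^sub>R f' n s" for h
      proof -
        have "h * (real (Suc j) * s ^ j) * inverse (fact (Suc j)) = h * (s ^ j * inverse (fact j))"
          by (simp add: field_simps del: of_nat_Suc)
        then show ?thesis by (simp add: f'_def Suc c_def mult.commute del: fact_Suc power_Suc funpow.simps)
      qed
      ultimately show ?thesis by simp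
    qed
    show "\<forall>\<^sub>F n in sequentially. \<forall>s\<in>S. \<forall>h. norm ((\<Sum>i<n. h *\<^sub>R f' i s) - h *\<^sub>R A (opexp A s x)) \<le> e * norm h"
      if e: "0 < e" for e
    proof -
      have "\<forall>\<^sub>F n in sequentially. \<forall>s\<in>S. dist (\<Sum>i<n. f' i s) (\<Sum>i. f' i s) < e"
        using ev e unfolding uniform_limit_iff by blast
      then show ?thesis
      proof eventually_elim
        case (elim n)
        show ?case
        proof (intro ballI allI)
          fix s h assume "s \<in> S"
          then have "norm ((\<Sum>i<n. f' i s) - A (opexp A s x)) \<le> e"
            using elim sums_unique[OF sumA[of s]] by (auto simp: dist_norm less_imp_le)
          then have "norm (h *\<^sub>R ((\<Sum>i<n. f' i s) - A (opexp A s x))) \<le> norm h * e"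
            unfolding norm_scaleR by (metis abs_ge_zero mult_left_mono real_norm_def)
          then show "norm ((\<Sum>i<n. h *\<^sub>R f' i s) - h *\<^sub>R A (opexp A s x)) \<le> e * norm h"
            by (simp add: scaleR_diff_right scaleR_sum_right mult.commute)
        qed
      qed
    qed
    show "0 \<in> S" by (simp add: S_def r_def)
    show "(\<lambda>n. f n 0) sums opexp A 0 x" unfolding f_def by (rule opexp_sums)
  qed
  then obtain g where g: "\<And>s. s \<in> S \<Longrightarrow> (\<lambda>n. f n s) sums g s"
     "\<And>s. s \<in> S \<Longrightarrow> (g has_derivative (\<lambda>h. h *\<^sub>R A (opexp A s x))) (at s within S)" by blast
  have gS: "g s = opexp A s x" if "s \<in> S" for s
    using g(1)[OF that] opexp_sums[of s x] sums_unique2 unfolding f_def by blast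
  have tS: "t \<in> S" "open S" by (auto simp: S_def r_def)
  then have "(g has_derivative (\<lambda>h. h *\<^sub>R A (opexp A t x))) (at t)"
    using g(2)[OF tS(1)] by (simp only: at_within_open[OF tS])
  then have "((\<lambda>t. opexp A t x) has_derivative (\<lambda>h. h *\<^sub>R A (opexp A t x))) (at t)"
    by (rule has_derivative_transform_within_open[OF _ tS(2,1)]) (rule gS)
  then show ?thesis by (simp add: has_vector_derivative_def)
qed

lemma opexp_deriv_within: "((\<lambda>t. opexp A t x) has_vector_derivative A (opexp A t x)) (at t within S)"
  by (rule has_vector_derivative_at_within[OF opexp_deriv])

end

section \<open>Exponentials of skew-adjoint operators\<close>

definition skew :: "('a::real_inner \<Rightarrow> 'a) \<Rightarrow> bool" where
  "skew A \<longleftrightarrow> bounded_linear A \<and> (\<forall>x y. A x \<bullet> y = - (x \<bullet> A y))"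

lemma skew_bounded_linear: "skew A \<Longrightarrow> bounded_linear A"
  by (simp add: skew_def)

text \<open>Moving k factors A across the inner product costs the sign \<open>(- 1) ^ k\<close>,
  which the power of t absorbs as \<open>- t\<close>.\<close>

lemma opexp_adjoint:
  fixes A :: "'a::{real_inner,banach} \<Rightarrow> 'a"
  assumes "skew A"
  shows "opexp A t x \<bullet> y = x \<bullet> opexp A (- t) y"
proof -
  have A: "bounded_linear A" and sk: "\<And>x y. A x \<bullet> y = - (x \<bullet> A y)" using assms by (auto simp: skew_def)
  have pw: "(A ^^ k) x \<bullet> y = (- 1) ^ k * (x \<bullet> (A ^^ k) y)" for k x y
    by (induction k arbitrary: x y) (auto simp: sk funpow_swap1)
  have "(\<lambda>k. ((t ^ k /\<^sub>R fact k) *\<^sub>R (A ^^ k) x) \<bullet> y) sums (opexp A t x \<bullet> y)"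
    by (rule bounded_linear.sums[OF bounded_linear_inner_left opexp_sums[OF A]])
  moreover have "(\<lambda>k. x \<bullet> (((- t) ^ k /\<^sub>R fact k) *\<^sub>R (A ^^ k) y)) sums (x \<bullet> opexp A (- t) y)"
    by (rule bounded_linear.sums[OF bounded_linear_inner_right opexp_sums[OF A]])
  moreover have "((t ^ k /\<^sub>R fact k) *\<^sub>R (A ^^ k) x) \<bullet> y = x \<bullet> (((- t) ^ k /\<^sub>R fact k) *\<^sub>R (A ^^ k) y)" for k
    by (simp add: pw power_minus[of t])
  ultimately show ?thesis by (simp only: sums_unique2)
qed

text \<open>By skewness the two terms of the derivative of the inner product along the orbits
  cancel.\<close>

lemma opexp_inner:
  fixes A :: "'a::{real_inner,banach} \<Rightarrow> 'a"
  assumes "skew A"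
  shows "opexp A t x \<bullet> opexp A t y = x \<bullet> y"
proof -
  have A: "bounded_linear A" and sk: "\<And>x y. A x \<bullet> y = - (x \<bullet> A y)" using assms by (auto simp: skew_def)
  have "((\<lambda>t. opexp A t x \<bullet> opexp A t y) has_vector_derivative
      (opexp A t x \<bullet> A (opexp A t y) + A (opexp A t x) \<bullet> opexp A t y)) (at t)" for t
    by (rule bounded_bilinear.has_vector_derivative[OF bounded_bilinear_inner opexp_deriv[OF A] opexp_deriv[OF A]])
  then have "((\<lambda>t. opexp A t x \<bullet> opexp A t y) has_real_derivative 0) (at t)" for t
    by (simp add: sk has_real_derivative_iff_has_vector_derivative)
  then have "opexp A t x \<bullet> opexp A t y = opexp A 0 x \<bullet> opexp A 0 y"
    by (rule DERIV_isconst_all[rule_format, of "\<lambda>t. opexp A t x \<bullet> opexp A t y", simplified]) 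
  then show ?thesis by (simp add: opexp_0[OF A])
qed

lemma norm_opexp:
  fixes A :: "'a::{real_inner,banach} \<Rightarrow> 'a"
  shows "skew A \<Longrightarrow> norm (opexp A t x) = norm x"
  by (simp only: norm_eq_sqrt_inner opexp_inner)

text \<open>Duhamel's formula in scalar form. The difference y of the two orbits is paired with
  itself through \<open>\<phi>\<close>, which runs from \<open>opexp B t x \<bullet> y\<close> at 0
  to \<open>opexp A t x \<bullet> y\<close> at t. In its derivative A and B occur only as their
  difference along the orbit of A, so no commutation between A and B enters.\<close>

lemma opexp_diff_bound:
  fixes A B :: "'a::{real_inner,banach} \<Rightarrow> 'a"
  assumes "skew A" "skew B" and M: "\<And>s. norm (A (opexp A s x) - B (opexp A s x)) \<le> M"
  shows "norm (opexp A t x - opexp B t x) \<le> \<bar>t\<bar> * M"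
proof -
  have A: "bounded_linear A" and B: "bounded_linear B"
    and skB: "\<And>x y. B x \<bullet> y = - (x \<bullet> B y)" using assms by (auto simp: skew_def)
  define y where "y = opexp A t x - opexp B t x"
  define \<phi> where "\<phi> s = opexp A s x \<bullet> opexp B (s - t) y" for s
  have der: "(\<phi> has_real_derivative (A (opexp A s x) - B (opexp A s x)) \<bullet> opexp B (s - t) y) (at s)" for s
  proof -
    have "((\<lambda>s. opexp B (s - t) y) has_vector_derivative 1 *\<^sub>R B (opexp B (s - t) y)) (at s)"
      by (rule vector_diff_chain_at[where f="\<lambda>s. s - t" and g="\<lambda>s. opexp B s y", unfolded comp_def])
         (auto intro!: derivative_eq_intros opexp_deriv[OF B])
    then have "(\<phi> has_vector_derivative (opexp A s x \<bullet> B (opexp B (s - t) y) + A (opexp A s x) \<bullet> opexp B (s - t) y)) (at s)"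
      unfolding \<phi>_def
      by (intro bounded_bilinear.has_vector_derivative[OF bounded_bilinear_inner] opexp_deriv[OF A]) simp
    then show ?thesis by (simp add: has_real_derivative_iff_has_vector_derivative inner_diff_left skB add.commute)
  qed
  have "norm (\<phi> t - \<phi> 0) \<le> (M * norm y) * norm (t - 0)"
  proof (rule field_differentiable_bound[where S = UNIV])
    show "(\<phi> has_field_derivative (A (opexp A s x) - B (opexp A s x)) \<bullet> opexp B (s - t) y) (at s within UNIV)" for s
      using der by simp
    show "norm ((A (opexp A s x) - B (opexp A s x)) \<bullet> opexp B (s - t) y) \<le> M * norm y" for s
    proof -
      have "norm ((A (opexp A s x) - B (opexp A s x)) \<bullet> opexp B (s - t) y) \<le> norm (A (opexp A s x) - B (opexp A s x)) * norm (opexp B (s - t) y)"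
        by (simp add: Cauchy_Schwarz_ineq2)
      also have "\<dots> \<le> M * norm y" unfolding norm_opexp[OF assms(2)] by (intro mult_right_mono M) auto
      finally show ?thesis .
    qed
  qed auto
  moreover have "\<phi> t - \<phi> 0 = y \<bullet> y"
  proof -
    have "\<phi> 0 = opexp B t x \<bullet> y" unfolding \<phi>_def using opexp_adjoint[OF assms(2), of t x y] by (simp add: opexp_0[OF A])
    moreover have "\<phi> t = opexp A t x \<bullet> y" unfolding \<phi>_def by (simp add: opexp_0[OF B])
    ultimately show ?thesis by (simp add: y_def inner_diff_left)
  qed
  ultimately have "norm y * norm y \<le> (M * \<bar>t\<bar>) * norm y"
    by (simp add: dot_square_norm power2_eq_square mult_ac)
  then show ?thesis unfolding y_def[symmetric]
    using order_trans[OF norm_ge_zero M] by (cases "norm y = 0") (auto simp: mult.commute)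
qed

subsection \<open>Flows of integrable bilinear forms\<close>

text \<open>Sampling the two paths on the grid of mesh \<open>1 / Suc n\<close> leaves countably
  many argument pairs, for which measurability is assumed; joint continuity of each form
  \<open>k s\<close> gives convergence as the mesh shrinks.\<close>

lemma bilinear_measurable_compose:
  fixes k :: "real \<Rightarrow> 'h::real_normed_vector \<Rightarrow> 'h \<Rightarrow> real"
  assumes bil: "\<And>s. bounded_bilinear (k s)"
    and meas: "\<And>x y. (\<lambda>s. k s x y) \<in> borel_measurable borel"
    and cont: "continuous_on UNIV x" "continuous_on UNIV y"
  shows "(\<lambda>s. k s (x s) (y s)) \<in> borel_measurable borel"
proof (rule borel_measurable_LIMSEQ_real)
  define a where "a n s = real_of_int \<lfloor>real (Suc n) * s\<rfloor> / real (Suc n)" for n s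
  have a: "(\<lambda>n. a n s) \<longlonglongrightarrow> s" for s
  proof (rule LIM_zero_cancel, rule Lim_null_comparison)
    show "\<forall>\<^sub>F n in sequentially. norm (a n s - s) \<le> inverse (real (Suc n))"
      unfolding real_norm_def
    proof (rule always_eventually, rule allI)
      fix n
      have "\<bar>real_of_int \<lfloor>real (Suc n) * s\<rfloor> - real (Suc n) * s\<bar> \<le> 1" by linarith
      moreover have "a n s - s = (real_of_int \<lfloor>real (Suc n) * s\<rfloor> - real (Suc n) * s) / real (Suc n)"
        by (simp add: a_def field_simps)
      ultimately have "\<bar>a n s - s\<bar> \<le> 1 / real (Suc n)"
        by (simp only: abs_divide abs_of_nat) (rule divide_right_mono, auto)
      then show "\<bar>a n s - s\<bar> \<le> inverse (real (Suc n))" by (simp add: divide_inverse)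
    qed
  qed (rule LIMSEQ_inverse_real_of_nat)
  show "(\<lambda>s. k s (x (a n s)) (y (a n s))) \<in> borel_measurable borel" for n
    unfolding a_def
    by (rule measurable_compose_countable[where f = "\<lambda>i s. k s (x (real_of_int i / real (Suc n))) (y (real_of_int i / real (Suc n)))"
          and g = "\<lambda>s. \<lfloor>real (Suc n) * s\<rfloor>"]) (auto intro: meas)
  show "(\<lambda>n. k s (x (a n s)) (y (a n s))) \<longlonglongrightarrow> k s (x s) (y s)" for s
    by (intro bounded_bilinear.tendsto[OF bil] continuous_on_tendsto_compose[OF cont(1)]
        continuous_on_tendsto_compose[OF cont(2)] a) auto
qed

text \<open>Dominated convergence: the indicator functions converge at every point except possibly t
  itself, which is a null set.\<close>

lemma continuous_indefinite_lebesgue_integral: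
  fixes \<beta> :: "real \<Rightarrow> real"
  assumes "integrable lborel \<beta>"
  shows "continuous_on UNIV (\<lambda>t. LINT r:{..t}|lborel. \<beta> r)"
  unfolding continuous_on_eq_continuous_at[OF open_UNIV]
proof (intro ballI)
  fix t :: real
  have "(\<lambda>n. LINT r:{..X n}|lborel. \<beta> r) \<longlonglongrightarrow> (LINT r:{..t}|lborel. \<beta> r)" if X: "X \<longlonglongrightarrow> t" for X
    unfolding set_lebesgue_integral_def
  proof (rule integral_dominated_convergence[where w = "\<lambda>r. norm (\<beta> r)"])
    show "AE r in lborel. (\<lambda>n. indicat_real {..X n} r *\<^sub>R \<beta> r) \<longlonglongrightarrow> indicat_real {..t} r *\<^sub>R \<beta> r"
    proof (rule AE_mp[OF AE_lborel_singleton[of t]], rule AE_I2, rule impI)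
      fix r assume "r \<noteq> t"
      then consider "r < t" | "r > t" by linarith
      then have "\<forall>\<^sub>F n in sequentially. indicat_real {..X n} r *\<^sub>R \<beta> r = indicat_real {..t} r *\<^sub>R \<beta> r"
      proof cases
        case 1
        show ?thesis using order_tendstoD(1)[OF X 1] by eventually_elim (use 1 in \<open>auto simp: indicator_def\<close>)
      next
        case 2
        show ?thesis using order_tendstoD(2)[OF X 2] by eventually_elim (use 2 in \<open>auto simp: indicator_def\<close>)
      qed
      then show "(\<lambda>n. indicat_real {..X n} r *\<^sub>R \<beta> r) \<longlonglongrightarrow> indicat_real {..t} r *\<^sub>R \<beta> r"
        by (rule tendsto_eventually)
    qed
  qed (use assms in \<open>auto simp: indicator_def\<close>)
  then show "isCont (\<lambda>t. LINT r:{..t}|lborel. \<beta> r) t"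
    by (simp add: continuous_at_sequentially comp_def)
qed

lemma set_integral_atLeastAtMost_diff:
  fixes \<beta> :: "real \<Rightarrow> real"
  assumes "integrable lborel \<beta>" "s \<le> t"
  shows "(LINT r:{s..t}|lborel. \<beta> r) = (LINT r:{..t}|lborel. \<beta> r) - (LINT r:{..s}|lborel. \<beta> r)"
proof -
  have i: "set_integrable lborel A \<beta>" if "A \<in> sets borel" for A
    using assms(1) that unfolding set_integrable_def by (intro integrable_mult_indicator) auto
  have "(LINT r:{..t}|lborel. \<beta> r) = (LINT r:{..s} \<union> {s<..t}|lborel. \<beta> r)"
    using \<open>s \<le> t\<close> by (simp add: ivl_disj_un)
  also have "\<dots> = (LINT r:{..s}|lborel. \<beta> r) + (LINT r:{s<..t}|lborel. \<beta> r)"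
    by (rule set_integral_Un) (auto intro: i)
  also have "(LINT r:{s<..t}|lborel. \<beta> r) = (LINT r:{s..t}|lborel. \<beta> r)"
    unfolding set_lebesgue_integral_def
  proof (rule integral_cong_AE)
    show "AE r in lborel. indicat_real {s<..t} r *\<^sub>R \<beta> r = indicat_real {s..t} r *\<^sub>R \<beta> r"
      using AE_lborel_singleton[of s] by eventually_elim (auto simp: indicator_def)
  qed (use assms(1) in auto)
  finally show ?thesis by simp
qed

section \<open>Isomorphisms that respect a complex structure\<close>

text \<open>M plays the role of multiplication by i, so a real linear map commuting with M is
  complex linear.\<close>

definition hiso :: "'h::real_normed_vector set \<Rightarrow> ('h \<Rightarrow> 'h) \<Rightarrow> ('h \<Rightarrow> 'h) \<Rightarrow> bool" where
  "hiso X M W \<longleftrightarrow> (\<forall>x\<in>X. W x \<in> X) \<and> (\<forall>x\<in>X. \<forall>y\<in>X. W (x + y) = W x + W y)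
     \<and> (\<forall>c. \<forall>x\<in>X. W (c *\<^sub>R x) = c *\<^sub>R W x) \<and> (\<forall>x\<in>X. W (M x) = M (W x))
     \<and> (\<exists>C\<ge>0. \<forall>x\<in>X. norm (W x) \<le> C * norm x) \<and> (\<exists>c>0. \<forall>x\<in>X. c * norm x \<le> norm (W x))
     \<and> (\<forall>y\<in>X. \<exists>x\<in>X. W x = y)"

lemma hiso_id: "hiso X M (\<lambda>x. x)"
  unfolding hiso_def by (auto intro!: exI[of _ "1::real"])

lemma hiso_compose:
  assumes M: "\<And>x. x \<in> X \<Longrightarrow> M x \<in> X" "hiso X M W" "hiso X M W'" and X: "subspace X"
  shows "hiso X M (\<lambda>x. W' (W x))"
proof -
  obtain C where C: "C \<ge> 0" "\<And>x. x \<in> X \<Longrightarrow> norm (W x) \<le> C * norm x"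
    using assms(2) unfolding hiso_def by blast
  obtain C' where C': "C' \<ge> 0" "\<And>x. x \<in> X \<Longrightarrow> norm (W' x) \<le> C' * norm x"
    using assms(3) unfolding hiso_def by blast
  obtain c where c: "c > 0" "\<And>x. x \<in> X \<Longrightarrow> c * norm x \<le> norm (W x)"
    using assms(2) unfolding hiso_def by blast
  obtain c' where c': "c' > 0" "\<And>x. x \<in> X \<Longrightarrow> c' * norm x \<le> norm (W' x)"
    using assms(3) unfolding hiso_def by blast
  have WX: "\<And>x. x \<in> X \<Longrightarrow> W x \<in> X" using assms(2) unfolding hiso_def by blast
  have "norm (W' (W x)) \<le> (C' * C) * norm x" if "x \<in> X" for x
  proof -
    have "norm (W' (W x)) \<le> C' * norm (W x)" using C' WX that by auto
    also have "\<dots> \<le> C' * (C * norm x)" using C C' that by (intro mult_left_mono) auto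
    finally show ?thesis by (simp add: mult.assoc)
  qed
  moreover have "(c' * c) * norm x \<le> norm (W' (W x))" if "x \<in> X" for x
  proof -
    have "c' * (c * norm x) \<le> c' * norm (W x)" using c c' that by (intro mult_left_mono) auto
    also have "\<dots> \<le> norm (W' (W x))" using c' WX that by auto
    finally show ?thesis by (simp add: mult.assoc)
  qed
  moreover have "C' * C \<ge> 0" "c' * c > 0" using C c C' c' by auto
  moreover have "\<exists>x\<in>X. W' (W x) = y" if y: "y \<in> X" for y
  proof -
    obtain z where "z \<in> X" "W' z = y" using assms(3) y unfolding hiso_def by blast
    moreover then obtain x where "x \<in> X" "W x = z" using assms(2) unfolding hiso_def by blast
    ultimately show ?thesis by blast
  qed
  moreover have "W (M x) = M (W x)" "W' (M x) = M (W' x)" "W (c *\<^sub>R x) = c *\<^sub>R W x" "W' (c *\<^sub>R x) = c *\<^sub>R W' x"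
    "W' x \<in> X" if "x \<in> X" for x c
    using assms(2,3) that unfolding hiso_def by simp_all
  moreover have "W (x + y) = W x + W y" "W' (x + y) = W' x + W' y" if "x \<in> X" "y \<in> X" for x y
    using assms(2,3) that unfolding hiso_def by simp_all
  ultimately show ?thesis
    unfolding hiso_def using WX by (intro conjI exI[of _ "C' * C"] exI[of _ "c' * c"]) simp_all
qed

section \<open>Linear evolution equations with integrable generator\<close>

text \<open>Models the equation \<open>V' = K(t) V\<close> in X through the forms
  \<open>k t x y\<close>, standing for the inner product of \<open>K(t) x\<close> with y. In this
  way measurability in time is asked of scalar functions only. As M is skew, the condition
  \<open>kM\<close> says in weak form that \<open>K(t)\<close> commutes with M.\<close>

locale bilinear_flow =
  fixes X :: "'h::{real_inner,complete_space} set" and M :: "'h \<Rightarrow> 'h"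
    and k :: "real \<Rightarrow> 'h \<Rightarrow> 'h \<Rightarrow> real" and \<beta> :: "real \<Rightarrow> real"
  assumes subX: "subspace X" and clX: "closed X"
    and M_skew: "skew M" and MX: "\<And>x. x \<in> X \<Longrightarrow> M x \<in> X"
    and bil: "\<And>s. bounded_bilinear (k s)"
    and meas: "\<And>x y. (\<lambda>s. k s x y) \<in> borel_measurable borel"
    and bnd: "\<And>s x y. \<bar>k s x y\<bar> \<le> \<beta> s * norm x * norm y"
    and kM: "\<And>s x y. k s (M x) y = - k s x (M y)"
    and \<beta>_int: "integrable lborel \<beta>" and \<beta>_nonneg: "\<And>s. 0 \<le> \<beta> s"
begin

definition bc :: "(real \<Rightarrow> 'h) \<Rightarrow> bool" where
  "bc V \<longleftrightarrow> continuous_on UNIV V \<and> (\<exists>m. \<forall>t. norm (V t) \<le> m)"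

text \<open>The weak integral over J of the vectors \<open>K(r) (V r)\<close>, that is, the element
  of X that represents the functional given by the scalar integrals.\<close>

definition kint :: "real set \<Rightarrow> (real \<Rightarrow> 'h) \<Rightarrow> 'h" where
  "kint J V = (SOME R. R \<in> X \<and> (\<forall>q\<in>X. R \<bullet> q = (LINT r:J|lborel. k r (V r) q)))"

definition sol :: "(real \<Rightarrow> 'h) \<Rightarrow> bool" where
  "sol V \<longleftrightarrow> continuous_on UNIV V \<and> (\<forall>t. V t \<in> X)
     \<and> (\<forall>s t q. s \<le> t \<longrightarrow> q \<in> X \<longrightarrow> (V t - V s) \<bullet> q = (LINT r:{s..t}|lborel. k r (V r) q))"

lemma \<beta>_set: "J \<in> sets borel \<Longrightarrow> set_integrable lborel J \<beta>"
  using \<beta>_int unfolding set_integrable_def by (intro integrable_mult_indicator) auto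

lemma \<beta>_set_nonneg: "0 \<le> (LINT r:J|lborel. \<beta> r)"
  unfolding set_lebesgue_integral_def by (intro Bochner_Integration.integral_nonneg) (auto simp: \<beta>_nonneg)

lemma \<beta>_set_mono: "A \<subseteq> B \<Longrightarrow> A \<in> sets borel \<Longrightarrow> B \<in> sets borel \<Longrightarrow> (LINT r:A|lborel. \<beta> r) \<le> (LINT r:B|lborel. \<beta> r)"
  using \<beta>_set[of A] \<beta>_set[of B] unfolding set_lebesgue_integral_def set_integrable_def
  by (intro integral_mono) (auto simp: \<beta>_nonneg indicator_def)

lemma k_meas: "continuous_on UNIV V \<Longrightarrow> (\<lambda>r. k r (V r) q) \<in> borel_measurable borel"
  by (rule bilinear_measurable_compose[OF bil meas]) auto

lemma k_set_integrable:
  assumes "bc V" "J \<in> sets borel"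
  shows "set_integrable lborel J (\<lambda>r. k r (V r) q)"
proof -
  obtain m where m: "\<And>t. norm (V t) \<le> m" using assms by (auto simp: bc_def)
  have m0: "0 \<le> m" using norm_ge_zero m order_trans by blast
  note [measurable] = k_meas[of V q] assms(2)
  show ?thesis unfolding set_integrable_def
  proof (rule Bochner_Integration.integrable_bound[where f = "\<lambda>r. \<beta> r * (m * norm q)"])
    show "integrable lborel (\<lambda>r. \<beta> r * (m * norm q))" using \<beta>_int by simp
    show "(\<lambda>r. indicat_real J r *\<^sub>R k r (V r) q) \<in> borel_measurable lborel"
      using assms(1) by (auto simp: bc_def intro!: borel_measurable_scaleR k_meas)
    show "AE r in lborel. norm (indicat_real J r *\<^sub>R k r (V r) q) \<le> norm (\<beta> r * (m * norm q))"
    proof (rule AE_I2)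
      fix r
      have "\<bar>k r (V r) q\<bar> \<le> \<beta> r * norm (V r) * norm q" by (rule bnd)
      also have "\<dots> \<le> \<beta> r * m * norm q" using m \<beta>_nonneg by (intro mult_mono) (auto simp: m0)
      finally show "norm (indicat_real J r *\<^sub>R k r (V r) q) \<le> norm (\<beta> r * (m * norm q))"
        using \<beta>_nonneg[of r] m0 by (auto simp: indicator_def abs_mult mult.assoc)
    qed
  qed
qed

lemma k_integral_bound:
  assumes "bc V" "J \<in> sets borel" and m: "\<And>t. t \<in> J \<Longrightarrow> norm (V t) \<le> m"
  shows "\<bar>LINT r:J|lborel. k r (V r) q\<bar> \<le> (LINT r:J|lborel. \<beta> r) * m * norm q"
proof -
  have "\<bar>LINT r:J|lborel. k r (V r) q\<bar> \<le> (LINT r|lborel. (indicat_real J r *\<^sub>R \<beta> r) * (m * norm q))"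
    unfolding set_lebesgue_integral_def real_norm_def[symmetric]
  proof (rule Bochner_Integration.integral_norm_bound_integral)
    show "integrable lborel (\<lambda>r. indicat_real J r *\<^sub>R k r (V r) q)"
      using k_set_integrable[OF assms(1,2)] by (simp add: set_integrable_def)
    show "integrable lborel (\<lambda>r. (indicat_real J r *\<^sub>R \<beta> r) * (m * norm q))"
      using \<beta>_set[OF assms(2)] by (simp add: set_integrable_def)
    fix r
    have "\<bar>k r (V r) q\<bar> \<le> \<beta> r * norm (V r) * norm q" by (rule bnd)
    also have "\<dots> \<le> \<beta> r * m * norm q" if "r \<in> J"
      using m[OF that] \<beta>_nonneg by (intro mult_right_mono mult_left_mono) auto
    finally show "norm (indicat_real J r *\<^sub>R k r (V r) q) \<le> (indicat_real J r *\<^sub>R \<beta> r) * (m * norm q)"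
      by (auto simp: indicator_def mult.assoc)
  qed
  then show ?thesis unfolding integral_mult_left_zero set_lebesgue_integral_def by (simp only: mult.assoc)
qed

lemma k_lin:
  "k r (x + y) q = k r x q + k r y q" "k r (c *\<^sub>R x) q = c * k r x q"
  "k r q (x + y) = k r q x + k r q y" "k r q (c *\<^sub>R x) = c * k r q x"
  "k r (x - y) q = k r x q - k r y q"
  using bounded_bilinear.add_left[OF bil] bounded_bilinear.add_right[OF bil] bounded_bilinear.scaleR_left[OF bil]
    bounded_bilinear.scaleR_right[OF bil] bounded_bilinear.diff_left[OF bil] by auto

lemma kint_props:
  assumes "bc V" "J \<in> sets borel"
  shows kint_X: "kint J V \<in> X" and kint_inner: "q \<in> X \<Longrightarrow> kint J V \<bullet> q = (LINT r:J|lborel. k r (V r) q)"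
proof -
  obtain m where m: "\<And>t. norm (V t) \<le> m" using assms by (auto simp: bc_def)
  have i: "set_integrable lborel J (\<lambda>r. k r (V r) q)" for q by (rule k_set_integrable[OF assms])
  have "\<exists>R\<in>X. \<forall>q\<in>X. R \<bullet> q = (LINT r:J|lborel. k r (V r) q)"
  proof (rule riesz_subspace[OF subX clX])
    show "(LINT r:J|lborel. k r (V r) (x + y)) = (LINT r:J|lborel. k r (V r) x) + (LINT r:J|lborel. k r (V r) y)" for x y
      by (simp add: k_lin set_integral_add[OF i i])
    show "(LINT r:J|lborel. k r (V r) (c *\<^sub>R x)) = c * (LINT r:J|lborel. k r (V r) x)" for c x
      by (simp add: k_lin)
    show "\<bar>LINT r:J|lborel. k r (V r) x\<bar> \<le> ((LINT r:J|lborel. \<beta> r) * m) * norm x" for x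
      by (rule k_integral_bound[OF assms m])
  qed
  then have *: "kint J V \<in> X \<and> (\<forall>q\<in>X. kint J V \<bullet> q = (LINT r:J|lborel. k r (V r) q))"
    unfolding kint_def by (rule someI2_bex) blast
  show "kint J V \<in> X" "q \<in> X \<Longrightarrow> kint J V \<bullet> q = (LINT r:J|lborel. k r (V r) q)"
    using * by auto
qed

lemma X_eqI: "x \<in> X \<Longrightarrow> y \<in> X \<Longrightarrow> (\<And>q. q \<in> X \<Longrightarrow> x \<bullet> q = y \<bullet> q) \<Longrightarrow> x = y"
proof -
  assume a: "x \<in> X" "y \<in> X" "\<And>q. q \<in> X \<Longrightarrow> x \<bullet> q = y \<bullet> q"
  have "(x - y) \<bullet> (x - y) = 0" using a subX by (subst inner_diff_left) (simp add: subspace_diff)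
  then show ?thesis by simp
qed

lemma kintI:
  assumes "bc V" "J \<in> sets borel" "R \<in> X" "\<And>q. q \<in> X \<Longrightarrow> R \<bullet> q = (LINT r:J|lborel. k r (V r) q)"
  shows "kint J V = R"
  by (rule X_eqI) (use assms kint_props in auto)

lemma bc_add: "bc V \<Longrightarrow> bc V' \<Longrightarrow> bc (\<lambda>t. V t + V' t)"
  unfolding bc_def by (auto intro!: continuous_intros) (meson add_mono norm_triangle_ineq order_trans)

lemma bc_scaleR: "bc V \<Longrightarrow> bc (\<lambda>t. c *\<^sub>R V t)"
  unfolding bc_def by (auto intro!: continuous_intros) (meson abs_ge_zero mult_left_mono)

lemma bc_linear: "bounded_linear L \<Longrightarrow> bc V \<Longrightarrow> bc (\<lambda>t. L (V t))"
proof -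
  assume L: "bounded_linear L" and V: "bc V"
  obtain m where m: "\<And>t. norm (V t) \<le> m" using V by (auto simp: bc_def)
  have "norm (L (V t)) \<le> onorm L * m" for t
    using onorm[OF L, of "V t"] mult_left_mono[OF m onorm_pos_le[OF L], of t] by linarith
  then show ?thesis using V bounded_linear.continuous_on[OF L] by (auto simp: bc_def)
qed

lemma bc_diff: "bc V \<Longrightarrow> bc V' \<Longrightarrow> bc (\<lambda>t. V t - V' t)"
  using bc_add[of V "\<lambda>t. (-1) *\<^sub>R V' t"] bc_scaleR[of V' "-1"] by simp

lemma kint_add: 
  assumes "bc V" "bc V'" "J \<in> sets borel"
  shows "kint J (\<lambda>t. V t + V' t) = kint J V + kint J V'"
  using assms subX by (intro kintI) (auto simp: bc_add kint_X kint_inner subspace_add inner_add_left k_lin set_integral_add k_set_integrable)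

lemma kint_scaleR: 
  assumes "bc V" "J \<in> sets borel"
  shows "kint J (\<lambda>t. c *\<^sub>R V t) = c *\<^sub>R kint J V"
  using assms subX by (intro kintI) (auto simp: bc_scaleR kint_X kint_inner subspace_scale k_lin)

lemma kint_diff: 
  assumes "bc V" "bc V'" "J \<in> sets borel"
  shows "kint J (\<lambda>t. V t - V' t) = kint J V - kint J V'"
  using kint_add[OF assms(1) bc_scaleR[OF assms(2)] assms(3), of "-1"] kint_scaleR[OF assms(2,3), of "-1"] by simp

text \<open>Two signs cancel: one from the skewness of M, used to move M to the test vector, and one
  from \<open>kM\<close>, used to move it back inside the form.\<close>

lemma kint_M: 
  assumes "bc V" "J \<in> sets borel"
  shows "kint J (\<lambda>t. M (V t)) = M (kint J V)"
proof (rule kintI)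
  show "bc (\<lambda>t. M (V t))" using bc_linear[OF skew_bounded_linear[OF M_skew] assms(1)] .
  show "M (kint J V) \<bullet> q = (LINT r:J|lborel. k r (M (V r)) q)" if "q \<in> X" for q
  proof -
    have "M (kint J V) \<bullet> q = - (kint J V \<bullet> M q)" using M_skew by (simp add: skew_def)
    also have "\<dots> = - (LINT r:J|lborel. k r (V r) (M q))" using kint_inner[OF assms MX[OF that]] by simp
    also have "\<dots> = (LINT r:J|lborel. k r (M (V r)) q)" by (simp add: kM set_lebesgue_integral_def)
    finally show ?thesis .
  qed
qed (use assms MX kint_X in auto)

lemma kint_Un:
  assumes "bc V" "J \<in> sets borel" "J' \<in> sets borel" "J \<inter> J' = {}"
  shows "kint (J \<union> J') V = kint J V + kint J' V"
  using assms subX 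
  by (intro kintI) (auto simp: kint_X kint_inner subspace_add inner_add_left set_integral_Un k_set_integrable)

text \<open>The integral is tested against itself, and one factor of its norm cancels.\<close>

lemma kint_norm:
  assumes "bc V" "J \<in> sets borel" "\<And>t. t \<in> J \<Longrightarrow> norm (V t) \<le> m" "0 \<le> m"
  shows "norm (kint J V) \<le> (LINT r:J|lborel. \<beta> r) * m"
proof (cases "kint J V = 0")
  case True
  then show ?thesis using \<beta>_set_nonneg assms by simp
next
  case False
  have "norm (kint J V) * norm (kint J V) = kint J V \<bullet> kint J V"
    by (simp add: dot_square_norm power2_eq_square)
  also have "\<dots> = (LINT r:J|lborel. k r (V r) (kint J V))" using kint_props assms by blast
  also have "\<dots> \<le> (LINT r:J|lborel. \<beta> r) * m * norm (kint J V)"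
    using k_integral_bound[OF assms(1-3), of "kint J V"] by simp
  finally show ?thesis using False by simp
qed

text \<open>The increment between s and t is an integral over a part of \<open>{s<..t}\<close>, so
  it is dominated by the increment of the continuous primitive \<open>B\<close> of
  \<open>\<beta>\<close>.\<close>

lemma kint_continuous:
  assumes V: "bc V" and J: "J \<in> sets borel"
  shows "continuous_on UNIV (\<lambda>t. kint (J \<inter> {..t}) V)"
proof -
  obtain m where m: "\<And>t. norm (V t) \<le> m" using V by (auto simp: bc_def)
  have m0: "0 \<le> m" using norm_ge_zero m order_trans by blast
  define B where "B t = (LINT r:{..t}|lborel. \<beta> r)" for t
  have st: "dist (kint (J \<inter> {..t}) V) (kint (J \<inter> {..s}) V) \<le> m * \<bar>B t - B s\<bar>" if "s \<le> t" for s t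
  proof -
    have "kint (J \<inter> {..t}) V = kint ((J \<inter> {..s}) \<union> (J \<inter> {s<..t})) V"
      using that by (intro arg_cong[where f = "\<lambda>J. kint J V"]) auto
    also have "\<dots> = kint (J \<inter> {..s}) V + kint (J \<inter> {s<..t}) V"
      using V J by (intro kint_Un) auto
    finally have "dist (kint (J \<inter> {..t}) V) (kint (J \<inter> {..s}) V) = norm (kint (J \<inter> {s<..t}) V)"
      by (simp add: dist_norm)
    also have "\<dots> \<le> (LINT r:J \<inter> {s<..t}|lborel. \<beta> r) * m" using V J m m0 by (intro kint_norm) auto
    also have "\<dots> \<le> (LINT r:{s..t}|lborel. \<beta> r) * m" using m0 J by (intro mult_right_mono \<beta>_set_mono) auto
    also have "\<dots> \<le> m * \<bar>B t - B s\<bar>"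
      unfolding B_def set_integral_atLeastAtMost_diff[OF \<beta>_int that] using m0 by (simp add: mult.commute mult_left_mono)
    finally show ?thesis .
  qed
  then have st': "dist (kint (J \<inter> {..t}) V) (kint (J \<inter> {..s}) V) \<le> m * \<bar>B t - B s\<bar>" for s t
    using st[of t s] st[of s t] by (cases "s \<le> t") (auto simp: dist_commute abs_minus_commute)
  have B: "continuous_on UNIV B" unfolding B_def by (rule continuous_indefinite_lebesgue_integral[OF \<beta>_int])
  show ?thesis unfolding continuous_on_eq_continuous_at[OF open_UNIV]
  proof (intro ballI)
    fix s
    have "((\<lambda>t. m * \<bar>B t - B s\<bar>) \<longlongrightarrow> m * \<bar>B s - B s\<bar>) (at s)"
      using B by (intro tendsto_intros) (auto simp: continuous_on_def)
    then have "((\<lambda>t. m * \<bar>B t - B s\<bar>) \<longlongrightarrow> 0) (at s)" by simp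
    then have "((\<lambda>t. dist (kint (J \<inter> {..t}) V) (kint (J \<inter> {..s}) V)) \<longlongrightarrow> 0) (at s)"
      by (rule tendsto_sandwich[rotated 3, OF _ always_eventually always_eventually tendsto_const]) (use st' in auto)
    then show "isCont (\<lambda>t. kint (J \<inter> {..t}) V) s"
      unfolding isCont_def using tendsto_dist_iff by blast
  qed
qed

text \<open>The integral equation with initial value x, where the generator is switched off outside
  J. The cut-off lets the equation live on the whole time line, so that bounded intervals and half
  lines are treated in one space of bounded continuous functions.\<close>

definition fp :: "real set \<Rightarrow> 'h \<Rightarrow> (real \<Rightarrow> 'h) \<Rightarrow> bool" where
  "fp J x V \<longleftrightarrow> bc V \<and> (\<forall>t. V t \<in> X) \<and> (\<forall>t. V t = x + kint (J \<inter> {..t}) V)"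

section \<open>Sets of small mass: contraction and invertibility\<close>

context
  fixes J :: "real set"
  assumes J: "J \<in> sets borel" and small: "(LINT r:J|lborel. \<beta> r) \<le> 1/4"
begin

lemma Jt: "J \<inter> {..t} \<in> sets borel" "(LINT r:J \<inter> {..t}|lborel. \<beta> r) \<le> 1/4"
proof -
  show "J \<inter> {..t} \<in> sets borel" using J by auto
  then show "(LINT r:J \<inter> {..t}|lborel. \<beta> r) \<le> 1/4"
    using \<beta>_set_mono[of "J \<inter> {..t}" J] J small by auto
qed

lemma kint_small:
  assumes "bc V" "\<And>t. norm (V t) \<le> m" 
  shows "norm (kint (J \<inter> {..t}) V) \<le> m / 4" "norm (kint J V) \<le> m / 4"
proof -
  have m0: "0 \<le> m" using norm_ge_zero assms(2) order_trans by blast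
  have "norm (kint (J \<inter> {..t}) V) \<le> (LINT r:J \<inter> {..t}|lborel. \<beta> r) * m"
    using Jt assms m0 by (intro kint_norm) auto
  also have "\<dots> \<le> 1/4 * m" using Jt m0 by (intro mult_right_mono) auto
  finally show "norm (kint (J \<inter> {..t}) V) \<le> m / 4" by simp
  have "norm (kint J V) \<le> (LINT r:J|lborel. \<beta> r) * m"
    using J assms m0 by (intro kint_norm) auto
  also have "\<dots> \<le> 1/4 * m" using small m0 by (intro mult_right_mono) auto
  finally show "norm (kint J V) \<le> m / 4" by simp
qed

lemma bc_apply: "bc (apply_bcontfun V)"
proof -
  have "norm (apply_bcontfun V t) \<le> norm V" for t by (rule norm_bounded)
  then show ?thesis unfolding bc_def by (auto intro!: exI[of _ "norm V"])
qed

lemma bc_Bcontfun: "bc V \<Longrightarrow> apply_bcontfun (Bcontfun V) = V"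
  unfolding bc_def by (intro Bcontfun_inverse) (auto intro: bcontfun_normI)

text \<open>Banach's fixed point theorem in the closed set of bounded continuous functions with
  values in X: as J has mass at most 1/4, the right-hand side of the integral equation is a
  contraction with constant 1/4 in the supremum norm.\<close>

lemma fp_ex1: assumes x: "x \<in> X" shows "\<exists>!V. fp J x V"
proof -
  define S where "S = {V :: real \<Rightarrow>\<^sub>C 'h. \<forall>t. apply_bcontfun V t \<in> X}"
  define F where "F V = Bcontfun (\<lambda>t. x + kint (J \<inter> {..t}) (apply_bcontfun V))" for V :: "real \<Rightarrow>\<^sub>C 'h"
  have bcF: "bc (\<lambda>t. x + kint (J \<inter> {..t}) V)" if V: "bc V" for V
  proof -
    obtain m where m: "\<And>t. norm (V t) \<le> m" using V by (auto simp: bc_def)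
    have "norm (x + kint (J \<inter> {..t}) V) \<le> norm x + m / 4" for t
      using norm_triangle_ineq kint_small(1)[OF V m, of t] by (meson add_left_mono order_trans)
    then show ?thesis unfolding bc_def by (auto intro!: continuous_intros kint_continuous V J)
  qed
  have Fa: "apply_bcontfun (F V) t = x + kint (J \<inter> {..t}) (apply_bcontfun V)" for V t
    unfolding F_def by (subst bc_Bcontfun) (auto intro: bcF bc_apply)
  have "S = PiC UNIV (\<lambda>_. X)" unfolding S_def by (auto simp: mem_PiC_iff Pi_iff)
  then have "closed S" using clX by (simp add: closed_PiC)
  then have cS: "complete S" by (simp add: complete_eq_closed)
  have "\<exists>!V\<in>S. F V = V"
  proof (rule Banach_fix[OF cS, where c = "1/4"])
    have "apply_bcontfun (0 :: real \<Rightarrow>\<^sub>C 'h) t \<in> X" for t using subX by (simp add: subspace_0)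
    then show "S \<noteq> {}" unfolding S_def by blast
    show "F ` S \<subseteq> S" using x subX Jt kint_X bc_apply by (auto simp: S_def Fa subspace_add)
    show "dist (F V) (F V') \<le> 1/4 * dist V V'" for V V'
    proof (rule dist_bound)
      fix t
      have d: "norm (apply_bcontfun V s - apply_bcontfun V' s) \<le> dist V V'" for s
        using dist_bounded[of V s V'] by (simp add: dist_norm)
      have "dist (apply_bcontfun (F V) t) (apply_bcontfun (F V') t)
          = norm (kint (J \<inter> {..t}) (\<lambda>s. apply_bcontfun V s - apply_bcontfun V' s))"
        using Jt by (simp add: Fa dist_norm kint_diff bc_apply)
      also have "\<dots> \<le> dist V V' / 4" by (rule kint_small(1)[OF bc_diff[OF bc_apply bc_apply] d])
      finally show "dist (apply_bcontfun (F V) t) (apply_bcontfun (F V') t) \<le> 1/4 * dist V V'" by simp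
    qed
  qed auto
  then obtain V where V: "V \<in> S" "F V = V" and un: "\<And>V'. V' \<in> S \<Longrightarrow> F V' = V' \<Longrightarrow> V' = V" by blast
  show ?thesis
  proof (rule ex1I)
    show "fp J x (apply_bcontfun V)"
      unfolding fp_def using V bc_apply Fa[of V] by (auto simp: S_def)
    fix V' assume V': "fp J x V'"
    have a: "apply_bcontfun (Bcontfun V') = V'" using V' bc_Bcontfun by (auto simp: fp_def)
    have "F (Bcontfun V') = Bcontfun V'" unfolding F_def a by (rule arg_cong[where f = Bcontfun], rule ext)
      (use V' in \<open>auto simp: fp_def\<close>)
    moreover have "Bcontfun V' \<in> S" using V' a by (auto simp: S_def fp_def)
    ultimately have "Bcontfun V' = V" using un by blast
    then show "V' = apply_bcontfun V" using a by simp
  qed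
qed

lemma fp_bc: "fp J x V \<Longrightarrow> bc V" by (simp add: fp_def)

text \<open>The supremum m of the norm is finite and satisfies
  \<open>m \<le> norm x + m / 4\<close>, so the last term can be absorbed.\<close>

lemma fp_bound:
  assumes "fp J x V" shows "norm (V t) \<le> 4/3 * norm x"
proof -
  define m where "m = (SUP t. norm (V t))"
  have bdd: "bdd_above (range (\<lambda>t. norm (V t)))" using fp_bc[OF assms] unfolding bc_def bdd_above_def by auto
  have m: "norm (V t) \<le> m" for t unfolding m_def by (rule cSUP_upper) (use bdd in auto)
  have "norm (V t) \<le> norm x + m / 4" for t
  proof -
    have "V t = x + kint (J \<inter> {..t}) V" using assms by (simp add: fp_def)
    then have "norm (V t) \<le> norm x + norm (kint (J \<inter> {..t}) V)" using norm_triangle_ineq by metis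
    then show ?thesis using kint_small(1)[OF fp_bc[OF assms] m, of t] by auto
  qed
  then have "m \<le> norm x + m / 4" unfolding m_def by (intro cSUP_least) auto
  then show ?thesis using m[of t] by linarith
qed

definition fl :: "'h \<Rightarrow> real \<Rightarrow> 'h" where "fl x = (THE V. fp J x V)"

text \<open>The value of the solution once all of J has been passed: the integral is no longer cut
  off at a time t. For an interval this is the transition operator, for a half line the limit at
  infinity.\<close>

definition Wop :: "'h \<Rightarrow> 'h" where "Wop x = x + kint J (fl x)"

lemma fl: "x \<in> X \<Longrightarrow> fp J x (fl x)"
  unfolding fl_def by (rule theI'[OF fp_ex1])

lemma fl_eqI: "x \<in> X \<Longrightarrow> fp J x V \<Longrightarrow> fl x = V"
  using fp_ex1 fl by blast

lemma fl_bc: "x \<in> X \<Longrightarrow> bc (fl x)"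
  using fl by (simp add: fp_def)

lemma fl_eq: "x \<in> X \<Longrightarrow> fl x t = x + kint (J \<inter> {..t}) (fl x)"
  using fl[of x] unfolding fp_def by blast

lemma fl_X: "x \<in> X \<Longrightarrow> fl x t \<in> X"
  using fl[of x] unfolding fp_def by blast

lemma fl_add:
  assumes "x \<in> X" "y \<in> X" shows "fl (x + y) = (\<lambda>t. fl x t + fl y t)"
proof (rule fl_eqI)
  show "fp J (x + y) (\<lambda>t. fl x t + fl y t)" unfolding fp_def
  proof (intro conjI allI)
    fix t
    show "fl x t + fl y t = x + y + kint (J \<inter> {..t}) (\<lambda>t. fl x t + fl y t)"
      by (subst kint_add) (use assms fl_eq[of x t] fl_eq[of y t] fl_bc Jt in \<open>auto simp: algebra_simps\<close>)
  qed (use assms fl_bc fl_X bc_add subX in \<open>auto intro: subspace_add\<close>)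
qed (use assms subX in \<open>auto intro: subspace_add\<close>)

lemma fl_scaleR:
  assumes "x \<in> X" shows "fl (c *\<^sub>R x) = (\<lambda>t. c *\<^sub>R fl x t)"
proof (rule fl_eqI)
  show "fp J (c *\<^sub>R x) (\<lambda>t. c *\<^sub>R fl x t)" unfolding fp_def
  proof (intro conjI allI)
    fix t
    have "c *\<^sub>R fl x t = c *\<^sub>R (x + kint (J \<inter> {..t}) (fl x))" using fl_eq[OF assms, of t] by simp
    then show "c *\<^sub>R fl x t = c *\<^sub>R x + kint (J \<inter> {..t}) (\<lambda>t. c *\<^sub>R fl x t)"
      by (subst kint_scaleR) (use assms fl_bc Jt in \<open>auto simp: scaleR_add_right\<close>)
  qed (use assms fl_bc fl_X bc_scaleR subX in \<open>auto intro: subspace_scale\<close>)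
qed (use assms subX in \<open>auto intro: subspace_scale\<close>)

lemma fl_M:
  assumes "x \<in> X" shows "fl (M x) = (\<lambda>t. M (fl x t))"
proof (rule fl_eqI)
  show "fp J (M x) (\<lambda>t. M (fl x t))" unfolding fp_def
  proof (intro conjI allI)
    fix t
    have "M (fl x t) = M (x + kint (J \<inter> {..t}) (fl x))" using fl_eq[OF assms, of t] by simp
    then show "M (fl x t) = M x + kint (J \<inter> {..t}) (\<lambda>t. M (fl x t))"
      by (subst kint_M) (use assms fl_bc Jt linear_add[OF bounded_linear.linear[OF skew_bounded_linear[OF M_skew]]] in auto)
  qed (use assms fl_bc fl_X bc_linear[OF skew_bounded_linear[OF M_skew]] MX in auto)
qed (use assms MX in auto)

lemma Wop_add: "x \<in> X \<Longrightarrow> y \<in> X \<Longrightarrow> Wop (x + y) = Wop x + Wop y"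
  unfolding Wop_def by (simp add: fl_add kint_add fl_bc J)

lemma Wop_scaleR: "x \<in> X \<Longrightarrow> Wop (c *\<^sub>R x) = c *\<^sub>R Wop x"
  unfolding Wop_def by (simp add: fl_scaleR kint_scaleR fl_bc J scaleR_add_right)

lemma Wop_X: "x \<in> X \<Longrightarrow> Wop x \<in> X"
  unfolding Wop_def using kint_X[OF fl_bc J] subX by (auto intro: subspace_add)

text \<open>The solution is bounded by \<open>4/3 * norm x\<close> and J contributes the factor 1/4.
  That the product 1/3 is below 1 is what makes the operator invertible.\<close>

lemma Wop_near: "x \<in> X \<Longrightarrow> norm (Wop x - x) \<le> 1/3 * norm x"
  unfolding Wop_def using kint_small(2)[OF fl_bc fp_bound[OF fl]] by auto

lemma Wop_hiso: "hiso X M Wop"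
  unfolding hiso_def
proof (intro conjI ballI allI)
  show "Wop (M x) = M (Wop x)" if "x \<in> X" for x
    unfolding Wop_def using that 
    by (simp add: fl_M kint_M fl_bc J linear_add[OF bounded_linear.linear[OF skew_bounded_linear[OF M_skew]]])
  show "\<exists>C\<ge>0. \<forall>x\<in>X. norm (Wop x) \<le> C * norm x"
  proof (rule exI[of _ 2], intro conjI ballI)
    fix x assume "x \<in> X"
    from Wop_near[OF this] show "norm (Wop x) \<le> 2 * norm x"
      using norm_triangle_ineq2[of "Wop x" x] norm_ge_zero[of x] by linarith
  qed simp
  show "\<exists>c>0. \<forall>x\<in>X. c * norm x \<le> norm (Wop x)"
  proof (rule exI[of _ "1/2"], intro conjI ballI)
    fix x assume "x \<in> X"
    from Wop_near[OF this] show "1/2 * norm x \<le> norm (Wop x)"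
      using norm_triangle_ineq2[of x "Wop x"] norm_ge_zero[of "Wop x"]
      unfolding norm_minus_commute[of x] by linarith
  qed simp
  fix y assume y: "y \<in> X"
  \<comment> \<open>Surjectivity: the preimages of y are the fixed points of
    \<open>x \<mapsto> y - (Wop x - x)\<close>, a contraction with constant 1/3 by linearity and
    \<open>Wop_near\<close>.\<close>
  have "\<exists>!x\<in>X. y - (Wop x - x) = x"
  proof (rule Banach_fix[where c = "1/3"])
    show "complete X" using clX by (simp add: complete_eq_closed)
    show "X \<noteq> {}" using y by blast
    show "(\<lambda>x. y - (Wop x - x)) ` X \<subseteq> X" using y Wop_X subX by (auto intro!: subspace_diff)
    show "dist (y - (Wop x - x)) (y - (Wop x' - x')) \<le> 1/3 * dist x x'" if "x \<in> X" "x' \<in> X" for x x'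
    proof -
      have xd: "x - x' \<in> X" using that subX by (simp add: subspace_diff)
      have "Wop (x - x') = Wop x - Wop x'"
        using Wop_add[of "x - x'" x'] xd that by simp
      then have "dist (y - (Wop x - x)) (y - (Wop x' - x')) = norm (Wop (x - x') - (x - x'))"
        by (simp add: dist_norm) (metis (no_types) diff_diff_eq2 diff_add_eq_diff_diff_swap norm_minus_commute add_diff_eq diff_add_eq)
      then show ?thesis using Wop_near[OF xd] by (simp add: dist_norm)
    qed
  qed auto
  then show "\<exists>x\<in>X. Wop x = y" by (metis add.commute add_diff_cancel_left' diff_add_cancel)
qed (use Wop_add Wop_scaleR Wop_X in auto)

end

section \<open>Solutions on intervals and half lines, and the limit at infinity\<close>

lemma sol_step:
  assumes V: "sol V" and ab: "a \<le> b" and small: "(LINT r:{a..b}|lborel. \<beta> r) \<le> 1/4"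
  shows "V b = Wop {a..b} (V a)"
proof -
  define c where "c t = max a (min b t)" for t
  have cont: "continuous_on UNIV V" and VX: "\<And>t. V t \<in> X" using V by (auto simp: sol_def)
  have "compact (V ` {a..b})" using cont by (intro compact_continuous_image) (auto intro: continuous_on_subset)
  then obtain m where m: "\<And>t. t \<in> {a..b} \<Longrightarrow> norm (V t) \<le> m"
    using compact_imp_bounded bounded_iff by (metis imageI)
  have bcV: "bc (\<lambda>t. V (c t))" unfolding bc_def
  proof (intro conjI exI allI)
    show "continuous_on UNIV (\<lambda>t. V (c t))" unfolding c_def
      by (rule continuous_on_compose2[OF cont]) (auto intro!: continuous_intros)
    show "norm (V (c t)) \<le> m" for t using m ab by (auto simp: c_def)
  qed
  have eq: "V (c t) = V a + kint ({a..b} \<inter> {..t}) (\<lambda>t. V (c t))" for t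
  proof -
    have "kint ({a..b} \<inter> {..t}) (\<lambda>t. V (c t)) = V (c t) - V a"
    proof (rule kintI[OF bcV])
      show "V (c t) - V a \<in> X" using VX subX by (simp add: subspace_diff)
      fix q assume q: "q \<in> X"
      have "(V (c t) - V a) \<bullet> q = (LINT r:{a..c t}|lborel. k r (V r) q)"
        using V q by (simp add: sol_def c_def)
      also have "\<dots> = (LINT r:{a..b} \<inter> {..t}|lborel. k r (V (c r)) q)"
        unfolding set_lebesgue_integral_def
      proof (rule integral_cong_AE)
        show "(\<lambda>r. indicat_real {a..c t} r *\<^sub>R k r (V r) q) \<in> borel_measurable lborel"
          using k_meas[OF cont] by auto
        show "(\<lambda>r. indicat_real ({a..b} \<inter> {..t}) r *\<^sub>R k r (V (c r)) q) \<in> borel_measurable lborel"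
          using k_meas[of "\<lambda>t. V (c t)"] bcV by (auto simp: bc_def)
        \<comment> \<open>For t below a the first set is the single point a and the second is empty,
          so the integrands agree only up to a null set.\<close>
        show "AE r in lborel. indicat_real {a..c t} r *\<^sub>R k r (V r) q = indicat_real ({a..b} \<inter> {..t}) r *\<^sub>R k r (V (c r)) q"
          using AE_lborel_singleton[of a] by eventually_elim (use ab in \<open>auto simp: indicator_def c_def max_def min_def\<close>)
      qed
      finally show "(V (c t) - V a) \<bullet> q = (LINT r:{a..b} \<inter> {..t}|lborel. k r (V (c r)) q)" .
    qed auto
    then show ?thesis by simp
  qed
  have "fp {a..b} (V a) (\<lambda>t. V (c t))" unfolding fp_def using bcV VX eq by blast
  then have "fl {a..b} (V a) = (\<lambda>t. V (c t))" by (intro fl_eqI small VX) auto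
  then have "Wop {a..b} (V a) = V a + kint {a..b} (\<lambda>t. V (c t))" by (subst Wop_def[OF _ small]) auto
  also have "\<dots> = V (c b)" using eq[of b] ab by (simp add: Int_absorb2)
  finally show ?thesis using ab by (simp add: c_def)
qed

text \<open>The path is frozen before a and compared with the fixed point on the half line. What
  separates \<open>V t\<close> from the limit is the integral over \<open>{t<..}\<close>, which is
  controlled by the remaining mass of \<open>\<beta>\<close>.\<close>

lemma sol_tail:
  assumes V: "sol V" and small: "(LINT r:{a..}|lborel. \<beta> r) \<le> 1/4"
  shows "(V \<longlongrightarrow> Wop {a..} (V a)) at_top"
proof -
  define c where "c t = max a t" for t
  have cont: "continuous_on UNIV V" and VX: "\<And>t. V t \<in> X" using V by (auto simp: sol_def)
  \<comment> \<open>A solution is not assumed bounded. Boundedness on the half line follows from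
    \<open>sol_step\<close> on each \<open>{a..t}\<close>, whose mass is at most that of the half
    line, with a constant independent of t.\<close>
  have bd: "norm (V t) \<le> 4/3 * norm (V a)" if "a \<le> t" for t
  proof -
    have sm: "(LINT r:{a..t}|lborel. \<beta> r) \<le> 1/4"
      using \<beta>_set_mono[of "{a..t}" "{a..}"] small by auto
    have "norm (V t - V a) \<le> 1/3 * norm (V a)"
      unfolding sol_step[OF V that sm] by (rule Wop_near[OF _ sm VX]) auto
    then show ?thesis using norm_triangle_ineq2[of "V t" "V a"] by linarith
  qed
  define m where "m = 4/3 * norm (V a)"
  have bcV: "bc (\<lambda>t. V (c t))" unfolding bc_def
  proof (intro conjI exI allI)
    show "continuous_on UNIV (\<lambda>t. V (c t))" unfolding c_def
      by (rule continuous_on_compose2[OF cont]) (auto intro!: continuous_intros)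
    show "norm (V (c t)) \<le> m" for t using bd by (auto simp: c_def m_def)
  qed
  have eq: "V (c t) = V a + kint ({a..} \<inter> {..t}) (\<lambda>t. V (c t))" for t
  proof -
    have "kint ({a..} \<inter> {..t}) (\<lambda>t. V (c t)) = V (c t) - V a"
    proof (rule kintI[OF bcV])
      show "V (c t) - V a \<in> X" using VX subX by (simp add: subspace_diff)
      fix q assume q: "q \<in> X"
      have "(V (c t) - V a) \<bullet> q = (LINT r:{a..c t}|lborel. k r (V r) q)"
        using V q by (simp add: sol_def c_def)
      also have "\<dots> = (LINT r:{a..} \<inter> {..t}|lborel. k r (V (c r)) q)"
        unfolding set_lebesgue_integral_def
      proof (rule integral_cong_AE)
        show "(\<lambda>r. indicat_real {a..c t} r *\<^sub>R k r (V r) q) \<in> borel_measurable lborel"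
          using k_meas[OF cont] by auto
        show "(\<lambda>r. indicat_real ({a..} \<inter> {..t}) r *\<^sub>R k r (V (c r)) q) \<in> borel_measurable lborel"
          using k_meas[of "\<lambda>t. V (c t)"] bcV by (auto simp: bc_def)
        show "AE r in lborel. indicat_real {a..c t} r *\<^sub>R k r (V r) q = indicat_real ({a..} \<inter> {..t}) r *\<^sub>R k r (V (c r)) q"
          using AE_lborel_singleton[of a] by eventually_elim (auto simp: indicator_def c_def max_def)
      qed
      finally show "(V (c t) - V a) \<bullet> q = (LINT r:{a..} \<inter> {..t}|lborel. k r (V (c r)) q)" .
    qed auto
    then show ?thesis by simp
  qed
  have "fp {a..} (V a) (\<lambda>t. V (c t))" unfolding fp_def using bcV VX eq by blast
  then have fl: "fl {a..} (V a) = (\<lambda>t. V (c t))" by (intro fl_eqI small VX) auto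
  then have W: "Wop {a..} (V a) = V a + kint {a..} (\<lambda>t. V (c t))" by (subst Wop_def[OF _ small]) auto
  have d: "norm (V t - Wop {a..} (V a)) \<le> ((LINT r:{a..}|lborel. \<beta> r) - (LINT r:{a..} \<inter> {..t}|lborel. \<beta> r)) * m" if "a \<le> t" for t
  proof -
    have un: "{a..} = ({a..} \<inter> {..t}) \<union> {t<..}" using that by auto
    have "kint {a..} (\<lambda>t. V (c t)) = kint ({a..} \<inter> {..t}) (\<lambda>t. V (c t)) + kint {t<..} (\<lambda>t. V (c t))"
      by (subst un) (rule kint_Un[OF bcV], auto)
    then have "Wop {a..} (V a) = V (c t) + kint {t<..} (\<lambda>t. V (c t))" using W eq[of t] by simp
    then have "norm (V t - Wop {a..} (V a)) = norm (kint {t<..} (\<lambda>t. V (c t)))" using that by (simp add: c_def max_absorb2)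
    also have "\<dots> \<le> (LINT r:{t<..}|lborel. \<beta> r) * m"
      by (rule kint_norm[OF bcV]) (use bd in \<open>auto simp: c_def m_def\<close>)
    also have "(LINT r:{t<..}|lborel. \<beta> r) = (LINT r:{a..}|lborel. \<beta> r) - (LINT r:{a..} \<inter> {..t}|lborel. \<beta> r)"
      by (subst un, subst set_integral_Un) (auto intro: \<beta>_set)
    finally show ?thesis .
  qed
  have "((\<lambda>t. LINT r:{a..} \<inter> {..t}|lborel. \<beta> r) \<longlongrightarrow> (LINT r:{a..}|lborel. \<beta> r)) at_top"
    unfolding set_lebesgue_integral_def
  proof (rule integral_dominated_convergence_at_top[where w = "\<lambda>r. norm (\<beta> r)"])
    show "AE r in lborel. ((\<lambda>t. indicat_real ({a..} \<inter> {..t}) r *\<^sub>R \<beta> r) \<longlongrightarrow> indicat_real {a..} r *\<^sub>R \<beta> r) at_top"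
    proof (rule AE_I2, rule tendsto_eventually)
      fix r show "\<forall>\<^sub>F t in at_top. indicat_real ({a..} \<inter> {..t}) r *\<^sub>R \<beta> r = indicat_real {a..} r *\<^sub>R \<beta> r"
        using eventually_ge_at_top[of r] by eventually_elim (auto simp: indicator_def)
    qed
  qed (use \<beta>_int in \<open>auto simp: indicator_def\<close>)
  then have "((\<lambda>t. ((LINT r:{a..}|lborel. \<beta> r) - (LINT r:{a..} \<inter> {..t}|lborel. \<beta> r)) * m) \<longlongrightarrow> ((LINT r:{a..}|lborel. \<beta> r) - (LINT r:{a..}|lborel. \<beta> r)) * m) at_top"
    by (rule tendsto_mult_right[OF tendsto_diff[OF tendsto_const]])
  then have lim0: "((\<lambda>t. ((LINT r:{a..}|lborel. \<beta> r) - (LINT r:{a..} \<inter> {..t}|lborel. \<beta> r)) * m) \<longlongrightarrow> 0) at_top"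
    by simp
  have "\<forall>\<^sub>F t in at_top. norm (V t - Wop {a..} (V a)) \<le> ((LINT r:{a..}|lborel. \<beta> r) - (LINT r:{a..} \<inter> {..t}|lborel. \<beta> r)) * m"
    using eventually_ge_at_top[of a] by eventually_elim (rule d)
  then have "((\<lambda>t. V t - Wop {a..} (V a)) \<longlongrightarrow> 0) at_top"
    by (rule Lim_null_comparison[OF _ lim0])
  then show ?thesis by (rule LIM_zero_cancel)
qed

text \<open>The partition of the time axis depends on \<open>\<beta>\<close> alone, so one operator
  W, composed of the transition operators of the pieces and the limit operator of the last half
  line, serves all solutions.\<close>

lemma scattering_operator:
  "\<exists>W. hiso X M W \<and> (\<forall>V. sol V \<longrightarrow> (V \<longlongrightarrow> W (V 0)) at_top)"
proof -
  define B where "B t = (LINT r:{..t}|lborel. \<beta> r)" for t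
  have Bc: "continuous_on UNIV B" unfolding B_def by (rule continuous_indefinite_lebesgue_integral[OF \<beta>_int])
  have "(B \<longlongrightarrow> (LINT r|lborel. \<beta> r)) at_top"
    unfolding B_def set_lebesgue_integral_def
  proof (rule integral_dominated_convergence_at_top[where w = "\<lambda>r. norm (\<beta> r)"])
    show "AE r in lborel. ((\<lambda>t. indicat_real {..t} r *\<^sub>R \<beta> r) \<longlongrightarrow> \<beta> r) at_top"
    proof (rule AE_I2, rule tendsto_eventually)
      fix r show "\<forall>\<^sub>F t in at_top. indicat_real {..t} r *\<^sub>R \<beta> r = \<beta> r"
        using eventually_ge_at_top[of r] by eventually_elim (auto simp: indicator_def)
    qed
  qed (use \<beta>_int in \<open>auto simp: indicator_def\<close>)
  then have "\<forall>\<^sub>F t in at_top. dist (B t) (LINT r|lborel. \<beta> r) < 1/4" by (rule tendstoD) simp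
  then obtain T0 where T0: "\<And>t. t \<ge> T0 \<Longrightarrow> dist (B t) (LINT r|lborel. \<beta> r) < 1/4"
    by (auto simp: eventually_at_top_linorder)
  define T where "T = max 0 T0"
  have "T \<ge> T0" by (simp add: T_def)
  from T0[OF this] have TT: "(LINT r|lborel. \<beta> r) - B T \<le> 1/4" unfolding dist_real_def by linarith
  have tail: "(LINT r:{T..}|lborel. \<beta> r) \<le> 1/4"
  proof -
    have "(LINT r:{T<..}|lborel. \<beta> r) = (LINT r:{..T} \<union> {T<..}|lborel. \<beta> r) - B T"
      by (subst set_integral_Un) (auto intro: \<beta>_set simp: B_def)
    also have "{..T} \<union> {T<..} = UNIV" by auto
    also have "(LINT r:UNIV|lborel. \<beta> r) = (LINT r|lborel. \<beta> r)" by (simp add: set_lebesgue_integral_def)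
    finally have "(LINT r:{T<..}|lborel. \<beta> r) \<le> 1/4"
      using TT by simp
    moreover have "(LINT r:{T..}|lborel. \<beta> r) = (LINT r:{T<..}|lborel. \<beta> r)"
      unfolding set_lebesgue_integral_def
    proof (rule integral_cong_AE)
      show "AE r in lborel. indicat_real {T..} r *\<^sub>R \<beta> r = indicat_real {T<..} r *\<^sub>R \<beta> r"
        using AE_lborel_singleton[of T] by eventually_elim (auto simp: indicator_def)
    qed (use \<beta>_int in auto)
    ultimately show ?thesis by simp
  qed
  \<comment> \<open>As \<open>\<beta>\<close> may be unbounded, the length of the pieces is read off
    from the modulus of continuity of its primitive.\<close>
  have "uniformly_continuous_on {0..T} B"
    by (rule compact_uniformly_continuous) (auto intro: continuous_on_subset[OF Bc])
  then obtain \<delta> where \<delta>: "\<delta> > 0" "\<And>s t. s \<in> {0..T} \<Longrightarrow> t \<in> {0..T} \<Longrightarrow> dist t s < \<delta> \<Longrightarrow> dist (B t) (B s) < 1/4"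
    unfolding uniformly_continuous_on_def by (metis zero_less_divide_1_iff zero_less_numeral)
  have steps: "\<exists>W. hiso X M W \<and> (\<forall>V. sol V \<longrightarrow> V t = W (V 0))" if "0 \<le> t" "t \<le> T" "t \<le> real n * (\<delta>/2)" for n t
    using that
  proof (induction n arbitrary: t)
    case 0
    then have "t = 0" by simp
    then show ?case using hiso_id by blast
  next
    case (Suc n)
    \<comment> \<open>Half of \<open>\<delta>\<close> keeps the distance of t and s strictly below
      \<open>\<delta>\<close>, as the choice of \<open>\<delta>\<close> demands.\<close>
    define s where "s = max 0 (t - \<delta>/2)"
    have "t - \<delta>/2 \<le> real n * (\<delta>/2)" using Suc.prems(3) by (simp add: algebra_simps)
    moreover have "0 \<le> real n * (\<delta>/2)" using \<delta> by simp
    ultimately have "s \<le> real n * (\<delta>/2)" unfolding s_def by (rule max.boundedI[rotated])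
    then have s: "0 \<le> s" "s \<le> t" "t < s + \<delta>" "s \<le> T" "s \<le> real n * (\<delta>/2)"
      using Suc.prems \<delta> by (auto simp: s_def)
    then obtain W where W: "hiso X M W" "\<And>V. sol V \<Longrightarrow> V s = W (V 0)" using Suc.IH by blast
    have "dist (B t) (B s) < 1/4" using s Suc.prems by (intro \<delta>(2)) (auto simp: dist_real_def)
    then have "B t - B s \<le> 1/4" unfolding dist_real_def by linarith
    then have sm: "(LINT r:{s..t}|lborel. \<beta> r) \<le> 1/4"
      unfolding set_integral_atLeastAtMost_diff[OF \<beta>_int s(2)] B_def .
    have "hiso X M (\<lambda>x. Wop {s..t} (W x))"
      by (rule hiso_compose[OF MX W(1) Wop_hiso[OF _ sm] subX]) auto
    moreover have "\<forall>V. sol V \<longrightarrow> V t = Wop {s..t} (W (V 0))" using sol_step[OF _ s(2) sm] W(2) by metis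
    ultimately show ?case by (intro exI[of _ "\<lambda>x. Wop {s..t} (W x)"]) blast
  qed
  obtain n :: nat where "T / (\<delta>/2) \<le> real n" using real_arch_simple by blast
  then have "T \<le> real n * (\<delta>/2)" using \<delta> by (simp add: field_simps)
  then obtain W where W: "hiso X M W" "\<And>V. sol V \<Longrightarrow> V T = W (V 0)" using steps[of T n] by (auto simp: T_def)
  have "hiso X M (\<lambda>x. Wop {T..} (W x))"
    by (rule hiso_compose[OF MX W(1) Wop_hiso[OF _ tail] subX]) auto
  moreover have "\<forall>V. sol V \<longrightarrow> (V \<longlongrightarrow> Wop {T..} (W (V 0))) at_top" using sol_tail[OF _ tail] W(2) by metis
  ultimately show ?thesis by (intro exI[of _ "\<lambda>x. Wop {T..} (W x)"]) blast
qed

end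

subsection \<open>Square integrable functions\<close>

definition sqint :: "('a::euclidean_space \<Rightarrow> 'b::euclidean_space) \<Rightarrow> bool" where
  "sqint f \<longleftrightarrow> f \<in> borel_measurable lborel \<and> integrable lborel (\<lambda>x. (norm (f x))\<^sup>2)"

lemma sqint_measurable [measurable_dest]: "sqint f \<Longrightarrow> f \<in> borel_measurable borel"
  by (simp add: sqint_def)

lemma sqintI:
  fixes f :: "'a::euclidean_space \<Rightarrow> 'b::euclidean_space" and g :: "'a \<Rightarrow> real"
  assumes "f \<in> borel_measurable lborel" "integrable lborel g" "\<And>x. (norm (f x))\<^sup>2 \<le> g x"
  shows "sqint f"
  unfolding sqint_def
proof
  show "integrable lborel (\<lambda>x. (norm (f x))\<^sup>2)"
    using assms by (intro Bochner_Integration.integrable_bound[OF assms(2)]) (auto intro: order_trans[OF _ abs_ge_self])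
qed fact

lemma sqint_add:
  assumes "sqint f" "sqint g" shows "sqint (\<lambda>x. f x + g x)"
proof (rule sqintI[where g = "\<lambda>x. 2 * (norm (f x))\<^sup>2 + 2 * (norm (g x))\<^sup>2"])
  show "(norm (f x + g x))\<^sup>2 \<le> 2 * (norm (f x))\<^sup>2 + 2 * (norm (g x))\<^sup>2" for x
  proof -
    have "(norm (f x + g x))\<^sup>2 \<le> (norm (f x) + norm (g x))\<^sup>2" by (intro power_mono norm_triangle_ineq) auto
    also have "\<dots> \<le> 2 * (norm (f x))\<^sup>2 + 2 * (norm (g x))\<^sup>2"
      using sum_squares_bound[of "norm (f x)" "norm (g x)"] by (simp add: power2_sum)
    finally show ?thesis .
  qed
qed (use assms in \<open>auto simp: sqint_def\<close>)

lemma sqint_linear: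
  assumes "sqint f" "bounded_linear L" shows "sqint (\<lambda>x. L (f x))"
proof (rule sqintI[where g = "\<lambda>x. (onorm L)\<^sup>2 * (norm (f x))\<^sup>2"])
  have "L \<in> borel_measurable borel"
    using assms(2) by (intro borel_measurable_continuous_onI) (simp add: linear_continuous_on)
  then show "(\<lambda>x. L (f x)) \<in> borel_measurable lborel" using assms by (auto simp: sqint_def)
  show "(norm (L (f x)))\<^sup>2 \<le> (onorm L)\<^sup>2 * (norm (f x))\<^sup>2" for x
    using power_mono[OF onorm[OF assms(2)] norm_ge_zero, of "f x" 2] by (simp add: power_mult_distrib)
qed (use assms in \<open>auto simp: sqint_def\<close>)

lemma sqint_scaleR: "sqint f \<Longrightarrow> sqint (\<lambda>x. c *\<^sub>R f x)"
  by (rule sqint_linear) (auto intro: bounded_linear_scaleR_right)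

lemma sqint_minus: "sqint f \<Longrightarrow> sqint (\<lambda>x. - f x)"
  using sqint_scaleR[of f "-1"] by simp

lemma sqint_diff: "sqint f \<Longrightarrow> sqint g \<Longrightarrow> sqint (\<lambda>x. f x - g x)"
  using sqint_add[OF _ sqint_minus[of g]] by simp

lemma sqint_zero [simp]: "sqint (\<lambda>_. 0)"
  by (simp add: sqint_def)

lemma sqint_inner: "sqint f \<Longrightarrow> sqint g \<Longrightarrow> integrable lborel (\<lambda>x. f x \<bullet> g x)"
proof -
  assume a: "sqint f" "sqint g"
  note [measurable] = a[THEN sqint_measurable]
  show ?thesis
  proof (rule Bochner_Integration.integrable_bound[where f = "\<lambda>x. (norm (f x))\<^sup>2 + (norm (g x))\<^sup>2"])
    show "AE x in lborel. norm (f x \<bullet> g x) \<le> norm ((norm (f x))\<^sup>2 + (norm (g x))\<^sup>2)"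
    proof (rule AE_I2)
      fix x
      have "\<bar>f x \<bullet> g x\<bar> \<le> norm (f x) * norm (g x)" by (rule Cauchy_Schwarz_ineq2)
      also have "\<dots> \<le> (norm (f x))\<^sup>2 + (norm (g x))\<^sup>2"
        using sum_squares_bound[of "norm (f x)" "norm (g x)"] mult_nonneg_nonneg[OF norm_ge_zero[of "f x"] norm_ge_zero[of "g x"]] 
        by linarith
      finally show "norm (f x \<bullet> g x) \<le> norm ((norm (f x))\<^sup>2 + (norm (g x))\<^sup>2)" by simp
    qed
  qed (use a in \<open>auto simp: sqint_def\<close>)
qed

\<comment> \<open>The Hilbert space of square integrable functions\<close>
\<comment> \<open>The relation is partial because only square integrable functions have a class.
  Values are real Euclidean vectors, so the inner product is real also for complex valued functions;
  it is the real part of the Hermitian one.\<close>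
quotient_type (overloaded) ('a, 'b) lsq = "'a::euclidean_space \<Rightarrow> 'b::euclidean_space" /
  partial: "\<lambda>f g. sqint f \<and> sqint g \<and> (AE x in lborel. f x = g x)"
proof (rule part_equivpI)
  show "\<exists>x :: 'a \<Rightarrow> 'b. sqint x \<and> sqint x \<and> (AE xa in lborel. x xa = x xa)" by (rule exI[of _ "\<lambda>_. 0"]) simp
  show "symp (\<lambda>f g :: 'a \<Rightarrow> 'b. sqint f \<and> sqint g \<and> (AE x in lborel. f x = g x))"
    by (auto simp: symp_def elim!: eventually_mono)
  show "transp (\<lambda>f g :: 'a \<Rightarrow> 'b. sqint f \<and> sqint g \<and> (AE x in lborel. f x = g x))"
  proof (rule transpI, elim conjE, intro conjI)
    fix f g h :: "'a \<Rightarrow> 'b"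
    assume "AE x in lborel. f x = g x" "AE x in lborel. g x = h x"
    then show "AE x in lborel. f x = h x" by eventually_elim simp
  qed
qed

instantiation lsq :: (euclidean_space, euclidean_space) real_inner
begin

lift_definition zero_lsq :: "('a, 'b) lsq" is "\<lambda>_. 0" by simp

lift_definition plus_lsq :: "('a, 'b) lsq \<Rightarrow> ('a, 'b) lsq \<Rightarrow> ('a, 'b) lsq" is "\<lambda>f g x. f x + g x"
  by (auto intro: sqint_add elim: eventually_elim2)

lift_definition uminus_lsq :: "('a, 'b) lsq \<Rightarrow> ('a, 'b) lsq" is "\<lambda>f x. - f x"
  by (auto intro: sqint_minus elim: eventually_mono)

lift_definition minus_lsq :: "('a, 'b) lsq \<Rightarrow> ('a, 'b) lsq \<Rightarrow> ('a, 'b) lsq" is "\<lambda>f g x. f x - g x"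
  by (auto intro: sqint_diff elim: eventually_elim2)

lift_definition scaleR_lsq :: "real \<Rightarrow> ('a, 'b) lsq \<Rightarrow> ('a, 'b) lsq" is "\<lambda>c f x. c *\<^sub>R f x"
  by (auto intro: sqint_scaleR elim: eventually_mono)

lift_definition inner_lsq :: "('a, 'b) lsq \<Rightarrow> ('a, 'b) lsq \<Rightarrow> real" is "\<lambda>f g. LINT x|lborel. f x \<bullet> g x"
proof (elim conjE)
  fix f f' g g' :: "'a \<Rightarrow> 'b"
  assume s: "sqint f" "sqint f'" "sqint g" "sqint g'" 
    and ae: "AE x in lborel. f x = f' x" "AE x in lborel. g x = g' x"
  note [measurable] = s[THEN sqint_measurable]
  show "(LINT x|lborel. f x \<bullet> g x) = (LINT x|lborel. f' x \<bullet> g' x)"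
    by (rule integral_cong_AE) (use ae in \<open>auto elim: eventually_elim2\<close>)
qed

definition norm_lsq :: "('a, 'b) lsq \<Rightarrow> real" where "norm_lsq F = sqrt (F \<bullet> F)"
definition dist_lsq :: "('a, 'b) lsq \<Rightarrow> ('a, 'b) lsq \<Rightarrow> real" where "dist_lsq F G = norm (F - G)"
definition sgn_lsq :: "('a, 'b) lsq \<Rightarrow> ('a, 'b) lsq" where "sgn_lsq F = inverse (norm F) *\<^sub>R F"
definition uniformity_lsq :: "(('a, 'b) lsq \<times> ('a, 'b) lsq) filter" where
  "uniformity_lsq = (INF e\<in>{0 <..}. principal {(x, y). dist x y < e})"
definition open_lsq :: "('a, 'b) lsq set \<Rightarrow> bool" where
  "open_lsq U = (\<forall>x\<in>U. \<forall>\<^sub>F (x', y) in uniformity. x' = x \<longrightarrow> y \<in> U)"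

instance
proof
  fix F G H :: "('a, 'b) lsq" and a b :: real
  show "F + G + H = F + (G + H)" by transfer (auto intro: sqint_add simp: add.assoc)
  show "F + G = G + F" by transfer (auto intro: sqint_add simp: add.commute)
  show "0 + F = F" by transfer (auto intro: sqint_add)
  show "- F + F = 0" by transfer (auto intro: sqint_add sqint_minus)
  show "F - G = F + - G" by transfer (auto intro: sqint_add sqint_minus sqint_diff)
  show "a *\<^sub>R (F + G) = a *\<^sub>R F + a *\<^sub>R G" by transfer (auto intro: sqint_add sqint_scaleR simp: scaleR_add_right)
  show "(a + b) *\<^sub>R F = a *\<^sub>R F + b *\<^sub>R F" by transfer (auto intro: sqint_add sqint_scaleR simp: scaleR_add_left)
  show "a *\<^sub>R b *\<^sub>R F = (a * b) *\<^sub>R F" by transfer (auto intro: sqint_scaleR)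
  show "1 *\<^sub>R F = F" by transfer (auto intro: sqint_scaleR)
  show "F \<bullet> G = G \<bullet> F" by transfer (simp add: inner_commute)
  show "(F + G) \<bullet> H = F \<bullet> H + G \<bullet> H"
    by transfer (simp add: inner_add_left Bochner_Integration.integral_add sqint_inner)
  show "a *\<^sub>R F \<bullet> G = a * (F \<bullet> G)" by transfer simp
  show "0 \<le> F \<bullet> F" by transfer (auto intro!: Bochner_Integration.integral_nonneg)
  show "(F \<bullet> F = 0) = (F = 0)"
  proof transfer
    fix f :: "'a \<Rightarrow> 'b" assume f: "sqint f \<and> sqint f \<and> (AE x in lborel. f x = f x)"
    then have "((LINT x|lborel. f x \<bullet> f x) = 0) = (AE x in lborel. f x \<bullet> f x = 0)"
      by (intro integral_nonneg_eq_0_iff_AE sqint_inner) auto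
    then show "((LINT x|lborel. f x \<bullet> f x) = 0) = (sqint f \<and> sqint (\<lambda>_. 0 :: 'b) \<and> (AE x in lborel. f x = 0))"
      using f by simp
  qed
qed (auto simp: norm_lsq_def dist_lsq_def sgn_lsq_def uniformity_lsq_def open_lsq_def)

end

abbreviation cls :: "('a::euclidean_space \<Rightarrow> 'b::euclidean_space) \<Rightarrow> ('a, 'b) lsq" where
  "cls \<equiv> abs_lsq"

abbreviation rep :: "('a::euclidean_space, 'b::euclidean_space) lsq \<Rightarrow> 'a \<Rightarrow> 'b" where
  "rep \<equiv> rep_lsq"

lemma sqint_rep [simp]: "sqint (rep F)"
  using Quotient_rep_reflp[OF Quotient_lsq, of F] by simp

lemma cls_rep [simp]: "cls (rep F) = F"
  by (rule Quotient_abs_rep[OF Quotient_lsq])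

lemma lsq_cases [cases type: lsq]: obtains f where "sqint f" "F = cls f"
  using sqint_rep cls_rep by metis

lemma cls_eq_iff: "sqint f \<Longrightarrow> sqint g \<Longrightarrow> cls f = cls g \<longleftrightarrow> (AE x in lborel. f x = g x)"
  using Quotient_rel[OF Quotient_lsq, of f g] by auto

lemma rep_cls: "sqint f \<Longrightarrow> AE x in lborel. rep (cls f) x = f x"
  by (subst cls_eq_iff[symmetric]) auto

lemma cls_add: "sqint f \<Longrightarrow> sqint g \<Longrightarrow> cls (\<lambda>x. f x + g x) = cls f + cls g"
  by (simp add: plus_lsq.abs_eq)

lemma cls_diff: "sqint f \<Longrightarrow> sqint g \<Longrightarrow> cls (\<lambda>x. f x - g x) = cls f - cls g"
  by (simp add: minus_lsq.abs_eq)

lemma cls_scaleR: "sqint f \<Longrightarrow> cls (\<lambda>x. c *\<^sub>R f x) = c *\<^sub>R cls f"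
  by (simp add: scaleR_lsq.abs_eq)

lemma cls_inner: "sqint f \<Longrightarrow> sqint g \<Longrightarrow> cls f \<bullet> cls g = (LINT x|lborel. f x \<bullet> g x)"
  by (simp add: inner_lsq.abs_eq)

lemma cls_zero: "cls (\<lambda>_. 0) = 0"
  by (simp add: zero_lsq.abs_eq)

lemma norm_cls_sq: assumes "sqint f" shows "(norm (cls f))\<^sup>2 = (LINT x|lborel. (norm (f x))\<^sup>2)"
  unfolding power2_norm_eq_inner cls_inner[OF assms assms] ..

lemma norm_cls: "sqint f \<Longrightarrow> norm (cls f) = sqrt (LINT x|lborel. (norm (f x))\<^sup>2)"
  by (simp add: norm_cls_sq[symmetric])

lemma norm_cls_nn: "sqint f \<Longrightarrow> ennreal ((norm (cls f))\<^sup>2) = (\<integral>\<^sup>+x. ennreal ((norm (f x))\<^sup>2) \<partial>lborel)"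
  by (simp add: norm_cls_sq sqint_def nn_integral_eq_integral)

section \<open>Completeness\<close>

text \<open>On a space of infinite measure a bound in \<open>L2\<close> gives none in
  \<open>L1\<close>. A strictly positive weight h in \<open>L2\<close> repairs this: by
  Cauchy-Schwarz the weighted increments have summable integrals, so their sum is finite almost
  everywhere, and h can be divided out again.\<close>

lemma Cauchy_AE_convergent_subseq:
  fixes f :: "nat \<Rightarrow> 'a::euclidean_space \<Rightarrow> 'b::euclidean_space"
  assumes f: "\<And>n. sqint (f n)" and d: "\<And>n. norm (cls (f (Suc n)) - cls (f n)) \<le> (1/2) ^ n"
  shows "AE x in lborel. convergent (\<lambda>n. f n x)"
proof -
  note [measurable] = f[THEN sqint_measurable]
  obtain h :: "'a \<Rightarrow> real" where h: "h \<in> borel_measurable lborel" "\<And>x. 0 < h x" "\<And>x. h x \<le> 1" "integrable lborel h"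
    by (rule sigma_finite_measure.obtain_positive_integrable_function[OF sigma_finite_lborel]) (rule that)
  note [measurable] = h(1)
  have hs: "sqint h"
    by (rule sqintI[OF h(1,4)]) (use h in \<open>auto simp: power2_eq_square mult_left_le less_imp_le\<close>)
  define D where "D n x = norm (f (Suc n) x - f n x)" for n x
  have Ds: "sqint (D n)" for n
    using sqint_diff[OF f[of "Suc n"] f[of n]] unfolding sqint_def D_def by auto
  have Dn: "norm (cls (D n)) \<le> (1/2) ^ n" for n
  proof -
    have "norm (cls (D n)) = norm (cls (\<lambda>x. f (Suc n) x - f n x))"
      unfolding norm_cls[OF Ds] norm_cls[OF sqint_diff[OF f f]] by (simp add: D_def)
    then show ?thesis using d[of n] by (simp add: cls_diff f)
  qed
  have i: "integrable lborel (\<lambda>x. h x * D n x)" for n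
    using sqint_inner[OF hs Ds[of n]] by simp
  have I: "(LINT x|lborel. h x * D n x) \<le> norm (cls h) * (1/2) ^ n" for n
  proof -
    have "(LINT x|lborel. h x * D n x) = cls h \<bullet> cls (D n)" by (simp add: cls_inner hs Ds)
    also have "\<dots> \<le> norm (cls h) * norm (cls (D n))" by (rule norm_cauchy_schwarz)
    also have "\<dots> \<le> norm (cls h) * (1/2) ^ n" by (intro mult_left_mono Dn) auto
    finally show ?thesis .
  qed
  have nn: "0 \<le> h x * D n x" for x n using h(2)[of x] by (simp add: D_def)
  have "(\<integral>\<^sup>+x. (\<Sum>n. ennreal (h x * D n x)) \<partial>lborel) = (\<Sum>n. \<integral>\<^sup>+x. ennreal (h x * D n x) \<partial>lborel)"
    by (rule nn_integral_suminf) (simp add: D_def)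
  also have "\<dots> = (\<Sum>n. ennreal (LINT x|lborel. h x * D n x))"
    using i nn by (simp add: nn_integral_eq_integral)
  also have "\<dots> \<noteq> \<infinity>"
  proof -
    have s: "summable (\<lambda>n. norm (cls h) * (1/2::real) ^ n)" by (intro summable_mult summable_geometric) auto
    have "summable (\<lambda>n. LINT x|lborel. h x * D n x)"
      by (rule summable_comparison_test'[OF s, of 0])
         (use I nn in \<open>auto simp: Bochner_Integration.integral_nonneg\<close>)
    then show ?thesis using nn
      by (simp add: suminf_ennreal_eq[OF _ summable_sums] Bochner_Integration.integral_nonneg)
  qed
  finally have "AE x in lborel. (\<Sum>n. ennreal (h x * D n x)) \<noteq> \<infinity>"
    by (intro nn_integral_noteq_infinite) (auto simp: D_def)
  then show ?thesis
  proof eventually_elim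
    case (elim x)
    have "summable (\<lambda>n. h x * D n x)"
      using elim nn by (intro summable_suminf_not_top) auto
    then have "summable (\<lambda>n. inverse (h x) * (h x * D n x))" by (rule summable_mult)
    then have "summable (\<lambda>n. D n x)" using h(2)[of x] by (simp add: mult.assoc[symmetric])
    then have "summable (\<lambda>n. f (Suc n) x - f n x)" unfolding D_def by (rule summable_norm_cancel)
    then have "convergent (\<lambda>n. \<Sum>i<n. f (Suc i) x - f i x)" by (simp add: summable_iff_convergent)
    then have "convergent (\<lambda>n. f n x - f 0 x)" by (simp only: sum_lessThan_telescope[of "\<lambda>n. f n x"])
    then have "convergent (\<lambda>n. f n x - f 0 x + f 0 x)" by (intro convergent_add convergent_const)
    then show ?case by simp
  qed
qed

lemma Cauchy_fast_subseq:
  fixes F :: "nat \<Rightarrow> 'a::real_normed_vector"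
  assumes C: "Cauchy F"
  shows "\<exists>r. strict_mono r \<and> (\<forall>n. norm (F (r (Suc n)) - F (r n)) \<le> (1/2) ^ n)"
proof -
  have "\<exists>N. \<forall>m\<ge>N. \<forall>k\<ge>N. dist (F m) (F k) < (1/2) ^ n" for n
    by (rule metric_CauchyD[OF C]) simp
  then obtain N where N: "\<And>n m k. m \<ge> N n \<Longrightarrow> k \<ge> N n \<Longrightarrow> dist (F m) (F k) < (1/2) ^ n" by metis
  define r where "r = rec_nat (N 0) (\<lambda>n p. Suc (max p (N (Suc n))))"
  have r0: "r 0 = N 0" and rS: "\<And>n. r (Suc n) = Suc (max (r n) (N (Suc n)))" by (auto simp: r_def)
  have rN: "r n \<ge> N n" for n by (cases n) (auto simp: r0 rS)
  have "strict_mono r" by (rule strict_monoI_Suc) (simp add: rS less_Suc_eq_le)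
  moreover have "norm (F (r (Suc n)) - F (r n)) \<le> (1/2) ^ n" for n
    using N[of n "r (Suc n)" "r n"] rN[of n] by (simp add: rS dist_norm less_imp_le)
  ultimately show ?thesis by blast
qed

text \<open>Riesz-Fischer: a rapidly converging subsequence has a pointwise limit almost everywhere,
  and Fatou's lemma bounds the distance from this limit to the members of the subsequence. A Cauchy
  sequence converges with any of its subsequences.\<close>

instance lsq :: (euclidean_space, euclidean_space) complete_space
proof
  fix F :: "nat \<Rightarrow> ('a, 'b) lsq" assume C: "Cauchy F"
  obtain r where r: "strict_mono r" "\<And>n. norm (F (r (Suc n)) - F (r n)) \<le> (1/2) ^ n"
    using Cauchy_fast_subseq[OF C] by blast
  define f where "f n = rep (F (r n))" for n
  have f: "sqint (f n)" and fF: "cls (f n) = F (r n)" for n by (auto simp: f_def)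
  note [measurable] = f[THEN sqint_measurable]
  have ae: "AE x in lborel. convergent (\<lambda>n. f n x)"
    by (rule Cauchy_AE_convergent_subseq[OF f]) (simp add: fF r)
  define g where "g x = lim (\<lambda>n. f n x)" for x
  have [measurable]: "g \<in> borel_measurable lborel" unfolding g_def by measurable
  have lim: "AE x in lborel. (\<lambda>n. f n x) \<longlonglongrightarrow> g x"
    using ae by eventually_elim (simp add: g_def convergent_LIMSEQ_iff)
  have fatou: "(\<integral>\<^sup>+x. ennreal ((norm (g x - f n x))\<^sup>2) \<partial>lborel) \<le> ennreal (e\<^sup>2)"
    if "\<And>m. m \<ge> N \<Longrightarrow> norm (F (r m) - F (r n)) \<le> e" and "0 \<le> e" for n N e
  proof -
    have "(\<integral>\<^sup>+x. ennreal ((norm (g x - f n x))\<^sup>2) \<partial>lborel) = (\<integral>\<^sup>+x. liminf (\<lambda>m. ennreal ((norm (f m x - f n x))\<^sup>2)) \<partial>lborel)"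
    proof (rule nn_integral_cong_AE)
      show "AE x in lborel. ennreal ((norm (g x - f n x))\<^sup>2) = liminf (\<lambda>m. ennreal ((norm (f m x - f n x))\<^sup>2))"
        using lim
      proof eventually_elim
        case (elim x)
        then have "(\<lambda>m. ennreal ((norm (f m x - f n x))\<^sup>2)) \<longlonglongrightarrow> ennreal ((norm (g x - f n x))\<^sup>2)"
          by (intro tendsto_intros)
        then show ?case by (rule lim_imp_Liminf[OF sequentially_bot, symmetric])
      qed
    qed
    also have "\<dots> \<le> liminf (\<lambda>m. \<integral>\<^sup>+x. ennreal ((norm (f m x - f n x))\<^sup>2) \<partial>lborel)"
      by (rule nn_integral_liminf) measurable
    also have "\<dots> = liminf (\<lambda>m. ennreal ((norm (F (r m) - F (r n)))\<^sup>2))"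
      by (simp add: norm_cls_nn[symmetric] sqint_diff f cls_diff fF)
    also have "\<dots> \<le> ennreal (e\<^sup>2)"
    proof (rule Liminf_le[OF sequentially_bot])
      show "\<forall>\<^sub>F m in sequentially. ennreal ((norm (F (r m) - F (r n)))\<^sup>2) \<le> ennreal (e\<^sup>2)"
        using eventually_ge_at_top[of N]
        by eventually_elim (intro ennreal_leI power_mono that, auto)
    qed
    finally show ?thesis .
  qed
  have CF: "\<exists>N. \<forall>m\<ge>N. \<forall>n\<ge>N. norm (F (r m) - F (r n)) < e" if e: "e > 0" for e
  proof -
    obtain N where N: "\<And>m n. m \<ge> N \<Longrightarrow> n \<ge> N \<Longrightarrow> dist (F m) (F n) < e" using metric_CauchyD[OF C e] by blast
    have rm: "r m \<ge> N" if "m \<ge> N" for m by (rule le_trans[OF that seq_suble[OF r(1)]])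
    show ?thesis
    proof (intro exI allI impI)
      fix m n assume "N \<le> m" "N \<le> n"
      then show "norm (F (r m) - F (r n)) < e" unfolding dist_norm[symmetric] by (intro N rm)
    qed
  qed
  have gf: "sqint (\<lambda>x. g x - f n x)" and gfn: "norm (cls (\<lambda>x. g x - f n x)) \<le> e"
    if "\<And>m. m \<ge> N \<Longrightarrow> norm (F (r m) - F (r n)) \<le> e" and "0 \<le> e" for n N e
  proof -
    show s: "sqint (\<lambda>x. g x - f n x)" unfolding sqint_def
      using fatou[of N n e, OF that] by (auto simp: integrable_iff_bounded intro: le_less_trans)
    have "ennreal ((norm (cls (\<lambda>x. g x - f n x)))\<^sup>2) \<le> ennreal (e\<^sup>2)"
      unfolding norm_cls_nn[OF s] by (rule fatou[of N n e, OF that])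
    then have "(norm (cls (\<lambda>x. g x - f n x)))\<^sup>2 \<le> e\<^sup>2" by simp
    then show "norm (cls (\<lambda>x. g x - f n x)) \<le> e" using that(2) by (rule power2_le_imp_le)
  qed
  obtain N1 where N1: "\<And>m n. m \<ge> N1 \<Longrightarrow> n \<ge> N1 \<Longrightarrow> norm (F (r m) - F (r n)) < 1" using CF[of 1] by auto
  \<comment> \<open>The limit is square integrable because it differs from one member of the
    subsequence by a function that Fatou's lemma has shown to be so.\<close>
  have "sqint (\<lambda>x. g x - f N1 x)" by (rule gf[of N1 N1 1]) (use N1 in \<open>auto intro: less_imp_le\<close>)
  from sqint_add[OF this f[of N1]] have gs: "sqint g" by simp
  have "(\<lambda>n. F (r n)) \<longlonglongrightarrow> cls g"
  proof (rule metric_LIMSEQ_I)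
    fix e :: real assume "e > 0"
    then obtain N where N: "\<And>m n. m \<ge> N \<Longrightarrow> n \<ge> N \<Longrightarrow> norm (F (r m) - F (r n)) < e/2" using CF[of "e/2"] by auto
    have "dist (F (r n)) (cls g) < e" if n: "n \<ge> N" for n
    proof -
      have "norm (cls (\<lambda>x. g x - f n x)) \<le> e/2"
        by (rule gfn[of N]) (use N n \<open>e > 0\<close> in \<open>auto intro: less_imp_le\<close>)
      then show ?thesis using \<open>e > 0\<close> by (simp add: cls_diff gs f fF dist_norm norm_minus_commute)
    qed
    then show "\<exists>no. \<forall>n\<ge>no. dist (F (r n)) (cls g) < e" by blast
  qed
  then have "F \<longlonglongrightarrow> cls g"
  proof -
    assume l: "(\<lambda>n. F (r n)) \<longlonglongrightarrow> cls g"
    show ?thesis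
    proof (rule metric_LIMSEQ_I)
      fix e :: real assume e: "e > 0"
      obtain N where N: "\<And>m n. m \<ge> N \<Longrightarrow> n \<ge> N \<Longrightarrow> dist (F m) (F n) < e/2"
        using metric_CauchyD[OF C half_gt_zero[OF e]] by blast
      obtain K where K: "\<And>n. n \<ge> K \<Longrightarrow> dist (F (r n)) (cls g) < e/2"
        using metric_LIMSEQ_D[OF l half_gt_zero[OF e]] by blast
      have "dist (F n) (cls g) < e" if n: "n \<ge> N" for n
      proof -
        define p where "p = max N K"
        have "r p \<ge> p" by (rule seq_suble[OF r(1)])
        then have "dist (F n) (F (r p)) < e/2" by (intro N n) (simp add: p_def)
        moreover have "dist (F (r p)) (cls g) < e/2" by (intro K) (simp add: p_def)
        ultimately show ?thesis using dist_triangle[of "F n" "cls g" "F (r p)"] by linarith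
      qed
      then show "\<exists>no. \<forall>n\<ge>no. dist (F n) (cls g) < e" by blast
    qed
  qed
  then show "convergent F" by (auto simp: convergent_def)
qed

instance lsq :: (euclidean_space, euclidean_space) banach ..

lemma cls_tendsto_dominated:
  fixes f :: "nat \<Rightarrow> 'a::euclidean_space \<Rightarrow> 'b::euclidean_space"
  assumes f: "\<And>n. sqint (f n)" and g: "sqint g" and w: "integrable lborel w"
    and lim: "\<And>x. (\<lambda>n. f n x) \<longlonglongrightarrow> g x"
    and bound: "\<And>n x. (norm (f n x - g x))\<^sup>2 \<le> w x"
  shows "(\<lambda>n. cls (f n)) \<longlonglongrightarrow> cls g"
proof -
  note [measurable] = f[THEN sqint_measurable] g[THEN sqint_measurable]
  have "(\<lambda>n. LINT x|lborel. (norm (f n x - g x))\<^sup>2) \<longlonglongrightarrow> (LINT x|(lborel::'a measure). (0::real))"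
  proof (rule integral_dominated_convergence[OF _ _ w])
    show "AE x in lborel. (\<lambda>n. (norm (f n x - g x))\<^sup>2) \<longlonglongrightarrow> 0"
    proof (rule AE_I2)
      fix x
      have "(\<lambda>n. (norm (f n x - g x))\<^sup>2) \<longlonglongrightarrow> (norm (g x - g x))\<^sup>2" by (intro tendsto_intros lim)
      then show "(\<lambda>n. (norm (f n x - g x))\<^sup>2) \<longlonglongrightarrow> 0" by simp
    qed
  qed (use bound in auto)
  then have "(\<lambda>n. (norm (cls (f n) - cls g))\<^sup>2) \<longlonglongrightarrow> 0"
    by (simp add: cls_diff[symmetric] norm_cls_sq sqint_diff f g)
  then have "(\<lambda>n. sqrt ((norm (cls (f n) - cls g))\<^sup>2)) \<longlonglongrightarrow> sqrt 0" by (rule tendsto_real_sqrt)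
  then have "(\<lambda>n. norm (cls (f n) - cls g)) \<longlonglongrightarrow> 0" by simp
  then show ?thesis by (rule LIM_zero_cancel[OF tendsto_norm_zero_cancel])
qed

subsection \<open>Translations and pointwise linear maps\<close>

lemma AE_translate:
  fixes a :: "'a::euclidean_space"
  assumes "AE x in lborel. P x" shows "AE x in lborel. P (x + a)"
proof -
  have "AE x in distr lborel borel ((+) a). P x" using assms by (simp only: lborel_distr_plus)
  then obtain N where N: "N \<in> null_sets (distr lborel borel ((+) a))" "{x \<in> space (distr lborel borel ((+) a)). \<not> P x} \<subseteq> N"
    unfolding eventually_ae_filter by auto
  have Nb: "N \<in> sets borel" using N(1) by auto
  have "emeasure lborel ((+) a -` N) = 0"
    using N(1) Nb by (auto simp: null_sets_def emeasure_distr)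
  moreover have "(+) a -` N \<in> sets lborel" using measurable_sets[of "(+) a" borel borel N] Nb by simp
  ultimately have "(+) a -` N \<in> null_sets lborel" by auto
  moreover have "{x \<in> space lborel. \<not> P (x + a)} \<subseteq> (+) a -` N" using N(2) by (auto simp: add.commute)
  ultimately show ?thesis unfolding eventually_ae_filter by blast
qed

lemma integral_translate:
  fixes f :: "'a::euclidean_space \<Rightarrow> 'b::{banach, second_countable_topology}" and a :: 'a
  assumes "f \<in> borel_measurable borel"
  shows "(LINT x|lborel. f (x + a)) = (LINT x|lborel. f x)"
proof -
  have "(LINT x|lborel. f x) = (LINT x|distr lborel borel ((+) a). f x)" by (simp only: lborel_distr_plus)
  also have "\<dots> = (LINT x|lborel. f (a + x))" using assms by (intro integral_distr) auto
  finally show ?thesis by (simp add: add.commute)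
qed

lemma integrable_translate:
  fixes f :: "'a::euclidean_space \<Rightarrow> 'b::{banach, second_countable_topology}" and a :: 'a
  assumes "integrable lborel f" shows "integrable lborel (\<lambda>x. f (x + a))"
proof -
  have "integrable (distr lborel borel ((+) a)) f" using assms by (simp only: lborel_distr_plus)
  then have "integrable lborel (\<lambda>x. f (a + x))" by (rule integrable_distr[rotated]) auto
  then show ?thesis by (simp add: add.commute)
qed

lemma sqint_translate: "sqint f \<Longrightarrow> sqint (\<lambda>x. f (x + a))"
  unfolding sqint_def using integrable_translate[of "\<lambda>x. (norm (f x))\<^sup>2"] by auto

definition tr :: "'a::euclidean_space \<Rightarrow> ('a, 'b::euclidean_space) lsq \<Rightarrow> ('a, 'b) lsq" where
  "tr a F = cls (\<lambda>x. rep F (x + a))"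

definition lmap :: "('b \<Rightarrow> 'c) \<Rightarrow> ('a::euclidean_space, 'b::euclidean_space) lsq \<Rightarrow> ('a, 'c::euclidean_space) lsq" where
  "lmap L F = cls (\<lambda>x. L (rep F x))"

lemma tr_cls: "sqint f \<Longrightarrow> tr a (cls f) = cls (\<lambda>x. f (x + a))"
  unfolding tr_def by (subst cls_eq_iff) (auto intro: sqint_translate AE_translate[OF rep_cls])

lemma lmap_cls: "bounded_linear L \<Longrightarrow> sqint f \<Longrightarrow> lmap L (cls f) = cls (\<lambda>x. L (f x))"
  unfolding lmap_def by (subst cls_eq_iff) (auto intro: sqint_linear elim: eventually_mono[OF rep_cls])

lemma tr_inner: "tr a F \<bullet> tr a G = F \<bullet> G"
proof (cases F, cases G)
  fix f g assume *: "sqint f" "F = cls f" "sqint g" "G = cls g"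
  note [measurable] = *(1,3)[THEN sqint_measurable]
  show ?thesis
    using integral_translate[of "\<lambda>x. f x \<bullet> g x" a] * by (simp add: tr_cls cls_inner sqint_translate)
qed

lemma tr_add: "tr a (F + G) = tr a F + tr a G"
  by (cases F, cases G) (simp add: tr_cls cls_add[symmetric] sqint_translate sqint_add)

lemma tr_scaleR: "tr a (c *\<^sub>R F) = c *\<^sub>R tr a F"
  by (cases F) (simp add: tr_cls cls_scaleR[symmetric] sqint_translate sqint_scaleR)

lemma norm_tr [simp]: "norm (tr a F) = norm F"
  by (simp only: norm_eq_sqrt_inner tr_inner)

lemma bounded_linear_tr: "bounded_linear (tr a)"
  by (rule bounded_linear_intro[where K = 1]) (auto simp: tr_add tr_scaleR)

lemma tr_tr: "tr a (tr b F) = tr (a + b) F"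
  by (cases F) (simp add: tr_cls sqint_translate add.assoc)

lemma tr_0 [simp]: "tr 0 F = F"
  by (simp add: tr_def)

lemma tr_adjoint: "tr a F \<bullet> G = F \<bullet> tr (- a) G"
  using tr_inner[of a F "tr (- a) G"] by (simp add: tr_tr)

lemma lmap_tr: "bounded_linear L \<Longrightarrow> lmap L (tr a F) = tr a (lmap L F)"
  by (cases F) (simp add: tr_cls lmap_cls sqint_translate sqint_linear)

lemma lmap_add: assumes L: "bounded_linear L" shows "lmap L (F + G) = lmap L F + lmap L G"
  by (cases F, cases G)
     (simp add: L lmap_cls cls_add[symmetric] sqint_linear sqint_add linear_add[OF bounded_linear.linear[OF L]])

lemma lmap_scaleR: assumes L: "bounded_linear L" shows "lmap L (c *\<^sub>R F) = c *\<^sub>R lmap L F"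
  by (cases F)
     (simp add: L lmap_cls cls_scaleR[symmetric] sqint_linear sqint_scaleR linear_cmul[OF bounded_linear.linear[OF L]])

lemma norm_lmap: assumes L: "bounded_linear L" shows "norm (lmap L F) \<le> onorm L * norm F"
proof (cases F)
  fix f assume f: "sqint f" "F = cls f"
  have "(norm (lmap L F))\<^sup>2 = (LINT x|lborel. (norm (L (f x)))\<^sup>2)"
    by (simp add: f L lmap_cls norm_cls_sq sqint_linear)
  also have "\<dots> \<le> (LINT x|lborel. (onorm L)\<^sup>2 * (norm (f x))\<^sup>2)"
  proof (rule integral_mono)
    show "(norm (L (f x)))\<^sup>2 \<le> (onorm L)\<^sup>2 * (norm (f x))\<^sup>2" for x
      using power_mono[OF onorm[OF L] norm_ge_zero, of "f x" 2] by (simp add: power_mult_distrib)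
  qed (use f sqint_linear[OF f(1) L] in \<open>auto simp: sqint_def\<close>)
  also have "\<dots> = (onorm L * norm F)\<^sup>2" by (simp add: f norm_cls_sq power_mult_distrib)
  finally show ?thesis by (rule power2_le_imp_le) (simp add: onorm_pos_le[OF L])
qed

lemma bounded_linear_lmap: "bounded_linear L \<Longrightarrow> bounded_linear (lmap L)"
  by (rule bounded_linear_intro[where K = "onorm L"]) (auto simp: lmap_add lmap_scaleR norm_lmap mult.commute)

lemma lmap_adjoint:
  assumes "bounded_linear L" "bounded_linear L'" "\<And>x y. L x \<bullet> y = x \<bullet> L' y"
  shows "lmap L F \<bullet> G = F \<bullet> lmap L' G"
  by (cases F, cases G) (simp add: assms lmap_cls cls_inner sqint_linear)

subsection \<open>Test functions\<close>

definition C1 :: "('a::euclidean_space \<Rightarrow> real) \<Rightarrow> bool" where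
  "C1 f \<longleftrightarrow> (\<forall>x. f differentiable (at x)) \<and> (\<forall>v. continuous_on UNIV (pd f v))"

lemma test_fun_iff: "test_fun \<phi> \<longleftrightarrow> (\<exists>K. compact K \<and> (\<forall>x. x \<notin> K \<longrightarrow> \<phi> x = 0)) \<and> C1 \<phi>"
  unfolding test_fun_def C1_def pd_def[abs_def] by blast

lemma has_derivative_pd: "C1 f \<Longrightarrow> (f has_derivative (\<lambda>v. pd f v x)) (at x)"
  unfolding C1_def pd_def using frechet_derivative_works by blast

lemma pd_eqI: "(f has_derivative f') (at x) \<Longrightarrow> pd f v x = f' v"
  unfolding pd_def using frechet_derivative_at by metis

lemma C1I:
  assumes "\<And>x. (f has_derivative f' x) (at x)" "\<And>v. continuous_on UNIV (\<lambda>x. f' x v)"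
  shows "C1 f"
proof -
  have "pd f v = (\<lambda>x. f' x v)" for v using pd_eqI[OF assms(1)] by blast
  then show ?thesis using assms unfolding C1_def differentiable_def by auto
qed

lemma C1_continuous: "C1 f \<Longrightarrow> continuous_on UNIV f"
  using has_derivative_pd has_derivative_continuous_on by (metis has_derivative_at_withinI)

lemma C1_continuous_pd: "C1 f \<Longrightarrow> continuous_on UNIV (pd f v)"
  by (simp add: C1_def)

lemma linear_pd: "C1 f \<Longrightarrow> linear (\<lambda>v. pd f v x)"
  using has_derivative_pd has_derivative_linear by blast

lemma C1_const: "C1 (\<lambda>_. c)"
  by (rule C1I[where f' = "\<lambda>_ _. 0"]) auto

lemma C1_mult:
  assumes "C1 f" "C1 g" shows "C1 (\<lambda>x. f x * g x)"
proof (rule C1I)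
  show "((\<lambda>x. f x * g x) has_derivative (\<lambda>v. f x * pd g v x + pd f v x * g x)) (at x)" for x
    by (rule has_derivative_mult[OF has_derivative_pd[OF assms(1)] has_derivative_pd[OF assms(2)]])
  show "continuous_on UNIV (\<lambda>x. f x * pd g v x + pd f v x * g x)" for v
    by (intro continuous_intros C1_continuous C1_continuous_pd assms)
qed

lemma C1_prod: "finite I \<Longrightarrow> (\<And>i. i \<in> I \<Longrightarrow> C1 (f i)) \<Longrightarrow> C1 (\<lambda>x. \<Prod>i\<in>I. f i x)"
  by (induction I rule: finite_induct) (auto intro: C1_const C1_mult)

lemma C1_compose:
  assumes f: "C1 f" and g: "\<And>x. (g has_real_derivative g' (f x)) (at (f x))" and c: "continuous_on UNIV (\<lambda>x. g' (f x))"
  shows "C1 (\<lambda>x. g (f x))"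
proof (rule C1I)
  show "((\<lambda>x. g (f x)) has_derivative (\<lambda>v. pd f v x * g' (f x))) (at x)" for x
    by (rule DERIV_compose_FDERIV[OF g has_derivative_pd[OF f]])
  show "continuous_on UNIV (\<lambda>x. pd f v x * g' (f x))" for v
    by (intro continuous_intros C1_continuous_pd f c)
qed

lemma C1_affine: "C1 (\<lambda>x. c * (x \<bullet> i) + d)"
  by (rule C1I[where f' = "\<lambda>_ v. c * (v \<bullet> i)"]) (auto intro!: derivative_eq_intros)

text \<open>The squared positive part is the building block of all concrete test functions: it is
  continuously differentiable, vanishes on a half line and is positive on the other one.\<close>

lemma DERIV_max_square: "((\<lambda>t::real. (max 0 t)\<^sup>2) has_real_derivative 2 * max 0 t) (at t)"
proof -
  consider "t > 0" | "t < 0" | "t = 0" by linarith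
  then show ?thesis
  proof cases
    case 1
    have "((\<lambda>t::real. t\<^sup>2) has_real_derivative 2 * t) (at t)" by (auto intro!: derivative_eq_intros)
    then have "((\<lambda>t::real. (max 0 t)\<^sup>2) has_real_derivative 2 * t) (at t)"
      by (rule has_field_derivative_transform_within_open[OF _ open_greaterThan[of 0]]) (use 1 in auto)
    then show ?thesis using 1 by simp
  next
    case 2
    have "((\<lambda>t::real. 0) has_real_derivative 0) (at t)" by simp
    then have "((\<lambda>t::real. (max 0 t)\<^sup>2) has_real_derivative 0) (at t)"
      by (rule has_field_derivative_transform_within_open[OF _ open_lessThan[of 0]]) (use 2 in auto)
    then show ?thesis using 2 by simp
  next
    case 3
    have "((\<lambda>h::real. (max 0 h)\<^sup>2 / h) \<longlongrightarrow> 0) (at 0)"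
    proof (rule Lim_null_comparison)
      show "\<forall>\<^sub>F h::real in at 0. norm ((max 0 h)\<^sup>2 / h) \<le> \<bar>h\<bar>"
        by (rule always_eventually) (auto simp: max_def power2_eq_square)
      show "((\<lambda>h::real. \<bar>h\<bar>) \<longlongrightarrow> 0) (at 0)" by (rule tendsto_rabs_zero) (rule tendsto_ident_at)
    qed
    then show ?thesis using 3 by (simp add: DERIV_def)
  qed
qed

lemma C1_max_square: "C1 (\<lambda>x. (max 0 (c * (x \<bullet> i) + d))\<^sup>2)"
  by (rule C1_compose[OF C1_affine DERIV_max_square]) (intro continuous_intros)

lemma pd_eq_0: 
  assumes "compact K" "\<And>x. x \<notin> K \<Longrightarrow> f x = 0" "x \<notin> K" shows "pd f v x = 0"
proof -
  have "((\<lambda>_. 0) has_derivative (\<lambda>_. 0)) (at x)" by simp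
  then have "(f has_derivative (\<lambda>_. 0)) (at x)"
    by (rule has_derivative_transform_within_open[where s = "- K"])
       (use assms in \<open>auto simp: open_Compl compact_imp_closed\<close>)
  then show ?thesis by (rule pd_eqI)
qed

lemma test_fun_C1: "test_fun \<phi> \<Longrightarrow> C1 \<phi>"
  by (simp add: test_fun_iff)

lemma test_fun_support:
  assumes "test_fun \<phi>"
  obtains K where "compact K" "\<And>x. x \<notin> K \<Longrightarrow> \<phi> x = 0" "\<And>v x. x \<notin> K \<Longrightarrow> pd \<phi> v x = 0"
proof -
  obtain K where K: "compact K" "\<And>x. x \<notin> K \<Longrightarrow> \<phi> x = 0" using assms by (auto simp: test_fun_iff)
  show ?thesis by (rule that[OF K]) (auto intro: pd_eq_0[OF K])
qed

lemma continuous_compact_support_bounded: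
  fixes \<phi> :: "'a::euclidean_space \<Rightarrow> real"
  assumes "continuous_on UNIV \<phi>" "compact K" "\<And>x. x \<notin> K \<Longrightarrow> \<phi> x = 0"
  obtains C where "0 \<le> C" "\<And>x. \<bar>\<phi> x\<bar> \<le> C * indicat_real K x"
proof -
  have "compact (\<phi> ` K)" using assms by (intro compact_continuous_image) (auto intro: continuous_on_subset)
  then obtain C where C: "\<And>x. x \<in> K \<Longrightarrow> norm (\<phi> x) \<le> C" using compact_imp_bounded bounded_iff by (metis imageI)
  show ?thesis
  proof (rule that[of "max 0 C"])
    show "\<bar>\<phi> x\<bar> \<le> max 0 C * indicat_real K x" for x
      using C[of x] assms(3)[of x] by (auto simp: indicator_def)
  qed simp
qed

lemma test_fun_bounds:
  assumes "test_fun \<phi>"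
  obtains K C where "compact K" "0 \<le> C" "\<And>x. \<bar>\<phi> x\<bar> \<le> C * indicat_real K x"
proof -
  obtain K where K: "compact K" "\<And>x. x \<notin> K \<Longrightarrow> \<phi> x = 0" by (rule test_fun_support[OF assms]) auto
  obtain C where "0 \<le> C" "\<And>x. \<bar>\<phi> x\<bar> \<le> C * indicat_real K x"
    by (rule continuous_compact_support_bounded[OF C1_continuous[OF test_fun_C1[OF assms]] K]) (assumption | rule that)+
  then show ?thesis using that K(1) by blast
qed

lemma test_fun_pd_bounds:
  assumes "test_fun \<phi>"
  obtains K C where "compact K" "0 \<le> C" "\<And>x. \<bar>pd \<phi> v x\<bar> \<le> C * indicat_real K x"
proof -
  obtain K where K: "compact K" "\<And>x. x \<notin> K \<Longrightarrow> pd \<phi> v x = 0" by (rule test_fun_support[OF assms]) auto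
  obtain C where "0 \<le> C" "\<And>x. \<bar>pd \<phi> v x\<bar> \<le> C * indicat_real K x"
    by (rule continuous_compact_support_bounded[OF C1_continuous_pd[OF test_fun_C1[OF assms]] K]) (assumption | rule that)+
  then show ?thesis using that K(1) by blast
qed

lemma test_fun_measurable [measurable_dest]: "test_fun \<phi> \<Longrightarrow> \<phi> \<in> borel_measurable borel"
  by (intro borel_measurable_continuous_onI C1_continuous test_fun_C1)

lemma test_fun_pd_measurable: "test_fun \<phi> \<Longrightarrow> pd \<phi> v \<in> borel_measurable borel"
  by (intro borel_measurable_continuous_onI C1_continuous_pd test_fun_C1)

lemma locally_integrable_mult:
  fixes \<phi> :: "'a::euclidean_space \<Rightarrow> real"
  assumes f: "locally_integrable f" and [measurable]: "\<phi> \<in> borel_measurable borel"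
    and K: "compact K" and C: "\<And>x. \<bar>\<phi> x\<bar> \<le> C * indicat_real K x"
  shows "integrable lborel (\<lambda>x. f x * complex_of_real (\<phi> x))"
proof (rule Bochner_Integration.integrable_bound[where f = "\<lambda>x. C * norm (indicat_real K x *\<^sub>R f x)"])
  have [measurable]: "f \<in> borel_measurable borel" using f by (simp add: locally_integrable_def)
  show "integrable lborel (\<lambda>x. C * norm (indicat_real K x *\<^sub>R f x))"
    using f K unfolding locally_integrable_def set_integrable_def
    by (intro integrable_mult_right integrable_norm) auto
  show "(\<lambda>x. f x * complex_of_real (\<phi> x)) \<in> borel_measurable lborel" by measurable
  show "AE x in lborel. norm (f x * complex_of_real (\<phi> x)) \<le> norm (C * norm (indicat_real K x *\<^sub>R f x))"
  proof (rule AE_I2)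
    fix x
    have "norm (f x * complex_of_real (\<phi> x)) = norm (f x) * \<bar>\<phi> x\<bar>" by (simp add: norm_mult)
    also have "\<dots> \<le> norm (f x) * (C * indicat_real K x)" by (intro mult_left_mono C) auto
    also have "\<dots> = C * norm (indicat_real K x *\<^sub>R f x)" by (simp add: mult_ac indicator_def)
    also have "\<dots> \<le> norm (C * norm (indicat_real K x *\<^sub>R f x))" by simp
    finally show "norm (f x * complex_of_real (\<phi> x)) \<le> norm (C * norm (indicat_real K x *\<^sub>R f x))" .
  qed
qed

lemma integrable_test:
  assumes "locally_integrable f" "test_fun \<phi>"
  shows "integrable lborel (\<lambda>x. f x * complex_of_real (\<phi> x))"
proof -
  obtain K C where "compact K" "0 \<le> C" "\<And>x. \<bar>\<phi> x\<bar> \<le> C * indicat_real K x" by (rule test_fun_bounds[OF assms(2)]) auto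
  then show ?thesis using assms by (intro locally_integrable_mult[where K = K]) auto
qed

lemma integrable_test_pd:
  assumes "locally_integrable f" "test_fun \<phi>"
  shows "integrable lborel (\<lambda>x. f x * complex_of_real (pd \<phi> v x))"
proof -
  obtain K C where "compact K" "0 \<le> C" "\<And>x. \<bar>pd \<phi> v x\<bar> \<le> C * indicat_real K x" by (rule test_fun_pd_bounds[OF assms(2)]) auto
  then show ?thesis using assms test_fun_pd_measurable by (intro locally_integrable_mult[where K = K]) auto
qed

lemma test_fun_translate:
  assumes "test_fun \<phi>" shows "test_fun (\<lambda>x. \<phi> (x + a))" and "pd (\<lambda>x. \<phi> (x + a)) v x = pd \<phi> v (x + a)"
proof -
  note C = test_fun_C1[OF assms]
  have d: "((\<lambda>x. \<phi> (x + a)) has_derivative (\<lambda>v. pd \<phi> v (x + a))) (at x)" for x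
  proof -
    have "((\<lambda>x. x + a) has_derivative (\<lambda>v. v)) (at x)" by (auto intro!: derivative_eq_intros)
    from has_derivative_compose[OF this, of \<phi> "\<lambda>v. pd \<phi> v (x + a)"] has_derivative_pd[OF C, of "x + a"]
    show ?thesis by simp
  qed
  show "pd (\<lambda>x. \<phi> (x + a)) v x = pd \<phi> v (x + a)" by (rule pd_eqI[OF d])
  have "C1 (\<lambda>x. \<phi> (x + a))"
    by (rule C1I[OF d]) (intro continuous_on_compose2[OF C1_continuous_pd[OF C]] continuous_intros, auto)
  moreover obtain K where K: "compact K" "\<And>x. x \<notin> K \<Longrightarrow> \<phi> x = 0" by (rule test_fun_support[OF assms]) auto
  have "compact ((\<lambda>x. x - a) ` K)" by (intro compact_continuous_image continuous_intros K)
  moreover have "\<phi> (x + a) = 0" if "x \<notin> (\<lambda>x. x - a) ` K" for x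
  proof (rule K(2), rule notI)
    assume "x + a \<in> K"
    then have "x + a - a \<in> (\<lambda>x. x - a) ` K" by (rule imageI)
    then show False using that by simp
  qed
  ultimately show "test_fun (\<lambda>x. \<phi> (x + a))" unfolding test_fun_iff by blast
qed

text \<open>The product q of squared positive parts is positive exactly in the open box. The map
  \<open>t \<mapsto> k * t / (1 + k * t)\<close> fixes 0, stays below 1 on nonnegative arguments and
  drives positive ones to 1 as k grows.\<close>

lemma box_approximation:
  fixes a b :: "'a::euclidean_space"
  obtains \<phi> :: "nat \<Rightarrow> 'a \<Rightarrow> real" where "\<And>k. test_fun (\<phi> k)" "\<And>k x. \<bar>\<phi> k x\<bar> \<le> indicat_real (cbox a b) x"
    "\<And>x. (\<lambda>k. \<phi> k x) \<longlonglongrightarrow> indicat_real (box a b) x"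
proof -
  define q where "q x = (\<Prod>i\<in>Basis. (max 0 (1 * (x \<bullet> i) + (- (a \<bullet> i))))\<^sup>2 * (max 0 ((-1) * (x \<bullet> i) + b \<bullet> i))\<^sup>2)" for x
  have C: "C1 q" unfolding q_def by (intro C1_prod C1_mult C1_max_square) simp
  have q0: "q x \<ge> 0" for x unfolding q_def by (intro prod_nonneg) auto
  have qz: "q x = 0" if "x \<notin> box a b" for x
  proof -
    have "\<exists>i\<in>Basis. \<not> (a \<bullet> i < x \<bullet> i \<and> x \<bullet> i < b \<bullet> i)" using that unfolding mem_box by blast
    then obtain i where i: "i \<in> Basis" "x \<bullet> i \<le> a \<bullet> i \<or> b \<bullet> i \<le> x \<bullet> i" by (meson not_less)
    then have "(max 0 (1 * (x \<bullet> i) + (- (a \<bullet> i))))\<^sup>2 * (max 0 ((-1) * (x \<bullet> i) + b \<bullet> i))\<^sup>2 = 0" by auto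
    then show ?thesis unfolding q_def using i(1) by (intro prod_zero finite_Basis) blast
  qed
  have qp: "q x > 0" if "x \<in> box a b" for x
    unfolding q_def using that by (intro prod_pos) (auto simp: mem_box)
  define \<phi> where "\<phi> k x = real k * q x / (1 + real k * q x)" for k x
  have dn: "1 + real k * q x > 0" for k x by (simp add: add_pos_nonneg q0)
  show ?thesis
  proof (rule that)
    show "\<bar>\<phi> k x\<bar> \<le> indicat_real (cbox a b) x" for k x
    proof (cases "x \<in> box a b")
      case True
      then have "x \<in> cbox a b" using box_subset_cbox by blast
      moreover have "\<bar>\<phi> k x\<bar> \<le> 1" unfolding \<phi>_def using dn[of k x] q0[of x] by (simp add: abs_divide)
      ultimately show ?thesis by simp
    qed (simp add: \<phi>_def qz)
    show "test_fun (\<phi> k)" for k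
      unfolding test_fun_iff
    proof (intro conjI exI[of _ "cbox a b"] allI impI)
      show "\<phi> k x = 0" if "x \<notin> cbox a b" for x
        using qz[of x] that box_subset_cbox by (auto simp: \<phi>_def)
      show "C1 (\<phi> k)" unfolding \<phi>_def[abs_def]
      proof (rule C1_compose[OF C, where g = "\<lambda>t. real k * t / (1 + real k * t)" and g' = "\<lambda>t. real k / (1 + real k * t)\<^sup>2"])
        fix x
        show "((\<lambda>t. real k * t / (1 + real k * t)) has_real_derivative real k / (1 + real k * q x)\<^sup>2) (at (q x))"
          using dn[of k x] by (auto intro!: derivative_eq_intros simp: power2_eq_square algebra_simps)
      next
        show "continuous_on UNIV (\<lambda>x. real k / (1 + real k * q x)\<^sup>2)"
          by (intro continuous_intros C1_continuous C) (use dn[of k] in \<open>simp add: less_imp_neq[THEN not_sym]\<close>)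
      qed
    qed simp
    show "(\<lambda>k. \<phi> k x) \<longlonglongrightarrow> indicat_real (box a b) x" for x
    proof (cases "x \<in> box a b")
      case True
      have "(\<lambda>k. 1 - inverse (1 + real k * q x)) \<longlonglongrightarrow> 1 - 0"
      proof (intro tendsto_diff tendsto_const tendsto_inverse_0_at_top)
        show "filterlim (\<lambda>k. 1 + real k * q x) at_top sequentially"
          by (intro filterlim_tendsto_add_at_top[OF tendsto_const] filterlim_at_top_mult_tendsto_pos[OF tendsto_const qp[OF True]] filterlim_real_sequentially)
      qed
      moreover have "1 - inverse (1 + real k * q x) = \<phi> k x" for k
        using dn[of k x] by (simp add: \<phi>_def field_simps)
      ultimately show ?thesis using True by simp
    next
      case False
      then show ?thesis by (simp add: \<phi>_def qz)
    qed
  qed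
qed

section \<open>The fundamental lemma of the calculus of variations\<close>

text \<open>Approximating indicator functions of boxes shows that f has integral 0 over every box.
  Boxes are stable under intersection and generate the Borel sets, so the same holds for all Borel
  sets, and a density with vanishing integrals is 0 almost everywhere.\<close>

lemma fundamental_lemma:
  fixes f :: "'a::euclidean_space \<Rightarrow> complex"
  assumes f: "locally_integrable f"
    and zero: "\<And>\<phi>. test_fun \<phi> \<Longrightarrow> (LINT x|lborel. f x * complex_of_real (\<phi> x)) = 0"
  shows "AE x in lborel. f x = 0"
proof -
  have [measurable]: "f \<in> borel_measurable borel" using f by (simp add: locally_integrable_def)
  have ci: "set_integrable lborel (cbox a b) f" for a b using f by (simp add: locally_integrable_def compact_cbox)
  have bi: "set_integrable lborel (A \<inter> box a b) f" if "A \<in> sets borel" for A a b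
    by (rule set_integrable_subset[OF ci[of a b]]) (use that box_subset_cbox[of a b] in auto)
  have box0: "(LINT x:box a b|lborel. f x) = 0" for a b
  proof -
    obtain \<phi> :: "nat \<Rightarrow> 'a \<Rightarrow> real" where \<phi>: "\<And>k. test_fun (\<phi> k)" "\<And>k x. \<bar>\<phi> k x\<bar> \<le> indicat_real (cbox a b) x"
      "\<And>x. (\<lambda>k. \<phi> k x) \<longlonglongrightarrow> indicat_real (box a b) x" using box_approximation by blast
    note [measurable] = test_fun_measurable[OF \<phi>(1)]
    have "(\<lambda>k. LINT x|lborel. f x * complex_of_real (\<phi> k x)) \<longlonglongrightarrow> (LINT x|lborel. indicat_real (box a b) x *\<^sub>R f x)"
    proof (rule integral_dominated_convergence[where w = "\<lambda>x. norm (indicat_real (cbox a b) x *\<^sub>R f x)"])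
      show "integrable lborel (\<lambda>x. norm (indicat_real (cbox a b) x *\<^sub>R f x))"
        using ci[of a b] unfolding set_integrable_def by (rule integrable_norm)
      show "AE x in lborel. (\<lambda>k. f x * complex_of_real (\<phi> k x)) \<longlonglongrightarrow> indicat_real (box a b) x *\<^sub>R f x"
      proof (rule AE_I2)
        fix x
        have "(\<lambda>k. f x * complex_of_real (\<phi> k x)) \<longlonglongrightarrow> f x * complex_of_real (indicat_real (box a b) x)"
          by (intro tendsto_intros \<phi>(3))
        then show "(\<lambda>k. f x * complex_of_real (\<phi> k x)) \<longlonglongrightarrow> indicat_real (box a b) x *\<^sub>R f x"
          by (simp add: scaleR_conv_of_real mult.commute)
      qed
      show "AE x in lborel. norm (f x * complex_of_real (\<phi> k x)) \<le> norm (indicat_real (cbox a b) x *\<^sub>R f x)" for k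
      proof (rule AE_I2)
        fix x
        have "norm (f x) * \<bar>\<phi> k x\<bar> \<le> norm (f x) * indicat_real (cbox a b) x" by (intro mult_left_mono \<phi>) auto
        then show "norm (f x * complex_of_real (\<phi> k x)) \<le> norm (indicat_real (cbox a b) x *\<^sub>R f x)"
          by (simp add: norm_mult mult.commute)
      qed
    qed auto
    then have "(\<lambda>k::nat. 0::complex) \<longlonglongrightarrow> (LINT x:box a b|lborel. f x)"
      using zero[OF \<phi>(1)] by (simp add: set_lebesgue_integral_def)
    then show ?thesis using LIMSEQ_const_iff by metis
  qed
  \<comment> \<open>As f is only locally integrable, the induction over Borel sets is carried out
    inside a fixed bounded box; the boxes \<open>B n\<close> exhaust the space.\<close>
  define B where "B n = box (- (real n *\<^sub>R One)) (real n *\<^sub>R One :: 'a)" for n :: nat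
  have Bn: "B n \<in> sets borel" for n by (simp add: B_def)
  have A0: "(LINT x:A \<inter> B n|lborel. f x) = 0" if "A \<in> sets borel" for A n
  proof -
    have mem: "A \<in> sigma_sets UNIV (range (\<lambda>(a, b). box a b))" using that by (simp add: borel_eq_box)
    have ist: "Int_stable (range (\<lambda>(a, b). box a b :: 'a set))"
    proof (rule Int_stableI)
      fix S T :: "'a set" assume "S \<in> range (\<lambda>(a, b). box a b)" "T \<in> range (\<lambda>(a, b). box a b)"
      then obtain a b c d where "S = box a b" "T = box c d" by auto
      then have "S \<inter> T = box (\<Sum>i\<in>Basis. max (a \<bullet> i) (c \<bullet> i) *\<^sub>R i) (\<Sum>i\<in>Basis. min (b \<bullet> i) (d \<bullet> i) *\<^sub>R i)"
        by (simp add: box_Int_box)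
      then show "S \<inter> T \<in> range (\<lambda>(a, b). box a b)" by auto
    qed
    have sub: "range (\<lambda>(a, b). box a b :: 'a set) \<subseteq> Pow UNIV" by simp
    show ?thesis using ist sub mem
    proof (induction rule: sigma_sets_induct_disjoint)
      case (basic A)
      then obtain a b where "A = box a b" by auto
      then have "A \<inter> B n = box (\<Sum>i\<in>Basis. max (a \<bullet> i) ((- (real n *\<^sub>R One)) \<bullet> i) *\<^sub>R i) (\<Sum>i\<in>Basis. min (b \<bullet> i) ((real n *\<^sub>R One) \<bullet> i) *\<^sub>R i)"
        by (simp only: box_Int_box B_def)
      then show ?case by (simp only: box0)
    next
      case empty
      then show ?case by (simp add: set_lebesgue_integral_def)
    next
      case (compl A)
      have Ab: "A \<in> sets borel" using compl(1) by (simp add: borel_eq_box)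
      have "(LINT x:(UNIV - A) \<inter> B n \<union> A \<inter> B n|lborel. f x) = (LINT x:(UNIV - A) \<inter> B n|lborel. f x) + (LINT x:A \<inter> B n|lborel. f x)"
        by (rule set_integral_Un) (use Ab bi in \<open>auto simp: B_def\<close>)
      moreover have "(UNIV - A) \<inter> B n \<union> A \<inter> B n = B n" by auto
      ultimately show ?case using compl(2) box0 by (simp add: B_def)
    next
      case (union A)
      have Ab: "A i \<in> sets borel" for i using union(2) by (auto simp: borel_eq_box)
      have "(LINT x:(\<Union>i. A i \<inter> B n)|lborel. f x) = (\<Sum>i. (LINT x:A i \<inter> B n|lborel. f x))"
      proof (rule lebesgue_integral_countable_add)
        show "set_integrable lborel (\<Union>i. A i \<inter> B n) f"
          using bi[of "\<Union>i. A i"] Ab by (simp add: B_def)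
        show "A i \<inter> B n \<inter> (A j \<inter> B n) = {}" if "i \<noteq> j" for i j
          using union(1) that by (auto simp: disjoint_family_on_def)
      qed (use Ab Bn in auto)
      then show ?case using union(3) by simp
    qed
  qed
  have "AE x in lborel. indicat_real (B n) x *\<^sub>R f x = 0" for n
  proof (rule sigma_finite_measure.density_zero[OF sigma_finite_lborel])
    show "integrable lborel (\<lambda>x. indicat_real (B n) x *\<^sub>R f x)"
      using bi[of UNIV] unfolding set_integrable_def B_def by simp
    show "(LINT x:A|lborel. indicat_real (B n) x *\<^sub>R f x) = 0" if "A \<in> sets lborel" for A
      using A0[of A n] that by (simp add: set_lebesgue_integral_def indicator_inter_arith)
  qed
  then have "AE x in lborel. \<forall>n. indicat_real (B n) x *\<^sub>R f x = 0" unfolding AE_all_countable by blast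
  then show ?thesis
  proof eventually_elim
    case (elim x)
    obtain n :: nat where n: "norm x < real n" using reals_Archimedean2 by blast
    have "x \<in> B n" unfolding B_def mem_box
    proof (intro ballI conjI)
      fix i :: 'a assume "i \<in> Basis"
      then have "\<bar>x \<bullet> i\<bar> < real n" using Basis_le_norm[of i x] n by linarith
      then show "(- (real n *\<^sub>R One)) \<bullet> i < x \<bullet> i" "x \<bullet> i < (real n *\<^sub>R One) \<bullet> i"
        using \<open>i \<in> Basis\<close> by auto
    qed
    then show ?case using elim[rule_format, of n] by simp
  qed
qed

subsection \<open>Weak gradients\<close>

lemma L2fun_iff: "L2fun f \<longleftrightarrow> sqint f"
  by (simp add: L2fun_def sqint_def)

lemma sqint_locally_integrable:
  assumes "sqint f" shows "locally_integrable f"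
  unfolding locally_integrable_def
proof (intro conjI allI impI)
  show "f \<in> borel_measurable lborel" using assms by (simp add: sqint_def)
  note [measurable] = sqint_measurable[OF assms]
  fix K :: "'a set" assume K: "compact K"
  then have [measurable]: "K \<in> sets borel" by (simp add: borel_compact)
  show "set_integrable lborel K f" unfolding set_integrable_def
  proof (rule Bochner_Integration.integrable_bound[where f = "\<lambda>x. indicat_real K x + (norm (f x))\<^sup>2"])
    show "integrable lborel (\<lambda>x. indicat_real K x + (norm (f x))\<^sup>2)"
      using assms K emeasure_compact_finite[OF K] by (auto simp: sqint_def)
    show "AE x in lborel. norm (indicat_real K x *\<^sub>R f x) \<le> norm (indicat_real K x + (norm (f x))\<^sup>2)"
    proof (rule AE_I2)
      fix x
      have "norm (f x) \<le> 1 + (norm (f x))\<^sup>2" using sum_squares_bound[of 1 "norm (f x)"] norm_ge_zero[of "f x"]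
        unfolding power_one by linarith
      then show "norm (indicat_real K x *\<^sub>R f x) \<le> norm (indicat_real K x + (norm (f x))\<^sup>2)"
        by (auto simp: indicator_def)
    qed
  qed simp
qed

lemma locally_integrable_add:
  "locally_integrable f \<Longrightarrow> locally_integrable g \<Longrightarrow> locally_integrable (\<lambda>x. f x + g x)"
  unfolding locally_integrable_def by (auto intro: set_integral_add)

lemma locally_integrable_cmult:
  "locally_integrable f \<Longrightarrow> locally_integrable (\<lambda>x. c * f x)"
  unfolding locally_integrable_def by auto

lemma locally_integrable_const: "locally_integrable (\<lambda>x::'a::euclidean_space. c)"
  unfolding locally_integrable_def set_integrable_def
  using emeasure_compact_finite by (auto intro!: integrable_scaleR_left integrable_real_indicator simp: borel_compact)

lemma weak_grad_unique:
  assumes "weak_grad f g" "weak_grad f g'"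
  shows "AE x in lborel. g x = g' x"
proof -
  have "AE x in lborel. g x $ j + (-1) * (g' x $ j) = 0" for j
  proof (rule fundamental_lemma)
    show l: "locally_integrable (\<lambda>x. g x $ j + (-1) * (g' x $ j))"
      using assms by (intro locally_integrable_add locally_integrable_cmult) (auto simp: weak_grad_def)
    fix \<phi> :: "real^'a \<Rightarrow> real" assume \<phi>: "test_fun \<phi>"
    have i: "integrable lborel (\<lambda>x. g x $ j * complex_of_real (\<phi> x))" "integrable lborel (\<lambda>x. g' x $ j * complex_of_real (\<phi> x))"
      using assms \<phi> by (auto intro!: integrable_test simp: weak_grad_def)
    have "(LINT x|lborel. f x * complex_of_real (pd \<phi> (axis j 1) x)) = - (LINT x|lborel. g x $ j * complex_of_real (\<phi> x))"
      "(LINT x|lborel. f x * complex_of_real (pd \<phi> (axis j 1) x)) = - (LINT x|lborel. g' x $ j * complex_of_real (\<phi> x))"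
      using assms \<phi> unfolding weak_grad_def by blast+
    then have "(LINT x|lborel. g x $ j * complex_of_real (\<phi> x)) = (LINT x|lborel. g' x $ j * complex_of_real (\<phi> x))"
      by simp
    then show "(LINT x|lborel. (g x $ j + (-1) * (g' x $ j)) * complex_of_real (\<phi> x)) = 0"
      using i by (simp add: left_diff_distrib)
  qed
  then have "AE x in lborel. \<forall>j\<in>UNIV. g x $ j + (-1) * (g' x $ j) = 0" by (intro AE_finite_allI) auto
  then show ?thesis by eventually_elim (simp add: vec_eq_iff)
qed

lemma weak_grad_lin:
  assumes "weak_grad f g" "weak_grad f' g'"
  shows "weak_grad (\<lambda>x. a * f x + c * f' x) (\<lambda>x. \<chi> j. a * (g x $ j) + c * (g' x $ j))"
  unfolding weak_grad_def
proof (intro conjI allI impI)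
  show "locally_integrable (\<lambda>x. a * f x + c * f' x)"
    using assms by (intro locally_integrable_add locally_integrable_cmult) (auto simp: weak_grad_def)
  show "locally_integrable (\<lambda>x. (\<chi> j. a * (g x $ j) + c * (g' x $ j)) $ j)" for j
    using assms by (simp, intro locally_integrable_add locally_integrable_cmult) (auto simp: weak_grad_def)
  fix \<phi> :: "real^'a \<Rightarrow> real" and j assume \<phi>: "test_fun \<phi>"
  have i: "integrable lborel (\<lambda>x. g x $ j * complex_of_real (\<phi> x))" "integrable lborel (\<lambda>x. g' x $ j * complex_of_real (\<phi> x))"
    "integrable lborel (\<lambda>x. f x * complex_of_real (pd \<phi> (axis j 1) x))" "integrable lborel (\<lambda>x. f' x * complex_of_real (pd \<phi> (axis j 1) x))"
    using assms \<phi> by (auto intro!: integrable_test integrable_test_pd simp: weak_grad_def)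
  have e: "(LINT x|lborel. f x * complex_of_real (pd \<phi> (axis j 1) x)) = - (LINT x|lborel. g x $ j * complex_of_real (\<phi> x))"
    "(LINT x|lborel. f' x * complex_of_real (pd \<phi> (axis j 1) x)) = - (LINT x|lborel. g' x $ j * complex_of_real (\<phi> x))"
    using assms \<phi> unfolding weak_grad_def by blast+
  show "(LINT x|lborel. (a * f x + c * f' x) * complex_of_real (pd \<phi> (axis j 1) x))
    = - (LINT x|lborel. (\<chi> j. a * (g x $ j) + c * (g' x $ j)) $ j * complex_of_real (\<phi> x))"
    using i e by (simp add: distrib_right mult.assoc)
qed

subsection \<open>Differences of weakly differentiable functions\<close>

lemma integrable_pair_bound:
  fixes F :: "real \<times> 'a::euclidean_space \<Rightarrow> 'b::{banach, second_countable_topology}"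
  assumes [measurable]: "F \<in> borel_measurable borel"
    and u: "integrable lborel u" and v: "integrable lborel v"
    and bound: "\<And>s x. norm (F (s, x)) \<le> u s * v x"
  shows "integrable (lborel \<Otimes>\<^sub>M lborel) F"
proof (rule lborel_pair.Fubini_integrable)
  have mp: "F \<in> borel_measurable (lborel \<Otimes>\<^sub>M lborel)" by (simp add: lborel_prod)
  then show "F \<in> borel_measurable (lborel \<Otimes>\<^sub>M lborel)" .
  have m: "(\<lambda>x. F (s, x)) \<in> borel_measurable borel" for s by measurable
  have uv: "integrable lborel (\<lambda>x. u s * v x)" for s using v by simp
  have i: "integrable lborel (\<lambda>x. F (s, x))" for s
    by (rule Bochner_Integration.integrable_bound[OF uv[of s]]) (use m in \<open>auto intro!: order_trans[OF bound abs_ge_self]\<close>)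
  then show "AE s in lborel. integrable lborel (\<lambda>x. F (s, x))" by simp
  show "integrable lborel (\<lambda>s. LINT x|lborel. norm (F (s, x)))"
  proof (rule Bochner_Integration.integrable_bound[where f = "\<lambda>s. u s * (LINT x|lborel. v x)"])
    show "integrable lborel (\<lambda>s. u s * (LINT x|lborel. v x))" using u by simp
    show "(\<lambda>s. LINT x|lborel. norm (F (s, x))) \<in> borel_measurable lborel"
      using mp by (intro lborel.borel_measurable_lebesgue_integral) auto
    show "AE s in lborel. norm (LINT x|lborel. norm (F (s, x))) \<le> norm (u s * (LINT x|lborel. v x))"
    proof (rule AE_I2)
      fix s
      have "(LINT x|lborel. norm (F (s, x))) \<le> (LINT x|lborel. u s * v x)"
        using i[of s] uv[of s] bound by (intro integral_mono) auto
      then show "norm (LINT x|lborel. norm (F (s, x))) \<le> norm (u s * (LINT x|lborel. v x))"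
        by (simp add: Bochner_Integration.integral_nonneg order_trans[OF _ abs_ge_self])
    qed
  qed
qed

lemma pd_sum_axis:
  fixes \<phi> :: "real^'n \<Rightarrow> real"
  assumes "C1 \<phi>"
  shows "pd \<phi> h x = (\<Sum>j\<in>UNIV. h $ j * pd \<phi> (axis j 1) x)"
proof -
  have "h = (\<Sum>j\<in>UNIV. h $ j *\<^sub>R axis j 1)"
    using basis_expansion[of h] by (simp add: scalar_mult_eq_scaleR)
  then have "pd \<phi> h x = pd \<phi> (\<Sum>j\<in>UNIV. h $ j *\<^sub>R axis j 1) x" by simp
  also have "\<dots> = (\<Sum>j\<in>UNIV. pd \<phi> (h $ j *\<^sub>R axis j 1) x)" by (rule linear_sum[OF linear_pd[OF assms]])
  also have "\<dots> = (\<Sum>j\<in>UNIV. h $ j * pd \<phi> (axis j 1) x)" by (simp add: linear_cmul[OF linear_pd[OF assms]])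
  finally show ?thesis .
qed

lemma test_fun_difference:
  fixes \<phi> :: "'a::euclidean_space \<Rightarrow> real"
  assumes "test_fun \<phi>"
  shows "\<phi> (x - h) - \<phi> x = (LINT s:{0..1}|lborel. - pd \<phi> h (x - s *\<^sub>R h))"
proof -
  note C = test_fun_C1[OF assms]
  have d: "((\<lambda>s. \<phi> (x - s *\<^sub>R h)) has_vector_derivative - pd \<phi> h (x - s *\<^sub>R h)) (at s within {0..1})" for s
  proof -
    have "((\<lambda>s. x - s *\<^sub>R h) has_derivative (\<lambda>r. - (r *\<^sub>R h))) (at s within {0..1})"
      by (auto intro!: derivative_eq_intros)
    from has_derivative_compose[OF this has_derivative_pd[OF C]]
    have "((\<lambda>s. \<phi> (x - s *\<^sub>R h)) has_derivative (\<lambda>r. pd \<phi> (- (r *\<^sub>R h)) (x - s *\<^sub>R h))) (at s within {0..1})" .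
    moreover have "pd \<phi> (- (r *\<^sub>R h)) y = r *\<^sub>R (- pd \<phi> h y)" for r y
      using linear_cmul[OF linear_pd[OF C], of "-r" h y] by simp
    ultimately show ?thesis by (simp only: has_vector_derivative_def)
  qed
  have c: "continuous_on {0..1::real} (\<lambda>s. - pd \<phi> h (x - s *\<^sub>R h))"
    by (intro continuous_intros continuous_on_compose2[OF C1_continuous_pd[OF C, of h]]) auto
  show ?thesis
    using integral_FTC_Icc[OF zero_le_one d c] by (simp add: set_lebesgue_integral_def)
qed

text \<open>The set swept by K along the segment from 0 to h contains the supports of all
  intermediate translates at once, which provides a dominating function for Fubini
  arguments.\<close>

lemma compact_sweep:
  fixes h :: "'a::euclidean_space"
  shows "compact K \<Longrightarrow> compact ((\<lambda>(y, s). y + s *\<^sub>R h) ` (K \<times> {0..1::real}))"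
  by (intro compact_continuous_image compact_Times) (auto intro!: continuous_intros simp: case_prod_unfold)

text \<open>The fundamental theorem of calculus is applied to the test function along the segment
  from x to \<open>x - h\<close>; after an exchange of integrals the definition of the weak gradient
  is used with each translated test function.\<close>

lemma weak_grad_translation:
  fixes f :: "real^'n \<Rightarrow> complex"
  assumes w: "weak_grad f g" and \<phi>: "test_fun \<phi>"
  shows "(LINT x|lborel. f x * complex_of_real (\<phi> (x - h) - \<phi> x))
    = (LINT s:{0..1}|lborel. LINT x|lborel. (\<Sum>j\<in>UNIV. complex_of_real (h $ j) * g x $ j) * complex_of_real (\<phi> (x - s *\<^sub>R h)))"
proof -
  note C = test_fun_C1[OF \<phi>]
  have f: "locally_integrable f" and g: "\<And>j. locally_integrable (\<lambda>x. g x $ j)" using w by (auto simp: weak_grad_def)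
  have [measurable]: "f \<in> borel_measurable borel" using f by (simp add: locally_integrable_def)
  have [measurable]: "pd \<phi> v \<in> borel_measurable borel" for v by (rule test_fun_pd_measurable[OF \<phi>])
  obtain K c where K: "compact K" and c: "0 \<le> c" "\<And>x. \<bar>pd \<phi> h x\<bar> \<le> c * indicat_real K x"
    by (rule test_fun_pd_bounds[OF \<phi>, of h]) blast
  define K' where "K' = (\<lambda>(y, s). y + s *\<^sub>R h) ` (K \<times> {0..1::real})"
  have K': "compact K'" unfolding K'_def by (rule compact_sweep[OF K])
  define F where "F = (\<lambda>(s::real, x). indicat_real {0..1} s *\<^sub>R (f x * complex_of_real (- pd \<phi> h (x - s *\<^sub>R h))))"
  have Fi: "integrable (lborel \<Otimes>\<^sub>M lborel) F"
  proof (rule integrable_pair_bound[where u = "\<lambda>s. c * indicat_real {0..1} s" and v = "\<lambda>x. norm (indicat_real K' x *\<^sub>R f x)"])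
    show "F \<in> borel_measurable borel" unfolding F_def case_prod_unfold borel_prod[symmetric] by measurable
    show "integrable lborel (\<lambda>x. norm (indicat_real K' x *\<^sub>R f x))"
      using f K' by (intro integrable_norm) (auto simp: locally_integrable_def set_integrable_def)
    show "norm (F (s, x)) \<le> c * indicat_real {0..1} s * norm (indicat_real K' x *\<^sub>R f x)" for s x
    proof (cases "s \<in> {0..1} \<and> x - s *\<^sub>R h \<in> K")
      case True
      then have "x \<in> K'" unfolding K'_def by (intro image_eqI[of _ _ "(x - s *\<^sub>R h, s)"]) auto
      moreover have "norm (f x) * \<bar>pd \<phi> h (x - s *\<^sub>R h)\<bar> \<le> norm (f x) * c"
        using c(2)[of "x - s *\<^sub>R h"] True by (intro mult_left_mono) auto
      ultimately show ?thesis using True by (simp add: F_def norm_mult mult.commute)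
    next
      case False
      then have "F (s, x) = 0" using c(2)[of "x - s *\<^sub>R h"] by (auto simp: F_def indicator_def split: if_splits)
      then show ?thesis using c by simp
    qed
  qed auto
  have 1: "(LINT s|lborel. F (s, x)) = f x * complex_of_real (\<phi> (x - h) - \<phi> x)" for x
  proof -
    have "(LINT s|lborel. F (s, x)) = (LINT s|lborel. f x * complex_of_real (indicat_real {0..1} s *\<^sub>R (- pd \<phi> h (x - s *\<^sub>R h))))"
      unfolding F_def by (intro Bochner_Integration.integral_cong) (auto simp: scaleR_conv_of_real)
    also have "\<dots> = f x * complex_of_real (LINT s|lborel. indicat_real {0..1} s *\<^sub>R (- pd \<phi> h (x - s *\<^sub>R h)))"
      by (subst integral_mult_right_zero, subst integral_complex_of_real) simp
    also have "\<dots> = f x * complex_of_real (\<phi> (x - h) - \<phi> x)"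
      by (simp add: test_fun_difference[OF \<phi>] set_lebesgue_integral_def)
    finally show ?thesis .
  qed
  have 2: "(LINT x|lborel. F (s, x)) = indicat_real {0..1} s *\<^sub>R
      (LINT x|lborel. (\<Sum>j\<in>UNIV. complex_of_real (h $ j) * g x $ j) * complex_of_real (\<phi> (x - s *\<^sub>R h)))" for s
  proof -
    define \<psi> where "\<psi> x = \<phi> (x + - (s *\<^sub>R h))" for x
    have \<psi>: "test_fun \<psi>" and pd\<psi>: "\<And>v x. pd \<psi> v x = pd \<phi> v (x - s *\<^sub>R h)"
      using test_fun_translate[OF \<phi>, of "- (s *\<^sub>R h)"] by (simp_all add: \<psi>_def[abs_def])
    have i: "integrable lborel (\<lambda>x. f x * complex_of_real (pd \<psi> (axis j 1) x))" for j by (rule integrable_test_pd[OF f \<psi>])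
    have i2: "integrable lborel (\<lambda>x. g x $ j * complex_of_real (\<psi> x))" for j by (rule integrable_test[OF g \<psi>])
    have "(LINT x|lborel. f x * complex_of_real (- pd \<phi> h (x - s *\<^sub>R h)))
       = (LINT x|lborel. (\<Sum>j\<in>UNIV. - complex_of_real (h $ j) * (f x * complex_of_real (pd \<psi> (axis j 1) x))))"
      unfolding pd_sum_axis[OF C, of h] pd\<psi>
      by (intro Bochner_Integration.integral_cong refl) (simp add: sum_distrib_left sum_negf[symmetric] mult_ac)
    also have "\<dots> = (\<Sum>j\<in>UNIV. - complex_of_real (h $ j) * (LINT x|lborel. f x * complex_of_real (pd \<psi> (axis j 1) x)))"
      using i by (subst Bochner_Integration.integral_sum) auto
    also have "\<dots> = (\<Sum>j\<in>UNIV. complex_of_real (h $ j) * (LINT x|lborel. g x $ j * complex_of_real (\<psi> x)))"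
      using w \<psi> by (intro sum.cong refl) (simp add: weak_grad_def)
    also have "\<dots> = (LINT x|lborel. (\<Sum>j\<in>UNIV. complex_of_real (h $ j) * (g x $ j * complex_of_real (\<psi> x))))"
      using i2 by (subst Bochner_Integration.integral_sum) auto
    also have "\<dots> = (LINT x|lborel. (\<Sum>j\<in>UNIV. complex_of_real (h $ j) * g x $ j) * complex_of_real (\<phi> (x - s *\<^sub>R h)))"
      by (intro Bochner_Integration.integral_cong refl) (simp add: \<psi>_def sum_distrib_right mult.assoc)
    finally have eq: "(LINT x|lborel. f x * complex_of_real (- pd \<phi> h (x - s *\<^sub>R h)))
      = (LINT x|lborel. (\<Sum>j\<in>UNIV. complex_of_real (h $ j) * g x $ j) * complex_of_real (\<phi> (x - s *\<^sub>R h)))" .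
    show ?thesis unfolding F_def prod.case integral_scaleR_right eq ..
  qed
  have "(LINT x|lborel. LINT s|lborel. F (s, x)) = (LINT s|lborel. LINT x|lborel. F (s, x))"
    using lborel_pair.Fubini_integral[of "\<lambda>s x. F (s, x)"] Fi by simp
  then show ?thesis unfolding 1 2 set_lebesgue_integral_def .
qed

lemma integral_Cauchy_Schwarz_indicator:
  fixes G :: "'a::euclidean_space \<Rightarrow> complex"
  assumes G: "sqint G" and K: "compact K"
  shows "integrable lborel (\<lambda>x. indicat_real K x *\<^sub>R G (x + a))"
    "(LINT x|lborel. norm (indicat_real K x *\<^sub>R G (x + a))) \<le> sqrt (measure lborel K) * norm (cls G)"
proof -
  have Kb [measurable]: "K \<in> sets borel" using K by (simp add: borel_compact)
  note [measurable] = sqint_measurable[OF G]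
  have fin: "emeasure lborel K < \<infinity>" using emeasure_compact_finite[OF K] by simp
  have Ks: "sqint (indicat_real K)"
  proof (rule sqintI[where g = "indicat_real K"])
    show "integrable lborel (indicat_real K)" using fin by (intro integrable_real_indicator) auto
  qed (auto simp: indicator_def)
  define H where "H x = norm (G (x + a))" for x
  have Hs: "sqint H" using sqint_translate[OF G, of a] by (auto simp: sqint_def H_def[abs_def])
  have nH: "norm (cls H) = norm (cls G)"
  proof -
    have "norm (cls H) = sqrt (LINT x|lborel. (norm (G (x + a)))\<^sup>2)" by (simp add: norm_cls Hs H_def)
    also have "\<dots> = sqrt (LINT x|lborel. (norm (G x))\<^sup>2)"
      using integral_translate[of "\<lambda>x. (norm (G x))\<^sup>2" a] by simp
    finally show ?thesis by (simp add: norm_cls G)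
  qed
  have nK: "norm (cls (indicat_real K)) = sqrt (measure lborel K)"
  proof -
    have "(LINT x|lborel. (norm (indicat_real K x))\<^sup>2) = (LINT x|lborel. indicat_real K x)"
      by (intro Bochner_Integration.integral_cong) (auto simp: indicator_def)
    then show ?thesis by (simp add: norm_cls Ks)
  qed
  show i: "integrable lborel (\<lambda>x. indicat_real K x *\<^sub>R G (x + a))"
    using sqint_inner[OF Ks Hs]
    by (rule Bochner_Integration.integrable_bound) (auto simp: H_def indicator_def)
  have "(LINT x|lborel. norm (indicat_real K x *\<^sub>R G (x + a))) = cls (indicat_real K) \<bullet> cls H"
    by (simp add: cls_inner Ks Hs H_def)
  also have "\<dots> \<le> norm (cls (indicat_real K)) * norm (cls H)" by (rule norm_cauchy_schwarz)
  finally show "(LINT x|lborel. norm (indicat_real K x *\<^sub>R G (x + a))) \<le> sqrt (measure lborel K) * norm (cls G)"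
    by (simp add: nH nK)
qed

text \<open>By the fundamental lemma the difference \<open>f (x + h) - f x\<close> is almost
  everywhere the mean over the segment of the directional derivative \<open>G\<close> along h.
  Cauchy-Schwarz on B and translation invariance of the \<open>L2\<close> norm bound this
  mean.\<close>

lemma weak_grad_difference_bound:
  fixes f :: "real^'n \<Rightarrow> complex" and h :: "real^'n"
  assumes w: "weak_grad f g" and g2: "\<And>j. sqint (\<lambda>x. g x $ j)" and B: "compact B"
  shows "(\<integral>\<^sup>+x. indicator B x * ennreal (norm (f (x + h) - f x)) \<partial>lborel)
    \<le> ennreal (sqrt (measure lborel B) * (norm h * (\<Sum>j\<in>UNIV. norm (cls (\<lambda>x. g x $ j)))))"
proof -
  define G where "G x = (\<Sum>j\<in>UNIV. complex_of_real (h $ j) * g x $ j)" for x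
  have sqG: "sqint (\<lambda>x. \<Sum>j\<in>J. complex_of_real (h $ j) * g x $ j) \<and>
      norm (cls (\<lambda>x. \<Sum>j\<in>J. complex_of_real (h $ j) * g x $ j)) \<le> norm h * (\<Sum>j\<in>J. norm (cls (\<lambda>x. g x $ j)))"
    if "finite J" for J using that
  proof (induction J rule: finite_induct)
    case empty
    then show ?case by (simp add: cls_zero)
  next
    case (insert k J)
    have s: "sqint (\<lambda>x. complex_of_real (h $ k) * g x $ k)"
      using sqint_scaleR[OF g2[of k], of "h $ k"] by (simp add: scaleR_conv_of_real)
    have "cls (\<lambda>x. complex_of_real (h $ k) * g x $ k) = h $ k *\<^sub>R cls (\<lambda>x. g x $ k)"
      using cls_scaleR[OF g2[of k], of "h $ k"] by (simp add: scaleR_conv_of_real)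
    then have "norm (cls (\<lambda>x. complex_of_real (h $ k) * g x $ k)) \<le> norm h * norm (cls (\<lambda>x. g x $ k))"
      using component_le_norm_cart[of h k] by (simp add: mult_right_mono)
    moreover have "cls (\<lambda>x. \<Sum>j\<in>insert k J. complex_of_real (h $ j) * g x $ j)
      = cls (\<lambda>x. complex_of_real (h $ k) * g x $ k) + cls (\<lambda>x. \<Sum>j\<in>J. complex_of_real (h $ j) * g x $ j)"
      using insert s by (simp add: cls_add)
    ultimately have "norm (cls (\<lambda>x. \<Sum>j\<in>insert k J. complex_of_real (h $ j) * g x $ j)) \<le> norm h * (\<Sum>j\<in>insert k J. norm (cls (\<lambda>x. g x $ j)))"
      using insert norm_triangle_ineq[of "cls (\<lambda>x. complex_of_real (h $ k) * g x $ k)" "cls (\<lambda>x. \<Sum>j\<in>J. complex_of_real (h $ j) * g x $ j)"]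
      by (simp add: distrib_left)
    then show ?case using insert s by (simp add: sqint_add)
  qed
  have Gs: "sqint G" and Gn: "norm (cls G) \<le> norm h * (\<Sum>j\<in>UNIV. norm (cls (\<lambda>x. g x $ j)))"
    using sqG[of UNIV] by (simp_all add: G_def[abs_def])
  have f: "locally_integrable f" using w by (simp add: weak_grad_def)
  have [measurable]: "f \<in> borel_measurable borel" using f by (simp add: locally_integrable_def)
  have [measurable]: "G \<in> borel_measurable borel" by (rule sqint_measurable[OF Gs])
  define c where "c K = sqrt (measure lborel K) * norm (cls G)" for K :: "(real^'n) set"
  define F where "F K = (\<lambda>(s::real, x). indicat_real {0..1} s *\<^sub>R indicat_real K x *\<^sub>R G (x + s *\<^sub>R h))" for K
  have Fi: "integrable (lborel \<Otimes>\<^sub>M lborel) (F K)" and FK: "(LINT s|lborel. LINT x|lborel. norm (F K (s, x))) \<le> c K" if K: "compact K" for K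
  proof -
    have [measurable]: "K \<in> sets borel" using K by (simp add: borel_compact)
    have m: "F K \<in> borel_measurable borel" unfolding F_def case_prod_unfold borel_prod[symmetric] by measurable
    then have mp: "F K \<in> borel_measurable (lborel \<Otimes>\<^sub>M lborel)" by (simp add: lborel_prod)
    have b: "(LINT x|lborel. norm (F K (s, x))) \<le> indicat_real {0..1} s * c K" for s
      using integral_Cauchy_Schwarz_indicator(2)[OF Gs K, of "s *\<^sub>R h"] by (auto simp: F_def c_def indicator_def)
    have ii: "integrable lborel (\<lambda>s. LINT x|lborel. norm (F K (s, x)))"
    proof (rule Bochner_Integration.integrable_bound[where f = "\<lambda>s. indicat_real {0..1} s * c K"])
      show "(\<lambda>s. LINT x|lborel. norm (F K (s, x))) \<in> borel_measurable lborel"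
        using mp by (intro lborel.borel_measurable_lebesgue_integral) auto
      show "AE s in lborel. norm (LINT x|lborel. norm (F K (s, x))) \<le> norm (indicat_real {0..1} s * c K)"
        by (intro AE_I2) (simp add: Bochner_Integration.integral_nonneg order_trans[OF b abs_ge_self])
    qed simp
    show "integrable (lborel \<Otimes>\<^sub>M lborel) (F K)"
      by (rule lborel_pair.Fubini_integrable[OF mp ii], unfold F_def prod.case)
         (intro AE_I2 integrable_scaleR_right integral_Cauchy_Schwarz_indicator(1)[OF Gs K])
    have "(LINT s|lborel. LINT x|lborel. norm (F K (s, x))) \<le> (LINT s|lborel. indicat_real {0..1::real} s * c K)"
      by (rule integral_mono[OF ii]) (use b in auto)
    then show "(LINT s|lborel. LINT x|lborel. norm (F K (s, x))) \<le> c K" by simp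
  qed
  \<comment> \<open>The candidate for the difference of f. Where the integral does not exist its
    default value 0 does no harm, since D is compared with f almost everywhere only.\<close>
  define D where "D x = (LINT s|lborel. indicat_real {0..1} s *\<^sub>R G (x + s *\<^sub>R h))" for x
  have FD: "(LINT s|lborel. F K (s, x)) = indicat_real K x *\<^sub>R D x" for K x
    unfolding F_def D_def by (cases "x \<in> K") auto
  have Dm [measurable]: "D \<in> borel_measurable borel"
  proof -
    have "(\<lambda>(x, s). indicat_real {0..1} s *\<^sub>R G (x + s *\<^sub>R h)) \<in> borel_measurable (borel \<Otimes>\<^sub>M borel)" by measurable
    then have "(\<lambda>(x, s). indicat_real {0..1} s *\<^sub>R G (x + s *\<^sub>R h)) \<in> borel_measurable (lborel \<Otimes>\<^sub>M lborel)"
      by (simp add: lborel_prod borel_prod)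
    from lborel.borel_measurable_lebesgue_integral[OF this] show ?thesis by (simp add: D_def[abs_def])
  qed
  have Dl: "locally_integrable D" unfolding locally_integrable_def
  proof (intro conjI allI impI)
    fix K :: "(real^'n) set" assume K: "compact K"
    have "integrable lborel (\<lambda>x. LINT s|lborel. F K (s, x))"
      using lborel_pair.integrable_snd[of "\<lambda>s x. F K (s, x)"] Fi[OF K] by simp
    then show "set_integrable lborel K D" by (simp add: FD set_integrable_def)
  qed simp
  have eq: "AE x in lborel. (f (x + h) + (-1) * f x) + (-1) * D x = 0"
  proof (rule fundamental_lemma)
    have fh: "locally_integrable (\<lambda>x. f (x + h))" unfolding locally_integrable_def
    proof (intro conjI allI impI)
      fix K :: "(real^'n) set" assume K: "compact K"
      define K' where "K' = (\<lambda>x. x + h) ` K"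
      have "compact K'" unfolding K'_def by (intro compact_continuous_image continuous_intros K)
      then have "integrable lborel (\<lambda>x. indicat_real K' x *\<^sub>R f x)" using f by (simp add: locally_integrable_def set_integrable_def)
      from integrable_translate[OF this, of h]
      show "set_integrable lborel K (\<lambda>x. f (x + h))"
        unfolding set_integrable_def by (rule back_subst[of "integrable lborel"]) (auto simp: K'_def indicator_def fun_eq_iff)
    qed simp
    show "locally_integrable (\<lambda>x. (f (x + h) + (-1) * f x) + (-1) * D x)"
      by (intro locally_integrable_add locally_integrable_cmult fh f Dl)
    fix \<phi> :: "real^'n \<Rightarrow> real" assume \<phi>: "test_fun \<phi>"
    note [measurable] = test_fun_measurable[OF \<phi>]
    obtain K C where K: "compact K" and C: "0 \<le> C" "\<And>x. \<bar>\<phi> x\<bar> \<le> C * indicat_real K x" by (rule test_fun_bounds[OF \<phi>]) blast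
    have \<phi>h: "test_fun (\<lambda>x. \<phi> (x - h))" using test_fun_translate(1)[OF \<phi>, of "- h"] by simp
    have i1: "integrable lborel (\<lambda>x. f (x + h) * complex_of_real (\<phi> x))" by (rule integrable_test[OF fh \<phi>])
    have i2: "integrable lborel (\<lambda>x. f x * complex_of_real (\<phi> x))" by (rule integrable_test[OF f \<phi>])
    have i3: "integrable lborel (\<lambda>x. D x * complex_of_real (\<phi> x))" by (rule integrable_test[OF Dl \<phi>])
    have i4: "integrable lborel (\<lambda>x. f x * complex_of_real (\<phi> (x - h)))" by (rule integrable_test[OF f \<phi>h])
    have "(LINT x|lborel. f (x + h) * complex_of_real (\<phi> x)) = (LINT x|lborel. f x * complex_of_real (\<phi> (x - h)))"
      using integral_translate[of "\<lambda>x. f x * complex_of_real (\<phi> (x - h))" h] by simp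
    then have lhs: "(LINT x|lborel. f (x + h) * complex_of_real (\<phi> x)) - (LINT x|lborel. f x * complex_of_real (\<phi> x))
      = (LINT x|lborel. f x * complex_of_real (\<phi> (x - h) - \<phi> x))"
      using i2 i4 by (simp add: right_diff_distrib)
    define \<Phi> where "\<Phi> = (\<lambda>(s, x). F K (s, x) * complex_of_real (\<phi> x))"
    have Pi: "integrable (lborel \<Otimes>\<^sub>M lborel) \<Phi>"
    proof (rule Bochner_Integration.integrable_bound[where f = "\<lambda>z. C * norm (F K z)"])
      show "integrable (lborel \<Otimes>\<^sub>M lborel) (\<lambda>z. C * norm (F K z))" using Fi[OF K] by simp
      have [measurable]: "K \<in> sets borel" using K by (simp add: borel_compact)
      have "\<Phi> \<in> borel_measurable (borel \<Otimes>\<^sub>M borel)"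
        unfolding \<Phi>_def F_def case_prod_unfold by measurable
      then show "\<Phi> \<in> borel_measurable (lborel \<Otimes>\<^sub>M lborel)" by (simp add: lborel_prod borel_prod)
      show "AE z in lborel \<Otimes>\<^sub>M lborel. norm (\<Phi> z) \<le> norm (C * norm (F K z))"
      proof (rule AE_I2)
        fix z :: "real \<times> (real^'n)"
        have "norm (F K z) * \<bar>\<phi> (snd z)\<bar> \<le> norm (F K z) * C"
          using C(2)[of "snd z"] C(1) by (intro mult_left_mono) (cases "snd z \<in> K", auto)
        then show "norm (\<Phi> z) \<le> norm (C * norm (F K z))"
          using C(1) by (simp add: \<Phi>_def case_prod_unfold norm_mult mult.commute)
      qed
    qed
    have "(LINT x|lborel. LINT s|lborel. \<Phi> (s, x)) = (LINT s|lborel. LINT x|lborel. \<Phi> (s, x))"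
      using lborel_pair.Fubini_integral[of "\<lambda>s x. \<Phi> (s, x)"] Pi by simp
    moreover have "(LINT s|lborel. \<Phi> (s, x)) = D x * complex_of_real (\<phi> x)" for x
    proof -
      have "(LINT s|lborel. \<Phi> (s, x)) = (indicat_real K x *\<^sub>R D x) * complex_of_real (\<phi> x)"
        by (simp add: \<Phi>_def FD)
      then show ?thesis using C(2)[of x] by (auto simp: indicator_def split: if_splits)
    qed
    moreover have "(LINT x|lborel. \<Phi> (s, x)) = indicat_real {0..1} s *\<^sub>R (LINT x|lborel. G x * complex_of_real (\<phi> (x - s *\<^sub>R h)))" for s
    proof -
      have "\<Phi> (s, x) = indicat_real {0..1} s *\<^sub>R (G (x + s *\<^sub>R h) * complex_of_real (\<phi> (x + s *\<^sub>R h - s *\<^sub>R h)))" for x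
        using C(2)[of x] by (auto simp: \<Phi>_def F_def indicator_def split: if_splits)
      then show ?thesis
        using integral_translate[of "\<lambda>x. G x * complex_of_real (\<phi> (x - s *\<^sub>R h))" "s *\<^sub>R h"] by simp
    qed
    ultimately have "(LINT x|lborel. D x * complex_of_real (\<phi> x)) = (LINT x|lborel. f x * complex_of_real (\<phi> (x - h) - \<phi> x))"
      using weak_grad_translation[OF w \<phi>, of h] by (simp add: set_lebesgue_integral_def G_def)
    then show "(LINT x|lborel. ((f (x + h) + (-1) * f x) + (-1) * D x) * complex_of_real (\<phi> x)) = 0"
      using lhs i1 i2 i3 by (simp add: left_diff_distrib)
  qed
  have [measurable]: "B \<in> sets borel" using B by (simp add: borel_compact)
  have nF: "integrable (lborel \<Otimes>\<^sub>M lborel) (\<lambda>(s, x). norm (F B (s, x)))"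
    using integrable_norm[OF Fi[OF B]] by (simp add: case_prod_unfold)
  have iD: "integrable lborel (\<lambda>x. indicat_real B x *\<^sub>R D x)" using Dl B by (simp add: locally_integrable_def set_integrable_def)
  have "(\<integral>\<^sup>+x. indicator B x * ennreal (norm (f (x + h) - f x)) \<partial>lborel) = (\<integral>\<^sup>+x. ennreal (norm (indicat_real B x *\<^sub>R D x)) \<partial>lborel)"
    by (rule nn_integral_cong_AE) (use eq in eventually_elim, auto simp: indicator_def)
  also have "\<dots> = ennreal (LINT x|lborel. norm (indicat_real B x *\<^sub>R D x))"
    using iD by (intro nn_integral_eq_integral integrable_norm) auto
  also have "\<dots> \<le> ennreal (c B)"
  proof (rule ennreal_leI)
    have "(LINT x|lborel. norm (indicat_real B x *\<^sub>R D x)) \<le> (LINT x|lborel. LINT s|lborel. norm (F B (s, x)))"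
    proof (rule integral_mono)
      show "integrable lborel (\<lambda>x. LINT s|lborel. norm (F B (s, x)))"
        by (rule lborel_pair.integrable_snd[OF nF])
      show "norm (indicat_real B x *\<^sub>R D x) \<le> (LINT s|lborel. norm (F B (s, x)))" for x
        unfolding FD[symmetric] by (rule integral_norm_bound)
    qed (use iD in \<open>rule integrable_norm\<close>)
    also have "\<dots> = (LINT s|lborel. LINT x|lborel. norm (F B (s, x)))"
      by (rule lborel_pair.Fubini_integral[OF nF])
    also have "\<dots> \<le> c B" by (rule FK[OF B])
    finally show "(LINT x|lborel. norm (indicat_real B x *\<^sub>R D x)) \<le> c B" .
  qed
  also have "\<dots> \<le> ennreal (sqrt (measure lborel B) * (norm h * (\<Sum>j\<in>UNIV. norm (cls (\<lambda>x. g x $ j)))))"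
    unfolding c_def by (intro ennreal_leI mult_left_mono Gn) auto
  finally show ?thesis .
qed

subsection \<open>Closedness of the space of gradients\<close>

lemma nn_integral_translate:
  fixes f :: "'a::euclidean_space \<Rightarrow> ennreal" and a :: 'a
  assumes "f \<in> borel_measurable borel"
  shows "(\<integral>\<^sup>+x. f (a + x) \<partial>lborel) = (\<integral>\<^sup>+x. f x \<partial>lborel)"
proof -
  have "(\<integral>\<^sup>+x. f x \<partial>lborel) = (\<integral>\<^sup>+x. f x \<partial>distr lborel borel ((+) a))" by (simp only: lborel_distr_plus)
  also have "\<dots> = (\<integral>\<^sup>+x. f (a + x) \<partial>lborel)" using assms by (intro nn_integral_distr) auto
  finally show ?thesis by simp
qed

definition avg :: "(real^'n \<Rightarrow> complex) \<Rightarrow> complex" where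
  "avg f = (LINT x:cball 0 1|lborel. f x) /\<^sub>R measure lborel (cball (0::real^'n) 1)"

text \<open>The double integral of \<open>f y - f x\<close> over two balls becomes, with \<open>h = y - x\<close>, an integral
  of \<open>L1\<close> norms of differences of \<open>f\<close>, which the gradient controls.\<close>

lemma poincare:
  fixes R :: real
  shows "\<exists>C\<ge>0. \<forall>(f :: real^'n \<Rightarrow> complex) g. weak_grad f g \<longrightarrow> (\<forall>j. sqint (\<lambda>x. g x $ j)) \<longrightarrow>
    (\<integral>\<^sup>+x. indicator (cball 0 R) x * ennreal (norm (f x - avg f)) \<partial>lborel)
      \<le> ennreal (C * (\<Sum>j\<in>UNIV. norm (cls (\<lambda>x. g x $ j))))"
proof -
  define B where "B = cball (0::real^'n) 1"
  define v where "v = measure lborel B"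
  define BR where "BR = cball (0::real^'n) R"
  define B' where "B' = cball (0::real^'n) (R + 1)"
  have cB: "compact B" and [measurable]: "B \<in> sets borel" "BR \<in> sets borel" "B' \<in> sets borel" and cB': "compact B'"
    by (auto simp: B_def BR_def B'_def)
  have fin: "emeasure lborel K < \<infinity>" if "compact K" for K :: "(real^'n) set" using emeasure_compact_finite[OF that] by simp
  have v: "v > 0"
    unfolding v_def B_def using content_cball_pos[of 1 "0::real^'n"] by simp
  \<comment> \<open>Every h occurring below lies in \<open>B'\<close>, which contributes its volume;
    \<open>sqrt v * R'\<close> comes from the difference bound with
    \<open>norm h \<le> R + 1\<close>, and the division by v undoes the averaging over the unit
    ball. The absolute value keeps the constant nonnegative for every R.\<close>
  define R' where "R' = \<bar>R + 1\<bar>"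
  define C where "C = measure lborel B' * (sqrt v * R') / v"
  have "(\<integral>\<^sup>+x. indicator BR x * ennreal (norm (f x - avg f)) \<partial>lborel) \<le> ennreal (C * S)"
    if w: "weak_grad f g" and g2: "\<And>j. sqint (\<lambda>x. g x $ j)" and S: "S = (\<Sum>j\<in>UNIV. norm (cls (\<lambda>x. g x $ j)))"
    for f :: "real^'n \<Rightarrow> complex" and g S
  proof -
    have f: "locally_integrable f" using w by (simp add: weak_grad_def)
    have [measurable]: "f \<in> borel_measurable borel" using f by (simp add: locally_integrable_def)
    have S0: "S \<ge> 0" unfolding S by (intro sum_nonneg) auto
    have fB: "integrable lborel (\<lambda>x. indicat_real B x *\<^sub>R f x)" using f cB by (simp add: locally_integrable_def set_integrable_def)
    have pt: "ennreal v * ennreal (norm (f y - avg f)) \<le> (\<integral>\<^sup>+x. indicator B x * ennreal (norm (f y - f x)) \<partial>lborel)" for y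
    proof -
      have cB1: "integrable lborel (\<lambda>x. indicat_real B x *\<^sub>R f y)"
        by (intro integrable_scaleR_left integrable_real_indicator) (use fin[OF cB] in auto)
      have i: "integrable lborel (\<lambda>x. indicat_real B x *\<^sub>R (f y - f x))"
        using cB1 fB by (simp add: scaleR_diff_right)
      have "(LINT x|lborel. indicat_real B x *\<^sub>R (f y - f x)) = (LINT x|lborel. indicat_real B x *\<^sub>R f y) - (LINT x|lborel. indicat_real B x *\<^sub>R f x)"
        using cB1 fB by (simp add: scaleR_diff_right)
      also have "(LINT x|lborel. indicat_real B x *\<^sub>R f y) = v *\<^sub>R f y"
        using fin[OF cB] by (simp add: v_def)
      also have "(LINT x|lborel. indicat_real B x *\<^sub>R f x) = v *\<^sub>R avg f"
        using v by (simp add: avg_def B_def[symmetric] v_def[symmetric] set_lebesgue_integral_def)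
      finally have "v *\<^sub>R (f y - avg f) = (LINT x|lborel. indicat_real B x *\<^sub>R (f y - f x))" by (simp add: scaleR_diff_right)
      then have "ennreal (v * norm (f y - avg f)) = ennreal (norm (LINT x|lborel. indicat_real B x *\<^sub>R (f y - f x)))"
        using v by (metis abs_of_pos norm_scaleR)
      also have "\<dots> \<le> (\<integral>\<^sup>+x. ennreal (norm (indicat_real B x *\<^sub>R (f y - f x))) \<partial>lborel)"
        by (rule integral_norm_bound_ennreal[OF i])
      also have "\<dots> = (\<integral>\<^sup>+x. indicator B x * ennreal (norm (f y - f x)) \<partial>lborel)"
        by (intro nn_integral_cong) (auto simp: indicator_def)
      finally show ?thesis using v by (simp add: ennreal_mult)
    qed
    have mprod: "(\<lambda>(y, x). indicator BR y * (indicator B x * ennreal (norm (f y - f x)))) \<in> borel_measurable (lborel \<Otimes>\<^sub>M lborel)"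
    proof -
      have "(\<lambda>(y, x). indicator BR y * (indicator B x * ennreal (norm (f y - f x)))) \<in> borel_measurable (borel \<Otimes>\<^sub>M borel)"
        by measurable
      then show ?thesis by (simp add: lborel_prod borel_prod)
    qed
    have mprod2: "(\<lambda>(x, h). indicator B x * (indicator B' h * ennreal (norm (f (x + h) - f x)))) \<in> borel_measurable (lborel \<Otimes>\<^sub>M lborel)"
    proof -
      have "(\<lambda>(x, h). indicator B x * (indicator B' h * ennreal (norm (f (x + h) - f x)))) \<in> borel_measurable (borel \<Otimes>\<^sub>M borel)"
        by measurable
      then show ?thesis by (simp add: lborel_prod borel_prod)
    qed
    have "ennreal v * (\<integral>\<^sup>+y. indicator BR y * ennreal (norm (f y - avg f)) \<partial>lborel)
        = (\<integral>\<^sup>+y. indicator BR y * (ennreal v * ennreal (norm (f y - avg f))) \<partial>lborel)"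
      by (subst nn_integral_cmult[symmetric]) (auto simp: mult_ac)
    also have "\<dots> \<le> (\<integral>\<^sup>+y. indicator BR y * (\<integral>\<^sup>+x. indicator B x * ennreal (norm (f y - f x)) \<partial>lborel) \<partial>lborel)"
      by (intro nn_integral_mono mult_left_mono pt) auto
    also have "\<dots> = (\<integral>\<^sup>+y. (\<integral>\<^sup>+x. indicator BR y * (indicator B x * ennreal (norm (f y - f x))) \<partial>lborel) \<partial>lborel)"
      by (intro nn_integral_cong) (simp add: nn_integral_cmult)
    also have "\<dots> = (\<integral>\<^sup>+x. (\<integral>\<^sup>+y. indicator BR y * (indicator B x * ennreal (norm (f y - f x))) \<partial>lborel) \<partial>lborel)"
      by (rule lborel_pair.Fubini'[OF mprod, symmetric])
    also have "\<dots> = (\<integral>\<^sup>+x. (\<integral>\<^sup>+h. indicator BR (x + h) * (indicator B x * ennreal (norm (f (x + h) - f x))) \<partial>lborel) \<partial>lborel)"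
    proof (rule nn_integral_cong)
      fix x :: "real^'n"
      have "(\<lambda>y. indicator BR y * (indicator B x * ennreal (norm (f y - f x)))) \<in> borel_measurable borel" by measurable
      from nn_integral_translate[OF this, of x]
      show "(\<integral>\<^sup>+y. indicator BR y * (indicator B x * ennreal (norm (f y - f x))) \<partial>lborel)
        = (\<integral>\<^sup>+h. indicator BR (x + h) * (indicator B x * ennreal (norm (f (x + h) - f x))) \<partial>lborel)" by simp
    qed
    also have "\<dots> \<le> (\<integral>\<^sup>+x. (\<integral>\<^sup>+h. indicator B x * (indicator B' h * ennreal (norm (f (x + h) - f x))) \<partial>lborel) \<partial>lborel)"
    proof (intro nn_integral_mono)
      fix x h :: "real^'n"
      have "h \<in> B'" if "x + h \<in> BR" "x \<in> B"
      proof -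
        have "norm h \<le> norm (x + h) + norm x" using norm_triangle_ineq4[of "x + h" x] by simp
        then show ?thesis using that by (simp add: B'_def BR_def B_def)
      qed
      then show "indicator BR (x + h) * (indicator B x * ennreal (norm (f (x + h) - f x))) \<le> indicator B x * (indicator B' h * ennreal (norm (f (x + h) - f x)))"
        by (auto simp: indicator_def)
    qed
    also have "\<dots> = (\<integral>\<^sup>+h. (\<integral>\<^sup>+x. indicator B x * (indicator B' h * ennreal (norm (f (x + h) - f x))) \<partial>lborel) \<partial>lborel)"
      by (rule lborel_pair.Fubini'[OF mprod2, symmetric])
    also have "\<dots> \<le> (\<integral>\<^sup>+h. indicator B' h * ennreal (sqrt v * (R' * S)) \<partial>lborel)"
    proof (rule nn_integral_mono)
      fix h :: "real^'n"
      have "(\<integral>\<^sup>+x. indicator B x * (indicator B' h * ennreal (norm (f (x + h) - f x))) \<partial>lborel)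
        = indicator B' h * (\<integral>\<^sup>+x. indicator B x * ennreal (norm (f (x + h) - f x)) \<partial>lborel)"
        by (subst nn_integral_cmult[symmetric]) (auto simp: mult_ac)
      also have "\<dots> \<le> indicator B' h * ennreal (sqrt v * (norm h * S))"
        unfolding v_def S by (intro mult_left_mono weak_grad_difference_bound[OF w g2 cB]) auto
      also have "\<dots> \<le> indicator B' h * ennreal (sqrt v * (R' * S))"
        using v S0 by (auto simp: indicator_def B'_def R'_def intro!: ennreal_leI mult_left_mono mult_right_mono)
      finally show "(\<integral>\<^sup>+x. indicator B x * (indicator B' h * ennreal (norm (f (x + h) - f x))) \<partial>lborel) \<le> indicator B' h * ennreal (sqrt v * (R' * S))" .
    qed
    also have "\<dots> = ennreal (sqrt v * (R' * S)) * emeasure lborel B'"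
      by (simp add: nn_integral_multc mult.commute)
    also have "\<dots> = ennreal (measure lborel B' * (sqrt v * (R' * S)))"
      using fin[OF cB'] v S0 by (simp add: emeasure_eq_ennreal_measure ennreal_mult R'_def mult_ac less_top[symmetric])
    finally have "ennreal v * (\<integral>\<^sup>+y. indicator BR y * ennreal (norm (f y - avg f)) \<partial>lborel) \<le> ennreal v * ennreal (C * S)"
      using v S0 by (simp add: C_def ennreal_mult[symmetric] R'_def mult_ac)
    then show ?thesis using v by (simp add: ennreal_mult_le_mult_iff)
  qed
  moreover have "C \<ge> 0" using v by (simp add: C_def R'_def)
  ultimately show ?thesis unfolding BR_def by (intro exI[of _ C]) blast
qed

text \<open>What has to be seen is that a derivative of a test function has integral 0. By Fubini
  its integral, up to sign, is the integral of \<open>\<phi> (x - h) - \<phi> x\<close>, which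
  vanishes by translation invariance.\<close>

lemma weak_grad_const:
  "weak_grad (\<lambda>x::real^'n. c) (\<lambda>x. 0)"
  unfolding weak_grad_def
proof (intro conjI allI impI)
  fix \<phi> :: "real^'n \<Rightarrow> real" and j assume \<phi>: "test_fun \<phi>"
  define h where "h = (axis j 1 :: real^'n)"
  note [measurable] = test_fun_pd_measurable[OF \<phi>, of h] test_fun_measurable[OF \<phi>]
  obtain K b where K: "compact K" and b: "0 \<le> b" "\<And>x. \<bar>pd \<phi> h x\<bar> \<le> b * indicat_real K x"
    by (rule test_fun_pd_bounds[OF \<phi>, of h]) blast
  have ip: "integrable lborel \<phi>"
    using integrable_test[OF locally_integrable_const[of 1] \<phi>]
    by (simp add: complex_of_real_integrable_eq)
  define K' where "K' = (\<lambda>(y, s). y + s *\<^sub>R h) ` (K \<times> {0..1::real})"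
  have K': "compact K'" unfolding K'_def by (rule compact_sweep[OF K])
  define F where "F = (\<lambda>(s::real, x). indicat_real {0..1} s *\<^sub>R (- pd \<phi> h (x - s *\<^sub>R h)))"
  have Fi: "integrable (lborel \<Otimes>\<^sub>M lborel) F"
  proof (rule integrable_pair_bound[where u = "\<lambda>s. b * indicat_real {0..1} s" and v = "indicat_real K'"])
    show "F \<in> borel_measurable borel" unfolding F_def case_prod_unfold borel_prod[symmetric] by measurable
    show "integrable lborel (indicat_real K')"
      using emeasure_compact_finite[OF K'] K' by (intro integrable_real_indicator) (auto simp: borel_compact)
    show "norm (F (s, x)) \<le> b * indicat_real {0..1} s * indicat_real K' x" for s x
    proof (cases "s \<in> {0..1} \<and> x - s *\<^sub>R h \<in> K")
      case True
      then have "x \<in> K'" unfolding K'_def by (intro image_eqI[of _ _ "(x - s *\<^sub>R h, s)"]) auto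
      then show ?thesis using b(2)[of "x - s *\<^sub>R h"] True by (simp add: F_def)
    next
      case False
      then have "F (s, x) = 0" using b(2)[of "x - s *\<^sub>R h"] by (auto simp: F_def indicator_def split: if_splits)
      then show ?thesis using b by simp
    qed
  qed auto
  have "(LINT x|lborel. LINT s|lborel. F (s, x)) = (LINT s|lborel. LINT x|lborel. F (s, x))"
    using lborel_pair.Fubini_integral[of "\<lambda>s x. F (s, x)"] Fi by simp
  moreover have "(LINT s|lborel. F (s, x)) = \<phi> (x - h) - \<phi> x" for x
    by (simp add: F_def test_fun_difference[OF \<phi>] set_lebesgue_integral_def)
  moreover have "(LINT x|lborel. \<phi> (x - h) - \<phi> x) = 0"
    using integral_translate[of \<phi> "- h"] integrable_translate[OF ip, of "- h"] ip by simp
  moreover have "(LINT x|lborel. F (s, x)) = indicat_real {0..1} s *\<^sub>R (LINT x|lborel. - pd \<phi> h x)" for s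
    using integral_translate[of "\<lambda>x. - pd \<phi> h x" "- (s *\<^sub>R h)"] by (simp add: F_def)
  ultimately have "(LINT x|lborel. pd \<phi> h x) = 0" by simp
  then have "(LINT x|lborel. c * complex_of_real (pd \<phi> h x)) = 0"
    by (simp add: integral_complex_of_real)
  then show "(LINT x|lborel. c * complex_of_real (pd \<phi> (axis j 1) x)) = - (LINT x|lborel. 0 $ j * complex_of_real (\<phi> x))"
    by (simp add: h_def)
qed (auto intro: locally_integrable_const)

section \<open>States and the closed subspace of gradients\<close>

type_synonym 'n state = "(real^'n, (complex^'n) \<times> complex) lsq"

text \<open>Only the first component is constrained. Its potential f is locally integrable and
  otherwise free; it need not be square integrable, which is why membership does not pass to limits
  for trivial reasons.\<close>

definition gradient_states :: "('n::finite) state set" where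
  "gradient_states = {F. \<exists>f. weak_grad f (\<lambda>x. fst (rep F x))}"

lemma weak_grad_cong_AE:
  fixes f :: "real^'n \<Rightarrow> complex"
  assumes w: "weak_grad f g" and [measurable]: "g' \<in> borel_measurable borel" and ae: "AE x in lborel. g x = g' x"
  shows "weak_grad f g'"
  unfolding weak_grad_def
proof (intro conjI allI impI)
  show "locally_integrable f" using w by (simp add: weak_grad_def)
  have g: "locally_integrable (\<lambda>x. g x $ j)" for j using w by (simp add: weak_grad_def)
  have mg [measurable]: "(\<lambda>x. g x $ j) \<in> borel_measurable borel" for j using g[of j] by (simp add: locally_integrable_def)
  have mg' [measurable]: "(\<lambda>x. g' x $ j) \<in> borel_measurable borel" for j
    by (rule measurable_compose[OF assms(2)]) (intro borel_measurable_continuous_onI continuous_intros)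
  show "locally_integrable (\<lambda>x. g' x $ j)" for j unfolding locally_integrable_def
  proof (intro conjI allI impI)
    fix K :: "(real^'n) set" assume K: "compact K"
    then have [measurable]: "K \<in> sets borel" by (simp add: borel_compact)
    have "integrable lborel (\<lambda>x. indicat_real K x *\<^sub>R g x $ j)" using g[of j] K by (simp add: locally_integrable_def set_integrable_def)
    then show "set_integrable lborel K (\<lambda>x. g' x $ j)" unfolding set_integrable_def
      by (rule integrable_cong_AE_imp) (use ae in \<open>auto elim: eventually_mono\<close>)
  qed simp
  fix \<phi> :: "real^'n \<Rightarrow> real" and j assume \<phi>: "test_fun \<phi>"
  note [measurable] = test_fun_measurable[OF \<phi>]
  have "(LINT x|lborel. g x $ j * complex_of_real (\<phi> x)) = (LINT x|lborel. g' x $ j * complex_of_real (\<phi> x))"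
    by (rule integral_cong_AE) (use ae in \<open>auto elim: eventually_mono\<close>)
  then show "(LINT x|lborel. f x * complex_of_real (pd \<phi> (axis j 1) x)) = - (LINT x|lborel. g' x $ j * complex_of_real (\<phi> x))"
    using w \<phi> by (simp add: weak_grad_def)
qed

lemma bounded_linear_fst_nth: "bounded_linear (\<lambda>z :: (complex^'n) \<times> 'c::real_normed_vector. fst z $ j)"
  using bounded_linear_compose[OF bounded_linear_vec_nth bounded_linear_fst] .

lemma norm_fst_nth_le: "norm (fst z $ j) \<le> norm (z :: (complex^'n) \<times> complex)"
  using Finite_Cartesian_Product.norm_nth_le[of "fst z" j] norm_fst_le[of "fst z" "snd z"] by simp

lemma sqint_fst_nth:
  fixes f :: "real^'n \<Rightarrow> (complex^'n) \<times> complex"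
  assumes "sqint f"
  shows "sqint (\<lambda>x. fst (f x) $ j)" "norm (cls (\<lambda>x. fst (f x) $ j)) \<le> norm (cls f)"
proof -
  show s: "sqint (\<lambda>x. fst (f x) $ j)" by (rule sqint_linear[OF assms bounded_linear_fst_nth])
  show "norm (cls (\<lambda>x. fst (f x) $ j)) \<le> norm (cls f)"
    unfolding norm_cls[OF s] norm_cls[OF assms]
    by (intro real_sqrt_le_mono integral_mono power_mono norm_fst_nth_le)
       (use s assms in \<open>auto simp: sqint_def\<close>)
qed

lemma gradient_states_cls:
  assumes "sqint F"
  shows "cls F \<in> gradient_states \<longleftrightarrow> (\<exists>f. weak_grad f (\<lambda>x. fst (F x)))"
proof -
  have m: "(\<lambda>x. fst (F x)) \<in> borel_measurable borel" if "sqint F" for F :: "real^'n \<Rightarrow> (complex^'n) \<times> complex"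
    by (rule measurable_compose[OF sqint_measurable[OF that]]) (intro borel_measurable_continuous_onI continuous_intros)
  have ae: "AE x in lborel. fst (rep (cls F) x) = fst (F x)" using rep_cls[OF assms] by eventually_elim simp
  then have ae': "AE x in lborel. fst (F x) = fst (rep (cls F) x)" by eventually_elim simp
  show ?thesis unfolding gradient_states_def
    using weak_grad_cong_AE[OF _ m[OF assms] ae] weak_grad_cong_AE[OF _ m[OF sqint_rep] ae'] by blast
qed

lemma subspace_gradient_states: "subspace (gradient_states :: ('n::finite) state set)"
  unfolding subspace_def
proof (intro conjI ballI allI)
  show "0 \<in> (gradient_states :: 'n state set)"
    unfolding cls_zero[symmetric] gradient_states_cls[OF sqint_zero]
    using weak_grad_const by (auto intro!: exI[of _ "\<lambda>_. 0"])
  fix F G :: "'n state" and c :: real assume F: "F \<in> gradient_states"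
  obtain f where f: "weak_grad f (\<lambda>x. fst (rep F x))" using F by (auto simp: gradient_states_def)
  have "cls (\<lambda>x. c *\<^sub>R rep F x) \<in> gradient_states"
    unfolding gradient_states_cls[OF sqint_scaleR[OF sqint_rep]]
  proof
    have "(\<lambda>x. \<chi> j. complex_of_real c * (fst (rep F x) $ j) + 0 * (fst (rep F x) $ j)) = (\<lambda>x. fst (c *\<^sub>R rep F x))"
      by (simp add: fun_eq_iff vec_eq_iff) (simp add: scaleR_conv_of_real)
    then show "weak_grad (\<lambda>x. complex_of_real c * f x + 0 * f x) (\<lambda>x. fst (c *\<^sub>R rep F x))"
      using weak_grad_lin[OF f f, of "complex_of_real c" 0] by simp
  qed
  then show "c *\<^sub>R F \<in> gradient_states" by (simp add: cls_scaleR)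
  assume G: "G \<in> gradient_states"
  obtain g where g: "weak_grad g (\<lambda>x. fst (rep G x))" using G by (auto simp: gradient_states_def)
  have "cls (\<lambda>x. rep F x + rep G x) \<in> gradient_states"
    unfolding gradient_states_cls[OF sqint_add[OF sqint_rep sqint_rep]]
  proof
    have "(\<lambda>x. \<chi> j. 1 * (fst (rep F x) $ j) + 1 * (fst (rep G x) $ j)) = (\<lambda>x. fst (rep F x + rep G x))"
      by (simp add: fun_eq_iff vec_eq_iff)
    then show "weak_grad (\<lambda>x. 1 * f x + 1 * g x) (\<lambda>x. fst (rep F x + rep G x))"
      using weak_grad_lin[OF f g, of 1 1] by simp
  qed
  then show "F + G \<in> gradient_states" by (simp add: cls_add)
qed

text \<open>Potentials of a convergent sequence need not converge, since each carries an arbitrary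
  constant. Along a fast subsequence the differences of consecutive potentials are normalised to
  mean 0 on the unit ball; by the Poincare inequality they are then summable in \<open>L1\<close>
  over every ball, and their sum plus the first potential is a potential of the limit.\<close>

lemma closed_gradient_states: "closed (gradient_states :: ('n::finite) state set)"
  unfolding closed_sequential_limits
proof (intro allI impI, elim conjE)
  fix X :: "nat \<Rightarrow> 'n state" and Y :: "'n state"
  assume X: "\<forall>n. X n \<in> gradient_states" and lim: "X \<longlonglongrightarrow> Y"
  obtain r where r: "strict_mono r" "\<And>n. norm (X (r (Suc n)) - X (r n)) \<le> (1/2) ^ n"
    using Cauchy_fast_subseq[OF LIMSEQ_imp_Cauchy[OF lim]] by blast
  define F where "F n = rep (X (r n))" for n
  have Fs: "sqint (F n)" and FX: "cls (F n) = X (r n)" for n by (auto simp: F_def)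
  have "\<exists>f. weak_grad f (\<lambda>x. fst (F n x))" for n
    using X FX[of n] gradient_states_cls[OF Fs[of n]] by metis
  then obtain f where f: "\<And>n. weak_grad (f n) (\<lambda>x. fst (F n x))" by metis
  define e where "e n x = 1 * f (Suc n) x + (-1) * f n x" for n x
  define d where "d n x = 1 * e n x + (-1) * avg (e n)" for n x
  define g where "g n x = (\<chi> j. 1 * (fst (F (Suc n) x) $ j) + (-1) * (fst (F n x) $ j))" for n x
  have we: "weak_grad (e n) (g n)" for n
    unfolding e_def[abs_def] g_def[abs_def] by (rule weak_grad_lin[OF f f])
  have gF: "g n x $ j = fst (F (Suc n) x - F n x) $ j" for n x j by (simp add: g_def)
  have gs: "sqint (\<lambda>x. g n x $ j)" and gn: "norm (cls (\<lambda>x. g n x $ j)) \<le> (1/2) ^ n" for n j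
  proof -
    have s: "sqint (\<lambda>x. F (Suc n) x - F n x)" by (intro sqint_diff Fs)
    show "sqint (\<lambda>x. g n x $ j)" unfolding gF by (rule sqint_fst_nth(1)[OF s])
    have "norm (cls (\<lambda>x. g n x $ j)) \<le> norm (cls (\<lambda>x. F (Suc n) x - F n x))"
      unfolding gF by (rule sqint_fst_nth(2)[OF s])
    also have "\<dots> \<le> (1/2) ^ n" using r(2)[of n] by (simp add: cls_diff Fs FX)
    finally show "norm (cls (\<lambda>x. g n x $ j)) \<le> (1/2) ^ n" .
  qed
  have wd: "weak_grad (d n) (g n)" for n
    using weak_grad_lin[OF we weak_grad_const, of 1 n "-1" "avg (e n)"] by (simp add: d_def[abs_def])
  have dl: "locally_integrable (d n)" for n using wd by (simp add: weak_grad_def)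
  have [measurable]: "d n \<in> borel_measurable borel" for n using dl by (simp add: locally_integrable_def)
  have f0l: "locally_integrable (f 0)" using f by (simp add: weak_grad_def)
  have dbound: "\<exists>C. \<forall>n. (\<integral>\<^sup>+x. indicator (cball 0 R) x * ennreal (norm (d n x)) \<partial>lborel) \<le> ennreal (C * (1/2) ^ n)" for R
  proof -
    obtain C where C: "C \<ge> 0" and P: "\<And>(f :: real^'n \<Rightarrow> complex) g. weak_grad f g \<Longrightarrow> (\<forall>j. sqint (\<lambda>x. g x $ j)) \<Longrightarrow>
      (\<integral>\<^sup>+x. indicator (cball 0 R) x * ennreal (norm (f x - avg f)) \<partial>lborel) \<le> ennreal (C * (\<Sum>j\<in>UNIV. norm (cls (\<lambda>x. g x $ j))))"
      using poincare[of R] by blast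
    have "(\<integral>\<^sup>+x. indicator (cball 0 R) x * ennreal (norm (d n x)) \<partial>lborel) \<le> ennreal ((C * real CARD('n)) * (1/2) ^ n)" for n
    proof -
      have "(\<integral>\<^sup>+x. indicator (cball 0 R) x * ennreal (norm (d n x)) \<partial>lborel) \<le> ennreal (C * (\<Sum>j\<in>UNIV. norm (cls (\<lambda>x. g n x $ j))))"
        using P[OF we[of n]] gs by (simp add: d_def)
      also have "\<dots> \<le> ennreal (C * (real CARD('n) * (1/2) ^ n))"
        using C sum_bounded_above[of UNIV "\<lambda>j. norm (cls (\<lambda>x. g n x $ j))" "(1/2) ^ n"] gn
        by (intro ennreal_leI mult_left_mono) auto
      finally show ?thesis by (simp only: mult.assoc)
    qed
    then show ?thesis by blast
  qed
  define B where "B R = cball (0::real^'n) R" for R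
  have Bb [measurable]: "B R \<in> sets borel" for R by (simp add: B_def)
  have di: "integrable lborel (\<lambda>x. indicat_real (B R) x *\<^sub>R d n x)" for n R
    using dl[of n] by (simp add: locally_integrable_def set_integrable_def B_def)
  have nn_d: "(\<integral>\<^sup>+x. indicator (B R) x * ennreal (norm (d n x)) \<partial>lborel) = ennreal (LINT x|lborel. norm (indicat_real (B R) x *\<^sub>R d n x))" for n R
  proof -
    have "(\<integral>\<^sup>+x. indicator (B R) x * ennreal (norm (d n x)) \<partial>lborel) = (\<integral>\<^sup>+x. ennreal (norm (indicat_real (B R) x *\<^sub>R d n x)) \<partial>lborel)"
      by (intro nn_integral_cong) (auto simp: indicator_def)
    also have "\<dots> = ennreal (LINT x|lborel. norm (indicat_real (B R) x *\<^sub>R d n x))"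
      using di by (intro nn_integral_eq_integral integrable_norm) auto
    finally show ?thesis .
  qed
  have summI: "summable (\<lambda>n. LINT x|lborel. norm (indicat_real (B R) x *\<^sub>R d n x))" for R
  proof -
    obtain C where C: "\<And>n. (\<integral>\<^sup>+x. indicator (B R) x * ennreal (norm (d n x)) \<partial>lborel) \<le> ennreal (C * (1/2) ^ n)"
      using dbound[of R] by (auto simp: B_def)
    have s: "summable (\<lambda>n. \<bar>C\<bar> * (1/2::real) ^ n)" by (intro summable_mult summable_geometric) auto
    show ?thesis
    proof (rule summable_comparison_test'[OF s, of 0])
      fix n
      have "ennreal (LINT x|lborel. norm (indicat_real (B R) x *\<^sub>R d n x)) \<le> ennreal (C * (1/2) ^ n)"
        using C[of n] by (simp only: nn_d)
      also have "\<dots> \<le> ennreal (\<bar>C\<bar> * (1/2) ^ n)" by (intro ennreal_leI mult_right_mono) auto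
      finally have "(LINT x|lborel. norm (indicat_real (B R) x *\<^sub>R d n x)) \<le> \<bar>C\<bar> * (1/2) ^ n"
        by (subst (asm) ennreal_le_iff) auto
      then show "norm (LINT x|lborel. norm (indicat_real (B R) x *\<^sub>R d n x)) \<le> \<bar>C\<bar> * (1/2) ^ n"
        by (simp add: Bochner_Integration.integral_nonneg)
    qed
  qed
  have AER: "AE x in lborel. summable (\<lambda>n. norm (indicat_real (B R) x *\<^sub>R d n x))" for R
  proof -
    have "(\<integral>\<^sup>+x. (\<Sum>n. ennreal (norm (indicat_real (B R) x *\<^sub>R d n x))) \<partial>lborel)
      = (\<Sum>n. \<integral>\<^sup>+x. ennreal (norm (indicat_real (B R) x *\<^sub>R d n x)) \<partial>lborel)"
      by (rule nn_integral_suminf) measurable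
    also have "\<dots> = (\<Sum>n. ennreal (LINT x|lborel. norm (indicat_real (B R) x *\<^sub>R d n x)))"
      by (intro arg_cong[where f = suminf] ext nn_integral_eq_integral integrable_norm di) auto
    also have "\<dots> \<noteq> \<infinity>"
      using summI[of R] by (simp add: suminf_ennreal_eq[OF _ summable_sums] Bochner_Integration.integral_nonneg)
    finally have "AE x in lborel. (\<Sum>n. ennreal (norm (indicat_real (B R) x *\<^sub>R d n x))) \<noteq> \<infinity>"
      by (intro nn_integral_noteq_infinite) auto
    then show ?thesis by eventually_elim (rule summable_suminf_not_top, auto)
  qed
  \<comment> \<open>The series converges absolutely almost everywhere; the value of S on the
    remaining null set is arbitrary.\<close>
  define S where "S x = (\<Sum>n. d n x)" for x
  have [measurable]: "S \<in> borel_measurable borel" unfolding S_def by measurable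
  have Sl: "locally_integrable S" unfolding locally_integrable_def
  proof (intro conjI allI impI)
    fix K :: "(real^'n) set" assume K: "compact K"
    obtain R where R: "K \<subseteq> B R"
      using compact_imp_bounded[OF K] unfolding bounded_iff B_def by (auto simp: subset_eq)
    have "integrable lborel (\<lambda>x. \<Sum>n. indicat_real (B R) x *\<^sub>R d n x)"
      by (rule integrable_suminf[OF di AER summI])
    moreover have "(\<Sum>n. indicat_real (B R) x *\<^sub>R d n x) = indicat_real (B R) x *\<^sub>R S x" for x
      unfolding S_def by (auto simp: indicator_def)
    ultimately have "set_integrable lborel (B R) S" by (simp add: set_integrable_def)
    then show "set_integrable lborel K S" by (rule set_integrable_subset) (use K R in \<open>auto simp: borel_compact\<close>)
  qed simp
  \<comment> \<open>The partial sums telescope to \<open>f n\<close> up to a constant, so they have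
    the same weak gradient.\<close>
  have f': "weak_grad (\<lambda>x. f 0 x + (\<Sum>i<n. d i x)) (\<lambda>x. fst (F n x))" for n
  proof (induction n)
    case 0
    then show ?case using f[of 0] by simp
  next
    case (Suc n)
    have "(\<lambda>x. \<chi> j. 1 * (fst (F n x) $ j) + 1 * (g n x $ j)) = (\<lambda>x. fst (F (Suc n) x))"
      by (simp add: fun_eq_iff vec_eq_iff g_def)
    then show ?case using weak_grad_lin[OF Suc wd[of n], of 1 1] by (simp add: add.assoc)
  qed
  have Ylim: "(\<lambda>n. X (r n)) \<longlonglongrightarrow> Y" using LIMSEQ_subseq_LIMSEQ[OF lim r(1)] by (simp add: comp_def)
  define G where "G = rep Y"
  have Gs: "sqint G" and GY: "cls G = Y" by (auto simp: G_def)
  have "weak_grad (\<lambda>x. f 0 x + S x) (\<lambda>x. fst (G x))"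
    unfolding weak_grad_def
  proof (intro conjI allI impI)
    show "locally_integrable (\<lambda>x. f 0 x + S x)" by (intro locally_integrable_add f0l Sl)
    show "locally_integrable (\<lambda>x. fst (G x) $ j)" for j
      by (rule sqint_locally_integrable[OF sqint_fst_nth(1)[OF Gs]])
    fix \<phi> :: "real^'n \<Rightarrow> real" and j assume \<phi>: "test_fun \<phi>"
    define p where "p = pd \<phi> (axis j 1)"
    have [measurable]: "p \<in> borel_measurable borel" unfolding p_def by (rule test_fun_pd_measurable[OF \<phi>])
    obtain K c where K: "compact K" and c: "0 \<le> c" "\<And>x. \<bar>p x\<bar> \<le> c * indicat_real K x"
      unfolding p_def by (rule test_fun_pd_bounds[OF \<phi>]) blast
    obtain R where R: "K \<subseteq> B R"
      using compact_imp_bounded[OF K] unfolding bounded_iff B_def by (auto simp: subset_eq)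
    have pB: "p x = indicat_real (B R) x * p x" for x
      using c(2)[of x] R by (cases "x \<in> K") auto
    have nb: "norm (d n x * complex_of_real (p x)) \<le> c * norm (indicat_real (B R) x *\<^sub>R d n x)" for n x
    proof -
      have "\<bar>p x\<bar> \<le> c * indicat_real (B R) x"
        using c(2)[of x] c(1) R by (cases "x \<in> K") auto
      then have "norm (d n x) * \<bar>p x\<bar> \<le> norm (d n x) * (c * indicat_real (B R) x)" by (intro mult_left_mono) auto
      then show ?thesis by (simp add: norm_mult mult_ac)
    qed
    have i1: "integrable lborel (\<lambda>x. d n x * complex_of_real (p x))" for n
      unfolding p_def by (rule integrable_test_pd[OF dl \<phi>])
    have i2: "AE x in lborel. summable (\<lambda>n. norm (d n x * complex_of_real (p x)))"
      using AER[of R]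
    proof eventually_elim
      case (elim x)
      show ?case by (rule summable_comparison_test'[OF summable_mult[OF elim, of c], of 0]) (use nb in auto)
    qed
    have i3: "summable (\<lambda>n. LINT x|lborel. norm (d n x * complex_of_real (p x)))"
    proof (rule summable_comparison_test'[OF summable_mult[OF summI, of c R], of 0])
      fix n
      have "(LINT x|lborel. norm (d n x * complex_of_real (p x))) \<le> (LINT x|lborel. c * norm (indicat_real (B R) x *\<^sub>R d n x))"
        using i1 di nb by (intro integral_mono integrable_norm integrable_mult_right)
      then show "norm (LINT x|lborel. norm (d n x * complex_of_real (p x))) \<le> c * (LINT x|lborel. norm (indicat_real (B R) x *\<^sub>R d n x))"
        by (simp add: Bochner_Integration.integral_nonneg)
    qed
    have "(\<lambda>n. LINT x|lborel. d n x * complex_of_real (p x)) sums (LINT x|lborel. (\<Sum>n. d n x * complex_of_real (p x)))"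
      by (rule sums_integral[OF i1 i2 i3])
    moreover have "(LINT x|lborel. (\<Sum>n. d n x * complex_of_real (p x))) = (LINT x|lborel. S x * complex_of_real (p x))"
    proof (rule integral_cong_AE)
      show "AE x in lborel. (\<Sum>n. d n x * complex_of_real (p x)) = S x * complex_of_real (p x)"
        using AER[of R]
      proof eventually_elim
        case (elim x)
        show ?case
        proof (cases "x \<in> B R")
          case True
          then have "summable (\<lambda>n. norm (d n x))" using elim by simp
          then have "summable (\<lambda>n. d n x)" by (rule summable_norm_cancel)
          then show ?thesis unfolding S_def by (simp add: suminf_mult2)
        next
          case False
          then have "p x = 0" using pB[of x] by simp
          then show ?thesis by simp
        qed
      qed
    qed measurable
    ultimately have "(\<lambda>n. \<Sum>i<n. LINT x|lborel. d i x * complex_of_real (p x)) \<longlonglongrightarrow> (LINT x|lborel. S x * complex_of_real (p x))"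
      by (simp add: sums_def)
    then have l1: "(\<lambda>n. (LINT x|lborel. f 0 x * complex_of_real (p x)) + (\<Sum>i<n. LINT x|lborel. d i x * complex_of_real (p x)))
       \<longlonglongrightarrow> (LINT x|lborel. f 0 x * complex_of_real (p x)) + (LINT x|lborel. S x * complex_of_real (p x))"
      by (intro tendsto_intros)
    have if0: "integrable lborel (\<lambda>x. f 0 x * complex_of_real (p x))"
      unfolding p_def by (rule integrable_test_pd[OF f0l \<phi>])
    have iS: "integrable lborel (\<lambda>x. S x * complex_of_real (p x))"
      unfolding p_def by (rule integrable_test_pd[OF Sl \<phi>])
    have e1: "(LINT x|lborel. f 0 x * complex_of_real (p x)) + (\<Sum>i<n. LINT x|lborel. d i x * complex_of_real (p x))
      = - (LINT x|lborel. fst (F n x) $ j * complex_of_real (\<phi> x))" for n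
    proof -
      have "(LINT x|lborel. f 0 x * complex_of_real (p x)) + (\<Sum>i<n. LINT x|lborel. d i x * complex_of_real (p x))
        = (LINT x|lborel. (f 0 x + (\<Sum>i<n. d i x)) * complex_of_real (p x))"
        using if0 i1 by (simp add: distrib_right sum_distrib_right)
      then show ?thesis using f'[of n] \<phi> by (simp add: weak_grad_def p_def)
    qed
    have l2: "(\<lambda>n. LINT x|lborel. fst (F n x) $ j * complex_of_real (\<phi> x)) \<longlonglongrightarrow> (LINT x|lborel. fst (G x) $ j * complex_of_real (\<phi> x))"
    proof -
      obtain K c where K: "compact K" and c: "0 \<le> c" "\<And>x. \<bar>\<phi> x\<bar> \<le> c * indicat_real K x"
        by (rule test_fun_bounds[OF \<phi>]) blast
      have "norm ((LINT x|lborel. fst (F n x) $ j * complex_of_real (\<phi> x)) - (LINT x|lborel. fst (G x) $ j * complex_of_real (\<phi> x)))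
         \<le> c * (sqrt (measure lborel K) * norm (X (r n) - Y))" for n
      proof -
        have s: "sqint (\<lambda>x. F n x - G x)" by (intro sqint_diff Fs Gs)
        define H where "H x = fst (F n x - G x) $ j" for x
        have H: "sqint H" "norm (cls H) \<le> norm (X (r n) - Y)"
          using sqint_fst_nth[OF s, of j] by (simp_all add: H_def[abs_def] cls_diff Fs Gs FX GY)
        have iH: "integrable lborel (\<lambda>x. H x * complex_of_real (\<phi> x))"
          by (rule integrable_test[OF sqint_locally_integrable[OF H(1)] \<phi>])
        have iF: "integrable lborel (\<lambda>x. fst (F n x) $ j * complex_of_real (\<phi> x))" "integrable lborel (\<lambda>x. fst (G x) $ j * complex_of_real (\<phi> x))"
          by (intro integrable_test[OF _ \<phi>] sqint_locally_integrable sqint_fst_nth(1) Fs Gs)+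
        have "(LINT x|lborel. fst (F n x) $ j * complex_of_real (\<phi> x)) - (LINT x|lborel. fst (G x) $ j * complex_of_real (\<phi> x))
          = (LINT x|lborel. H x * complex_of_real (\<phi> x))"
          using iF by (simp add: H_def left_diff_distrib)
        also have "norm \<dots> \<le> (LINT x|lborel. c * norm (indicat_real K x *\<^sub>R H (x + 0)))"
        proof (rule Bochner_Integration.integral_norm_bound_integral[OF iH])
          show "integrable lborel (\<lambda>x. c * norm (indicat_real K x *\<^sub>R H (x + 0)))"
            by (intro integrable_mult_right integrable_norm integral_Cauchy_Schwarz_indicator(1)[OF H(1) K])
          fix x
          have "norm (H x) * \<bar>\<phi> x\<bar> \<le> norm (H x) * (c * indicat_real K x)" by (intro mult_left_mono c) auto
          then show "norm (H x * complex_of_real (\<phi> x)) \<le> c * norm (indicat_real K x *\<^sub>R H (x + 0))"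
            by (simp add: norm_mult mult_ac)
        qed
        also have "\<dots> \<le> c * (sqrt (measure lborel K) * norm (cls H))"
          using integral_Cauchy_Schwarz_indicator(2)[OF H(1) K, of 0] c by (simp add: mult_left_mono)
        also have "\<dots> \<le> c * (sqrt (measure lborel K) * norm (X (r n) - Y))"
          using H(2) c by (intro mult_left_mono) auto
        finally show ?thesis .
      qed
      then have ev: "\<forall>\<^sub>F n in sequentially. norm ((LINT x|lborel. fst (F n x) $ j * complex_of_real (\<phi> x)) - (LINT x|lborel. fst (G x) $ j * complex_of_real (\<phi> x)))
         \<le> c * (sqrt (measure lborel K) * norm (X (r n) - Y))" by simp
      have lim0: "(\<lambda>n. c * (sqrt (measure lborel K) * norm (X (r n) - Y))) \<longlonglongrightarrow> 0"
        by (intro tendsto_mult_right_zero tendsto_norm_zero LIM_zero Ylim)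
      show ?thesis by (rule LIM_zero_cancel[OF Lim_null_comparison[OF ev lim0]])
    qed
    have "(LINT x|lborel. (f 0 x + S x) * complex_of_real (p x)) = (LINT x|lborel. f 0 x * complex_of_real (p x)) + (LINT x|lborel. S x * complex_of_real (p x))"
      using if0 iS by (simp add: distrib_right)
    also have "\<dots> = - (LINT x|lborel. fst (G x) $ j * complex_of_real (\<phi> x))"
      using LIMSEQ_unique[OF l1[unfolded e1] tendsto_minus[OF l2]] .
    finally show "(LINT x|lborel. (f 0 x + S x) * complex_of_real (pd \<phi> (axis j 1) x)) = - (LINT x|lborel. fst (G x) $ j * complex_of_real (\<phi> x))"
      by (simp add: p_def)
  qed
  then show "Y \<in> gradient_states" using gradient_states_cls[OF Gs] GY by auto
qed

subsection \<open>Elementary states\<close>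

text \<open>Besides test functions, \<open>\<phi>\<close> is also allowed to be a derivative
  \<open>pd\<close> of one, which is continuous with compact support.\<close>

definition tens :: "('a::euclidean_space \<Rightarrow> real) \<Rightarrow> 'b::euclidean_space \<Rightarrow> ('a, 'b) lsq" where
  "tens \<phi> e = cls (\<lambda>x. \<phi> x *\<^sub>R e)"

lemma sqint_bounded_support:
  fixes \<phi> :: "'a::euclidean_space \<Rightarrow> real" and e :: "'b::euclidean_space"
  assumes [measurable]: "\<phi> \<in> borel_measurable borel" and K: "compact K" and C: "\<And>x. \<bar>\<phi> x\<bar> \<le> C * indicat_real K x"
  shows "sqint (\<lambda>x. \<phi> x *\<^sub>R e)"
proof (rule sqintI[where g = "\<lambda>x. (C * norm e)\<^sup>2 * indicat_real K x"])
  show "integrable lborel (\<lambda>x. (C * norm e)\<^sup>2 * indicat_real K x)"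
    using emeasure_compact_finite[OF K] K by (intro integrable_mult_right integrable_real_indicator) (auto simp: borel_compact)
  show "(norm (\<phi> x *\<^sub>R e))\<^sup>2 \<le> (C * norm e)\<^sup>2 * indicat_real K x" for x
  proof (cases "x \<in> K")
    case True
    then have "\<bar>\<phi> x\<bar> * norm e \<le> C * norm e" using C[of x] by (intro mult_right_mono) auto
    then have "(\<bar>\<phi> x\<bar> * norm e)\<^sup>2 \<le> (C * norm e)\<^sup>2" by (intro power_mono) auto
    then show ?thesis using True by simp
  next
    case False
    then show ?thesis using C[of x] by simp
  qed
qed measurable

lemma sqint_test: "test_fun \<phi> \<Longrightarrow> sqint (\<lambda>x. \<phi> x *\<^sub>R e)"
  by (rule test_fun_bounds) (auto intro: sqint_bounded_support test_fun_measurable)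

lemma sqint_test_pd: "test_fun \<phi> \<Longrightarrow> sqint (\<lambda>x. pd \<phi> v x *\<^sub>R e)"
  by (rule test_fun_pd_bounds[where v = v]) (auto intro: sqint_bounded_support test_fun_pd_measurable)

lemma tens_translate: "test_fun \<phi> \<Longrightarrow> tr a (tens \<phi> e) = tens (\<lambda>x. \<phi> (x + a)) e"
  by (simp add: tens_def tr_cls sqint_test)

lemma tens_pd_translate: "test_fun \<phi> \<Longrightarrow> tr a (tens (pd \<phi> v) e) = tens (pd (\<lambda>x. \<phi> (x + a)) v) e"
  by (simp add: tens_def tr_cls sqint_test_pd test_fun_translate(2))

lemma lmap_tens: "bounded_linear L \<Longrightarrow> test_fun \<phi> \<Longrightarrow> lmap L (tens \<phi> e) = tens \<phi> (L e)"
  by (simp add: tens_def lmap_cls sqint_test linear_cmul bounded_linear.linear)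

lemma lmap_tens_pd: "bounded_linear L \<Longrightarrow> test_fun \<phi> \<Longrightarrow> lmap L (tens (pd \<phi> v) e) = tens (pd \<phi> v) (L e)"
  by (simp add: tens_def lmap_cls sqint_test_pd linear_cmul bounded_linear.linear)

lemma inner_tens: "sqint f \<Longrightarrow> test_fun \<phi> \<Longrightarrow> cls f \<bullet> tens \<phi> e = (LINT x|lborel. (f x \<bullet> e) * \<phi> x)"
  by (simp add: tens_def cls_inner sqint_test mult.commute)

lemma inner_tens_pd: "sqint f \<Longrightarrow> test_fun \<phi> \<Longrightarrow> cls f \<bullet> tens (pd \<phi> v) e = (LINT x|lborel. (f x \<bullet> e) * pd \<phi> v x)"
  by (simp add: tens_def cls_inner sqint_test_pd mult.commute)

lemma orthogonal_tens_eq_0: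
  fixes F :: "('a::euclidean_space, 'b::euclidean_space) lsq"
  assumes "\<And>\<phi> e. test_fun \<phi> \<Longrightarrow> F \<bullet> tens \<phi> e = 0"
  shows "F = 0"
proof (cases F)
  fix f assume f: "sqint f" "F = cls f"
  have "AE x in lborel. complex_of_real (f x \<bullet> e) = 0" for e :: 'b
  proof (rule fundamental_lemma)
    have "sqint (\<lambda>x. complex_of_real (f x \<bullet> e))"
      by (rule sqint_linear[OF f(1)]) (rule bounded_linear_compose[OF bounded_linear_of_real bounded_linear_inner_left])
    then show "locally_integrable (\<lambda>x. complex_of_real (f x \<bullet> e))" by (rule sqint_locally_integrable)
    fix \<phi> :: "'a \<Rightarrow> real" assume \<phi>: "test_fun \<phi>"
    have "(LINT x|lborel. complex_of_real (f x \<bullet> e) * complex_of_real (\<phi> x)) = complex_of_real (LINT x|lborel. (f x \<bullet> e) * \<phi> x)"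
      by (simp only: of_real_mult[symmetric] integral_complex_of_real)
    then show "(LINT x|lborel. complex_of_real (f x \<bullet> e) * complex_of_real (\<phi> x)) = 0"
      using assms[OF \<phi>, of e] f \<phi> by (simp add: inner_tens)
  qed
  then have "AE x in lborel. \<forall>e\<in>Basis. complex_of_real (f x \<bullet> e) = 0" by (intro AE_finite_allI) auto
  then have "AE x in lborel. f x = 0" by eventually_elim (simp add: euclidean_all_zero_iff)
  then show ?thesis using f by (simp add: cls_zero[symmetric] cls_eq_iff)
qed

text \<open>By the fundamental lemma only 0 is orthogonal to all elementary states, so their span is
  dense. Identities and convergence statements that survive sums and limits are henceforth checked
  on elementary states.\<close>

lemma closed_subspace_tens_UNIV:
  fixes S :: "('a::euclidean_space, 'b::euclidean_space) lsq set"
  assumes "subspace S" "closed S" "\<And>\<phi> e. test_fun \<phi> \<Longrightarrow> tens \<phi> e \<in> S"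
  shows "S = UNIV"
  using assms by (intro closed_subspace_eq_UNIV orthogonal_tens_eq_0) auto

text \<open>Supplies the dominating functions for limits of translates and of difference quotients:
  the support of the derivative is swept in both directions along h, so that one compact set serves
  all increments of modulus at most 1.\<close>

lemma test_fun_line_bound:
  fixes \<phi> :: "'a::euclidean_space \<Rightarrow> real"
  assumes \<phi>: "test_fun \<phi>"
  obtains K C where "compact K" "0 \<le> C" "\<And>\<eta> x. \<bar>\<eta>\<bar> \<le> 1 \<Longrightarrow> \<bar>\<phi> (x - \<eta> *\<^sub>R h) - \<phi> x\<bar> \<le> \<bar>\<eta>\<bar> * (C * indicat_real K x)"
    "\<And>x. \<bar>pd \<phi> h x\<bar> \<le> C * indicat_real K x"
proof -
  obtain K C where K: "compact K" and C: "0 \<le> C" "\<And>x. \<bar>pd \<phi> h x\<bar> \<le> C * indicat_real K x"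
    by (rule test_fun_pd_bounds[OF \<phi>, of h]) blast
  define K' where "K' = (\<lambda>(y, s). y + s *\<^sub>R h) ` (K \<times> {-1..1::real})"
  have "compact K'" unfolding K'_def
    by (intro compact_continuous_image compact_Times K) (auto intro!: continuous_intros simp: case_prod_unfold)
  moreover have pdK: "\<bar>pd \<phi> h (x - s *\<^sub>R h)\<bar> \<le> C * indicat_real K' x" if "\<bar>s\<bar> \<le> 1" for s x
  proof (cases "x - s *\<^sub>R h \<in> K")
    case True
    then have "x \<in> K'" unfolding K'_def using that by (intro image_eqI[of _ _ "(x - s *\<^sub>R h, s)"]) auto
    then show ?thesis using C(2)[of "x - s *\<^sub>R h"] True by simp
  next
    case False
    then show ?thesis using C(2)[of "x - s *\<^sub>R h"] C(1) by simp
  qed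
  moreover have "\<bar>\<phi> (x - \<eta> *\<^sub>R h) - \<phi> x\<bar> \<le> \<bar>\<eta>\<bar> * (C * indicat_real K' x)" if \<eta>: "\<bar>\<eta>\<bar> \<le> 1" for \<eta> x
  proof -
    have p: "pd \<phi> (\<eta> *\<^sub>R h) y = \<eta> * pd \<phi> h y" for y
      using linear_cmul[OF linear_pd[OF test_fun_C1[OF \<phi>]], of \<eta> h y] by simp
    have "norm (LINT s:{0..1}|lborel. - pd \<phi> (\<eta> *\<^sub>R h) (x - s *\<^sub>R (\<eta> *\<^sub>R h)))
      \<le> (LINT s|lborel. indicat_real {0..1::real} s * (\<bar>\<eta>\<bar> * (C * indicat_real K' x)))"
      unfolding set_lebesgue_integral_def
    proof (rule Bochner_Integration.integral_norm_bound_integral)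
      have "continuous_on {0..1::real} (\<lambda>s. - pd \<phi> (\<eta> *\<^sub>R h) (x - s *\<^sub>R (\<eta> *\<^sub>R h)))"
        by (intro continuous_intros continuous_on_compose2[OF C1_continuous_pd[OF test_fun_C1[OF \<phi>]]]) auto
      then show "integrable lborel (\<lambda>s. indicat_real {0..1::real} s *\<^sub>R - pd \<phi> (\<eta> *\<^sub>R h) (x - s *\<^sub>R (\<eta> *\<^sub>R h)))"
        by (rule borel_integrable_compact[OF compact_Icc])
      show "norm (indicat_real {0..1::real} s *\<^sub>R - pd \<phi> (\<eta> *\<^sub>R h) (x - s *\<^sub>R (\<eta> *\<^sub>R h))) \<le> indicat_real {0..1::real} s * (\<bar>\<eta>\<bar> * (C * indicat_real K' x))" for s
      proof (cases "s \<in> {0..1}")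
        case True
        then have "\<bar>s * \<eta>\<bar> \<le> 1" using \<eta> by (simp add: abs_mult mult_le_one)
        from mult_left_mono[OF pdK[OF this, of x], of "\<bar>\<eta>\<bar>"] show ?thesis using True by (simp add: p abs_mult)
      qed simp
    qed simp
    then show ?thesis by (simp add: test_fun_difference[OF \<phi>, of x "\<eta> *\<^sub>R h"])
  qed
  ultimately show ?thesis using that[of K' C] C(1) pdK[of 0] by simp
qed

lemma tens_shift_tendsto:
  assumes \<phi>: "test_fun \<phi>" and \<eta>: "\<eta> \<longlonglongrightarrow> 0" "\<And>m. \<bar>\<eta> m\<bar> \<le> 1"
  shows "(\<lambda>m. tens (\<lambda>x. \<phi> (x - \<eta> m *\<^sub>R h)) e) \<longlonglongrightarrow> tens \<phi> e"
proof -
  obtain K C where K: "compact K" "0 \<le> C" and b: "\<And>\<eta> x. \<bar>\<eta>\<bar> \<le> 1 \<Longrightarrow> \<bar>\<phi> (x - \<eta> *\<^sub>R h) - \<phi> x\<bar> \<le> \<bar>\<eta>\<bar> * (C * indicat_real K x)"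
    by (rule test_fun_line_bound[OF \<phi>, of h]) blast
  have t: "test_fun (\<lambda>x. \<phi> (x - \<eta> m *\<^sub>R h))" for m
    using test_fun_translate(1)[OF \<phi>, of "- (\<eta> m *\<^sub>R h)"] by simp
  show ?thesis unfolding tens_def
  proof (rule cls_tendsto_dominated[where w = "\<lambda>x. (C * norm e)\<^sup>2 * indicat_real K x"])
    show "integrable lborel (\<lambda>x. (C * norm e)\<^sup>2 * indicat_real K x)"
      using emeasure_compact_finite[OF K(1)] K by (intro integrable_mult_right integrable_real_indicator) (auto simp: borel_compact)
    fix x
    show "(\<lambda>m. \<phi> (x - \<eta> m *\<^sub>R h) *\<^sub>R e) \<longlonglongrightarrow> \<phi> x *\<^sub>R e"
    proof (intro tendsto_scaleR tendsto_const)
      have "(\<lambda>m. x - \<eta> m *\<^sub>R h) \<longlonglongrightarrow> x - 0 *\<^sub>R h" by (intro tendsto_intros \<eta>)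
      then have "(\<lambda>m. x - \<eta> m *\<^sub>R h) \<longlonglongrightarrow> x" by simp
      then show "(\<lambda>m. \<phi> (x - \<eta> m *\<^sub>R h)) \<longlonglongrightarrow> \<phi> x"
        by (intro continuous_on_tendsto_compose[OF C1_continuous[OF test_fun_C1[OF \<phi>]]]) auto
    qed
    fix m
    have "\<bar>\<phi> (x - \<eta> m *\<^sub>R h) - \<phi> x\<bar> \<le> 1 * (C * indicat_real K x)"
      by (rule order_trans[OF b[OF \<eta>(2)] mult_right_mono[OF \<eta>(2)]]) (use K in auto)
    then have "\<bar>\<phi> (x - \<eta> m *\<^sub>R h) - \<phi> x\<bar> * norm e \<le> C * indicat_real K x * norm e" by (intro mult_right_mono) auto
    then have "(norm (\<phi> (x - \<eta> m *\<^sub>R h) *\<^sub>R e - \<phi> x *\<^sub>R e))\<^sup>2 \<le> (C * indicat_real K x * norm e)\<^sup>2"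
      by (intro power_mono) (auto simp: scaleR_diff_left[symmetric])
    also have "\<dots> = (C * norm e)\<^sup>2 * indicat_real K x" by (auto simp: indicator_def)
    finally show "(norm (\<phi> (x - \<eta> m *\<^sub>R h) *\<^sub>R e - \<phi> x *\<^sub>R e))\<^sup>2 \<le> (C * norm e)\<^sup>2 * indicat_real K x" .
  qed (intro sqint_test t \<phi>)+
qed

lemma tens_quotient_tendsto:
  fixes \<phi> :: "'a::euclidean_space \<Rightarrow> real" and e :: "'b::euclidean_space"
  assumes \<phi>: "test_fun \<phi>" and \<eta>: "\<eta> \<longlonglongrightarrow> 0" "\<And>m. \<bar>\<eta> m\<bar> \<le> 1" "\<And>m. \<eta> m \<noteq> 0"
  shows "(\<lambda>m. (1 / \<eta> m) *\<^sub>R (tens (\<lambda>x. \<phi> (x + \<eta> m *\<^sub>R h)) e - tens \<phi> e)) \<longlonglongrightarrow> tens (pd \<phi> h) e"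
proof -
  obtain K C where K: "compact K" "0 \<le> C" and b: "\<And>\<eta> x. \<bar>\<eta>\<bar> \<le> 1 \<Longrightarrow> \<bar>\<phi> (x - \<eta> *\<^sub>R h) - \<phi> x\<bar> \<le> \<bar>\<eta>\<bar> * (C * indicat_real K x)"
    and bp: "\<And>x. \<bar>pd \<phi> h x\<bar> \<le> C * indicat_real K x"
    by (rule test_fun_line_bound[OF \<phi>, of h]) blast
  have t: "test_fun (\<lambda>x. \<phi> (x + \<eta> m *\<^sub>R h))" for m
    by (rule test_fun_translate(1)[OF \<phi>])
  define q where "q m x = (\<phi> (x + \<eta> m *\<^sub>R h) - \<phi> x) / \<eta> m" for m x
  have qe: "(1 / \<eta> m) *\<^sub>R (tens (\<lambda>x. \<phi> (x + \<eta> m *\<^sub>R h)) e - tens \<phi> e) = cls (\<lambda>x. q m x *\<^sub>R e)" for m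
  proof -
    have "cls (\<lambda>x. q m x *\<^sub>R e) = cls (\<lambda>x. (1 / \<eta> m) *\<^sub>R (\<phi> (x + \<eta> m *\<^sub>R h) *\<^sub>R e - \<phi> x *\<^sub>R e))"
      by (intro arg_cong[where f = cls] ext) (simp add: q_def scaleR_diff_left[symmetric])
    also have "\<dots> = (1 / \<eta> m) *\<^sub>R (tens (\<lambda>x. \<phi> (x + \<eta> m *\<^sub>R h)) e - tens \<phi> e)"
      by (simp add: cls_scaleR cls_diff sqint_diff sqint_test t \<phi> tens_def)
    finally show ?thesis by simp
  qed
  have sq: "sqint (\<lambda>x. q m x *\<^sub>R e)" for m
  proof -
    have "(\<lambda>x. q m x *\<^sub>R e) = (\<lambda>x. (1 / \<eta> m) *\<^sub>R (\<phi> (x + \<eta> m *\<^sub>R h) *\<^sub>R e - \<phi> x *\<^sub>R e))"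
      by (simp add: fun_eq_iff q_def scaleR_diff_left[symmetric])
    then show ?thesis by (simp add: sqint_scaleR sqint_diff sqint_test t \<phi>)
  qed
  have qb: "\<bar>q m x\<bar> \<le> C * indicat_real K x" for m x
  proof -
    have "\<bar>\<phi> (x + \<eta> m *\<^sub>R h) - \<phi> x\<bar> \<le> \<bar>\<eta> m\<bar> * (C * indicat_real K x)"
      using b[of "- \<eta> m" x] \<eta>(2)[of m] by simp
    then show ?thesis using \<eta>(3)[of m] by (simp add: q_def abs_divide divide_le_eq mult.commute)
  qed
  have ql: "(\<lambda>m. q m x) \<longlonglongrightarrow> pd \<phi> h x" for x
  proof -
    have "((\<lambda>r. x + r *\<^sub>R h) has_derivative (\<lambda>r. r *\<^sub>R h)) (at 0)" by (auto intro!: derivative_eq_intros)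
    moreover have "(\<phi> has_derivative (\<lambda>v. pd \<phi> v x)) (at (x + 0 *\<^sub>R h))"
      using has_derivative_pd[OF test_fun_C1[OF \<phi>], of x] by simp
    ultimately have "((\<lambda>r. \<phi> (x + r *\<^sub>R h)) has_derivative (\<lambda>r. pd \<phi> (r *\<^sub>R h) x)) (at 0)"
      by (rule has_derivative_compose)
    moreover have "(\<lambda>r. pd \<phi> (r *\<^sub>R h) x) = (*) (pd \<phi> h x)"
      using linear_cmul[OF linear_pd[OF test_fun_C1[OF \<phi>]]] by (auto simp: fun_eq_iff)
    ultimately have "((\<lambda>r. \<phi> (x + r *\<^sub>R h)) has_real_derivative pd \<phi> h x) (at 0)" by (simp add: has_field_derivative_def)
    then have "((\<lambda>r. (\<phi> (x + r *\<^sub>R h) - \<phi> x) / r) \<longlongrightarrow> pd \<phi> h x) (at 0)" by (simp add: DERIV_def)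
    moreover have "filterlim \<eta> (at 0) sequentially" using \<eta> by (auto simp: filterlim_at)
    ultimately show ?thesis unfolding q_def by (rule filterlim_compose)
  qed
  have "(\<lambda>m. cls (\<lambda>x. q m x *\<^sub>R e)) \<longlonglongrightarrow> cls (\<lambda>x. pd \<phi> h x *\<^sub>R e)"
  proof (rule cls_tendsto_dominated[where w = "\<lambda>x. (2 * C * norm e)\<^sup>2 * indicat_real K x"])
    show "integrable lborel (\<lambda>x. (2 * C * norm e)\<^sup>2 * indicat_real K x)"
      using emeasure_compact_finite[OF K(1)] K by (intro integrable_mult_right integrable_real_indicator) (auto simp: borel_compact)
    fix x
    show "(\<lambda>m. q m x *\<^sub>R e) \<longlonglongrightarrow> pd \<phi> h x *\<^sub>R e" by (intro tendsto_intros ql)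
    fix m
    have "\<bar>q m x - pd \<phi> h x\<bar> \<le> 2 * C * indicat_real K x" using qb[of m x] bp[of x] by linarith
    then have "\<bar>q m x - pd \<phi> h x\<bar> * norm e \<le> 2 * C * indicat_real K x * norm e" by (intro mult_right_mono) auto
    then have "(norm (q m x *\<^sub>R e - pd \<phi> h x *\<^sub>R e))\<^sup>2 \<le> (2 * C * indicat_real K x * norm e)\<^sup>2"
      by (intro power_mono) (auto simp: scaleR_diff_left[symmetric])
    also have "\<dots> = (2 * C * norm e)\<^sup>2 * indicat_real K x" by (auto simp: indicator_def)
    finally show "(norm (q m x *\<^sub>R e - pd \<phi> h x *\<^sub>R e))\<^sup>2 \<le> (2 * C * norm e)\<^sup>2 * indicat_real K x" .
  qed (intro sq sqint_test_pd \<phi>)+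
  then show ?thesis unfolding qe by (simp only: tens_def)
qed

subsection \<open>The free wave group\<close>

text \<open>The first order form of the wave equation is
  \<open>\<partial>\<^sub>t (g, z) = \<Sum>j. S j (\<partial>\<^sub>j (g, z))\<close>, where \<open>S j\<close> is the map \<open>coupling j\<close>.\<close>

definition coupling :: "'n \<Rightarrow> (complex^'n) \<times> complex \<Rightarrow> (complex^'n) \<times> complex" where
  "coupling j z = (axis j (snd z), fst z $ j)"

lemma linear_coupling: "linear (coupling j)"
  by (rule linearI) (auto simp: coupling_def axis_def vec_eq_iff)

lemma bounded_linear_coupling: "bounded_linear (coupling j)"
  using linear_coupling by (simp add: linear_conv_bounded_linear)

lemma coupling_symmetric: "coupling j z \<bullet> w = z \<bullet> coupling j w"
  by (simp add: coupling_def inner_Pair_0 inner_prod_def inner_axis inner_axis')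

definition step :: "nat \<Rightarrow> real" where "step m = inverse (real (Suc m))"

lemma step: "step m > 0" "step m \<le> 1" "step \<longlonglongrightarrow> 0"
  using LIMSEQ_inverse_real_of_nat by (auto simp: step_def[abs_def] field_simps)

text \<open>The central difference quotient is bounded and, unlike the one-sided quotients,
  skew-adjoint.\<close>

definition cdiff :: "nat \<Rightarrow> 'n::finite \<Rightarrow> 'n state \<Rightarrow> 'n state" where
  "cdiff m j F = (1 / (2 * step m)) *\<^sub>R (tr (step m *\<^sub>R axis j 1) F - tr (- (step m *\<^sub>R axis j 1)) F)"

definition wave_op :: "nat \<Rightarrow> ('n::finite) state \<Rightarrow> 'n state" where
  "wave_op m F = (\<Sum>j\<in>UNIV. lmap (coupling j) (cdiff m j F))"

lemma bounded_linear_cdiff: "bounded_linear (cdiff m j)"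
  unfolding cdiff_def[abs_def] by (intro bounded_linear_intros bounded_linear_tr bounded_linear_sub
    bounded_linear_compose[OF bounded_linear_scaleR_right])

lemma cdiff_skew: "cdiff m j F \<bullet> G = - (F \<bullet> cdiff m j G)"
  by (simp add: cdiff_def inner_diff_left inner_diff_right tr_adjoint algebra_simps)

lemma lmap_cdiff: "bounded_linear L \<Longrightarrow> lmap L (cdiff m j F) = cdiff m j (lmap L F)"
  by (simp add: cdiff_def lmap_tr[symmetric] lmap_scaleR linear_diff[OF bounded_linear.linear[OF bounded_linear_lmap]])

lemma tr_cdiff: "tr a (cdiff m j F) = cdiff m j (tr a F)"
  by (simp add: cdiff_def tr_scaleR linear_diff[OF bounded_linear.linear[OF bounded_linear_tr]] tr_tr add.commute)

lemma bounded_linear_wave_op: "bounded_linear (wave_op m)"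
  unfolding wave_op_def[abs_def]
  by (intro bounded_linear_sum bounded_linear_compose[OF bounded_linear_lmap[OF bounded_linear_coupling]] bounded_linear_cdiff)

text \<open>Each summand is the product of a symmetric matrix acting pointwise and a skew difference
  operator. The two commute because the matrix is constant in x.\<close>

lemma skew_wave_op: "skew (wave_op m :: ('n::finite) state \<Rightarrow> 'n state)"
  unfolding skew_def
proof (intro conjI allI)
  fix F G :: "'n state"
  have "lmap (coupling j) (cdiff m j F) \<bullet> G = - (F \<bullet> lmap (coupling j) (cdiff m j G))" for j
    by (subst lmap_adjoint[OF bounded_linear_coupling bounded_linear_coupling coupling_symmetric])
       (simp add: cdiff_skew lmap_cdiff bounded_linear_coupling)
  then show "wave_op m F \<bullet> G = - (F \<bullet> wave_op m G)"
    by (simp add: wave_op_def inner_sum_left inner_sum_right sum_negf)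
qed (rule bounded_linear_wave_op)

lemma tr_wave_op: "tr a (wave_op m F) = wave_op m (tr a F)"
  by (simp add: wave_op_def linear_sum[OF bounded_linear.linear[OF bounded_linear_tr]] lmap_tr[symmetric] bounded_linear_coupling tr_cdiff)

definition wave_approx :: "nat \<Rightarrow> real \<Rightarrow> ('n::finite) state \<Rightarrow> 'n state" where
  "wave_approx m = opexp (wave_op m)"

lemmas wave_approx_linear = opexp_add[OF bounded_linear_wave_op, folded wave_approx_def]
  opexp_scaleR[OF bounded_linear_wave_op, folded wave_approx_def]

lemmas wave_approx_adjoint = opexp_adjoint[OF skew_wave_op, folded wave_approx_def]

lemmas norm_wave_approx = norm_opexp[OF skew_wave_op, folded wave_approx_def]

lemmas wave_approx_commute = opexp_commute[OF bounded_linear_wave_op, folded wave_approx_def]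

lemmas wave_approx_deriv = opexp_deriv_within[OF bounded_linear_wave_op, folded wave_approx_def]

lemmas wave_approx_0 = opexp_0[OF bounded_linear_wave_op, folded wave_approx_def]

lemma wave_approx_diff: "wave_approx m t (F - G) = wave_approx m t F - wave_approx m t G"
  using wave_approx_linear(1)[of m t F "(-1) *\<^sub>R G"] wave_approx_linear(2)[of m t "-1" G] by simp

lemma wave_approx_wave_op: "wave_op m (wave_approx m t F) = wave_approx m t (wave_op m F)"
  by (rule wave_approx_commute[OF bounded_linear_wave_op]) simp

lemma wave_approx_tr: "tr a (wave_approx m t F) = wave_approx m t (tr a F)"
  by (rule wave_approx_commute[OF bounded_linear_tr]) (rule tr_wave_op)

lemma wave_approx_cdiff: "cdiff k j (wave_approx m t F) = wave_approx m t (cdiff k j F)"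
  by (simp add: cdiff_def wave_approx_tr wave_approx_diff wave_approx_linear)

text \<open>The maps \<open>coupling j\<close> do not commute, so neither do the operators \<open>wave_op m\<close>; but the scalar
  operators \<open>cdiff m j - cdiff k j\<close> commute with the approximate groups, and that is enough.\<close>

lemma wave_approx_compare:
  "norm (wave_approx m t F - wave_approx k t F)
    \<le> \<bar>t\<bar> * (\<Sum>j\<in>UNIV. onorm (coupling j) * norm (cdiff m j F - cdiff k j F))"
  unfolding wave_approx_def
proof (rule opexp_diff_bound[OF skew_wave_op skew_wave_op], fold wave_approx_def)
  fix s
  have "wave_op m (wave_approx m s F) - wave_op k (wave_approx m s F)
    = (\<Sum>j\<in>UNIV. lmap (coupling j) (wave_approx m s (cdiff m j F - cdiff k j F)))"
    by (simp add: wave_op_def sum_subtractf[symmetric] wave_approx_cdiff wave_approx_diff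
        linear_diff[OF bounded_linear.linear[OF bounded_linear_lmap[OF bounded_linear_coupling]]])
  also have "norm \<dots> \<le> (\<Sum>j\<in>UNIV. norm (lmap (coupling j) (wave_approx m s (cdiff m j F - cdiff k j F))))"
    by (rule norm_sum)
  also have "\<dots> \<le> (\<Sum>j\<in>UNIV. onorm (coupling j) * norm (cdiff m j F - cdiff k j F))"
    by (intro sum_mono order_trans[OF norm_lmap[OF bounded_linear_coupling]]) (simp add: norm_wave_approx)
  finally show "norm (wave_op m (wave_approx m s F) - wave_op k (wave_approx m s F))
    \<le> (\<Sum>j\<in>UNIV. onorm (coupling j) * norm (cdiff m j F - cdiff k j F))" .
qed

lemma cdiff_tens_tendsto:
  assumes \<phi>: "test_fun \<phi>"
  shows "(\<lambda>m. cdiff m j (tens \<phi> e)) \<longlonglongrightarrow> tens (pd \<phi> (axis j 1)) e"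
proof -
  define h where "h = (axis j 1 :: real^'a)"
  define T where "T = tens \<phi> e"
  define P where "P m = (1 / step m) *\<^sub>R (tens (\<lambda>x. \<phi> (x + step m *\<^sub>R h)) e - tens \<phi> e)" for m
  define Q where "Q m = (1 / - step m) *\<^sub>R (tens (\<lambda>x. \<phi> (x + - step m *\<^sub>R h)) e - tens \<phi> e)" for m
  have P: "P \<longlonglongrightarrow> tens (pd \<phi> h) e"
    unfolding P_def by (rule tens_quotient_tendsto[OF \<phi> step(3)]) (use step in \<open>auto simp: abs_of_pos less_imp_neq[THEN not_sym]\<close>)
  have "(\<lambda>m. - step m) \<longlonglongrightarrow> 0" using tendsto_minus[OF step(3)] by simp
  then have Q: "Q \<longlonglongrightarrow> tens (pd \<phi> h) e"
    unfolding Q_def by (rule tens_quotient_tendsto[OF \<phi>]) (use step in \<open>auto simp: abs_of_pos less_imp_neq[THEN not_sym]\<close>)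
  \<comment> \<open>The central quotient is the mean of the forward and the backward quotient, so
    \<open>tens_quotient_tendsto\<close> applies with both signs of the increment.\<close>
  have cd: "(1 / (2 * s)) *\<^sub>R (a - b) = (1/2) *\<^sub>R ((1 / s) *\<^sub>R (a - c) + (1 / - s) *\<^sub>R (b - c))" for s and a b c :: "'a state"
  proof -
    have "(1/2) *\<^sub>R ((1 / s) *\<^sub>R (a - c) + (1 / - s) *\<^sub>R (b - c)) = (1 / (2 * s)) *\<^sub>R (a - c) - (1 / (2 * s)) *\<^sub>R (b - c)"
      by (simp add: scaleR_add_right scaleR_diff_right)
    also have "\<dots> = (1 / (2 * s)) *\<^sub>R (a - b)"
      unfolding scaleR_diff_right[symmetric] by simp
    finally show ?thesis by simp
  qed
  have "cdiff m j (tens \<phi> e) = (1/2) *\<^sub>R (P m + Q m)" for m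
    unfolding P_def Q_def cdiff_def tens_translate[OF \<phi>] h_def[symmetric] cd[where c = "tens \<phi> e"] by simp
  moreover have "(\<lambda>m. (1/2) *\<^sub>R (P m + Q m)) \<longlonglongrightarrow> (1/2) *\<^sub>R (tens (pd \<phi> h) e + tens (pd \<phi> h) e)"
    by (intro tendsto_intros P Q)
  moreover have "(1/2) *\<^sub>R (tens (pd \<phi> h) e + tens (pd \<phi> h) e) = tens (pd \<phi> h) e"
    by (simp add: scaleR_half_double)
  ultimately show ?thesis by (simp add: h_def)
qed

text \<open>The unbounded generator of the free equation, evaluated on the elementary state
  \<open>tens \<phi> e\<close>. It is never introduced as an operator on a larger domain.\<close>

definition wave_gen :: "(real^'n \<Rightarrow> real) \<Rightarrow> (complex^'n) \<times> complex \<Rightarrow> ('n::finite) state" where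
  "wave_gen \<phi> e = (\<Sum>j\<in>UNIV. tens (pd \<phi> (axis j 1)) (coupling j e))"

lemma wave_op_tens_tendsto:
  assumes \<phi>: "test_fun \<phi>"
  shows "(\<lambda>m. wave_op m (tens \<phi> e)) \<longlonglongrightarrow> wave_gen \<phi> e"
proof -
  have "(\<lambda>m. lmap (coupling j) (cdiff m j (tens \<phi> e))) \<longlonglongrightarrow> lmap (coupling j) (tens (pd \<phi> (axis j 1)) e)" for j
    by (rule bounded_linear.tendsto[OF bounded_linear_lmap[OF bounded_linear_coupling] cdiff_tens_tendsto[OF \<phi>]])
  then show ?thesis unfolding wave_op_def wave_gen_def
    by (intro tendsto_sum) (simp add: lmap_tens_pd bounded_linear_coupling \<phi>)
qed

text \<open>As the approximate groups are isometric, the states for which they converge form a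
  closed subspace. On elementary states the difference quotients converge, and
  \<open>wave_approx_compare\<close> turns this into the Cauchy property.\<close>

lemma wave_approx_convergent: "convergent (\<lambda>m. wave_approx m t F)"
proof -
  define S where "S = {F :: 'a state. convergent (\<lambda>m. wave_approx m t F)}"
  have "S = UNIV"
  proof (rule closed_subspace_tens_UNIV)
    have "wave_approx m t (0 :: 'a state) = 0" for m using wave_approx_linear(2)[of m t 0 "0 :: 'a state"] by simp
    then show "subspace S" unfolding S_def subspace_def
      by (simp add: wave_approx_linear convergent_const convergent_add
          bounded_linear.convergent[OF bounded_linear_scaleR_right])
    show "closed S" unfolding closed_sequential_limits
    proof (intro allI impI, elim conjE)
      fix X and F :: "'a state" assume X: "\<forall>n. X n \<in> S" and lim: "X \<longlonglongrightarrow> F"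
      have "Cauchy (\<lambda>m. wave_approx m t F)"
      proof (rule metric_CauchyI)
        fix \<epsilon> :: real assume "\<epsilon> > 0"
        then have e3: "\<epsilon> / 3 > 0" by simp
        obtain n where n: "dist (X n) F < \<epsilon> / 3" using metric_LIMSEQ_D[OF lim e3] by blast
        have "Cauchy (\<lambda>m. wave_approx m t (X n))" using X by (simp add: S_def convergent_Cauchy)
        then obtain N where N: "\<And>m k. m \<ge> N \<Longrightarrow> k \<ge> N \<Longrightarrow> dist (wave_approx m t (X n)) (wave_approx k t (X n)) < \<epsilon> / 3"
          using metric_CauchyD[OF _ e3] by blast
        have d: "dist (wave_approx m t F) (wave_approx m t (X n)) < \<epsilon> / 3" for m
          using n by (simp add: dist_norm wave_approx_diff[symmetric] norm_wave_approx norm_minus_commute)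
        have "dist (wave_approx m t F) (wave_approx k t F) < \<epsilon>" if "m \<ge> N" "k \<ge> N" for m k
          using N[OF that] d[of m] d[of k]
            dist_triangle[of "wave_approx m t F" "wave_approx k t F" "wave_approx m t (X n)"]
            dist_triangle[of "wave_approx m t (X n)" "wave_approx k t F" "wave_approx k t (X n)"]
          by (simp add: dist_commute)
        then show "\<exists>M. \<forall>m\<ge>M. \<forall>k\<ge>M. dist (wave_approx m t F) (wave_approx k t F) < \<epsilon>" by blast
      qed
      then show "F \<in> S" by (simp add: S_def Cauchy_convergent)
    qed
    fix \<phi> :: "real^'a \<Rightarrow> real" and e :: "(complex^'a) \<times> complex" assume \<phi>: "test_fun \<phi>"
    define D where "D j = tens (pd \<phi> (axis j 1)) e" for j
    \<comment> \<open>Comparing both indices with the limiting derivative \<open>D j\<close> splits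
      the bound into a null sequence in m and one in k.\<close>
    define \<delta> where "\<delta> m = \<bar>t\<bar> * (\<Sum>j\<in>UNIV. onorm (coupling j :: (complex^'a) \<times> complex \<Rightarrow> _) * norm (cdiff m j (tens \<phi> e) - D j))" for m
    have "(\<lambda>m. \<delta> m) \<longlonglongrightarrow> \<bar>t\<bar> * (\<Sum>j\<in>UNIV. onorm (coupling j :: (complex^'a) \<times> complex \<Rightarrow> _) * norm (D j - D j))"
      unfolding \<delta>_def D_def by (intro tendsto_intros cdiff_tens_tendsto[OF \<phi>])
    then have \<delta>: "\<delta> \<longlonglongrightarrow> 0" by simp
    have b: "dist (wave_approx m t (tens \<phi> e)) (wave_approx k t (tens \<phi> e)) \<le> \<delta> m + \<delta> k" for m k
    proof -
      have "norm (cdiff m j (tens \<phi> e) - cdiff k j (tens \<phi> e)) \<le> norm (cdiff m j (tens \<phi> e) - D j) + norm (cdiff k j (tens \<phi> e) - D j)" for j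
        using norm_triangle_ineq4[of "cdiff m j (tens \<phi> e) - D j" "cdiff k j (tens \<phi> e) - D j"] by simp
      then have "(\<Sum>j\<in>UNIV. onorm (coupling j :: (complex^'a) \<times> complex \<Rightarrow> _) * norm (cdiff m j (tens \<phi> e) - cdiff k j (tens \<phi> e)))
         \<le> (\<Sum>j\<in>UNIV. onorm (coupling j :: (complex^'a) \<times> complex \<Rightarrow> _) * (norm (cdiff m j (tens \<phi> e) - D j) + norm (cdiff k j (tens \<phi> e) - D j)))"
        by (intro sum_mono mult_left_mono onorm_pos_le bounded_linear_coupling)
      then have "\<bar>t\<bar> * (\<Sum>j\<in>UNIV. onorm (coupling j :: (complex^'a) \<times> complex \<Rightarrow> _) * norm (cdiff m j (tens \<phi> e) - cdiff k j (tens \<phi> e))) \<le> \<delta> m + \<delta> k"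
        unfolding \<delta>_def distrib_left[symmetric] sum.distrib[symmetric] by (intro mult_left_mono) auto
      then show ?thesis unfolding dist_norm using wave_approx_compare[of m t "tens \<phi> e" k] by linarith
    qed
    have "Cauchy (\<lambda>m. wave_approx m t (tens \<phi> e))"
    proof (rule metric_CauchyI)
      fix \<epsilon> :: real assume "\<epsilon> > 0"
      then obtain N where N: "\<And>m. m \<ge> N \<Longrightarrow> norm (\<delta> m - 0) < \<epsilon> / 2" using LIMSEQ_D[OF \<delta>, of "\<epsilon>/2"] by auto
      have "dist (wave_approx m t (tens \<phi> e)) (wave_approx k t (tens \<phi> e)) < \<epsilon>" if "m \<ge> N" "k \<ge> N" for m k
        using b[of m k] N[OF that(1)] N[OF that(2)] by (simp add: abs_less_iff)
      then show "\<exists>M. \<forall>m\<ge>M. \<forall>k\<ge>M. dist (wave_approx m t (tens \<phi> e)) (wave_approx k t (tens \<phi> e)) < \<epsilon>" by blast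
    qed
    then show "tens \<phi> e \<in> S" by (simp add: S_def Cauchy_convergent)
  qed
  then show ?thesis by (auto simp: S_def)
qed

section \<open>The limit group\<close>

definition wave_group :: "real \<Rightarrow> ('n::finite) state \<Rightarrow> 'n state" where
  "wave_group t F = lim (\<lambda>m. wave_approx m t F)"

lemma wave_group_tendsto: "(\<lambda>m. wave_approx m t F) \<longlonglongrightarrow> wave_group t F"
  unfolding wave_group_def using wave_approx_convergent convergent_LIMSEQ_iff by blast

lemma wave_group_tendsto_seq:
  assumes "X \<longlonglongrightarrow> F" shows "(\<lambda>m. wave_approx m t (X m)) \<longlonglongrightarrow> wave_group t F"
proof -
  have "(\<lambda>m. wave_approx m t (X m - F)) \<longlonglongrightarrow> 0"
    by (rule tendsto_norm_zero_cancel) (simp add: norm_wave_approx tendsto_norm_zero LIM_zero assms)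
  from tendsto_add[OF this wave_group_tendsto[of t F]] show ?thesis by (simp add: wave_approx_diff)
qed

lemma wave_group_add: "wave_group t (F + G) = wave_group t F + wave_group t G"
  by (rule LIMSEQ_unique[OF wave_group_tendsto]) (simp add: wave_approx_linear tendsto_add wave_group_tendsto)

lemma wave_group_scaleR: "wave_group t (c *\<^sub>R F) = c *\<^sub>R wave_group t F"
  by (rule LIMSEQ_unique[OF wave_group_tendsto]) (simp add: wave_approx_linear tendsto_scaleR wave_group_tendsto)

lemma norm_wave_group [simp]: "norm (wave_group t F) = norm F"
  by (rule LIMSEQ_unique[OF tendsto_norm[OF wave_group_tendsto]]) (simp add: norm_wave_approx)

lemma bounded_linear_wave_group: "bounded_linear (wave_group t)"
  by (rule bounded_linear_intro[where K = 1]) (auto simp: wave_group_add wave_group_scaleR)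

lemma wave_group_adjoint: "wave_group t F \<bullet> G = F \<bullet> wave_group (- t) G"
proof (rule LIMSEQ_unique)
  show "(\<lambda>m. wave_approx m t F \<bullet> G) \<longlonglongrightarrow> wave_group t F \<bullet> G"
    by (intro tendsto_intros wave_group_tendsto)
  show "(\<lambda>m. wave_approx m t F \<bullet> G) \<longlonglongrightarrow> F \<bullet> wave_group (- t) G"
    unfolding wave_approx_adjoint by (intro tendsto_intros wave_group_tendsto)
qed

text \<open>An isometry preserves inner products by polarisation, so its adjoint is a left inverse;
  the adjoint is the operator at time \<open>- t\<close>.\<close>

lemma wave_group_inverse: "wave_group (- t) (wave_group t F) = F"
proof -
  have "(wave_group (- t) (wave_group t F) - F) \<bullet> G = 0" for G
  proof -
    have pol: "4 * (x \<bullet> y) = (norm (x + y))\<^sup>2 - (norm (x - y))\<^sup>2" for x y :: "'a state"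
      by (simp add: power2_norm_eq_inner inner_simps inner_commute)
    have "wave_group t F + wave_group t G = wave_group t (F + G)" "wave_group t F - wave_group t G = wave_group t (F - G)"
      by (simp_all add: wave_group_add linear_diff[OF bounded_linear.linear[OF bounded_linear_wave_group]])
    then have "wave_group t F \<bullet> wave_group t G = F \<bullet> G"
      using pol[of "wave_group t F" "wave_group t G"] pol[of F G] by simp
    then show ?thesis using wave_group_adjoint[of "- t" "wave_group t F" G] by (simp add: inner_diff_left)
  qed
  from this[of "wave_group (- t) (wave_group t F) - F"] show ?thesis by simp
qed

lemma wave_group_0: "wave_group 0 F = F"
  by (rule LIMSEQ_unique[OF wave_group_tendsto]) (simp add: wave_approx_0)

lemma wave_approx_lipschitz: "norm (wave_approx m t F - wave_approx m s F) \<le> norm (wave_op m F) * \<bar>t - s\<bar>"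
proof -
  have "norm (wave_approx m t F - wave_approx m s F) \<le> norm (wave_op m F) * norm (t - s)"
  proof (rule differentiable_bound[where S = UNIV])
    fix r :: real
    show "((\<lambda>t. wave_approx m t F) has_derivative (\<lambda>h. h *\<^sub>R wave_op m (wave_approx m r F))) (at r within UNIV)"
      using wave_approx_deriv by (simp only: has_vector_derivative_def)
    show "onorm (\<lambda>h. h *\<^sub>R wave_op m (wave_approx m r F)) \<le> norm (wave_op m F)"
      by (rule onorm_le) (simp add: wave_approx_wave_op norm_wave_approx mult.commute)
  qed auto
  then show ?thesis by simp
qed

text \<open>Isometry makes convergence of initial states uniform in t, so the states with continuous
  orbit form a closed subspace. For elementary states the approximate orbits share a Lipschitz
  constant, because \<open>wave_op m (tens \<phi> e)\<close> converges and hence is bounded.\<close>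

lemma continuous_wave_group: "continuous_on UNIV (\<lambda>t. wave_group t F)"
proof -
  define S where "S = {F :: 'a state. continuous_on UNIV (\<lambda>t. wave_group t F)}"
  have "S = UNIV"
  proof (rule closed_subspace_tens_UNIV)
    have "wave_group t (0 :: 'a state) = 0" for t using wave_group_scaleR[of t 0 "0 :: 'a state"] by simp
    then show "subspace S" unfolding S_def subspace_def
      by (auto simp: wave_group_add wave_group_scaleR intro!: continuous_intros)
    show "closed S" unfolding closed_sequential_limits
    proof (intro allI impI, elim conjE)
      fix X and F :: "'a state" assume X: "\<forall>n. X n \<in> S" and lim: "X \<longlonglongrightarrow> F"
      have "uniform_limit UNIV (\<lambda>n t. wave_group t (X n)) (\<lambda>t. wave_group t F) sequentially"
        unfolding uniform_limit_iff
      proof (intro allI impI)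
        fix \<epsilon> :: real assume "\<epsilon> > 0"
        from tendstoD[OF lim this] show "\<forall>\<^sub>F n in sequentially. \<forall>t\<in>UNIV. dist (wave_group t (X n)) (wave_group t F) < \<epsilon>"
          by eventually_elim (simp add: dist_norm linear_diff[OF bounded_linear.linear[OF bounded_linear_wave_group], symmetric])
      qed
      then have "continuous_on UNIV (\<lambda>t. wave_group t F)"
        by (rule uniform_limit_theorem[rotated]) (use X in \<open>auto simp: S_def\<close>)
      then show "F \<in> S" by (simp add: S_def)
    qed
    fix \<phi> :: "real^'a \<Rightarrow> real" and e :: "(complex^'a) \<times> complex" assume \<phi>: "test_fun \<phi>"
    have "Bseq (\<lambda>m. wave_op m (tens \<phi> e))"
      by (rule convergent_imp_Bseq[OF convergentI[OF wave_op_tens_tendsto[OF \<phi>]]])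
    then obtain C where C: "\<And>m. norm (wave_op m (tens \<phi> e)) \<le> C" unfolding Bseq_def by blast
    have lip: "norm (wave_group t (tens \<phi> e) - wave_group s (tens \<phi> e)) \<le> C * \<bar>t - s\<bar>" for s t
    proof (rule LIMSEQ_le_const2)
      show "(\<lambda>m. norm (wave_approx m t (tens \<phi> e) - wave_approx m s (tens \<phi> e))) \<longlonglongrightarrow> norm (wave_group t (tens \<phi> e) - wave_group s (tens \<phi> e))"
        by (intro tendsto_intros wave_group_tendsto)
      show "\<exists>N. \<forall>m\<ge>N. norm (wave_approx m t (tens \<phi> e) - wave_approx m s (tens \<phi> e)) \<le> C * \<bar>t - s\<bar>"
        by (intro exI allI impI order_trans[OF wave_approx_lipschitz] mult_right_mono C) auto
    qed
    have "0 \<le> C" using C norm_ge_zero order_trans by blast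
    then have "C-lipschitz_on UNIV (\<lambda>t. wave_group t (tens \<phi> e))"
      by (intro lipschitz_onI) (simp_all add: dist_norm lip)
    then show "tens \<phi> e \<in> S" by (simp add: S_def lipschitz_on_continuous_on)
  qed
  then show ?thesis by (auto simp: S_def)
qed

lemma set_integral_Icc_tendsto:
  fixes a :: "nat \<Rightarrow> real \<Rightarrow> real"
  assumes cont: "\<And>m. continuous_on {s..t} (a m)" and lim: "\<And>r. (\<lambda>m. a m r) \<longlonglongrightarrow> a' r"
    and bound: "\<And>m r. r \<in> {s..t} \<Longrightarrow> \<bar>a m r\<bar> \<le> C"
  shows "(\<lambda>m. LINT r:{s..t}|lborel. a m r) \<longlonglongrightarrow> (LINT r:{s..t}|lborel. a' r)"
  unfolding set_lebesgue_integral_def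
proof (rule integral_dominated_convergence[where w = "\<lambda>r. indicat_real {s..t} r *\<^sub>R C"])
  have i: "integrable lborel (\<lambda>r. indicat_real {s..t} r *\<^sub>R a m r)" for m
    by (rule borel_integrable_compact[OF compact_Icc cont])
  then show m: "(\<lambda>r. indicat_real {s..t} r *\<^sub>R a m r) \<in> borel_measurable lborel" for m by simp
  show "(\<lambda>r. indicat_real {s..t} r *\<^sub>R a' r) \<in> borel_measurable lborel"
  proof (rule borel_measurable_LIMSEQ_real)
    show "(\<lambda>m. indicat_real {s..t} r *\<^sub>R a m r) \<longlonglongrightarrow> indicat_real {s..t} r *\<^sub>R a' r" for r
      by (intro tendsto_intros lim)
  qed (rule m)
  show "AE r in lborel. (\<lambda>m. indicat_real {s..t} r *\<^sub>R a m r) \<longlonglongrightarrow> indicat_real {s..t} r *\<^sub>R a' r"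
    by (intro AE_I2 tendsto_intros lim)
  show "AE r in lborel. norm (indicat_real {s..t} r *\<^sub>R a m r) \<le> indicat_real {s..t} r *\<^sub>R C" for m
    using bound by (intro AE_I2) (auto simp: indicator_def)
  show "integrable lborel (\<lambda>r. indicat_real {s..t} r *\<^sub>R C)"
    by (rule borel_integrable_compact[OF compact_Icc]) auto
qed

lemma continuous_wave_approx: "continuous_on S (\<lambda>t. wave_approx m t F)"
  by (rule continuous_on_vector_derivative, rule wave_approx_deriv)

lemma wave_approx_FTC:
  assumes "s \<le> t"
  shows "(wave_approx m t F - wave_approx m s F) \<bullet> G = (LINT r:{s..t}|lborel. wave_approx m r (wave_op m F) \<bullet> G)"
proof -
  have "((\<lambda>r. wave_approx m r F \<bullet> G) has_vector_derivative wave_approx m r (wave_op m F) \<bullet> G) (at r within {s..t})" for r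
    using bounded_linear.has_vector_derivative[OF bounded_linear_inner_left wave_approx_deriv]
    by (simp add: wave_approx_wave_op)
  moreover have "continuous_on {s..t} (\<lambda>r. wave_approx m r (wave_op m F) \<bullet> G)"
    by (intro continuous_intros continuous_wave_approx)
  ultimately show ?thesis
    using integral_FTC_Icc[OF assms, of "\<lambda>r. wave_approx m r F \<bullet> G" "\<lambda>r. wave_approx m r (wave_op m F) \<bullet> G"]
    by (simp add: set_lebesgue_integral_def inner_diff_left)
qed

text \<open>Limit of the fundamental theorem for the approximate groups; an elementary state lies in
  the domain of the generator, which may therefore act before the group.\<close>

lemma wave_group_tens_FTC:
  assumes \<phi>: "test_fun \<phi>" and st: "s \<le> t"
  shows "(wave_group t (tens \<phi> e) - wave_group s (tens \<phi> e)) \<bullet> G = (LINT r:{s..t}|lborel. wave_group r (wave_gen \<phi> e) \<bullet> G)"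
proof (rule LIMSEQ_unique)
  show "(\<lambda>m. (wave_approx m t (tens \<phi> e) - wave_approx m s (tens \<phi> e)) \<bullet> G) \<longlonglongrightarrow> (wave_group t (tens \<phi> e) - wave_group s (tens \<phi> e)) \<bullet> G"
    by (intro tendsto_intros wave_group_tendsto)
  have "Bseq (\<lambda>m. wave_op m (tens \<phi> e))"
    by (rule convergent_imp_Bseq[OF convergentI[OF wave_op_tens_tendsto[OF \<phi>]]])
  then obtain C where C: "\<And>m. norm (wave_op m (tens \<phi> e)) \<le> C" unfolding Bseq_def by blast
  show "(\<lambda>m. (wave_approx m t (tens \<phi> e) - wave_approx m s (tens \<phi> e)) \<bullet> G) \<longlonglongrightarrow> (LINT r:{s..t}|lborel. wave_group r (wave_gen \<phi> e) \<bullet> G)"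
    unfolding wave_approx_FTC[OF st]
  proof (rule set_integral_Icc_tendsto)
    show "continuous_on {s..t} (\<lambda>r. wave_approx m r (wave_op m (tens \<phi> e)) \<bullet> G)" for m
      by (intro continuous_intros continuous_wave_approx)
    show "(\<lambda>m. wave_approx m r (wave_op m (tens \<phi> e)) \<bullet> G) \<longlonglongrightarrow> wave_group r (wave_gen \<phi> e) \<bullet> G" for r
      by (intro tendsto_intros wave_group_tendsto_seq wave_op_tens_tendsto \<phi>)
    show "\<bar>wave_approx m r (wave_op m (tens \<phi> e)) \<bullet> G\<bar> \<le> C * norm G" for m r
      by (rule order_trans[OF Cauchy_Schwarz_ineq2]) (simp add: norm_wave_approx mult_right_mono C)
  qed
qed

text \<open>A general F need not lie in the domain of the generator. Skewness of
  \<open>wave_op\<close> moves the generator to the elementary test state, at the cost of a minus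
  sign, before the limit is taken.\<close>

lemma wave_group_FTC_tens:
  assumes \<phi>: "test_fun \<phi>" and st: "s \<le> t"
  shows "(wave_group t F - wave_group s F) \<bullet> tens \<phi> e = - (LINT r:{s..t}|lborel. wave_group r F \<bullet> wave_gen \<phi> e)"
proof (rule LIMSEQ_unique)
  show "(\<lambda>m. (wave_approx m t F - wave_approx m s F) \<bullet> tens \<phi> e) \<longlonglongrightarrow> (wave_group t F - wave_group s F) \<bullet> tens \<phi> e"
    by (intro tendsto_intros wave_group_tendsto)
  have "Bseq (\<lambda>m. wave_op m (tens \<phi> e))"
    by (rule convergent_imp_Bseq[OF convergentI[OF wave_op_tens_tendsto[OF \<phi>]]])
  then obtain C where C: "\<And>m. norm (wave_op m (tens \<phi> e)) \<le> C" unfolding Bseq_def by blast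
  have sk: "wave_approx m r (wave_op m F) \<bullet> tens \<phi> e = - (wave_approx m r F \<bullet> wave_op m (tens \<phi> e))" for m r
    unfolding wave_approx_wave_op[symmetric] using skew_wave_op by (auto simp: skew_def)
  have "(\<lambda>m. LINT r:{s..t}|lborel. - (wave_approx m r F \<bullet> wave_op m (tens \<phi> e))) \<longlonglongrightarrow> (LINT r:{s..t}|lborel. - (wave_group r F \<bullet> wave_gen \<phi> e))"
  proof (rule set_integral_Icc_tendsto)
    show "continuous_on {s..t} (\<lambda>r. - (wave_approx m r F \<bullet> wave_op m (tens \<phi> e)))" for m
      by (intro continuous_intros continuous_wave_approx)
    show "(\<lambda>m. - (wave_approx m r F \<bullet> wave_op m (tens \<phi> e))) \<longlonglongrightarrow> - (wave_group r F \<bullet> wave_gen \<phi> e)" for r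
      by (intro tendsto_intros wave_group_tendsto wave_op_tens_tendsto \<phi>)
    show "\<bar>- (wave_approx m r F \<bullet> wave_op m (tens \<phi> e))\<bar> \<le> norm F * C" for m r
      using order_trans[OF Cauchy_Schwarz_ineq2 mult_left_mono[OF C norm_ge_zero], of "wave_approx m r F" m]
      by (simp add: norm_wave_approx)
  qed
  then show "(\<lambda>m. (wave_approx m t F - wave_approx m s F) \<bullet> tens \<phi> e) \<longlonglongrightarrow> - (LINT r:{s..t}|lborel. wave_group r F \<bullet> wave_gen \<phi> e)"
    unfolding wave_approx_FTC[OF st] sk by (simp add: set_lebesgue_integral_def)
qed

lemma tens_0 [simp]: "tens \<phi> 0 = 0"
  by (simp add: tens_def cls_zero)

lemma wave_gen_fst: "wave_gen \<phi> (axis j \<zeta>, 0) = tens (pd \<phi> (axis j 1)) (0, \<zeta>)"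
proof -
  have "tens (pd \<phi> (axis k 1)) (coupling k (axis j \<zeta>, 0)) = (if k = j then tens (pd \<phi> (axis j 1)) (0, \<zeta>) else 0)" for k
  proof -
    have "coupling k (axis j \<zeta>, 0) = (0, if k = j then \<zeta> else 0)"
      by (auto simp: coupling_def axis_def vec_eq_iff)
    then show ?thesis by (auto simp: zero_prod_def[symmetric])
  qed
  then show ?thesis by (simp add: wave_gen_def)
qed

text \<open>The second component of Y is the potential. The inner products being real,
  \<open>\<zeta> = 1\<close> and \<open>\<zeta> = \<i>\<close> yield the real and the imaginary part
  of the defining identity.\<close>

lemma gradient_statesI:
  fixes F Y :: "('n::finite) state"
  assumes *: "\<And>\<phi> j \<zeta>. test_fun \<phi> \<Longrightarrow> F \<bullet> tens \<phi> (axis j \<zeta>, 0) = - (Y \<bullet> tens (pd \<phi> (axis j 1)) (0, \<zeta>))"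
  shows "F \<in> gradient_states"
proof -
  define f where "f x = snd (rep Y x)" for x
  define g where "g x = fst (rep F x)" for x
  have fs: "sqint f" unfolding f_def[abs_def] by (rule sqint_linear[OF sqint_rep bounded_linear_snd])
  have gs: "sqint (\<lambda>x. g x $ j)" for j unfolding g_def by (rule sqint_fst_nth(1)[OF sqint_rep])
  have "weak_grad f g" unfolding weak_grad_def
  proof (intro conjI allI impI)
    show fl: "locally_integrable f" by (rule sqint_locally_integrable[OF fs])
    show gl: "locally_integrable (\<lambda>x. g x $ j)" for j by (rule sqint_locally_integrable[OF gs])
    fix \<phi> :: "real^'n \<Rightarrow> real" and j assume \<phi>: "test_fun \<phi>"
    have if': "integrable lborel (\<lambda>x. f x * complex_of_real (pd \<phi> (axis j 1) x))" by (rule integrable_test_pd[OF fl \<phi>])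
    have ig: "integrable lborel (\<lambda>x. g x $ j * complex_of_real (\<phi> x))" by (rule integrable_test[OF gl \<phi>])
    have key: "(LINT x|lborel. (g x $ j \<bullet> \<zeta>) * \<phi> x) = - (LINT x|lborel. (f x \<bullet> \<zeta>) * pd \<phi> (axis j 1) x)" for \<zeta>
    proof -
      have "F \<bullet> tens \<phi> (axis j \<zeta>, 0) = (LINT x|lborel. (g x $ j \<bullet> \<zeta>) * \<phi> x)"
        using inner_tens[OF sqint_rep \<phi>, of F "(axis j \<zeta>, 0)"] by (simp add: g_def inner_prod_def inner_axis)
      moreover have "Y \<bullet> tens (pd \<phi> (axis j 1)) (0, \<zeta>) = (LINT x|lborel. (f x \<bullet> \<zeta>) * pd \<phi> (axis j 1) x)"
        using inner_tens_pd[OF sqint_rep \<phi>, of Y "axis j 1" "(0, \<zeta>)"] by (simp add: f_def inner_prod_def)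
      ultimately show ?thesis using *[OF \<phi>] by simp
    qed
    show "(LINT x|lborel. f x * complex_of_real (pd \<phi> (axis j 1) x)) = - (LINT x|lborel. g x $ j * complex_of_real (\<phi> x))"
    proof (rule complex_eqI)
      show "Re (LINT x|lborel. f x * complex_of_real (pd \<phi> (axis j 1) x)) = Re (- (LINT x|lborel. g x $ j * complex_of_real (\<phi> x)))"
        using key[of 1] by (simp add: integral_Re[OF if', symmetric] integral_Re[OF ig, symmetric] inner_complex_def)
      show "Im (LINT x|lborel. f x * complex_of_real (pd \<phi> (axis j 1) x)) = Im (- (LINT x|lborel. g x $ j * complex_of_real (\<phi> x)))"
        using key[of \<i>] by (simp add: integral_Im[OF if', symmetric] integral_Im[OF ig, symmetric] inner_complex_def)
    qed
  qed
  then show ?thesis unfolding gradient_states_def g_def[abs_def] by blast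
qed

text \<open>Integrating the equation for the first component in time exhibits its increment as the
  gradient of the time integral of the second component. Here \<open>Y\<close> is the weak time
  integral of the whole orbit. The reasoning applies to every F, gradient or not.\<close>

lemma wave_group_diff_gradient:
  assumes st: "s \<le> t"
  shows "wave_group t F - wave_group s F \<in> gradient_states"
proof -
  have c: "continuous_on {s..t} (\<lambda>r. wave_group r F \<bullet> q)" for q
    by (intro continuous_intros continuous_on_subset[OF continuous_wave_group]) auto
  have i: "set_integrable lborel {s..t} (\<lambda>r. wave_group r F \<bullet> q)" for q
    unfolding set_integrable_def by (rule borel_integrable_compact[OF compact_Icc c])
  have "\<exists>Y\<in>UNIV. \<forall>q\<in>UNIV. Y \<bullet> q = (LINT r:{s..t}|lborel. wave_group r F \<bullet> q)"
  proof (rule riesz_subspace[OF subspace_UNIV closed_UNIV])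
    show "(LINT r:{s..t}|lborel. wave_group r F \<bullet> (x + y)) = (LINT r:{s..t}|lborel. wave_group r F \<bullet> x) + (LINT r:{s..t}|lborel. wave_group r F \<bullet> y)" for x y
      by (simp add: inner_add_right set_integral_add[OF i i])
    show "(LINT r:{s..t}|lborel. wave_group r F \<bullet> (c *\<^sub>R x)) = c * (LINT r:{s..t}|lborel. wave_group r F \<bullet> x)" for c x
      by simp
    show "\<bar>LINT r:{s..t}|lborel. wave_group r F \<bullet> x\<bar> \<le> ((t - s) * norm F) * norm x" for x
    proof -
      have "norm (LINT r:{s..t}|lborel. wave_group r F \<bullet> x) \<le> (LINT r|lborel. indicat_real {s..t} r * (norm F * norm x))"
        unfolding set_lebesgue_integral_def
      proof (rule Bochner_Integration.integral_norm_bound_integral)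
        show "integrable lborel (\<lambda>r. indicat_real {s..t} r *\<^sub>R (wave_group r F \<bullet> x))" using i by (simp add: set_integrable_def)
        fix r
        have "\<bar>wave_group r F \<bullet> x\<bar> \<le> norm F * norm x" using Cauchy_Schwarz_ineq2[of "wave_group r F" x] by simp
        then show "norm (indicat_real {s..t} r *\<^sub>R (wave_group r F \<bullet> x)) \<le> indicat_real {s..t} r * (norm F * norm x)"
          by (auto simp: indicator_def)
      qed (use borel_integrable_compact[OF compact_Icc[of s t], of "\<lambda>_. norm F * norm x"] in simp)
      then show ?thesis using st by simp
    qed
  qed
  then obtain Y where Y: "\<And>q. Y \<bullet> q = (LINT r:{s..t}|lborel. wave_group r F \<bullet> q)" by blast
  show ?thesis
    by (rule gradient_statesI[where Y = Y]) (simp add: wave_group_FTC_tens[OF _ st] wave_gen_fst Y)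
qed

lemma wave_group_gradient:
  assumes "F \<in> gradient_states" shows "wave_group t F \<in> gradient_states"
proof (cases "0 \<le> t")
  case True
  then have "F + (wave_group t F - wave_group 0 F) \<in> gradient_states"
    by (intro subspace_add[OF subspace_gradient_states] assms wave_group_diff_gradient)
  then show ?thesis by (simp add: wave_group_0)
next
  case False
  then have "F - (wave_group 0 F - wave_group t F) \<in> gradient_states"
    by (intro subspace_diff[OF subspace_gradient_states] assms wave_group_diff_gradient) simp
  then show ?thesis by (simp add: wave_group_0)
qed

section \<open>Multiplication by i\<close>

definition imul :: "(complex^'n) \<times> complex \<Rightarrow> (complex^'n) \<times> complex" where
  "imul z = ((\<chi> j. \<i> * fst z $ j), \<i> * snd z)"

lemma bounded_linear_imul: "bounded_linear imul"
proof -
  have "linear (imul :: (complex^'n) \<times> complex \<Rightarrow> _)"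
    by (rule linearI) (auto simp: imul_def vec_eq_iff distrib_left)
  then show ?thesis by (simp add: linear_conv_bounded_linear)
qed

lemma imul_skew: "imul z \<bullet> w = z \<bullet> (- imul w)"
  by (simp add: imul_def inner_prod_def inner_vec_def inner_complex_def sum_negf[symmetric] sum.distrib[symmetric])

lemma imul_coupling: "imul (coupling j z) = coupling j (imul z)"
  by (simp add: imul_def coupling_def axis_def vec_eq_iff)

definition Imul :: "('n::finite) state \<Rightarrow> 'n state" where "Imul = lmap imul"

lemma bounded_linear_Imul: "bounded_linear Imul"
  unfolding Imul_def by (rule bounded_linear_lmap[OF bounded_linear_imul])

lemma lmap_uminus: "bounded_linear L \<Longrightarrow> lmap (\<lambda>z. - L z) F = - lmap L F"
proof (cases F)
  fix f assume L: "bounded_linear L" and f: "sqint f" "F = cls f"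
  have "cls (\<lambda>x. - L (f x)) = - cls (\<lambda>x. L (f x))"
    using cls_scaleR[OF sqint_linear[OF f(1) L], of "-1"] by simp
  then show ?thesis using L f by (simp add: lmap_cls bounded_linear_minus)
qed

lemma skew_Imul: "skew (Imul :: ('n::finite) state \<Rightarrow> 'n state)"
  unfolding skew_def
proof (intro conjI allI bounded_linear_Imul)
  fix F G :: "'n state"
  have "Imul F \<bullet> G = F \<bullet> lmap (\<lambda>w. - imul w) G"
    unfolding Imul_def by (rule lmap_adjoint[OF bounded_linear_imul bounded_linear_minus[OF bounded_linear_imul] imul_skew])
  then show "Imul F \<bullet> G = - (F \<bullet> Imul G)" by (simp add: Imul_def lmap_uminus bounded_linear_imul)
qed

lemma lmap_lmap: "bounded_linear L \<Longrightarrow> bounded_linear L' \<Longrightarrow> lmap L (lmap L' F) = lmap (\<lambda>x. L (L' x)) F"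
  by (cases F) (simp add: lmap_cls sqint_linear bounded_linear_compose)

lemma Imul_wave_op: "Imul (wave_op m F) = wave_op m (Imul F)"
proof -
  have "Imul (lmap (coupling j) (cdiff m j F)) = lmap (coupling j) (cdiff m j (Imul F))" for j
    by (simp add: Imul_def lmap_lmap bounded_linear_imul bounded_linear_coupling imul_coupling lmap_cdiff[symmetric])
  then show ?thesis by (simp add: wave_op_def linear_sum[OF bounded_linear.linear[OF bounded_linear_Imul]])
qed

lemma Imul_wave_group: "Imul (wave_group t F) = wave_group t (Imul F)"
proof (rule LIMSEQ_unique)
  show "(\<lambda>m. Imul (wave_approx m t F)) \<longlonglongrightarrow> Imul (wave_group t F)"
    by (rule bounded_linear.tendsto[OF bounded_linear_Imul wave_group_tendsto])
  have "Imul (wave_approx m t F) = wave_approx m t (Imul F)" for m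
    by (rule wave_approx_commute[OF bounded_linear_Imul Imul_wave_op])
  then show "(\<lambda>m. Imul (wave_approx m t F)) \<longlonglongrightarrow> wave_group t (Imul F)"
    by (simp add: wave_group_tendsto)
qed

lemma Imul_gradient:
  assumes "F \<in> gradient_states" shows "Imul F \<in> gradient_states"
proof -
  obtain f where f: "weak_grad f (\<lambda>x. fst (rep F x))" using assms by (auto simp: gradient_states_def)
  have "(\<lambda>x. \<chi> j. \<i> * (fst (rep F x) $ j) + 0 * (fst (rep F x) $ j)) = (\<lambda>x. fst (imul (rep F x)))"
    by (simp add: imul_def)
  then have "weak_grad (\<lambda>x. \<i> * f x + 0 * f x) (\<lambda>x. fst (imul (rep F x)))"
    using weak_grad_lin[OF f f, of \<i> 0] by simp
  then have "cls (\<lambda>x. imul (rep F x)) \<in> gradient_states"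
    using gradient_states_cls[OF sqint_linear[OF sqint_rep bounded_linear_imul]] by blast
  then show ?thesis by (simp add: Imul_def lmap_def)
qed

subsection \<open>Weak solutions in the interaction picture\<close>

text \<open>Elementary states form a core of the generator because the approximate groups are power series
  in translations and pointwise linear maps, which preserve elementary states.\<close>

lemma wave_group_core:
  fixes \<Gamma> :: "(('n::finite) state \<times> 'n state) set"
  assumes sub: "subspace \<Gamma>" and cl: "closed \<Gamma>"
    and core: "\<And>\<phi> e. test_fun \<phi> \<Longrightarrow> (tens \<phi> e, wave_gen \<phi> e) \<in> \<Gamma>"
    and \<phi>: "test_fun \<phi>"
  shows "(wave_group t (tens \<phi> e), wave_group t (wave_gen \<phi> e)) \<in> \<Gamma>"
proof -
  \<comment> \<open>The second entry stands for the generator applied to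
    \<open>B (tens \<phi> e)\<close>. For B built from \<open>wave_op m\<close> the derivatives may
    be moved inside B, whereas the maps \<open>coupling j\<close> do not commute with B and stay
    outside.\<close>
  define Z where "Z B \<phi> e = (B (tens \<phi> e), \<Sum>j\<in>UNIV. lmap (coupling j) (B (tens (pd \<phi> (axis j 1)) e)))"
    for B :: "'n state \<Rightarrow> 'n state" and \<phi> e
  have lin: "linear (lmap (coupling j) :: 'n state \<Rightarrow> _)" for j
    by (rule bounded_linear.linear[OF bounded_linear_lmap[OF bounded_linear_coupling]])
  \<comment> \<open>\<open>wave_op m\<close> turns an elementary state into a finite combination of
    elementary states with translated test functions; hence the property for B, at all elementary
    states, passes to B composed with \<open>wave_op m\<close>.\<close>
  have comp: "Z (\<lambda>F. B (wave_op m F)) \<phi> e \<in> \<Gamma>"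
    if B: "linear B" and Z: "\<And>\<phi> e. test_fun \<phi> \<Longrightarrow> Z B \<phi> e \<in> \<Gamma>" and \<phi>: "test_fun \<phi>" for B m \<phi> e
  proof -
    define c where "c = 1 / (2 * step m)"
    define p where "p k x = \<phi> (x + step m *\<^sub>R axis k 1)" for k x
    define n where "n k x = \<phi> (x + - (step m *\<^sub>R axis k 1))" for k x
    have pn: "test_fun (p k)" "test_fun (n k)" for k
      unfolding p_def[abs_def] n_def[abs_def] by (rule test_fun_translate(1)[OF \<phi>])+
    have w: "B (wave_op m (tens \<phi> e)) = (\<Sum>k\<in>UNIV. c *\<^sub>R (B (tens (p k) (coupling k e)) - B (tens (n k) (coupling k e))))"
      unfolding wave_op_def lmap_cdiff[OF bounded_linear_coupling] lmap_tens[OF bounded_linear_coupling \<phi>]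
      unfolding cdiff_def tens_translate[OF \<phi>] c_def p_def[abs_def] n_def[abs_def]
      by (simp only: linear_sum[OF B] linear_cmul[OF B] linear_diff[OF B])
    have w2: "B (wave_op m (tens (pd \<phi> v) e)) = (\<Sum>k\<in>UNIV. c *\<^sub>R (B (tens (pd (p k) v) (coupling k e)) - B (tens (pd (n k) v) (coupling k e))))" for v
      unfolding wave_op_def lmap_cdiff[OF bounded_linear_coupling] lmap_tens_pd[OF bounded_linear_coupling \<phi>]
      unfolding cdiff_def tens_pd_translate[OF \<phi>] c_def p_def[abs_def] n_def[abs_def]
      by (simp only: linear_sum[OF B] linear_cmul[OF B] linear_diff[OF B])
    have "Z (\<lambda>F. B (wave_op m F)) \<phi> e = (\<Sum>k\<in>UNIV. c *\<^sub>R (Z B (p k) (coupling k e) - Z B (n k) (coupling k e)))"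
    proof (rule prod_eqI)
      show "fst (Z (\<lambda>F. B (wave_op m F)) \<phi> e) = fst (\<Sum>k\<in>UNIV. c *\<^sub>R (Z B (p k) (coupling k e) - Z B (n k) (coupling k e)))"
        by (simp add: Z_def w fst_sum)
      have "(\<Sum>j\<in>UNIV. lmap (coupling j) (\<Sum>k\<in>UNIV. c *\<^sub>R (B (tens (pd (p k) (axis j 1)) (coupling k e)) - B (tens (pd (n k) (axis j 1)) (coupling k e)))))
         = (\<Sum>j\<in>UNIV. \<Sum>k\<in>UNIV. c *\<^sub>R (lmap (coupling j) (B (tens (pd (p k) (axis j 1)) (coupling k e))) - lmap (coupling j) (B (tens (pd (n k) (axis j 1)) (coupling k e)))))"
        by (simp add: linear_sum[OF lin] linear_cmul[OF lin] linear_diff[OF lin])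
      also have "\<dots> = (\<Sum>k\<in>UNIV. \<Sum>j\<in>UNIV. c *\<^sub>R (lmap (coupling j) (B (tens (pd (p k) (axis j 1)) (coupling k e))) - lmap (coupling j) (B (tens (pd (n k) (axis j 1)) (coupling k e)))))"
        by (rule sum.swap)
      finally show "snd (Z (\<lambda>F. B (wave_op m F)) \<phi> e) = snd (\<Sum>k\<in>UNIV. c *\<^sub>R (Z B (p k) (coupling k e) - Z B (n k) (coupling k e)))"
        by (simp add: Z_def w2 snd_sum scaleR_sum_right[symmetric] sum_subtractf[symmetric])
    qed
    then show ?thesis using Z pn by (simp add: subspace_sum subspace_scale subspace_diff sub)
  qed
  have linpow: "linear ((wave_op m ^^ k) :: 'n state \<Rightarrow> _)" for m k
    by (rule bounded_linear.linear[OF bounded_linear_funpow[OF bounded_linear_wave_op]])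
  have pow: "Z (wave_op m ^^ k) \<phi> e \<in> \<Gamma>" if "test_fun \<phi>" for m k \<phi> e
    using that
  proof (induction k arbitrary: \<phi> e)
    case 0
    then show ?case using core by (simp add: Z_def wave_gen_def lmap_tens_pd bounded_linear_coupling)
  next
    case (Suc k)
    have eq: "Z (wave_op m ^^ Suc k) \<phi> e = Z (\<lambda>F. (wave_op m ^^ k) (wave_op m F)) \<phi> e"
      by (simp only: funpow_Suc_right comp_def)
    show ?case unfolding eq by (rule comp[OF linpow Suc.IH Suc.prems])
  qed
  have approx: "Z (wave_approx m t) \<phi> e \<in> \<Gamma>" for m
  proof (rule closed_sequentially[OF cl])
    show "(\<Sum>k<n. (t ^ k /\<^sub>R fact k) *\<^sub>R Z (wave_op m ^^ k) \<phi> e) \<in> \<Gamma>" for n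
      by (intro subspace_sum subspace_scale sub pow \<phi>)
    have os: "(\<lambda>k. (t ^ k /\<^sub>R fact k) *\<^sub>R (wave_op m ^^ k) x) sums wave_approx m t x" for x :: "'n state"
      unfolding wave_approx_def by (rule opexp_sums[OF bounded_linear_wave_op])
    have f: "(\<lambda>n. \<Sum>k<n. (t ^ k /\<^sub>R fact k) *\<^sub>R (wave_op m ^^ k) (tens \<phi> e)) \<longlonglongrightarrow> wave_approx m t (tens \<phi> e)"
      using os[of "tens \<phi> e"] by (simp only: sums_def)
    have "(\<lambda>k. \<Sum>j\<in>UNIV. lmap (coupling j) ((t ^ k /\<^sub>R fact k) *\<^sub>R (wave_op m ^^ k) (tens (pd \<phi> (axis j 1)) e)))
        sums (\<Sum>j\<in>UNIV. lmap (coupling j) (wave_approx m t (tens (pd \<phi> (axis j 1)) e)))"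
      by (intro sums_sum bounded_linear.sums[OF bounded_linear_lmap[OF bounded_linear_coupling]] os)
    then have g: "(\<lambda>n. \<Sum>k<n. (t ^ k /\<^sub>R fact k) *\<^sub>R (\<Sum>j\<in>UNIV. lmap (coupling j) ((wave_op m ^^ k) (tens (pd \<phi> (axis j 1)) e))))
        \<longlonglongrightarrow> (\<Sum>j\<in>UNIV. lmap (coupling j) (wave_approx m t (tens (pd \<phi> (axis j 1)) e)))"
      by (simp only: sums_def linear_cmul[OF lin] scaleR_sum_right)
    have "(\<Sum>k<n. (t ^ k /\<^sub>R fact k) *\<^sub>R Z (wave_op m ^^ k) \<phi> e) =
       (\<Sum>k<n. (t ^ k /\<^sub>R fact k) *\<^sub>R (wave_op m ^^ k) (tens \<phi> e),
        \<Sum>k<n. (t ^ k /\<^sub>R fact k) *\<^sub>R (\<Sum>j\<in>UNIV. lmap (coupling j) ((wave_op m ^^ k) (tens (pd \<phi> (axis j 1)) e))))" for n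
      by (rule prod_eqI) (simp_all only: fst_sum snd_sum fst_scaleR snd_scaleR Z_def fst_conv snd_conv)
    then show "(\<lambda>n. \<Sum>k<n. (t ^ k /\<^sub>R fact k) *\<^sub>R Z (wave_op m ^^ k) \<phi> e) \<longlonglongrightarrow> Z (wave_approx m t) \<phi> e"
      using tendsto_Pair[OF f g] by (simp only: Z_def)
  qed
  have l2: "(\<lambda>m. \<Sum>j\<in>UNIV. lmap (coupling j) (wave_approx m t (tens (pd \<phi> (axis j 1)) e))) \<longlonglongrightarrow> (\<Sum>j\<in>UNIV. lmap (coupling j) (wave_group t (tens (pd \<phi> (axis j 1)) e)))"
    by (intro tendsto_sum bounded_linear.tendsto[OF bounded_linear_lmap[OF bounded_linear_coupling]] wave_group_tendsto)
  \<comment> \<open>The generator commutes with its group: each approximate group commutes with its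
    own \<open>wave_op m\<close>, and both sides are limits of the resulting expression.\<close>
  have "(\<Sum>j\<in>UNIV. lmap (coupling j) (wave_group t (tens (pd \<phi> (axis j 1)) e))) = wave_group t (wave_gen \<phi> e)"
  proof (rule LIMSEQ_unique)
    show "(\<lambda>m. wave_approx m t (wave_op m (tens \<phi> e))) \<longlonglongrightarrow> wave_group t (wave_gen \<phi> e)"
      by (intro wave_group_tendsto_seq wave_op_tens_tendsto \<phi>)
    have "wave_approx m t (wave_op m (tens \<phi> e)) = (\<Sum>j\<in>UNIV. lmap (coupling j) (wave_approx m t (cdiff m j (tens \<phi> e))))" for m
      by (simp add: wave_approx_wave_op[symmetric] wave_op_def[of m "wave_approx m t (tens \<phi> e)"] wave_approx_cdiff)
    then show "(\<lambda>m. wave_approx m t (wave_op m (tens \<phi> e))) \<longlonglongrightarrow> (\<Sum>j\<in>UNIV. lmap (coupling j) (wave_group t (tens (pd \<phi> (axis j 1)) e)))"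
      by (simp only:) (intro tendsto_sum bounded_linear.tendsto[OF bounded_linear_lmap[OF bounded_linear_coupling]] wave_group_tendsto_seq cdiff_tens_tendsto \<phi>)
  qed
  with l2 have "(\<lambda>m. Z (wave_approx m t) \<phi> e) \<longlonglongrightarrow> (wave_group t (tens \<phi> e), wave_group t (wave_gen \<phi> e))"
    unfolding Z_def by (intro tendsto_Pair wave_group_tendsto) simp
  then show ?thesis by (rule closed_sequentially[OF cl approx])
qed

section \<open>Paths of states with a driving term\<close>

locale driven_path =
  fixes F :: "real \<Rightarrow> ('n::finite) state" and \<kappa> :: "real \<Rightarrow> 'n state \<Rightarrow> 'n state \<Rightarrow> real" and \<beta> :: "real \<Rightarrow> real"
  assumes F_cont: "continuous_on UNIV F"
    and bil: "\<And>s. bounded_bilinear (\<kappa> s)"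
    and meas: "\<And>x y. (\<lambda>s. \<kappa> s x y) \<in> borel_measurable borel"
    and bnd: "\<And>s x y. \<bar>\<kappa> s x y\<bar> \<le> \<beta> s * norm x * norm y"
    and \<beta>_int: "integrable lborel \<beta>" and \<beta>_nonneg: "\<And>s. 0 \<le> \<beta> s"
begin

lemma bounded_on_Icc:
  assumes "continuous_on UNIV (y :: real \<Rightarrow> 'n state)"
  obtains m where "0 \<le> m" "\<And>r. r \<in> {s..t} \<Longrightarrow> norm (y r) \<le> m"
proof -
  have "compact (y ` {s..t})" using assms by (intro compact_continuous_image) (auto intro: continuous_on_subset)
  then obtain m where m: "\<And>r. r \<in> {s..t} \<Longrightarrow> norm (y r) \<le> m" using compact_imp_bounded bounded_iff by (metis imageI)
  show ?thesis by (rule that[of "max 0 m"]) (use m in \<open>auto simp: le_max_iff_disj\<close>)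
qed

lemma \<kappa>_bound:
  assumes y: "continuous_on UNIV y" and m: "\<And>r. r \<in> {s..t} \<Longrightarrow> norm (F r) \<le> m"
    and m': "\<And>r. r \<in> {s..t} \<Longrightarrow> norm (y r) \<le> m'" "0 \<le> m" "0 \<le> m'"
  shows \<kappa>_integrable: "set_integrable lborel {s..t} (\<lambda>r. \<kappa> r (F r) (y r))"
    and "\<bar>LINT r:{s..t}|lborel. \<kappa> r (F r) (y r)\<bar> \<le> (LINT r:{s..t}|lborel. \<beta> r) * (m * m')"
proof -
  have [measurable]: "(\<lambda>r. \<kappa> r (F r) (y r)) \<in> borel_measurable borel"
    by (rule bilinear_measurable_compose[OF bil meas F_cont y])
  have \<beta>i: "integrable lborel (\<lambda>r. indicat_real {s..t} r *\<^sub>R \<beta> r)"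
    by (intro integrable_mult_indicator \<beta>_int) simp
  have le: "norm (indicat_real {s..t} r *\<^sub>R \<kappa> r (F r) (y r)) \<le> (indicat_real {s..t} r *\<^sub>R \<beta> r) * (m * m')" for r
  proof (cases "r \<in> {s..t}")
    case True
    have "\<bar>\<kappa> r (F r) (y r)\<bar> \<le> \<beta> r * (norm (F r) * norm (y r))" using bnd[of r "F r" "y r"] by (simp add: mult.assoc)
    also have "\<dots> \<le> \<beta> r * (m * m')"
      using True by (intro mult_left_mono mult_mono m m' \<beta>_nonneg) auto
    finally show ?thesis using True by simp
  qed simp
  show i: "set_integrable lborel {s..t} (\<lambda>r. \<kappa> r (F r) (y r))" unfolding set_integrable_def
    by (rule Bochner_Integration.integrable_bound[OF integrable_mult_left[OF \<beta>i, of "m * m'"]])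
       (measurable, intro AE_I2 order_trans[OF le], simp)
  have "norm (LINT r:{s..t}|lborel. \<kappa> r (F r) (y r)) \<le> (LINT r|lborel. (indicat_real {s..t} r *\<^sub>R \<beta> r) * (m * m'))"
    unfolding set_lebesgue_integral_def
    by (rule Bochner_Integration.integral_norm_bound_integral)
       (use i le integrable_mult_left[OF \<beta>i, of "m * m'"] in \<open>auto simp: set_integrable_def\<close>)
  then show "\<bar>LINT r:{s..t}|lborel. \<kappa> r (F r) (y r)\<bar> \<le> (LINT r:{s..t}|lborel. \<beta> r) * (m * m')"
    unfolding integral_mult_left_zero by (simp add: set_lebesgue_integral_def)
qed

lemma \<kappa>_set_integrable:
  assumes "continuous_on UNIV y" shows "set_integrable lborel {s..t} (\<lambda>r. \<kappa> r (F r) (y r))"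
proof -
  obtain m where "0 \<le> m" "\<And>r. r \<in> {s..t} \<Longrightarrow> norm (F r) \<le> m" by (rule bounded_on_Icc[OF F_cont, of s t]) blast
  moreover obtain m' where "0 \<le> m'" "\<And>r. r \<in> {s..t} \<Longrightarrow> norm (y r) \<le> m'" by (rule bounded_on_Icc[OF assms, of s t]) blast
  ultimately show ?thesis using assms by (intro \<kappa>_integrable)
qed

lemma inner_set_integrable:
  assumes "continuous_on UNIV x" "continuous_on UNIV y"
  shows "set_integrable lborel {s..t} (\<lambda>r::real. x r \<bullet> (y r :: 'n state))"
  unfolding set_integrable_def
  by (rule borel_integrable_compact[OF compact_Icc]) (intro continuous_intros continuous_on_subset[OF assms(1)] continuous_on_subset[OF assms(2)], auto)

lemma \<kappa>_lin:
  "\<kappa> r x (y + z) = \<kappa> r x y + \<kappa> r x z" "\<kappa> r x (c *\<^sub>R y) = c * \<kappa> r x y" "\<kappa> r x (y - z) = \<kappa> r x y - \<kappa> r x z"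
  using bounded_bilinear.add_right[OF bil] bounded_bilinear.scaleR_right[OF bil] bounded_bilinear.diff_right[OF bil] by auto

text \<open>The residual of the time-integrated weak equation, where \<open>snd z\<close> takes the
  place of the generator applied to \<open>fst z\<close>. Treating the two as independent makes the
  residual a bounded functional on pairs, so that its zeros form a closed subspace to which
  \<open>wave_group_core\<close> applies.\<close>

definition defect :: "real \<Rightarrow> real \<Rightarrow> 'n state \<times> 'n state \<Rightarrow> real" where
  "defect s t z = (F t - F s) \<bullet> fst z - (LINT r:{s..t}|lborel. \<kappa> r (F r) (fst z) - F r \<bullet> snd z)"

lemma defect_integrable: "set_integrable lborel {s..t} (\<lambda>r. \<kappa> r (F r) x - F r \<bullet> y)"
  by (intro set_integral_diff \<kappa>_set_integrable inner_set_integrable F_cont continuous_intros)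

lemma bounded_linear_defect: "s \<le> t \<Longrightarrow> bounded_linear (defect s t)"
proof -
  assume st: "s \<le> t"
  obtain m where m: "0 \<le> m" "\<And>r. r \<in> {s..t} \<Longrightarrow> norm (F r) \<le> m" by (rule bounded_on_Icc[OF F_cont, of s t]) blast
  define I where "I = (LINT r:{s..t}|lborel. \<beta> r)"
  show ?thesis
  proof (rule bounded_linear_intro[where K = "norm (F t - F s) + I * m + (t - s) * m"])
    fix z w :: "'n state \<times> 'n state" and c :: real
    have "(LINT r:{s..t}|lborel. \<kappa> r (F r) (fst (z + w)) - F r \<bullet> snd (z + w))
      = (LINT r:{s..t}|lborel. (\<kappa> r (F r) (fst z) - F r \<bullet> snd z) + (\<kappa> r (F r) (fst w) - F r \<bullet> snd w))"
      by (simp add: \<kappa>_lin inner_add_right algebra_simps)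
    also have "\<dots> = (LINT r:{s..t}|lborel. \<kappa> r (F r) (fst z) - F r \<bullet> snd z) + (LINT r:{s..t}|lborel. \<kappa> r (F r) (fst w) - F r \<bullet> snd w)"
      by (rule set_integral_add(2)[OF defect_integrable defect_integrable])
    finally show "defect s t (z + w) = defect s t z + defect s t w"
      by (simp add: defect_def inner_add_right)
    have "(LINT r:{s..t}|lborel. \<kappa> r (F r) (fst (c *\<^sub>R z)) - F r \<bullet> snd (c *\<^sub>R z))
      = (LINT r:{s..t}|lborel. c * (\<kappa> r (F r) (fst z) - F r \<bullet> snd z))"
      by (simp add: \<kappa>_lin right_diff_distrib)
    also have "\<dots> = c * (LINT r:{s..t}|lborel. \<kappa> r (F r) (fst z) - F r \<bullet> snd z)" by simp
    finally show "defect s t (c *\<^sub>R z) = c *\<^sub>R defect s t z"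
      by (simp add: defect_def right_diff_distrib)
    have 1: "\<bar>(F t - F s) \<bullet> fst z\<bar> \<le> norm (F t - F s) * norm z"
      by (rule order_trans[OF Cauchy_Schwarz_ineq2]) (metis norm_fst_le mult_left_mono norm_ge_zero prod.collapse)
    have 2: "\<bar>LINT r:{s..t}|lborel. \<kappa> r (F r) (fst z)\<bar> \<le> I * m * norm z"
    proof -
      have "\<bar>LINT r:{s..t}|lborel. \<kappa> r (F r) (fst z)\<bar> \<le> I * (m * norm z)" unfolding I_def
        by (rule \<kappa>_bound(2)) (use m norm_fst_le[of "fst z" "snd z"] in auto)
      then show ?thesis by (simp add: mult.assoc)
    qed
    have 3: "\<bar>LINT r:{s..t}|lborel. F r \<bullet> snd z\<bar> \<le> (t - s) * m * norm z"
    proof -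
      have "norm (LINT r:{s..t}|lborel. F r \<bullet> snd z) \<le> (LINT r|lborel. indicat_real {s..t} r *\<^sub>R (m * norm z))"
        unfolding set_lebesgue_integral_def
      proof (rule Bochner_Integration.integral_norm_bound_integral)
        show "integrable lborel (\<lambda>r. indicat_real {s..t} r *\<^sub>R (F r \<bullet> snd z))"
          using inner_set_integrable[OF F_cont continuous_on_const] by (simp add: set_integrable_def)
        show "integrable lborel (\<lambda>r. indicat_real {s..t} r *\<^sub>R (m * norm z))"
          by (rule borel_integrable_compact[OF compact_Icc continuous_on_const])
        fix r
        have "\<bar>F r \<bullet> snd z\<bar> \<le> m * norm z" if "r \<in> {s..t}"
          by (rule order_trans[OF Cauchy_Schwarz_ineq2 mult_mono]) (use m that norm_snd_le[of "snd z" "fst z"] in auto)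
        then show "norm (indicat_real {s..t} r *\<^sub>R (F r \<bullet> snd z)) \<le> indicat_real {s..t} r *\<^sub>R (m * norm z)"
          by (auto simp: indicator_def)
      qed
      then show ?thesis using st by simp
    qed
    have "(LINT r:{s..t}|lborel. \<kappa> r (F r) (fst z) - F r \<bullet> snd z)
      = (LINT r:{s..t}|lborel. \<kappa> r (F r) (fst z)) - (LINT r:{s..t}|lborel. F r \<bullet> snd z)"
      by (intro set_integral_diff \<kappa>_set_integrable inner_set_integrable F_cont continuous_intros)
    then have "\<bar>defect s t z\<bar> \<le> norm (F t - F s) * norm z + I * m * norm z + (t - s) * m * norm z"
      using 1 2 3 unfolding defect_def by linarith
    then show "norm (defect s t z) \<le> norm z * (norm (F t - F s) + I * m + (t - s) * m)"
      by (simp add: algebra_simps)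
  qed
qed

end

locale wave_path = driven_path F \<kappa> \<beta>
  for F :: "real \<Rightarrow> ('n::finite) state" and \<kappa> \<beta> +
  assumes weak: "\<And>\<phi> e s t. test_fun \<phi> \<Longrightarrow> s \<le> t \<Longrightarrow>
      (F t - F s) \<bullet> tens \<phi> e = (LINT r:{s..t}|lborel. \<kappa> r (F r) (tens \<phi> e) - F r \<bullet> wave_gen \<phi> e)"
begin

text \<open>The kernel of the defect is closed and contains the graph of the generator over
  elementary states; by \<open>wave_group_core\<close> it then contains the images of that graph
  under the free group, although these no longer come from compactly supported test
  functions.\<close>

lemma wave_group_core_identity:
  assumes \<phi>: "test_fun \<phi>" and st: "s \<le> t"
  shows "(F t - F s) \<bullet> wave_group \<tau> (tens \<phi> e)
    = (LINT r:{s..t}|lborel. \<kappa> r (F r) (wave_group \<tau> (tens \<phi> e)) - F r \<bullet> wave_group \<tau> (wave_gen \<phi> e))"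
proof -
  define \<Gamma> where "\<Gamma> = {z. defect s t z = 0}"
  note bl = bounded_linear_defect[OF st]
  note lin = bounded_linear.linear[OF bl]
  have "(wave_group \<tau> (tens \<phi> e), wave_group \<tau> (wave_gen \<phi> e)) \<in> \<Gamma>"
  proof (rule wave_group_core[OF _ _ _ \<phi>])
    show "subspace \<Gamma>" unfolding \<Gamma>_def subspace_def
      by (auto simp: linear_0[OF lin] linear_add[OF lin] linear_cmul[OF lin])
    have "closed (defect s t -` {0})"
      by (rule continuous_closed_vimage) (auto intro: linear_continuous_at[OF bl])
    then show "closed \<Gamma>" by (simp add: \<Gamma>_def vimage_def)
    show "(tens \<phi> e, wave_gen \<phi> e) \<in> \<Gamma>" if "test_fun \<phi>" for \<phi> e
      using weak[OF that st] by (simp add: \<Gamma>_def defect_def)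
  qed
  then show ?thesis by (simp add: \<Gamma>_def defect_def)
qed

text \<open>A product rule for the pairing of F with the free orbit \<open>\<eta>\<close>. The
  contributions of the generator cancel by skewness. As the derivatives exist only in the integrated
  weak sense, it is shown instead that the increments of the residual R are at most
  \<open>\<epsilon>\<close> times increments of a fixed function, for every
  \<open>\<epsilon>\<close>.\<close>

lemma interaction_tens:
  assumes \<phi>: "test_fun \<phi>" and ab: "a \<le> b"
  shows "F b \<bullet> wave_group b (tens \<phi> e) - F a \<bullet> wave_group a (tens \<phi> e)
    = (LINT r:{a..b}|lborel. \<kappa> r (F r) (wave_group r (tens \<phi> e)))"
proof -
  define \<eta> where "\<eta> t = wave_group t (tens \<phi> e)" for t
  define \<theta> where "\<theta> t = wave_group t (wave_gen \<phi> e)" for t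
  have \<eta>c: "continuous_on UNIV \<eta>" and \<theta>c: "continuous_on UNIV \<theta>"
    unfolding \<eta>_def[abs_def] \<theta>_def[abs_def] by (rule continuous_wave_group)+
  define R where "R t = F t \<bullet> \<eta> t - (LINT r:{a..t}|lborel. \<kappa> r (F r) (\<eta> r))" for t
  define B where "B t = (LINT r:{..t}|lborel. \<beta> r)" for t
  define L where "L = norm (wave_gen \<phi> e)"
  obtain m where m: "0 \<le> m" "\<And>r. r \<in> {a..b} \<Longrightarrow> norm (F r) \<le> m" by (rule bounded_on_Icc[OF F_cont, of a b]) blast
  \<comment> \<open>Uniform continuity of F, \<open>\<eta>\<close> and \<open>\<theta>\<close> on
    the compact interval fixes a step length for which all three vary by less than
    \<open>\<epsilon>\<close>; the bracket collects the factors that multiply these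
    oscillations.\<close>
  have main: "\<bar>R b - R a\<bar> \<le> \<epsilon> * ((L + m) * (b - a) + m * (B b - B a))" if \<epsilon>: "\<epsilon> > 0" for \<epsilon>
  proof -
    have uc: "uniformly_continuous_on {a..b} y" if "continuous_on UNIV y" for y :: "real \<Rightarrow> 'n state"
      by (rule compact_uniformly_continuous) (use that in \<open>auto intro: continuous_on_subset\<close>)
    have ud: "\<exists>\<delta>>0. \<forall>s\<in>{a..b}. \<forall>t\<in>{a..b}. dist t s < \<delta> \<longrightarrow> dist (y t) (y s) < \<epsilon>"
      if "continuous_on UNIV y" for y :: "real \<Rightarrow> 'n state"
      using uc[OF that] \<epsilon> unfolding uniformly_continuous_on_def by blast
    obtain \<delta>1 where d1: "\<delta>1 > 0" "\<And>s t. s \<in> {a..b} \<Longrightarrow> t \<in> {a..b} \<Longrightarrow> dist t s < \<delta>1 \<Longrightarrow> dist (F t) (F s) < \<epsilon>"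
      using ud[OF F_cont] by blast
    obtain \<delta>2 where d2: "\<delta>2 > 0" "\<And>s t. s \<in> {a..b} \<Longrightarrow> t \<in> {a..b} \<Longrightarrow> dist t s < \<delta>2 \<Longrightarrow> dist (\<eta> t) (\<eta> s) < \<epsilon>"
      using ud[OF \<eta>c] by blast
    obtain \<delta>3 where d3: "\<delta>3 > 0" "\<And>s t. s \<in> {a..b} \<Longrightarrow> t \<in> {a..b} \<Longrightarrow> dist t s < \<delta>3 \<Longrightarrow> dist (\<theta> t) (\<theta> s) < \<epsilon>"
      using ud[OF \<theta>c] by blast
    define \<delta> where "\<delta> = min \<delta>1 (min \<delta>2 \<delta>3) / 2"
    define \<mu> where "\<mu> t = \<epsilon> * ((L + m) * t + m * B t)" for t
    have "norm (R b - R a) \<le> \<mu> b - \<mu> a"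
    proof (rule norm_increment_bound[where \<delta> = \<delta>])
      show "\<delta> > 0" using d1 d2 d3 by (simp add: \<delta>_def)
      fix s t assume st: "a \<le> s" "s \<le> t" "t \<le> b" "t \<le> s + \<delta>"
      have close: "dist r r' < \<delta>1" "dist r r' < \<delta>2" "dist r r' < \<delta>3" if "r \<in> {s..t}" "r' \<in> {s..t}" for r r'
      proof -
        have "\<bar>r - r'\<bar> \<le> \<delta>" using that st by auto
        moreover have "\<delta> < \<delta>1" "\<delta> < \<delta>2" "\<delta> < \<delta>3" using d1(1) d2(1) d3(1) by (auto simp: \<delta>_def min_def)
        ultimately show "dist r r' < \<delta>1" "dist r r' < \<delta>2" "dist r r' < \<delta>3" unfolding dist_real_def by linarith+
      qed
      have k\<eta>: "set_integrable lborel {u..v} (\<lambda>r. \<kappa> r (F r) (\<eta> r))" for u v by (rule \<kappa>_set_integrable[OF \<eta>c])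
      have split: "(LINT r:{a..t}|lborel. \<kappa> r (F r) (\<eta> r)) = (LINT r:{a..s}|lborel. \<kappa> r (F r) (\<eta> r)) + (LINT r:{s..t}|lborel. \<kappa> r (F r) (\<eta> r))"
      proof -
        have "{a..t} = {a..s} \<union> {s..t}" using st by auto
        then have "(LINT r:{a..t}|lborel. \<kappa> r (F r) (\<eta> r)) = (LINT r:{a..s} \<union> {s..t}|lborel. \<kappa> r (F r) (\<eta> r))" by simp
        also have "\<dots> = (LINT r:{a..s}|lborel. \<kappa> r (F r) (\<eta> r)) + (LINT r:{s..t}|lborel. \<kappa> r (F r) (\<eta> r))"
          by (rule set_integral_Un_AE[OF _ _ _ k\<eta> k\<eta>]) (use AE_lborel_singleton[of s] in \<open>auto elim!: eventually_mono\<close>)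
        finally show ?thesis .
      qed
      have e1: "(F t - F s) \<bullet> \<eta> t = (LINT r:{s..t}|lborel. \<kappa> r (F r) (\<eta> t)) - (LINT r:{s..t}|lborel. F r \<bullet> \<theta> t)"
        unfolding \<eta>_def \<theta>_def wave_group_core_identity[OF \<phi> st(2)]
        by (intro set_integral_diff \<kappa>_set_integrable inner_set_integrable F_cont continuous_intros)
      have e2: "F s \<bullet> (\<eta> t - \<eta> s) = (LINT r:{s..t}|lborel. F s \<bullet> \<theta> r)"
        using wave_group_tens_FTC[OF \<phi> st(2), of e "F s"] by (simp add: \<eta>_def \<theta>_def inner_commute)
      have e3: "(LINT r:{s..t}|lborel. \<kappa> r (F r) (\<eta> t)) - (LINT r:{s..t}|lborel. \<kappa> r (F r) (\<eta> r)) = (LINT r:{s..t}|lborel. \<kappa> r (F r) (\<eta> t - \<eta> r))"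
        unfolding \<kappa>_lin by (intro set_integral_diff(2)[symmetric] \<kappa>_set_integrable \<eta>c continuous_on_const)
      have i4: "set_integrable lborel {s..t} (\<lambda>r. F s \<bullet> \<theta> r)" "set_integrable lborel {s..t} (\<lambda>r. F r \<bullet> \<theta> t)"
        by (intro inner_set_integrable F_cont \<theta>c continuous_on_const)+
      have e4: "(LINT r:{s..t}|lborel. F s \<bullet> \<theta> r) - (LINT r:{s..t}|lborel. F r \<bullet> \<theta> t) = (LINT r:{s..t}|lborel. F s \<bullet> \<theta> r - F r \<bullet> \<theta> t)"
        by (rule set_integral_diff(2)[OF i4, symmetric])
      \<comment> \<open>The increments are taken at different times: F moves against
        \<open>\<eta> t\<close>, then \<open>\<eta>\<close> moves against \<open>F s\<close>. Each
        is given by one integral identity, and what fails to cancel consists of differences over at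
        most one step.\<close>
      have "R t - R s = (F t - F s) \<bullet> \<eta> t + F s \<bullet> (\<eta> t - \<eta> s) - (LINT r:{s..t}|lborel. \<kappa> r (F r) (\<eta> r))"
        unfolding R_def split by (simp add: inner_diff_left inner_diff_right)
      also have "\<dots> = (LINT r:{s..t}|lborel. \<kappa> r (F r) (\<eta> t - \<eta> r)) + (LINT r:{s..t}|lborel. F s \<bullet> \<theta> r - F r \<bullet> \<theta> t)"
        unfolding e1 e2 e3[symmetric] e4[symmetric] by simp
      finally have Rd: "R t - R s = (LINT r:{s..t}|lborel. \<kappa> r (F r) (\<eta> t - \<eta> r)) + (LINT r:{s..t}|lborel. F s \<bullet> \<theta> r - F r \<bullet> \<theta> t)" .
      have "\<bar>LINT r:{s..t}|lborel. \<kappa> r (F r) (\<eta> t - \<eta> r)\<bar> \<le> (LINT r:{s..t}|lborel. \<beta> r) * (m * \<epsilon>)"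
      proof (rule \<kappa>_bound(2))
        show "continuous_on UNIV (\<lambda>r. \<eta> t - \<eta> r)" by (intro continuous_intros \<eta>c)
        show "norm (\<eta> t - \<eta> r) \<le> \<epsilon>" if "r \<in> {s..t}" for r
          using d2(2)[of r t] close(2)[of t r] that st by (auto simp: dist_norm less_imp_le)
      qed (use m st \<epsilon> in auto)
      also have "(LINT r:{s..t}|lborel. \<beta> r) = B t - B s"
        unfolding B_def by (rule set_integral_atLeastAtMost_diff[OF \<beta>_int st(2)])
      finally have b1: "\<bar>LINT r:{s..t}|lborel. \<kappa> r (F r) (\<eta> t - \<eta> r)\<bar> \<le> (B t - B s) * (m * \<epsilon>)" .
      have b2: "\<bar>LINT r:{s..t}|lborel. F s \<bullet> \<theta> r - F r \<bullet> \<theta> t\<bar> \<le> (t - s) * (\<epsilon> * (L + m))"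
      proof -
        have "norm (LINT r:{s..t}|lborel. F s \<bullet> \<theta> r - F r \<bullet> \<theta> t) \<le> (LINT r|lborel. indicat_real {s..t} r *\<^sub>R (\<epsilon> * (L + m)))"
          unfolding set_lebesgue_integral_def
        proof (rule Bochner_Integration.integral_norm_bound_integral)
          show "integrable lborel (\<lambda>r. indicat_real {s..t} r *\<^sub>R (F s \<bullet> \<theta> r - F r \<bullet> \<theta> t))"
            using set_integral_diff(1)[OF i4] by (simp add: set_integrable_def)
          show "integrable lborel (\<lambda>r. indicat_real {s..t} r *\<^sub>R (\<epsilon> * (L + m)))"
            by (rule borel_integrable_compact[OF compact_Icc continuous_on_const])
          fix r
          have "\<bar>F s \<bullet> \<theta> r - F r \<bullet> \<theta> t\<bar> \<le> \<epsilon> * (L + m)" if r: "r \<in> {s..t}"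
          proof -
            have "F s \<bullet> \<theta> r - F r \<bullet> \<theta> t = (F s - F r) \<bullet> \<theta> r + F r \<bullet> (\<theta> r - \<theta> t)"
              by (simp add: inner_diff_left inner_diff_right)
            moreover have "\<bar>(F s - F r) \<bullet> \<theta> r\<bar> \<le> \<epsilon> * L"
            proof (rule order_trans[OF Cauchy_Schwarz_ineq2 mult_mono])
              show "norm (F s - F r) \<le> \<epsilon>"
                using d1(2)[of r s] close(1)[of s r] r st by (auto simp: dist_norm less_imp_le)
            qed (use \<epsilon> in \<open>auto simp: L_def \<theta>_def\<close>)
            moreover have "\<bar>F r \<bullet> (\<theta> r - \<theta> t)\<bar> \<le> m * \<epsilon>"
            proof (rule order_trans[OF Cauchy_Schwarz_ineq2 mult_mono])
              show "norm (\<theta> r - \<theta> t) \<le> \<epsilon>"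
                using d3(2)[of t r] close(3)[of r t] r st by (auto simp: dist_norm less_imp_le)
            qed (use m r st in auto)
            ultimately show ?thesis by (simp add: algebra_simps)
          qed
          then show "norm (indicat_real {s..t} r *\<^sub>R (F s \<bullet> \<theta> r - F r \<bullet> \<theta> t)) \<le> indicat_real {s..t} r *\<^sub>R (\<epsilon> * (L + m))"
            by (auto simp: indicator_def)
        qed
        then show ?thesis using st by simp
      qed
      have "norm (R t - R s) \<le> (B t - B s) * (m * \<epsilon>) + (t - s) * (\<epsilon> * (L + m))"
        unfolding Rd using b1 b2 by simp
      also have "\<dots> = \<mu> t - \<mu> s" unfolding \<mu>_def by (simp add: algebra_simps)
      finally show "norm (R t - R s) \<le> \<mu> t - \<mu> s" .
    qed (rule ab)
    then show ?thesis by (simp add: \<mu>_def algebra_simps)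
  qed
  define M where "M = (L + m) * (b - a) + m * (B b - B a)"
  have "(LINT r:{a..b}|lborel. \<beta> r) \<ge> 0"
    unfolding set_lebesgue_integral_def
    by (intro Bochner_Integration.integral_nonneg) (auto simp: \<beta>_nonneg)
  then have "B b - B a \<ge> 0"
    unfolding B_def by (simp add: set_integral_atLeastAtMost_diff[OF \<beta>_int ab])
  then have M0: "M \<ge> 0" using m ab by (simp add: M_def L_def)
  have "\<bar>R b - R a\<bar> \<le> 0"
  proof (rule field_le_epsilon)
    fix \<epsilon> :: real assume e: "\<epsilon> > 0"
    \<comment> \<open>Dividing by \<open>M + 1\<close> instead of M covers the case
      \<open>M = 0\<close>.\<close>
    have "\<bar>R b - R a\<bar> \<le> \<epsilon> / (M + 1) * M" unfolding M_def[symmetric] using main[of "\<epsilon> / (M + 1)"] e M0 by (simp add: M_def)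
    also have "\<dots> \<le> \<epsilon>" using e M0 by (simp add: field_simps)
    finally show "\<bar>R b - R a\<bar> \<le> 0 + \<epsilon>" by simp
  qed
  moreover have "(LINT r:{a..a}|lborel. \<kappa> r (F r) (\<eta> r)) = 0"
  proof -
    have "(LINT r|lborel. indicat_real {a..a} r *\<^sub>R \<kappa> r (F r) (\<eta> r)) = (LINT r|(lborel::real measure). (0::real))"
    proof (rule integral_cong_AE)
      show "(\<lambda>r. indicat_real {a..a} r *\<^sub>R \<kappa> r (F r) (\<eta> r)) \<in> borel_measurable lborel"
        using \<kappa>_set_integrable[OF \<eta>c, of a a] unfolding set_integrable_def by (rule borel_measurable_integrable)
      show "AE r in lborel. indicat_real {a..a} r *\<^sub>R \<kappa> r (F r) (\<eta> r) = 0"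
        using AE_lborel_singleton[of a] by eventually_elim auto
    qed simp
    then show ?thesis by (simp add: set_lebesgue_integral_def)
  qed
  ultimately show ?thesis by (simp add: R_def \<eta>_def)
qed

text \<open>Both sides are bounded and linear in q, so density of elementary states extends
  \<open>interaction_tens\<close> to all q; the adjoint relation carries the group from the test
  state over to F.\<close>

lemma interaction:
  assumes ab: "a \<le> b"
  shows "(wave_group (- b) (F b) - wave_group (- a) (F a)) \<bullet> q
    = (LINT r:{a..b}|lborel. \<kappa> r (F r) (wave_group r q))"
proof -
  define \<Lambda> where "\<Lambda> q = (wave_group (- b) (F b) - wave_group (- a) (F a)) \<bullet> q - (LINT r:{a..b}|lborel. \<kappa> r (F r) (wave_group r q))" for q
  obtain m where m: "0 \<le> m" "\<And>r. r \<in> {a..b} \<Longrightarrow> norm (F r) \<le> m" by (rule bounded_on_Icc[OF F_cont, of a b]) blast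
  have i: "set_integrable lborel {a..b} (\<lambda>r. \<kappa> r (F r) (wave_group r q))" for q
    by (rule \<kappa>_set_integrable[OF continuous_wave_group])
  have bl: "bounded_linear \<Lambda>"
  proof (rule bounded_linear_intro[where K = "norm (wave_group (- b) (F b) - wave_group (- a) (F a)) + (LINT r:{a..b}|lborel. \<beta> r) * m"])
    show "\<Lambda> (x + y) = \<Lambda> x + \<Lambda> y" for x y
      by (simp add: \<Lambda>_def wave_group_add \<kappa>_lin set_integral_add(2)[OF i i] inner_add_right)
    show "\<Lambda> (c *\<^sub>R x) = c *\<^sub>R \<Lambda> x" for c x
      by (simp add: \<Lambda>_def wave_group_scaleR \<kappa>_lin right_diff_distrib)
    show "norm (\<Lambda> x) \<le> norm x * (norm (wave_group (- b) (F b) - wave_group (- a) (F a)) + (LINT r:{a..b}|lborel. \<beta> r) * m)" for x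
    proof -
      have "\<bar>LINT r:{a..b}|lborel. \<kappa> r (F r) (wave_group r x)\<bar> \<le> (LINT r:{a..b}|lborel. \<beta> r) * (m * norm x)"
        by (rule \<kappa>_bound(2)[OF continuous_wave_group]) (use m in auto)
      moreover have "\<bar>(wave_group (- b) (F b) - wave_group (- a) (F a)) \<bullet> x\<bar> \<le> norm (wave_group (- b) (F b) - wave_group (- a) (F a)) * norm x"
        by (rule Cauchy_Schwarz_ineq2)
      ultimately have "\<bar>\<Lambda> x\<bar> \<le> norm (wave_group (- b) (F b) - wave_group (- a) (F a)) * norm x + (LINT r:{a..b}|lborel. \<beta> r) * (m * norm x)"
        unfolding \<Lambda>_def by linarith
      then show ?thesis by (simp add: algebra_simps)
    qed
  qed
  note lin = bounded_linear.linear[OF bl]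
  have "{q. \<Lambda> q = 0} = UNIV"
  proof (rule closed_subspace_tens_UNIV)
    show "subspace {q. \<Lambda> q = 0}" unfolding subspace_def
      by (auto simp: linear_0[OF lin] linear_add[OF lin] linear_cmul[OF lin])
    have "closed (\<Lambda> -` {0})"
      by (rule continuous_closed_vimage) (auto intro: linear_continuous_at[OF bl])
    then show "closed {q. \<Lambda> q = 0}" by (simp add: vimage_def)
    show "tens \<phi> e \<in> {q. \<Lambda> q = 0}" if "test_fun \<phi>" for \<phi> e
      using interaction_tens[OF that ab, of e] by (simp add: \<Lambda>_def inner_diff_left wave_group_adjoint)
  qed
  then show ?thesis by (auto simp: \<Lambda>_def)
qed

end

subsection \<open>Testing in space-time\<close>

text \<open>The primitive of the tent function \<open>hat\<close>: a continuously differentiable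
  step that rises from 0 at 0 to 1 at 1.\<close>

definition smooth_step :: "real \<Rightarrow> real" where
  "smooth_step x = 2 * ((max 0 x)\<^sup>2 - 2 * (max 0 (x - 1/2))\<^sup>2 + (max 0 (x - 1))\<^sup>2)"

text \<open>Tent on the unit interval with peak 2 at 1/2, hence of integral 1.\<close>

definition hat :: "real \<Rightarrow> real" where
  "hat x = 4 * (max 0 x - 2 * max 0 (x - 1/2) + max 0 (x - 1))"

lemma DERIV_max_square_shift: "((\<lambda>x::real. (max 0 (x - c))\<^sup>2) has_real_derivative 2 * max 0 (x - c)) (at x)"
proof -
  have "((\<lambda>x. x - c) has_real_derivative 1) (at x)" by (auto intro!: derivative_eq_intros)
  from DERIV_chain2[OF DERIV_max_square this] show ?thesis by simp
qed

lemma DERIV_smooth_step: "(smooth_step has_real_derivative hat x) (at x)"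
  unfolding smooth_step_def[abs_def] hat_def
  by (rule derivative_eq_intros DERIV_max_square DERIV_max_square_shift refl | simp)+

lemma smooth_step_eq_0: "x \<le> 0 \<Longrightarrow> smooth_step x = 0"
  by (simp add: smooth_step_def)

lemma smooth_step_eq_1: "1 \<le> x \<Longrightarrow> smooth_step x = 1"
  by (simp add: smooth_step_def power2_eq_square algebra_simps)

lemma hat_eq_0: "x \<notin> {0..1} \<Longrightarrow> hat x = 0"
  by (auto simp: hat_def max_def)

lemma hat_bounds: "0 \<le> hat x" "hat x \<le> 2"
  by (auto simp: hat_def max_def)

lemma continuous_hat: "continuous_on S hat"
  unfolding hat_def[abs_def] by (intro continuous_intros)

lemma smooth_step_bounds: "0 \<le> smooth_step x" "smooth_step x \<le> 1"
proof -
  have mono: "smooth_step x \<le> smooth_step y" if "x \<le> y" for x y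
    by (rule DERIV_nonneg_imp_nondecreasing[OF that]) (use DERIV_smooth_step hat_bounds(1) in blast)
  show "0 \<le> smooth_step x" using mono[of "min x 0" x] smooth_step_eq_0[of "min x 0"] by simp
  show "smooth_step x \<le> 1" using mono[of x "max x 1"] smooth_step_eq_1[of "max x 1"] by simp
qed

lemma integral_hat: "(LINT x|lborel. hat x) = 1"
proof -
  have "(LINT x|lborel. hat x) = (LINT x|lborel. indicator {0..1} x *\<^sub>R hat x)"
  proof (intro Bochner_Integration.integral_cong refl)
    fix x :: real show "hat x = indicator {0..1} x *\<^sub>R hat x"
      by (cases "x \<in> {0..1}") (simp_all add: hat_eq_0 del: atLeastAtMost_iff)
  qed
  also have "\<dots> = smooth_step 1 - smooth_step 0"
    by (rule integral_FTC_Icc)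
       (auto simp: has_real_derivative_iff_has_vector_derivative[symmetric] intro: continuous_hat has_field_derivative_at_within[OF DERIV_smooth_step])
  finally show ?thesis by (simp add: smooth_step_eq_0 smooth_step_eq_1)
qed

text \<open>Test against a smoothed indicator function of the interval between \<open>s\<close> and \<open>t\<close>.\<close>

lemma weak_derivative_time:
  fixes a c :: "real \<Rightarrow> real"
  assumes a: "continuous_on UNIV a" and c: "\<And>s t. set_integrable lborel {s..t} c" "c \<in> borel_measurable borel"
    and weak: "\<And>\<omega>. test_fun \<omega> \<Longrightarrow> (LINT r|lborel. a r * pd \<omega> 1 r) = - (LINT r|lborel. c r * \<omega> r)"
    and st: "s \<le> t"
  shows "a t - a s = (LINT r:{s..t}|lborel. c r)"
proof -
  define k where "k n = real (Suc n)" for n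
  have k: "k n \<ge> 1" for n by (simp add: k_def)
  \<comment> \<open>Both ramps lie to the right of their end points, with width
    \<open>1 / k n\<close>, so the pointwise limit is the indicator of the half-open interval
    \<open>{s<..t}\<close>.\<close>
  define \<omega> where "\<omega> n r = smooth_step (k n * (r - s)) - smooth_step (k n * (r - t))" for n r
  define d where "d n r = k n * hat (k n * (r - s)) - k n * hat (k n * (r - t))" for n r
  have der: "(\<omega> n has_real_derivative d n r) (at r)" for n r
  proof -
    have "((\<lambda>r. smooth_step (k n * (r - q))) has_real_derivative k n * hat (k n * (r - q))) (at r)" for q
    proof -
      have "((\<lambda>r. k n * (r - q)) has_real_derivative k n) (at r)" by (auto intro!: derivative_eq_intros)
      from DERIV_chain2[OF DERIV_smooth_step this] show ?thesis by (simp add: mult.commute)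
    qed
    then show ?thesis unfolding \<omega>_def[abs_def] d_def by (intro DERIV_diff)
  qed
  have \<omega>0: "\<omega> n r = 0" if "r \<notin> {s..t+1}" for n r
  proof (cases "r < s")
    case True
    then have "k n * (r - s) \<le> 0" "k n * (r - t) \<le> 0" using k[of n] st by (auto intro!: mult_nonneg_nonpos)
    then show ?thesis by (simp add: \<omega>_def smooth_step_eq_0)
  next
    case False
    then have "r > t + 1" using that by auto
    then have "1 * 1 \<le> k n * (r - s)" "1 * 1 \<le> k n * (r - t)" using k[of n] st by (intro mult_mono; simp)+
    then show ?thesis by (simp add: \<omega>_def smooth_step_eq_1)
  qed
  have dc: "continuous_on UNIV (d n)" for n
    unfolding d_def[abs_def] by (intro continuous_intros continuous_on_compose2[OF continuous_hat]) auto
  have test: "test_fun (\<omega> n)" and pd: "pd (\<omega> n) 1 r = d n r" for n r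
  proof -
    have hd: "(\<omega> n has_derivative (\<lambda>v. d n r * v)) (at r)" for r
      using der[of n r] by (simp add: has_field_derivative_def)
    have "C1 (\<omega> n)" by (rule C1I[OF hd]) (intro continuous_intros dc)
    then show "test_fun (\<omega> n)" unfolding test_fun_iff using \<omega>0 by (intro conjI exI[of _ "{s..t+1}"]) auto
    show "pd (\<omega> n) 1 r = d n r" using pd_eqI[OF hd] by simp
  qed
  \<comment> \<open>The rescaled tents have integral 1 and concentrate at q. The substitution
    \<open>r = q + x / k n\<close> fixes the tent and lets the continuous function a converge
    instead.\<close>
  have lim: "(\<lambda>n. LINT r|lborel. a r * (k n * hat (k n * (r - q)))) \<longlonglongrightarrow> a q"
    and ih: "integrable lborel (\<lambda>r. a r * (k n * hat (k n * (r - q))))" for q n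
  proof -
    have "compact (a ` {q..q+1})" using a by (intro compact_continuous_image) (auto intro: continuous_on_subset)
    then obtain C where C: "\<And>r. r \<in> {q..q+1} \<Longrightarrow> norm (a r) \<le> C" using compact_imp_bounded bounded_iff by (metis imageI)
    have kx: "x / k n \<in> {0..1}" if "x \<in> {0..1}" for x n
      using that k[of n] by (auto simp: field_simps)
    have in': "integrable lborel (\<lambda>x. a (q + x / k n) * hat x)" for n
    proof -
      have "integrable lborel (\<lambda>x. indicator {0..1} x *\<^sub>R (a (q + x / k n) * hat x))"
        by (rule borel_integrable_compact[OF compact_Icc])
           (intro continuous_intros continuous_hat continuous_on_compose2[OF a], use k[of n] in auto)
      moreover have "(\<lambda>x. indicator {0..1} x *\<^sub>R (a (q + x / k n) * hat x)) = (\<lambda>x. a (q + x / k n) * hat x)"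
      proof
        fix x :: real show "indicator {0..1} x *\<^sub>R (a (q + x / k n) * hat x) = a (q + x / k n) * hat x"
          by (cases "x \<in> {0..1}") (simp_all add: hat_eq_0 del: atLeastAtMost_iff)
      qed
      ultimately show ?thesis by (simp only:)
    qed
    have sub: "(\<lambda>x. k n * (a (q + (1 / k n) * x) * hat (k n * ((q + (1 / k n) * x) - q)))) = (\<lambda>x. k n * (a (q + x / k n) * hat x))" for n
      using k[of n] by (auto simp: fun_eq_iff)
    have i0: "integrable lborel (\<lambda>r. k n * (a r * hat (k n * (r - q))))" for n
    proof -
      have "integrable lborel (\<lambda>x. k n * (a (q + (1 / k n) * x) * hat (k n * ((q + (1 / k n) * x) - q))))"
        unfolding sub by (intro integrable_mult_right in')
      then show ?thesis
        using lborel_integrable_real_affine_iff[of "1 / k n" "\<lambda>r. k n * (a r * hat (k n * (r - q)))" q] k[of n] by simp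
    qed
    then show "integrable lborel (\<lambda>r. a r * (k n * hat (k n * (r - q))))" by (simp add: mult.left_commute)
    have e: "(LINT r|lborel. a r * (k n * hat (k n * (r - q)))) = (LINT x|lborel. a (q + x / k n) * hat x)" for n
    proof -
      have "(LINT r|lborel. k n * (a r * hat (k n * (r - q)))) = \<bar>1 / k n\<bar> *\<^sub>R (LINT x|lborel. k n * (a (q + (1 / k n) * x) * hat (k n * ((q + (1 / k n) * x) - q))))"
        using k[of n] by (intro lborel_integral_real_affine) auto
      also have "\<dots> = (LINT x|lborel. a (q + x / k n) * hat x)"
        unfolding sub using k[of n] by simp
      finally show ?thesis by (simp only: mult.left_commute)
    qed
    have "(\<lambda>n. LINT x|lborel. a (q + x / k n) * hat x) \<longlonglongrightarrow> (LINT x|lborel. a q * hat x)"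
    proof (rule integral_dominated_convergence[where w = "\<lambda>x. indicat_real {0..1} x *\<^sub>R (C * 2)"])
      show "AE x in lborel. (\<lambda>n. a (q + x / k n) * hat x) \<longlonglongrightarrow> a q * hat x"
      proof (intro AE_I2 tendsto_mult tendsto_const)
        fix x
        have "(\<lambda>n. q + x * inverse (real (Suc n))) \<longlonglongrightarrow> q + x * 0"
          by (intro tendsto_intros LIMSEQ_inverse_real_of_nat)
        then have "(\<lambda>n. q + x / k n) \<longlonglongrightarrow> q" by (simp add: k_def divide_inverse)
        then show "(\<lambda>n. a (q + x / k n)) \<longlonglongrightarrow> a q" by (intro continuous_on_tendsto_compose[OF a]) auto
      qed
      show "AE x in lborel. norm (a (q + x / k n) * hat x) \<le> indicat_real {0..1} x *\<^sub>R (C * 2)" for n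
      proof (rule AE_I2)
        fix x show "norm (a (q + x / k n) * hat x) \<le> indicat_real {0..1} x *\<^sub>R (C * 2)"
        proof (cases "x \<in> {0..1}")
          case True
          have "norm (a (q + x / k n)) \<le> C" using kx[OF True, of n] by (intro C) auto
          then have "\<bar>a (q + x / k n)\<bar> * \<bar>hat x\<bar> \<le> C * 2" using hat_bounds[of x] by (intro mult_mono) auto
          then show ?thesis using True by (simp add: abs_mult)
        qed (simp add: hat_eq_0)
      qed
      show "(\<lambda>x. a q * hat x) \<in> borel_measurable lborel"
        using borel_measurable_continuous_onI[OF continuous_hat] by simp
      show "(\<lambda>x. a (q + x / k n) * hat x) \<in> borel_measurable lborel" for n using in'[of n] by simp
      show "integrable lborel (\<lambda>x::real. indicat_real {0..1} x *\<^sub>R (C * 2))"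
        by (intro integrable_scaleR_left integrable_real_indicator) auto
    qed
    then show "(\<lambda>n. LINT r|lborel. a r * (k n * hat (k n * (r - q)))) \<longlonglongrightarrow> a q"
      unfolding e using integral_hat by simp
  qed
  have 1: "(\<lambda>n. LINT r|lborel. a r * pd (\<omega> n) 1 r) \<longlonglongrightarrow> a s - a t"
  proof -
    have "(LINT r|lborel. a r * pd (\<omega> n) 1 r) = (LINT r|lborel. a r * (k n * hat (k n * (r - s)))) - (LINT r|lborel. a r * (k n * hat (k n * (r - t))))" for n
    proof -
      have "a r * pd (\<omega> n) 1 r = a r * (k n * hat (k n * (r - s))) - a r * (k n * hat (k n * (r - t)))" for r
        unfolding pd d_def by (rule right_diff_distrib)
      then show ?thesis by (simp only: Bochner_Integration.integral_diff[OF ih ih])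
    qed
    then show ?thesis by (simp only:) (intro tendsto_diff lim)
  qed
  have 2: "(\<lambda>n. LINT r|lborel. c r * \<omega> n r) \<longlonglongrightarrow> (LINT r|lborel. indicat_real {s<..t} r *\<^sub>R c r)"
  proof (rule integral_dominated_convergence[where w = "\<lambda>r. norm (indicat_real {s..t+1} r *\<^sub>R c r)"])
    have [measurable]: "\<omega> n \<in> borel_measurable borel" for n by (rule test_fun_measurable[OF test])
    note [measurable] = c(2)
    show "(\<lambda>r. c r * \<omega> n r) \<in> borel_measurable lborel" for n by measurable
    show "(\<lambda>r. indicat_real {s<..t} r *\<^sub>R c r) \<in> borel_measurable lborel" by measurable
    show "integrable lborel (\<lambda>r. norm (indicat_real {s..t+1} r *\<^sub>R c r))"
      using c(1)[of s "t+1"] unfolding set_integrable_def by (rule integrable_norm)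
    have limk: "filterlim (\<lambda>n. k n * y) at_top sequentially" if "y > 0" for y
    proof -
      have "filterlim k at_top sequentially"
        unfolding k_def by (rule filterlim_compose[OF filterlim_real_sequentially filterlim_Suc])
      then show ?thesis by (rule filterlim_at_top_mult_tendsto_pos[OF tendsto_const that])
    qed
    have ev1: "\<forall>\<^sub>F n in sequentially. smooth_step (k n * y) = 1" if "y > 0" for y
      using limk[OF that] unfolding filterlim_at_top by (elim allE[of _ 1]) (auto elim!: eventually_mono intro: smooth_step_eq_1)
    show "AE r in lborel. (\<lambda>n. c r * \<omega> n r) \<longlonglongrightarrow> indicat_real {s<..t} r *\<^sub>R c r"
    proof (rule AE_I2)
      fix r
      have "\<forall>\<^sub>F n in sequentially. \<omega> n r = indicat_real {s<..t} r"
      proof -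
        consider "r \<le> s" | "s < r" "r \<le> t" | "t < r" using st by linarith
        then show ?thesis
        proof cases
          case 1
          then have "k n * (r - s) \<le> 0" "k n * (r - t) \<le> 0" for n using k[of n] st by (auto intro!: mult_nonneg_nonpos)
          then show ?thesis using 1 by (simp add: \<omega>_def smooth_step_eq_0)
        next
          case 2
          then have "k n * (r - t) \<le> 0" for n using k[of n] by (auto intro!: mult_nonneg_nonpos)
          then show ?thesis using 2 ev1[of "r - s"] by (auto simp: \<omega>_def smooth_step_eq_0)
        next
          case 3
          then have "\<forall>\<^sub>F n in sequentially. smooth_step (k n * (r - s)) = 1" "\<forall>\<^sub>F n in sequentially. smooth_step (k n * (r - t)) = 1"
            using st by (auto intro: ev1)
          then show ?thesis by eventually_elim (use 3 in \<open>simp add: \<omega>_def\<close>)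
        qed
      qed
      then have "(\<lambda>n. \<omega> n r) \<longlonglongrightarrow> indicat_real {s<..t} r" by (rule tendsto_eventually)
      then have "(\<lambda>n. c r * \<omega> n r) \<longlonglongrightarrow> c r * indicat_real {s<..t} r" by (intro tendsto_intros)
      then show "(\<lambda>n. c r * \<omega> n r) \<longlonglongrightarrow> indicat_real {s<..t} r *\<^sub>R c r" by (simp add: mult.commute)
    qed
    show "AE r in lborel. norm (c r * \<omega> n r) \<le> norm (indicat_real {s..t+1} r *\<^sub>R c r)" for n
    proof (rule AE_I2)
      fix r
      have "\<bar>\<omega> n r\<bar> \<le> 1" unfolding \<omega>_def
        using smooth_step_bounds[of "k n * (r - s)"] smooth_step_bounds[of "k n * (r - t)"] by linarith
      then have "\<bar>c r\<bar> * \<bar>\<omega> n r\<bar> \<le> \<bar>c r\<bar> * 1" by (intro mult_left_mono) auto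
      then show "norm (c r * \<omega> n r) \<le> norm (indicat_real {s..t+1} r *\<^sub>R c r)"
        using \<omega>0[of r n] by (auto simp: abs_mult indicator_def)
    qed
  qed
  have "(LINT r|lborel. indicat_real {s<..t} r *\<^sub>R c r) = (LINT r|lborel. indicat_real {s..t} r *\<^sub>R c r)"
  proof (rule integral_cong_AE)
    show "AE r in lborel. indicat_real {s<..t} r *\<^sub>R c r = indicat_real {s..t} r *\<^sub>R c r"
      using AE_lborel_singleton[of s] by eventually_elim (auto simp: indicator_def)
  qed (use c(2) in measurable)
  moreover have "a s - a t = - (LINT r|lborel. indicat_real {s<..t} r *\<^sub>R c r)"
    using LIMSEQ_unique[OF 1[unfolded weak[OF test]] tendsto_minus[OF 2]] .
  ultimately show ?thesis by (simp add: set_lebesgue_integral_def)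
qed

lemma test_fun_prod:
  fixes \<omega> :: "real \<Rightarrow> real" and \<phi> :: "'a::euclidean_space \<Rightarrow> real"
  assumes \<omega>: "test_fun \<omega>" and \<phi>: "test_fun \<phi>"
  shows "test_fun (\<lambda>z. \<omega> (fst z) * \<phi> (snd z))"
    and "pd (\<lambda>z. \<omega> (fst z) * \<phi> (snd z)) (1, 0) z = pd \<omega> 1 (fst z) * \<phi> (snd z)"
    and "pd (\<lambda>z. \<omega> (fst z) * \<phi> (snd z)) (0, v) z = \<omega> (fst z) * pd \<phi> v (snd z)"
proof -
  note C = test_fun_C1[OF \<omega>] and D = test_fun_C1[OF \<phi>]
  have d: "((\<lambda>z. \<omega> (fst z) * \<phi> (snd z)) has_derivative (\<lambda>v. \<omega> (fst z) * pd \<phi> (snd v) (snd z) + pd \<omega> (fst v) (fst z) * \<phi> (snd z))) (at z)" for z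
  proof (rule has_derivative_mult)
    show "((\<lambda>z. \<omega> (fst z)) has_derivative (\<lambda>v. pd \<omega> (fst v) (fst z))) (at z)"
      by (rule has_derivative_compose[OF has_derivative_fst[OF has_derivative_ident] has_derivative_pd[OF C]])
    show "((\<lambda>z. \<phi> (snd z)) has_derivative (\<lambda>v. pd \<phi> (snd v) (snd z))) (at z)"
      by (rule has_derivative_compose[OF has_derivative_snd[OF has_derivative_ident] has_derivative_pd[OF D]])
  qed
  have z0: "pd \<phi> 0 x = 0" "pd \<omega> 0 r = 0" for x r
    using linear_0[OF linear_pd[OF C]] linear_0[OF linear_pd[OF D]] by auto
  show "pd (\<lambda>z. \<omega> (fst z) * \<phi> (snd z)) (1, 0) z = pd \<omega> 1 (fst z) * \<phi> (snd z)"
    "pd (\<lambda>z. \<omega> (fst z) * \<phi> (snd z)) (0, v) z = \<omega> (fst z) * pd \<phi> v (snd z)"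
    unfolding pd_eqI[OF d] by (simp_all add: z0)
  have c: "C1 (\<lambda>z. \<omega> (fst z) * \<phi> (snd z))"
    by (rule C1I[OF d])
       (intro continuous_intros continuous_on_compose2[OF C1_continuous[OF C]] continuous_on_compose2[OF C1_continuous[OF D]]
         continuous_on_compose2[OF C1_continuous_pd[OF C]] continuous_on_compose2[OF C1_continuous_pd[OF D]], auto)
  obtain K where K: "compact K" "\<And>x. x \<notin> K \<Longrightarrow> \<omega> x = 0" by (rule test_fun_support[OF \<omega>]) blast
  obtain K' where K': "compact K'" "\<And>x. x \<notin> K' \<Longrightarrow> \<phi> x = 0" by (rule test_fun_support[OF \<phi>]) blast
  show "test_fun (\<lambda>z. \<omega> (fst z) * \<phi> (snd z))"
    unfolding test_fun_iff
  proof (intro conjI exI[of _ "K \<times> K'"] allI impI)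
    show "compact (K \<times> K')" by (rule compact_Times[OF K(1) K'(1)])
    show "\<omega> (fst z) * \<phi> (snd z) = 0" if "z \<notin> K \<times> K'" for z
      using that K(2)[of "fst z"] K'(2)[of "snd z"] by (cases z) auto
  qed (rule c)
qed

subsection \<open>The energy space as a space of states\<close>

text \<open>As \<open>D\<^sub>t = - \<i> \<partial>\<^sub>t\<close>, the second component of an energy pair is multiplied by \<open>\<i>\<close> to give \<open>\<partial>\<^sub>t u\<close>.\<close>

definition state_of :: "('n::finite) epair \<Rightarrow> 'n state" where
  "state_of p = cls (\<lambda>x. (gradf (fst p) x, \<i> * snd p x))"

lemma gradf_props:
  assumes "Hdot1 f"
  shows "weak_grad f (gradf f)" "sqint (\<lambda>x. gradf f x $ j)"
proof -
  have "weak_grad f (gradf f) \<and> (\<forall>j. L2fun (\<lambda>x. gradf f x $ j))"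
    using someI_ex[OF assms[unfolded Hdot1_def]] unfolding gradf_def .
  then show "weak_grad f (gradf f)" "sqint (\<lambda>x. gradf f x $ j)" by (auto simp: L2fun_iff)
qed

lemma norm_pair_sq: "(norm (a :: complex^'n, b :: complex))\<^sup>2 = (\<Sum>j\<in>UNIV. (cmod (a $ j))\<^sup>2) + (cmod b)\<^sup>2"
  by (simp add: norm_Pair norm_vec_def L2_set_def sum_nonneg)

lemma vec_measurable:
  fixes g :: "'a \<Rightarrow> complex^'n"
  assumes "\<And>j. (\<lambda>x. g x $ j) \<in> borel_measurable M"
  shows "g \<in> borel_measurable M"
  unfolding borel_measurable_euclidean_space[of g]
proof
  fix i :: "complex^'n" assume "i \<in> Basis"
  then obtain j b where "i = axis j b" by (auto simp: Basis_vec_def)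
  then have "(\<lambda>x. g x \<bullet> i) = (\<lambda>x. g x $ j \<bullet> b)" by (simp add: inner_axis)
  then show "(\<lambda>x. g x \<bullet> i) \<in> borel_measurable M"
    using borel_measurable_inner[OF assms[of j] borel_measurable_const[of b]] by simp
qed

lemma sqint_pair:
  fixes g :: "real^'n \<Rightarrow> complex^'n"
  assumes g: "\<And>j. sqint (\<lambda>x. g x $ j)" and w: "sqint w"
  shows "sqint (\<lambda>x. (g x, \<i> * w x))"
proof (rule sqintI[where g = "\<lambda>x. (\<Sum>j\<in>UNIV. (cmod (g x $ j))\<^sup>2) + (cmod (w x))\<^sup>2"])
  note [measurable] = sqint_measurable[OF w]
  have [measurable]: "g \<in> borel_measurable borel" by (rule vec_measurable) (rule sqint_measurable[OF g])
  show "(\<lambda>x. (g x, \<i> * w x)) \<in> borel_measurable lborel" by measurable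
  show "integrable lborel (\<lambda>x. (\<Sum>j\<in>UNIV. (cmod (g x $ j))\<^sup>2) + (cmod (w x))\<^sup>2)"
    using g w by (intro Bochner_Integration.integrable_add Bochner_Integration.integrable_sum) (auto simp: sqint_def)
  show "(norm (g x, \<i> * w x))\<^sup>2 \<le> (\<Sum>j\<in>UNIV. (cmod (g x $ j))\<^sup>2) + (cmod (w x))\<^sup>2" for x
    by (simp add: norm_pair_sq norm_mult)
qed

lemma in_E_sqint:
  assumes "in_E p" shows "sqint (\<lambda>x. (gradf (fst p) x, \<i> * snd p x))"
  using assms by (intro sqint_pair gradf_props) (auto simp: in_E_def L2fun_iff)

lemma enorm_eq_norm:
  assumes p: "in_E p" shows "enorm p = norm (state_of p)"
proof -
  have g: "sqint (\<lambda>x. gradf (fst p) x $ j)" for j using p by (intro gradf_props) (simp add: in_E_def)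
  have w: "sqint (snd p)" using p by (simp add: in_E_def L2fun_iff)
  have "(LINT x|lborel. (norm (gradf (fst p) x, \<i> * snd p x))\<^sup>2)
    = (LINT x|lborel. (\<Sum>j\<in>UNIV. (cmod (gradf (fst p) x $ j))\<^sup>2) + (cmod (snd p x))\<^sup>2)"
    by (simp add: norm_pair_sq norm_mult)
  also have "\<dots> = (LINT x|lborel. (\<Sum>j\<in>UNIV. (cmod (gradf (fst p) x $ j))\<^sup>2)) + (LINT x|lborel. (cmod (snd p x))\<^sup>2)"
    using g w by (intro Bochner_Integration.integral_add Bochner_Integration.integrable_sum) (auto simp: sqint_def)
  finally show ?thesis unfolding state_of_def norm_cls[OF in_E_sqint[OF p]] enorm_def by simp
qed

text \<open>The gradient picked by choice in \<open>gradf\<close> may be replaced by any square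
  integrable weak gradient, since weak gradients agree almost everywhere.\<close>

lemma state_of_eqI:
  assumes p: "in_E p" and g: "weak_grad (fst p) g" "\<And>j. sqint (\<lambda>x. g x $ j)"
  shows "state_of p = cls (\<lambda>x. (g x, \<i> * snd p x))"
proof -
  have "AE x in lborel. gradf (fst p) x = g x"
    using p by (intro weak_grad_unique[OF gradf_props(1) g(1)]) (simp add: in_E_def)
  moreover have "sqint (\<lambda>x. (g x, \<i> * snd p x))" using p g by (intro sqint_pair) (auto simp: in_E_def L2fun_iff)
  ultimately show ?thesis
    unfolding state_of_def using in_E_sqint[OF p] by (subst cls_eq_iff) (auto elim: eventually_mono)
qed

lemma state_of_gradient: "in_E p \<Longrightarrow> state_of p \<in> gradient_states"
  unfolding state_of_def by (subst gradient_states_cls[OF in_E_sqint]) (auto intro!: gradf_props simp: in_E_def)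

text \<open>A potential of the first component exists by definition of
  \<open>gradient_states\<close>; the factor \<open>- \<i>\<close> undoes the factor that
  \<open>state_of\<close> puts on the second one.\<close>

lemma state_of_surj:
  assumes "F \<in> gradient_states" shows "\<exists>p. in_E p \<and> state_of p = F"
proof -
  obtain f where f: "weak_grad f (\<lambda>x. fst (rep F x))" using assms by (auto simp: gradient_states_def)
  have s: "sqint (\<lambda>x. fst (rep F x) $ j)" for j by (rule sqint_fst_nth(1)) simp
  have "sqint (\<lambda>x. - \<i> * snd (rep F x))"
    by (rule sqint_linear[OF sqint_rep]) (rule bounded_linear_compose[OF bounded_linear_mult_right bounded_linear_snd])
  then have p: "in_E (f, \<lambda>x. - \<i> * snd (rep F x))"
    using f s by (auto simp: in_E_def Hdot1_def L2fun_iff)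
  have "state_of (f, \<lambda>x. - \<i> * snd (rep F x)) = F"
    by (subst state_of_eqI[OF p]) (use f s in \<open>auto simp: mult.assoc[symmetric]\<close>)
  then show ?thesis using p by blast
qed

text \<open>Complex scalars acting on the real Hilbert space of states, expressed through
  \<open>Imul\<close> so that real linear maps commuting with \<open>Imul\<close> visibly respect
  them.\<close>

definition cmul :: "complex \<Rightarrow> ('n::finite) state \<Rightarrow> 'n state" where
  "cmul a F = Re a *\<^sub>R F + Im a *\<^sub>R Imul F"

lemma cmul_cls:
  assumes f: "sqint f"
  shows "cmul a (cls f) = cls (\<lambda>x. Re a *\<^sub>R f x + Im a *\<^sub>R imul (f x))"
  using sqint_linear[OF f bounded_linear_imul] f
  by (simp add: cmul_def Imul_def lmap_cls bounded_linear_imul cls_add cls_scaleR sqint_scaleR)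

lemma elin_state:
  assumes p: "in_E p" and q: "in_E q"
  shows in_E_elin: "in_E (elin a p c q)" and "state_of (elin a p c q) = cmul a (state_of p) + cmul c (state_of q)"
proof -
  define g where "g x = (\<chi> j. a * (gradf (fst p) x $ j) + c * (gradf (fst q) x $ j))" for x
  have h: "Hdot1 (fst p)" "Hdot1 (fst q)" and w: "sqint (snd p)" "sqint (snd q)" using p q by (auto simp: in_E_def L2fun_iff)
  have wg: "weak_grad (\<lambda>x. a * fst p x + c * fst q x) g"
    unfolding g_def[abs_def] by (rule weak_grad_lin[OF gradf_props(1)[OF h(1)] gradf_props(1)[OF h(2)]])
  have cm: "sqint (\<lambda>x. a * f x)" if "sqint f" for f :: "real^'a \<Rightarrow> complex" and a
    by (rule sqint_linear[OF that bounded_linear_mult_right])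
  have gs: "sqint (\<lambda>x. g x $ j)" for j
    unfolding g_def by (simp, intro sqint_add cm gradf_props h)
  show E: "in_E (elin a p c q)"
    unfolding in_E_def elin_def Hdot1_def L2fun_iff using wg gs by (auto intro!: sqint_add cm w)
  have "state_of (elin a p c q) = cls (\<lambda>x. (g x, \<i> * snd (elin a p c q) x))"
    by (rule state_of_eqI[OF E _ gs]) (simp add: elin_def wg)
  also have "\<dots> = cls (\<lambda>x. (Re a *\<^sub>R (gradf (fst p) x, \<i> * snd p x) + Im a *\<^sub>R imul (gradf (fst p) x, \<i> * snd p x))
     + (Re c *\<^sub>R (gradf (fst q) x, \<i> * snd q x) + Im c *\<^sub>R imul (gradf (fst q) x, \<i> * snd q x)))"
    by (intro arg_cong[where f = cls] ext) (simp add: elin_def g_def imul_def vec_eq_iff complex_eq_iff algebra_simps)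
  also have "\<dots> = cmul a (state_of p) + cmul c (state_of q)"
    unfolding state_of_def cmul_cls[OF in_E_sqint[OF p]] cmul_cls[OF in_E_sqint[OF q]]
    by (intro cls_add sqint_add sqint_scaleR sqint_linear[OF _ bounded_linear_imul] in_E_sqint p q)
  finally show "state_of (elin a p c q) = cmul a (state_of p) + cmul c (state_of q)" .
qed

lemma ediff_state:
  assumes "in_E p" "in_E q"
  shows "in_E (ediff p q)" "enorm (ediff p q) = norm (state_of p - state_of q)"
  using elin_state[OF assms, of 1 "-1"] by (simp_all add: ediff_def enorm_eq_norm cmul_def)

subsection \<open>The damping term\<close>

definition mulop :: "(real^'n \<Rightarrow> complex) \<Rightarrow> ('n::finite) state \<Rightarrow> 'n state" where
  "mulop m F = cls (\<lambda>x. (0, m x * snd (rep F x)))"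

lemma snd_measurable:
  fixes f :: "'a \<Rightarrow> 'b::euclidean_space \<times> 'c::euclidean_space"
  assumes "f \<in> borel_measurable M" shows "(\<lambda>x. snd (f x)) \<in> borel_measurable M"
  using measurable_compose[OF assms borel_measurable_continuous_onI[OF continuous_on_snd[OF continuous_on_id]]] .

lemma sqint_mul:
  fixes f :: "real^'n \<Rightarrow> (complex^'n) \<times> complex"
  assumes f: "sqint f" and [measurable]: "m \<in> borel_measurable borel" and B: "\<And>x. cmod (m x) \<le> B"
  shows "sqint (\<lambda>x. (0 :: complex^'n, m x * snd (f x)))"
proof (rule sqintI[where g = "\<lambda>x. B\<^sup>2 * (norm (f x))\<^sup>2"])
  have [measurable]: "(\<lambda>x. snd (f x)) \<in> borel_measurable borel" by (rule snd_measurable[OF sqint_measurable[OF f]])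
  show "(\<lambda>x. (0 :: complex^'n, m x * snd (f x))) \<in> borel_measurable lborel" by measurable
  show "integrable lborel (\<lambda>x. B\<^sup>2 * (norm (f x))\<^sup>2)" using f by (simp add: sqint_def)
  show "(norm (0 :: complex^'n, m x * snd (f x)))\<^sup>2 \<le> B\<^sup>2 * (norm (f x))\<^sup>2" for x
  proof -
    have "cmod (m x) * cmod (snd (f x)) \<le> B * norm (f x)"
      using norm_snd_le[of "snd (f x)" "fst (f x)"] B[of x] by (intro mult_mono) (auto intro: order_trans[OF norm_ge_zero])
    then have "(cmod (m x) * cmod (snd (f x)))\<^sup>2 \<le> (B * norm (f x))\<^sup>2" by (intro power_mono) auto
    then show ?thesis by (simp add: norm_pair_sq norm_mult power_mult_distrib)
  qed
qed

lemma mulop_cls: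
  assumes f: "sqint f" and m: "m \<in> borel_measurable borel" "\<And>x. cmod (m x) \<le> B"
  shows "mulop m (cls f) = cls (\<lambda>x. (0, m x * snd (f x)))"
proof -
  have "AE x in lborel. (0 :: complex^'n, m x * snd (rep (cls f) x)) = (0, m x * snd (f x))"
    using rep_cls[OF f] by (auto elim: eventually_mono)
  then show ?thesis unfolding mulop_def using sqint_mul[OF f m] sqint_mul[OF sqint_rep m] by (subst cls_eq_iff) auto
qed

lemma bounded_linear_mulop:
  assumes m: "m \<in> borel_measurable borel" "\<And>x. cmod (m x) \<le> B"
  shows "bounded_linear (mulop m)" "norm (mulop m F) \<le> B * norm F"
proof -
  have B0: "0 \<le> B" using order_trans[OF norm_ge_zero m(2)] .
  have n: "norm (mulop m F) \<le> B * norm F" for F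
  proof (cases F)
    fix f assume f: "sqint f" "F = cls f"
    have "(norm (mulop m F))\<^sup>2 = (LINT x|lborel. (norm (0 :: complex^'a, m x * snd (f x)))\<^sup>2)"
      by (simp only: f mulop_cls[OF f(1) m] norm_cls_sq[OF sqint_mul[OF f(1) m]])
    also have "\<dots> \<le> (LINT x|lborel. B\<^sup>2 * (norm (f x))\<^sup>2)"
    proof (rule integral_mono)
      show "integrable lborel (\<lambda>x. (norm (0 :: complex^'a, m x * snd (f x)))\<^sup>2)" using sqint_mul[OF f(1) m] by (simp add: sqint_def)
      show "integrable lborel (\<lambda>x. B\<^sup>2 * (norm (f x))\<^sup>2)" using f by (simp add: sqint_def)
      fix x
      have "cmod (m x) * cmod (snd (f x)) \<le> B * norm (f x)"
        using norm_snd_le[of "snd (f x)" "fst (f x)"] m(2)[of x] B0 by (intro mult_mono) auto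
      then have "(cmod (m x) * cmod (snd (f x)))\<^sup>2 \<le> (B * norm (f x))\<^sup>2" by (intro power_mono) auto
      then show "(norm (0 :: complex^'a, m x * snd (f x)))\<^sup>2 \<le> B\<^sup>2 * (norm (f x))\<^sup>2"
        by (simp add: norm_pair_sq norm_mult power_mult_distrib)
    qed
    also have "\<dots> = (B * norm F)\<^sup>2" by (simp add: f norm_cls_sq power_mult_distrib)
    finally show ?thesis by (rule power2_le_imp_le) (simp add: B0)
  qed
  show "norm (mulop m F) \<le> B * norm F" by (rule n)
  show "bounded_linear (mulop m)"
  proof (rule bounded_linear_intro[where K = B])
    fix F G :: "'a state" and c :: real
    obtain f g where f: "sqint f" "F = cls f" and g: "sqint g" "G = cls g" by (cases F, cases G) blast
    show "mulop m (F + G) = mulop m F + mulop m G"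
      by (simp add: f g cls_add[symmetric] sqint_add mulop_cls[OF _ m] sqint_mul[OF _ m] distrib_left)
    show "mulop m (c *\<^sub>R F) = c *\<^sub>R mulop m F"
      by (simp add: f cls_scaleR[symmetric] sqint_scaleR mulop_cls[OF _ m] sqint_mul[OF _ m])
    show "norm (mulop m F) \<le> norm F * B" using n[of F] by (simp add: mult.commute)
  qed
qed

text \<open>In first order form the damping is the term \<open>- b z\<close> in the equation for the
  second component z; the gradient component receives none.\<close>

definition damping :: "(real \<times> (real^'n) \<Rightarrow> complex) \<Rightarrow> real \<Rightarrow> ('n::finite) state \<Rightarrow> 'n state \<Rightarrow> real" where
  "damping b s F G = - (mulop (\<lambda>x. b (s, x)) F \<bullet> G)"

text \<open>The bound is demanded at every point and not only almost everywhere, so that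
  multiplication by b is a bounded operator at every single time.\<close>

locale damped =
  fixes b :: "real \<times> (real^'n) \<Rightarrow> complex" and \<beta> :: "real \<Rightarrow> real"
  assumes b_meas [measurable]: "b \<in> borel_measurable borel"
    and b_bound: "\<And>s x. cmod (b (s, x)) \<le> \<beta> s"
    and \<beta>_int: "integrable lborel \<beta>"
begin

lemma \<beta>_nonneg: "0 \<le> \<beta> s"
  using order_trans[OF norm_ge_zero b_bound] .

lemma b_section: "(\<lambda>x. b (s, x)) \<in> borel_measurable borel"
  by measurable

lemma damping_cls:
  assumes f: "sqint f" and g: "sqint g"
  shows "damping b s (cls f) (cls g) = - (LINT x|lborel. (b (s, x) * snd (f x)) \<bullet> snd (g x))"
  unfolding damping_def mulop_cls[OF f b_section b_bound] cls_inner[OF sqint_mul[OF f b_section b_bound] g]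
  by (simp add: inner_prod_def)

lemma damping_bilinear: "bounded_bilinear (damping b s)"
proof -
  have "bounded_linear (\<lambda>F. - mulop (\<lambda>x. b (s, x)) F :: 'n state)"
    by (intro bounded_linear_minus bounded_linear_mulop[OF b_section b_bound])
  from bounded_bilinear.comp[OF bounded_bilinear_inner this bounded_linear_ident]
  show ?thesis by (simp add: damping_def[abs_def])
qed

lemma damping_bound: "\<bar>damping b s F G\<bar> \<le> \<beta> s * norm F * norm G"
proof -
  have "\<bar>damping b s F G\<bar> \<le> norm (mulop (\<lambda>x. b (s, x)) F) * norm G"
    unfolding damping_def using Cauchy_Schwarz_ineq2 by simp
  also have "\<dots> \<le> \<beta> s * norm F * norm G"
    by (intro mult_right_mono bounded_linear_mulop(2)[OF b_section b_bound]) auto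
  finally show ?thesis .
qed

lemma damping_measurable: "(\<lambda>s. damping b s F G) \<in> borel_measurable borel"
proof (cases F, cases G)
  fix f g assume *: "sqint f" "F = cls f" "sqint g" "G = cls g"
  note [measurable] = *(1,3)[THEN sqint_measurable, THEN snd_measurable]
  have "(\<lambda>(s, x). (b (s, x) * snd (f x)) \<bullet> snd (g x)) \<in> borel_measurable (borel \<Otimes>\<^sub>M borel)" by measurable
  then have "(\<lambda>(s, x). (b (s, x) * snd (f x)) \<bullet> snd (g x)) \<in> borel_measurable (lborel \<Otimes>\<^sub>M lborel)"
    by (simp add: lborel_prod borel_prod)
  from lborel.borel_measurable_lebesgue_integral[OF this] show ?thesis by (simp add: * damping_cls)
qed

text \<open>Multiplication by b is complex linear, so \<open>Imul\<close> passes through it; the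
  sign comes from the skewness of \<open>Imul\<close>.\<close>

lemma damping_Imul: "damping b s (Imul F) G = - damping b s F (Imul G)"
proof -
  have "mulop (\<lambda>x. b (s, x)) (Imul F) = Imul (mulop (\<lambda>x. b (s, x)) F)"
  proof (cases F)
    fix f assume f: "sqint f" "F = cls f"
    show ?thesis
      by (simp add: f Imul_def lmap_cls bounded_linear_imul sqint_linear mulop_cls[OF _ b_section b_bound] sqint_mul[OF _ b_section b_bound])
         (simp add: imul_def zero_vec_def mult.left_commute)
  qed
  moreover have "Imul F \<bullet> G = - (F \<bullet> Imul G)" for F G :: "'n state"
    using skew_Imul[where 'n = 'n] unfolding skew_def by blast
  ultimately show ?thesis by (simp add: damping_def)
qed

end

subsection \<open>The damped wave equation as a first order system\<close>

lemma integrable_innerI: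
  fixes f :: "'a \<Rightarrow> 'b::euclidean_space"
  assumes "\<And>e. integrable M (\<lambda>x. f x \<bullet> e)" shows "integrable M f"
proof -
  have "integrable M (\<lambda>x. \<Sum>e\<in>Basis. (f x \<bullet> e) *\<^sub>R e)"
    using assms by (intro Bochner_Integration.integrable_sum integrable_scaleR_left) auto
  then show ?thesis by (simp add: euclidean_representation)
qed

lemma sqint_norm:
  assumes "sqint f" shows "sqint (\<lambda>x. norm (f x))" "norm (cls (\<lambda>x. norm (f x))) = norm (cls f)"
proof -
  show s: "sqint (\<lambda>x. norm (f x))" using assms by (auto simp: sqint_def)
  show "norm (cls (\<lambda>x. norm (f x))) = norm (cls f)" using s assms by (simp add: norm_cls)
qed

lemma integral_abs_inner_le:
  assumes f: "sqint f" and g: "sqint g"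
  shows "(LINT x|lborel. \<bar>f x \<bullet> g x\<bar>) \<le> norm (cls f) * norm (cls g)"
proof -
  have "(LINT x|lborel. \<bar>f x \<bullet> g x\<bar>) \<le> (LINT x|lborel. norm (f x) \<bullet> norm (g x))"
    using sqint_inner[OF f g] sqint_inner[OF sqint_norm(1)[OF f] sqint_norm(1)[OF g]]
    by (intro integral_mono) (auto intro: Cauchy_Schwarz_ineq2)
  also have "\<dots> = cls (\<lambda>x. norm (f x)) \<bullet> cls (\<lambda>x. norm (g x))" by (rule cls_inner[OF sqint_norm(1) sqint_norm(1), OF f g, symmetric])
  also have "\<dots> \<le> norm (cls f) * norm (cls g)"
    using norm_cauchy_schwarz[of "cls (\<lambda>x. norm (f x))" "cls (\<lambda>x. norm (g x))"] by (simp add: sqint_norm f g)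
  finally show ?thesis .
qed

text \<open>Fubini for product test functions: an integral over space-time becomes a time integral
  of inner products of states. By Cauchy-Schwarz in x the slices are dominated by
  \<open>N t\<close>, so integrability in time of \<open>\<omega> t * N t\<close> is all that
  remains to be assumed.\<close>

lemma spacetime_pairing:
  fixes f :: "real \<times> 'a::euclidean_space \<Rightarrow> 'b::euclidean_space"
  assumes fm: "f \<in> borel_measurable borel" and f: "\<And>t. sqint (\<lambda>x. f (t, x))"
    and N: "\<And>t. norm (cls (\<lambda>x. f (t, x))) \<le> N t" "integrable lborel (\<lambda>t. \<omega> t * N t)"
    and [measurable]: "\<omega> \<in> borel_measurable borel" "\<phi> \<in> borel_measurable borel"
    and \<phi>: "sqint (\<lambda>x. \<phi> x *\<^sub>R e)"
  shows "integrable lborel (\<lambda>z. (f z \<bullet> e) * (\<omega> (fst z) * \<phi> (snd z)))"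
    and "(LINT z|lborel. (f z \<bullet> e) * (\<omega> (fst z) * \<phi> (snd z)))
      = (LINT t|lborel. (cls (\<lambda>x. f (t, x)) \<bullet> tens \<phi> e) * \<omega> t)"
proof -
  let ?g = "\<lambda>z. (f z \<bullet> e) * (\<omega> (fst z) * \<phi> (snd z))"
  have [measurable]: "f \<in> borel_measurable (borel \<Otimes>\<^sub>M borel)" by (simp add: borel_prod fm)
  have gm: "?g \<in> borel_measurable (borel \<Otimes>\<^sub>M borel)" by measurable
  then have m: "?g \<in> borel_measurable (lborel \<Otimes>\<^sub>M lborel)" by (simp add: lborel_prod borel_prod)
  have e: "(f (t, x) \<bullet> e) * (\<omega> t * \<phi> x) = \<omega> t * (f (t, x) \<bullet> (\<phi> x *\<^sub>R e))" for t x by simp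
  have i: "integrable (lborel \<Otimes>\<^sub>M lborel) ?g"
  proof (rule lborel_pair.Fubini_integrable[OF m])
    have "(LINT x|lborel. norm (?g (t, x))) \<le> norm (\<omega> t * N t) * norm (tens \<phi> e)" for t
    proof -
      have "(LINT x|lborel. norm (?g (t, x))) = \<bar>\<omega> t\<bar> * (LINT x|lborel. \<bar>f (t, x) \<bullet> (\<phi> x *\<^sub>R e)\<bar>)"
        by (simp add: abs_mult mult_ac)
      also have "\<dots> \<le> \<bar>\<omega> t\<bar> * (norm (cls (\<lambda>x. f (t, x))) * norm (tens \<phi> e))"
        unfolding tens_def by (intro mult_left_mono integral_abs_inner_le f \<phi>) auto
      also have "\<dots> \<le> \<bar>\<omega> t\<bar> * (\<bar>N t\<bar> * norm (tens \<phi> e))"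
        by (intro mult_left_mono mult_right_mono order_trans[OF N(1)]) auto
      finally show ?thesis by (simp add: abs_mult)
    qed
    then show "integrable lborel (\<lambda>t. LINT x|lborel. norm (?g (t, x)))"
      by (intro Bochner_Integration.integrable_bound[OF integrable_mult_left[OF integrable_norm[OF N(2)], of "norm (tens \<phi> e)"]]
          lborel.borel_measurable_lebesgue_integral)
         (use m in \<open>auto simp: Bochner_Integration.integral_nonneg order_trans[OF _ abs_ge_self]\<close>)
    show "AE t in lborel. integrable lborel (\<lambda>x. ?g (t, x))"
      using sqint_inner[OF f \<phi>] unfolding fst_conv snd_conv e by simp
  qed
  then show "integrable lborel ?g" by (simp add: lborel_prod)
  have "(LINT z|lborel. ?g z) = (LINT t|lborel. LINT x|lborel. ?g (t, x))"
    using lborel_pair.integral_fst'[OF i] by (simp add: lborel_prod)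
  also have "\<dots> = (LINT t|lborel. (cls (\<lambda>x. f (t, x)) \<bullet> tens \<phi> e) * \<omega> t)"
    unfolding tens_def cls_inner[OF f \<phi>] fst_conv snd_conv e by (simp add: mult_ac)
  finally show "(LINT z|lborel. ?g z) = \<dots>" .
qed

lemma integrable_test_mult:
  fixes c :: "real \<Rightarrow> real"
  assumes c: "\<And>s t. set_integrable lborel {s..t} c" and [measurable]: "\<omega> \<in> borel_measurable borel"
    and K: "compact K" "\<And>x. \<bar>\<omega> x\<bar> \<le> C * indicat_real K x"
  shows "integrable lborel (\<lambda>t. \<omega> t * c t)"
proof -
  obtain a where a: "K \<subseteq> {-a..a}" using compact_imp_bounded[OF K(1)] bounded_subset_cbox_symmetric by (metis cbox_interval)
  have "integrable lborel (\<lambda>t. \<omega> t * (indicat_real {-a..a} t *\<^sub>R c t))"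
  proof (rule Bochner_Integration.integrable_bound[OF integrable_mult_right[OF integrable_norm[OF c[of "-a" a, unfolded set_integrable_def]], of "\<bar>C\<bar>"]])
    show "(\<lambda>t. \<omega> t * (indicat_real {-a..a} t *\<^sub>R c t)) \<in> borel_measurable lborel"
      using borel_measurable_integrable[OF c[of "-a" a, unfolded set_integrable_def]] by measurable
    have "\<bar>\<omega> t\<bar> \<le> \<bar>C\<bar>" for t using K(2)[of t] by (cases "t \<in> K") auto
    then show "AE t in lborel. norm (\<omega> t * (indicat_real {-a..a} t *\<^sub>R c t)) \<le> norm (\<bar>C\<bar> * norm (indicat_real {-a..a} t *\<^sub>R c t))"
      by (intro AE_I2) (auto simp: abs_mult intro!: mult_right_mono)
  qed
  moreover have "\<omega> t * (indicat_real {-a..a} t *\<^sub>R c t) = \<omega> t * c t" for t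
    using a K(2)[of t] by (cases "t \<in> K"; cases "t \<in> {-a..a}") auto
  ultimately show ?thesis by (simp only:)
qed

lemma tens_shift_continuous:
  fixes \<phi> :: "'a::euclidean_space \<Rightarrow> real" and e :: "'b::euclidean_space"
  assumes \<phi>: "test_fun \<phi>"
  shows "continuous_on UNIV (\<lambda>\<sigma>. tens (\<lambda>x. \<phi> (x - \<sigma> *\<^sub>R h)) e)"
proof (rule continuous_on_sequentiallyI)
  fix \<tau> :: "nat \<Rightarrow> real" and \<sigma> assume "\<tau> \<longlonglongrightarrow> \<sigma>"
  then have d: "(\<lambda>m. \<tau> m - \<sigma>) \<longlonglongrightarrow> 0" by (rule LIM_zero)
  \<comment> \<open>\<open>tens_shift_tendsto\<close> asks for shifts of modulus at most 1; the
    truncation changes only finitely many members of the sequence.\<close>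
  define \<eta> where "\<eta> m = (if \<bar>\<tau> m - \<sigma>\<bar> \<le> 1 then \<tau> m - \<sigma> else 0)" for m
  have ev: "\<forall>\<^sub>F m in sequentially. \<tau> m - \<sigma> = \<eta> m"
    using tendstoD[OF d, of 1] by (auto simp: \<eta>_def dist_real_def elim!: eventually_mono)
  have \<eta>: "\<eta> \<longlonglongrightarrow> 0" by (rule Lim_transform_eventually[OF d ev])
  have t: "test_fun (\<lambda>x. \<phi> (x - \<sigma> *\<^sub>R h))" using test_fun_translate(1)[OF \<phi>, of "- (\<sigma> *\<^sub>R h)"] by simp
  have "(\<lambda>m. tens (\<lambda>x. \<phi> (x - \<eta> m *\<^sub>R h - \<sigma> *\<^sub>R h)) e) \<longlonglongrightarrow> tens (\<lambda>x. \<phi> (x - \<sigma> *\<^sub>R h)) e"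
    by (rule tens_shift_tendsto[OF t \<eta>]) (simp add: \<eta>_def)
  then show "(\<lambda>m. tens (\<lambda>x. \<phi> (x - \<tau> m *\<^sub>R h)) e) \<longlonglongrightarrow> tens (\<lambda>x. \<phi> (x - \<sigma> *\<^sub>R h)) e"
  proof (rule Lim_transform_eventually)
    show "\<forall>\<^sub>F m in sequentially. tens (\<lambda>x. \<phi> (x - \<eta> m *\<^sub>R h - \<sigma> *\<^sub>R h)) e = tens (\<lambda>x. \<phi> (x - \<tau> m *\<^sub>R h)) e"
      using ev
    proof eventually_elim
      case (elim m)
      have "x - \<eta> m *\<^sub>R h - \<sigma> *\<^sub>R h = x - \<tau> m *\<^sub>R h" for x
        unfolding elim[symmetric] by (simp add: algebra_simps)
      then show ?case by (simp only:)
    qed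
  qed
qed

lemma test_fun_diff: "test_fun \<phi> \<Longrightarrow> test_fun \<psi> \<Longrightarrow> test_fun (\<lambda>x. \<phi> x - \<psi> x)"
proof -
  assume a: "test_fun \<phi>" "test_fun \<psi>"
  obtain K where K: "compact K" "\<And>x. x \<notin> K \<Longrightarrow> \<phi> x = 0" by (rule test_fun_support[OF a(1)]) blast
  obtain L where L: "compact L" "\<And>x. x \<notin> L \<Longrightarrow> \<psi> x = 0" by (rule test_fun_support[OF a(2)]) blast
  note C = a[THEN test_fun_C1]
  have "C1 (\<lambda>x. \<phi> x - \<psi> x)"
    by (rule C1I[OF has_derivative_diff[OF C[THEN has_derivative_pd]]])
       (intro continuous_intros C[THEN C1_continuous_pd])
  moreover have "compact (K \<union> L)" using K L by (rule_tac compact_Un)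
  ultimately show ?thesis unfolding test_fun_iff using K L by (intro conjI exI[of _ "K \<union> L"]) auto
qed

lemma norm_tens_shift: "test_fun \<phi> \<Longrightarrow> norm (tens (\<lambda>x. \<phi> (x - h)) e) = norm (tens \<phi> e)"
  using tens_translate[of \<phi> "- h" e] norm_tr[of "- h" "tens \<phi> e"] by simp

lemma inner_complex_of_real: "(a * complex_of_real r) \<bullet> \<xi> = (a \<bullet> \<xi>) * r"
  by (simp add: inner_complex_def algebra_simps)

section \<open>The path of states of an energy solution\<close>

locale energy_curve = damped b \<beta> for b :: "real \<times> (real^('n::finite)) \<Rightarrow> complex" and \<beta> +
  fixes u w :: "real \<Rightarrow> real^'n \<Rightarrow> complex" and G :: "real \<Rightarrow> real^'n \<Rightarrow> complex^'n"
  assumes u_loc: "locally_integrable (\<lambda>z. u (fst z) (snd z))"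
    and w_meas: "(\<lambda>z. w (fst z) (snd z)) \<in> borel_measurable borel"
    and G_meas: "(\<lambda>z. G (fst z) (snd z)) \<in> borel_measurable borel"
    and uw: "\<And>t. in_E (u t, w t)" and grad: "\<And>t. weak_grad (u t) (G t)" and G2: "\<And>t j. sqint (\<lambda>x. G t x $ j)"
    and curve: "\<And>t0. ((\<lambda>t. enorm (ediff (u t, w t) (u t0, w t0))) \<longlongrightarrow> 0) (at t0)"
    and weak_u: "\<And>\<psi>. test_fun \<psi> \<Longrightarrow>
        (\<integral>z. u (fst z) (snd z) * complex_of_real (pd \<psi> (1, 0) z) \<partial>lborel)
        = - (\<integral>z. \<i> * w (fst z) (snd z) * complex_of_real (\<psi> z) \<partial>lborel)"
    and weak_w: "\<And>\<psi>. test_fun \<psi> \<Longrightarrow>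
        (\<integral>z. - \<i> * w (fst z) (snd z) * complex_of_real (pd \<psi> (1, 0) z)
             + (\<Sum>j\<in>UNIV. G (fst z) (snd z) $ j * complex_of_real (pd \<psi> (0, axis j 1) z))
             + \<i> * b z * w (fst z) (snd z) * complex_of_real (\<psi> z) \<partial>lborel) = 0"
begin

definition F :: "real \<Rightarrow> 'n state" where "F t = state_of (u t, w t)"

text \<open>A representative of the path F that is measurable jointly in time and space, as Fubini
  requires; representatives chosen separately at each time would not be.\<close>

definition H :: "real \<times> (real^'n) \<Rightarrow> (complex^'n) \<times> complex" where
  "H z = (G (fst z) (snd z), \<i> * w (fst z) (snd z))"

lemma H_meas [measurable]: "H \<in> borel_measurable borel"
  using borel_measurable_Pair[OF G_meas borel_measurable_times[OF borel_measurable_const w_meas]]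
  by (simp add: H_def[abs_def])

lemma sqint_H: "sqint (\<lambda>x. H (t, x))"
  unfolding H_def fst_conv snd_conv using uw[of t] by (intro sqint_pair G2) (simp add: in_E_def L2fun_iff)

lemma F_cls: "F t = cls (\<lambda>x. H (t, x))"
  unfolding F_def H_def by (subst state_of_eqI[OF uw]) (use grad G2 in auto)

lemma F_continuous: "continuous_on UNIV F"
proof -
  have "isCont F t" for t
    using curve[of t] unfolding ediff_state(2)[OF uw uw] F_def[symmetric] isCont_def
    by (rule tendsto_norm_zero_cancel[THEN LIM_zero_cancel])
  then show ?thesis by (intro continuous_at_imp_continuous_on ballI)
qed

sublocale driven_path F "damping b" \<beta>
  by (rule driven_path.intro[OF F_continuous damping_bilinear damping_measurable damping_bound \<beta>_int \<beta>_nonneg])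

lemma damping_F: "damping b t (F t) (tens \<phi> e) = - (cls (\<lambda>x. (0, b (t, x) * snd (H (t, x)))) \<bullet> tens \<phi> e)"
  unfolding damping_def F_cls mulop_cls[OF sqint_H b_section b_bound] ..

lemma F_norm_integrable: "set_integrable lborel {s..t} (\<lambda>r. norm (F r))"
  unfolding set_integrable_def
  by (rule borel_integrable_compact[OF compact_Icc]) (intro continuous_intros continuous_on_subset[OF F_cont], auto)

lemma \<beta>_norm_integrable: "set_integrable lborel {s..t} (\<lambda>r. \<beta> r * norm (F r))"
proof -
  obtain m where m: "0 \<le> m" "\<And>r. r \<in> {s..t} \<Longrightarrow> norm (F r) \<le> m" by (rule bounded_on_Icc[OF F_cont, of s t]) blast
  have [measurable]: "(\<lambda>r. norm (F r)) \<in> borel_measurable borel"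
    by (intro borel_measurable_continuous_onI continuous_intros F_cont)
  have [measurable]: "\<beta> \<in> borel_measurable borel" using borel_measurable_integrable[OF \<beta>_int] by simp
  have "integrable lborel (\<lambda>r. m * \<beta> r)" using \<beta>_int by simp
  then show ?thesis unfolding set_integrable_def
  proof (rule Bochner_Integration.integrable_bound)
    have "norm (indicat_real {s..t} r *\<^sub>R (\<beta> r * norm (F r))) \<le> norm (m * \<beta> r)" for r
      using m(2)[of r] m(1) \<beta>_nonneg[of r] mult_right_mono[of "norm (F r)" m "\<beta> r"]
      by (cases "r \<in> {s..t}") (auto simp: abs_mult mult.commute)
    then show "AE r in lborel. norm (indicat_real {s..t} r *\<^sub>R (\<beta> r * norm (F r))) \<le> norm (m * \<beta> r)" by simp
  qed measurable
qed

text \<open>Gathers the space-time pairings that occur in the two weak equations. The spatial factor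
  is only assumed measurable and square integrable, so that both a test function and its derivatives
  may be inserted.\<close>

lemma H_pairing:
  assumes "test_fun \<omega>" "\<phi> \<in> borel_measurable borel" "sqint (\<lambda>x. \<phi> x *\<^sub>R e)"
  shows "integrable lborel (\<lambda>z. (H z \<bullet> e) * (\<omega> (fst z) * \<phi> (snd z)))"
    and "(LINT z|lborel. (H z \<bullet> e) * (\<omega> (fst z) * \<phi> (snd z))) = (LINT t|lborel. (F t \<bullet> tens \<phi> e) * \<omega> t)"
    and "integrable lborel (\<lambda>z. (H z \<bullet> e) * (pd \<omega> 1 (fst z) * \<phi> (snd z)))"
    and "(LINT z|lborel. (H z \<bullet> e) * (pd \<omega> 1 (fst z) * \<phi> (snd z))) = (LINT t|lborel. (F t \<bullet> tens \<phi> e) * pd \<omega> 1 t)"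
    and "integrable lborel (\<lambda>z. ((0 :: complex^'n, b z * snd (H z)) \<bullet> e) * (\<omega> (fst z) * \<phi> (snd z)))"
    and "(LINT z|lborel. ((0 :: complex^'n, b z * snd (H z)) \<bullet> e) * (\<omega> (fst z) * \<phi> (snd z))) = - (LINT t|lborel. damping b t (F t) (tens \<phi> e) * \<omega> t)"
proof -
  obtain K C where K: "compact K" "\<And>x. \<bar>\<omega> x\<bar> \<le> C * indicat_real K x" by (rule test_fun_bounds[OF assms(1)]) blast
  obtain K' C' where K': "compact K'" "\<And>x. \<bar>pd \<omega> 1 x\<bar> \<le> C' * indicat_real K' x" by (rule test_fun_pd_bounds[OF assms(1), of 1]) blast
  note \<omega> = test_fun_measurable[OF assms(1)] test_fun_pd_measurable[OF assms(1), of 1]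
  have n: "norm (cls (\<lambda>x. H (t, x))) \<le> norm (F t)" for t by (simp add: F_cls)
  note 1 = spacetime_pairing[OF H_meas sqint_H n integrable_test_mult[OF F_norm_integrable \<omega>(1) K] \<omega>(1) assms(2,3)]
  note 2 = spacetime_pairing[OF H_meas sqint_H n integrable_test_mult[OF F_norm_integrable \<omega>(2) K'] \<omega>(2) assms(2,3)]
  have bm: "(\<lambda>z. (0 :: complex^'n, b z * snd (H z))) \<in> borel_measurable borel"
    by (intro borel_measurable_Pair borel_measurable_times b_meas snd_measurable H_meas) simp
  have bs: "sqint (\<lambda>x. (0 :: complex^'n, b (t, x) * snd (H (t, x))))" for t
    by (rule sqint_mul[OF sqint_H b_section b_bound])
  have bn: "norm (cls (\<lambda>x. (0 :: complex^'n, b (t, x) * snd (H (t, x))))) \<le> \<beta> t * norm (F t)" for t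
    using bounded_linear_mulop(2)[OF b_section b_bound, of t "F t"] unfolding F_cls mulop_cls[OF sqint_H b_section b_bound] .
  note 3 = spacetime_pairing[OF bm bs bn integrable_test_mult[OF \<beta>_norm_integrable \<omega>(1) K] \<omega>(1) assms(2,3)]
  show "integrable lborel (\<lambda>z. (H z \<bullet> e) * (\<omega> (fst z) * \<phi> (snd z)))"
    and "(LINT z|lborel. (H z \<bullet> e) * (\<omega> (fst z) * \<phi> (snd z))) = (LINT t|lborel. (F t \<bullet> tens \<phi> e) * \<omega> t)"
    using 1 unfolding F_cls .
  show "integrable lborel (\<lambda>z. (H z \<bullet> e) * (pd \<omega> 1 (fst z) * \<phi> (snd z)))"
    and "(LINT z|lborel. (H z \<bullet> e) * (pd \<omega> 1 (fst z) * \<phi> (snd z))) = (LINT t|lborel. (F t \<bullet> tens \<phi> e) * pd \<omega> 1 t)"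
    using 2 unfolding F_cls .
  show "integrable lborel (\<lambda>z. ((0 :: complex^'n, b z * snd (H z)) \<bullet> e) * (\<omega> (fst z) * \<phi> (snd z)))"
    by (rule 3(1))
  show "(LINT z|lborel. ((0 :: complex^'n, b z * snd (H z)) \<bullet> e) * (\<omega> (fst z) * \<phi> (snd z))) = - (LINT t|lborel. damping b t (F t) (tens \<phi> e) * \<omega> t)"
    unfolding 3(2) damping_F by simp
qed

text \<open>The second weak equation is tested with products of a function of t and one of x. Fubini
  reduces it to a scalar weak derivative in time, and \<open>weak_derivative_time\<close> yields the
  integrated form between arbitrary times.\<close>

lemma defect_snd:
  assumes \<phi>: "test_fun \<phi>" and st: "s \<le> t"
  shows "defect s t (tens \<phi> (0, \<zeta>), wave_gen \<phi> (0, \<zeta>)) = 0"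
proof -
  define c where "c r = damping b r (F r) (tens \<phi> (0, \<zeta>)) - F r \<bullet> wave_gen \<phi> (0, \<zeta>)" for r
  have "F t \<bullet> tens \<phi> (0, \<zeta>) - F s \<bullet> tens \<phi> (0, \<zeta>) = (LINT r:{s..t}|lborel. c r)"
  proof (rule weak_derivative_time[OF _ _ _ _ st])
    show "continuous_on UNIV (\<lambda>r. F r \<bullet> tens \<phi> (0, \<zeta>))" by (intro continuous_intros F_cont)
    show "set_integrable lborel {s..t} c" for s t unfolding c_def[abs_def] by (rule defect_integrable)
    show "c \<in> borel_measurable borel" unfolding c_def[abs_def]
      by (intro borel_measurable_diff bilinear_measurable_compose[OF damping_bilinear damping_measurable F_cont]
          borel_measurable_continuous_onI continuous_intros F_cont)
    fix \<omega> :: "real \<Rightarrow> real" assume \<omega>: "test_fun \<omega>"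
    note P = test_fun_prod[OF \<omega> \<phi>]
    note m = test_fun_measurable[OF \<phi>] test_fun_pd_measurable[OF \<phi>]
    define T where "T z = - \<i> * w (fst z) (snd z) * complex_of_real (pd \<omega> 1 (fst z) * \<phi> (snd z))
             + (\<Sum>j\<in>UNIV. G (fst z) (snd z) $ j * complex_of_real (\<omega> (fst z) * pd \<phi> (axis j 1) (snd z)))
             + \<i> * b z * w (fst z) (snd z) * complex_of_real (\<omega> (fst z) * \<phi> (snd z))" for z
    have T0: "(LINT z|lborel. T z) = 0" using weak_w[OF P(1)] unfolding P T_def .
    have Te: "T z \<bullet> \<xi> = - ((H z \<bullet> (0, \<xi>)) * (pd \<omega> 1 (fst z) * \<phi> (snd z)))
        + (\<Sum>j\<in>UNIV. (H z \<bullet> (axis j \<xi>, 0)) * (\<omega> (fst z) * pd \<phi> (axis j 1) (snd z)))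
        + ((0 :: complex^'n, b z * snd (H z)) \<bullet> (0, \<xi>)) * (\<omega> (fst z) * \<phi> (snd z))" for z \<xi>
      unfolding T_def inner_add_left inner_sum_left inner_complex_of_real
      by (simp add: H_def inner_axis mult_ac)
    have i1: "integrable lborel (\<lambda>z. - ((H z \<bullet> (0, \<xi>)) * (pd \<omega> 1 (fst z) * \<phi> (snd z))))" for \<xi>
      by (rule Bochner_Integration.integrable_minus[OF H_pairing(3)[OF \<omega> m(1) sqint_test[OF \<phi>]]])
    have i2: "integrable lborel (\<lambda>z. (H z \<bullet> (axis j \<xi>, 0)) * (\<omega> (fst z) * pd \<phi> (axis j 1) (snd z)))" for j \<xi>
      by (rule H_pairing(1)[OF \<omega> m(2) sqint_test_pd[OF \<phi>]])
    have i3: "integrable lborel (\<lambda>z. ((0 :: complex^'n, b z * snd (H z)) \<bullet> (0, \<xi>)) * (\<omega> (fst z) * \<phi> (snd z)))" for \<xi>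
      by (rule H_pairing(5)[OF \<omega> m(1) sqint_test[OF \<phi>]])
    have i2': "integrable lborel (\<lambda>z. \<Sum>j\<in>UNIV. (H z \<bullet> (axis j \<xi>, 0)) * (\<omega> (fst z) * pd \<phi> (axis j 1) (snd z)))" for \<xi>
      by (rule Bochner_Integration.integrable_sum[OF i2])
    have i: "integrable lborel (\<lambda>z. T z \<bullet> \<xi>)" for \<xi>
      unfolding Te by (rule Bochner_Integration.integrable_add[OF Bochner_Integration.integrable_add[OF i1 i2'] i3])
    obtain K C where K: "compact K" "\<And>x. \<bar>\<omega> x\<bar> \<le> C * indicat_real K x" by (rule test_fun_bounds[OF \<omega>]) blast
    have j: "integrable lborel (\<lambda>r. (F r \<bullet> x) * \<omega> r)" for x
      using integrable_test_mult[OF inner_set_integrable[OF F_cont continuous_on_const] test_fun_measurable[OF \<omega>] K, of x]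
      by (simp add: mult.commute)
    have j': "integrable lborel (\<lambda>r. damping b r (F r) x * \<omega> r)" for x
      using integrable_test_mult[OF \<kappa>_set_integrable[OF continuous_on_const] test_fun_measurable[OF \<omega>] K, of x]
      by (simp add: mult.commute)
    have "0 = (LINT z|lborel. T z \<bullet> \<zeta>)"
      using integral_inner_left[OF integrable_innerI[OF i], of \<zeta>] T0 by simp
    also have "\<dots> = - (LINT z|lborel. (H z \<bullet> (0, \<zeta>)) * (pd \<omega> 1 (fst z) * \<phi> (snd z)))
        + (\<Sum>j\<in>UNIV. LINT z|lborel. (H z \<bullet> (axis j \<zeta>, 0)) * (\<omega> (fst z) * pd \<phi> (axis j 1) (snd z)))
        + (LINT z|lborel. ((0 :: complex^'n, b z * snd (H z)) \<bullet> (0, \<zeta>)) * (\<omega> (fst z) * \<phi> (snd z)))"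
      unfolding Te Bochner_Integration.integral_add[OF Bochner_Integration.integrable_add[OF i1 i2'] i3]
        Bochner_Integration.integral_add[OF i1 i2'] Bochner_Integration.integral_sum[OF i2]
        Bochner_Integration.integral_minus ..
    also have "\<dots> = - (LINT r|lborel. (F r \<bullet> tens \<phi> (0, \<zeta>)) * pd \<omega> 1 r)
        + (\<Sum>j\<in>UNIV. LINT r|lborel. (F r \<bullet> tens (pd \<phi> (axis j 1)) (axis j \<zeta>, 0)) * \<omega> r)
        - (LINT r|lborel. damping b r (F r) (tens \<phi> (0, \<zeta>)) * \<omega> r)"
      unfolding H_pairing(4)[OF \<omega> m(1) sqint_test[OF \<phi>]] H_pairing(2)[OF \<omega> m(2) sqint_test_pd[OF \<phi>]]
        H_pairing(6)[OF \<omega> m(1) sqint_test[OF \<phi>]] by simp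
    also have "(\<Sum>j\<in>UNIV. LINT r|lborel. (F r \<bullet> tens (pd \<phi> (axis j 1)) (axis j \<zeta>, 0)) * \<omega> r)
        = (LINT r|lborel. (F r \<bullet> wave_gen \<phi> (0, \<zeta>)) * \<omega> r)"
      unfolding Bochner_Integration.integral_sum[OF j, symmetric]
      by (simp add: wave_gen_def coupling_def inner_sum_right sum_distrib_right)
    finally have "(LINT r|lborel. (F r \<bullet> tens \<phi> (0, \<zeta>)) * pd \<omega> 1 r)
      = - ((LINT r|lborel. damping b r (F r) (tens \<phi> (0, \<zeta>)) * \<omega> r) - (LINT r|lborel. (F r \<bullet> wave_gen \<phi> (0, \<zeta>)) * \<omega> r))" by simp
    also have "\<dots> = - (LINT r|lborel. c r * \<omega> r)"
      unfolding Bochner_Integration.integral_diff[OF j' j, symmetric] c_def left_diff_distrib ..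
    finally show "(LINT r|lborel. (F r \<bullet> tens \<phi> (0, \<zeta>)) * pd \<omega> 1 r) = - (LINT r|lborel. c r * \<omega> r)" .
  qed
  then show ?thesis by (simp add: defect_def c_def[abs_def] inner_diff_left)
qed

text \<open>The energy controls \<open>u(t)\<close> only modulo constants, so the equation \<open>\<partial>\<^sub>t u = \<i> w\<close> is tested with
  \<open>\<phi>(x - h) - \<phi>(x)\<close>, which has mean zero; dividing by \<open>\<bar>h\<bar>\<close> and letting \<open>h\<close> tend to 0 yields the
  equation for the gradient.\<close>

lemma translation_pairing:
  assumes \<phi>: "test_fun \<phi>"
  shows "(LINT x|lborel. u t x * complex_of_real (\<phi> (x - r *\<^sub>R axis k 1) - \<phi> x)) \<bullet> \<zeta>
    = r * (LINT \<sigma>:{0..1}|lborel. F t \<bullet> tens (\<lambda>x. \<phi> (x - \<sigma> *\<^sub>R r *\<^sub>R axis k 1)) (axis k \<zeta>, 0))"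
proof -
  define h :: "real^'n" where "h = r *\<^sub>R axis k 1"
  define Z where "Z \<sigma> = (LINT x|lborel. (complex_of_real r * G t x $ k) * complex_of_real (\<phi> (x - \<sigma> *\<^sub>R h)))" for \<sigma>
  have t: "test_fun (\<lambda>x. \<phi> (x - \<sigma> *\<^sub>R h))" for \<sigma> using test_fun_translate(1)[OF \<phi>, of "- (\<sigma> *\<^sub>R h)"] by simp
  have "(\<Sum>j\<in>UNIV. complex_of_real (h $ j) * G t x $ j) = (\<Sum>j\<in>UNIV. if j = k then complex_of_real r * G t x $ j else 0)" for x
    by (intro sum.cong refl) (auto simp: h_def axis_def)
  then have sum: "(\<Sum>j\<in>UNIV. complex_of_real (h $ j) * G t x $ j) = complex_of_real r * G t x $ k" for x by simp
  have Gk: "locally_integrable (\<lambda>x. complex_of_real r * G t x $ k)"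
    using grad[of t] by (intro locally_integrable_cmult) (simp add: weak_grad_def)
  have Z: "Z \<sigma> \<bullet> \<xi> = r * (F t \<bullet> tens (\<lambda>x. \<phi> (x - \<sigma> *\<^sub>R h)) (axis k \<xi>, 0))" for \<sigma> \<xi>
  proof -
    have "Z \<sigma> \<bullet> \<xi> = (LINT x|lborel. (complex_of_real r * G t x $ k * complex_of_real (\<phi> (x - \<sigma> *\<^sub>R h))) \<bullet> \<xi>)"
      unfolding Z_def by (rule integral_inner_left[OF integrable_test[OF Gk t], symmetric])
    also have "\<dots> = (LINT x|lborel. r * ((H (t, x) \<bullet> (axis k \<xi>, 0)) * \<phi> (x - \<sigma> *\<^sub>R h)))"
      unfolding inner_complex_of_real by (simp add: H_def inner_axis inner_complex_def algebra_simps)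
    finally show ?thesis by (simp add: F_cls inner_tens[OF sqint_H t])
  qed
  have "integrable lborel (\<lambda>\<sigma>. (indicat_real {0..1} \<sigma> *\<^sub>R Z \<sigma>) \<bullet> \<xi>)" for \<xi>
    unfolding inner_scaleR_left Z real_scaleR_def[symmetric]
    by (rule borel_integrable_compact[OF compact_Icc])
       (intro continuous_intros continuous_on_subset[OF tens_shift_continuous[OF \<phi>]], auto)
  then have "integrable lborel (\<lambda>\<sigma>. indicat_real {0..1} \<sigma> *\<^sub>R Z \<sigma>)"
    by (rule integrable_innerI)
  from integral_inner_left[OF this, of \<zeta>]
  have "(LINT \<sigma>:{0..1}|lborel. Z \<sigma>) \<bullet> \<zeta> = (LINT \<sigma>:{0..1}|lborel. Z \<sigma> \<bullet> \<zeta>)"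
    by (simp add: set_lebesgue_integral_def)
  also have "\<dots> = r * (LINT \<sigma>:{0..1}|lborel. F t \<bullet> tens (\<lambda>x. \<phi> (x - \<sigma> *\<^sub>R h)) (axis k \<zeta>, 0))"
    unfolding Z by (rule set_integral_mult_right)
  finally show ?thesis
    unfolding weak_grad_translation[OF grad \<phi>] sum Z_def[symmetric] h_def[symmetric] .
qed

lemma mean_pairing_bounded_linear:
  assumes \<phi>: "test_fun \<phi>"
  shows "bounded_linear (\<lambda>x. LINT \<sigma>:{0..1}|lborel. x \<bullet> tens (\<lambda>y. \<phi> (y - \<sigma> *\<^sub>R h)) e)"
proof (rule bounded_linear_intro[where K = "norm (tens \<phi> e)"])
  have i: "set_integrable lborel {0..1} (\<lambda>\<sigma>. x \<bullet> tens (\<lambda>y. \<phi> (y - \<sigma> *\<^sub>R h)) e)" for x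
    unfolding set_integrable_def
    by (intro borel_integrable_compact[OF compact_Icc] continuous_intros continuous_on_subset[OF tens_shift_continuous[OF \<phi>]]) auto
  fix x y and c :: real
  show "(LINT \<sigma>:{0..1}|lborel. (x + y) \<bullet> tens (\<lambda>y. \<phi> (y - \<sigma> *\<^sub>R h)) e)
    = (LINT \<sigma>:{0..1}|lborel. x \<bullet> tens (\<lambda>y. \<phi> (y - \<sigma> *\<^sub>R h)) e) + (LINT \<sigma>:{0..1}|lborel. y \<bullet> tens (\<lambda>y. \<phi> (y - \<sigma> *\<^sub>R h)) e)"
    unfolding inner_add_left by (rule set_integral_add(2)[OF i i])
  show "(LINT \<sigma>:{0..1}|lborel. (c *\<^sub>R x) \<bullet> tens (\<lambda>y. \<phi> (y - \<sigma> *\<^sub>R h)) e)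
    = c *\<^sub>R (LINT \<sigma>:{0..1}|lborel. x \<bullet> tens (\<lambda>y. \<phi> (y - \<sigma> *\<^sub>R h)) e)"
    by simp
  have "norm (LINT \<sigma>:{0..1}|lborel. x \<bullet> tens (\<lambda>y. \<phi> (y - \<sigma> *\<^sub>R h)) e)
    \<le> (LINT \<sigma>::real|lborel. indicat_real {0..1} \<sigma> *\<^sub>R (norm x * norm (tens \<phi> e)))"
    unfolding set_lebesgue_integral_def
  proof (rule Bochner_Integration.integral_norm_bound_integral)
    show "integrable lborel (\<lambda>\<sigma>. indicat_real {0..1} \<sigma> *\<^sub>R (x \<bullet> tens (\<lambda>y. \<phi> (y - \<sigma> *\<^sub>R h)) e))"
      using i by (simp add: set_integrable_def)
    show "integrable lborel (\<lambda>\<sigma>::real. indicat_real {0..1} \<sigma> *\<^sub>R (norm x * norm (tens \<phi> e)))"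
      by (rule borel_integrable_compact[OF compact_Icc continuous_on_const])
    fix \<sigma> :: real
    have "\<bar>x \<bullet> tens (\<lambda>y. \<phi> (y - \<sigma> *\<^sub>R h)) e\<bar> \<le> norm x * norm (tens \<phi> e)"
      using Cauchy_Schwarz_ineq2[of x "tens (\<lambda>y. \<phi> (y - \<sigma> *\<^sub>R h)) e"] by (simp add: norm_tens_shift[OF \<phi>])
    then show "norm (indicat_real {0..1} \<sigma> *\<^sub>R (x \<bullet> tens (\<lambda>y. \<phi> (y - \<sigma> *\<^sub>R h)) e))
      \<le> indicat_real {0..1} \<sigma> *\<^sub>R (norm x * norm (tens \<phi> e))" by (auto simp: indicator_def)
  qed
  then show "norm (LINT \<sigma>:{0..1}|lborel. x \<bullet> tens (\<lambda>y. \<phi> (y - \<sigma> *\<^sub>R h)) e) \<le> norm x * norm (tens \<phi> e)" by simp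
qed

text \<open>Pairings of u(t) with a general test function need not be continuous in t, since the
  energy leaves a constant free at each time. With the mean zero function \<open>\<psi>\<close> the
  pairing equals \<open>r * D t\<close> by \<open>translation_pairing\<close>, which depends on the
  gradient alone and is continuous, so \<open>weak_derivative_time\<close> applies.\<close>

lemma translation_derivative:
  fixes r s t :: real and \<zeta> :: complex and k :: 'n
  assumes \<phi>: "test_fun \<phi>" and st: "s \<le> t"
  defines "D q \<equiv> LINT \<sigma>:{0..1}|lborel. F q \<bullet> tens (\<lambda>x. \<phi> (x - \<sigma> *\<^sub>R r *\<^sub>R axis k 1)) (axis k \<zeta>, 0)"
  shows "r * D t - r * D s = (LINT q:{s..t}|lborel. F q \<bullet> tens (\<lambda>x. \<phi> (x - r *\<^sub>R axis k 1) - \<phi> x) (0, \<zeta>))"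
proof (rule weak_derivative_time[OF _ _ _ _ st])
  define \<psi> where "\<psi> x = \<phi> (x - r *\<^sub>R axis k 1) - \<phi> x" for x
  have \<psi>: "test_fun \<psi>"
    unfolding \<psi>_def using test_fun_diff[OF test_fun_translate(1)[OF \<phi>, of "- (r *\<^sub>R axis k 1)"] \<phi>] by simp
  show "continuous_on UNIV (\<lambda>t. r * D t)" unfolding D_def
    by (intro continuous_intros bounded_linear.continuous_on[OF mean_pairing_bounded_linear[OF \<phi>]] F_cont)
  show "set_integrable lborel {s..t} (\<lambda>q. F q \<bullet> tens (\<lambda>x. \<phi> (x - r *\<^sub>R axis k 1) - \<phi> x) (0, \<zeta>))" for s t
    by (intro inner_set_integrable F_cont continuous_on_const)
  show "(\<lambda>q. F q \<bullet> tens (\<lambda>x. \<phi> (x - r *\<^sub>R axis k 1) - \<phi> x) (0, \<zeta>)) \<in> borel_measurable borel"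
    by (intro borel_measurable_continuous_onI continuous_intros F_cont)
  fix \<omega> :: "real \<Rightarrow> real" assume \<omega>: "test_fun \<omega>"
  note P = test_fun_prod[OF \<omega> \<psi>]
  define Z where "Z q = (LINT x|lborel. u q x * complex_of_real (\<psi> x))" for q
  have rD: "Z q \<bullet> \<zeta> = r * D q" for q
    unfolding Z_def \<psi>_def D_def by (rule translation_pairing[OF \<phi>])
  define U where "U z = u (fst z) (snd z) * complex_of_real (pd \<omega> 1 (fst z) * \<psi> (snd z))" for z
  have "integrable lborel U" using integrable_test_pd[OF u_loc P(1), of "(1, 0)"] unfolding P U_def .
  then have U: "integrable (lborel \<Otimes>\<^sub>M lborel) U" by (simp add: lborel_prod)
  have Ux: "(LINT x|lborel. U (q, x)) = Z q * complex_of_real (pd \<omega> 1 q)" for q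
    unfolding Z_def U_def integral_mult_left_zero[symmetric] by (simp add: mult_ac)
  have "(LINT z|lborel. U z) \<bullet> \<zeta> = (LINT q|lborel. Z q * complex_of_real (pd \<omega> 1 q)) \<bullet> \<zeta>"
    using lborel_pair.integral_fst'[OF U] by (simp add: lborel_prod Ux)
  also have "\<dots> = (LINT q|lborel. (Z q * complex_of_real (pd \<omega> 1 q)) \<bullet> \<zeta>)"
    using lborel_pair.integrable_fst'[OF U] unfolding Ux by (rule integral_inner_left[symmetric])
  also have "\<dots> = (LINT q|lborel. r * D q * pd \<omega> 1 q)" unfolding inner_complex_of_real rD ..
  finally have 1: "(LINT z|lborel. U z) \<bullet> \<zeta> = (LINT q|lborel. r * D q * pd \<omega> 1 q)" .
  define Y where "Y z = \<i> * w (fst z) (snd z) * complex_of_real (\<omega> (fst z) * \<psi> (snd z))" for z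
  have Y: "Y z \<bullet> \<xi> = (H z \<bullet> (0, \<xi>)) * (\<omega> (fst z) * \<psi> (snd z))" for z \<xi>
    unfolding Y_def inner_complex_of_real by (simp add: H_def)
  note HP = H_pairing[OF \<omega> test_fun_measurable[OF \<psi>] sqint_test[OF \<psi>]]
  have "(LINT z|lborel. Y z) \<bullet> \<zeta> = (LINT z|lborel. Y z \<bullet> \<zeta>)"
    by (rule integral_inner_left[symmetric], rule integrable_innerI) (unfold Y, rule HP(1))
  also have "\<dots> = (LINT q|lborel. (F q \<bullet> tens \<psi> (0, \<zeta>)) * \<omega> q)" unfolding Y by (rule HP(2))
  finally have 2: "(LINT z|lborel. Y z) \<bullet> \<zeta> = (LINT q|lborel. (F q \<bullet> tens \<psi> (0, \<zeta>)) * \<omega> q)" .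
  have "(LINT z|lborel. U z) = - (LINT z|lborel. Y z)" using weak_u[OF P(1)] unfolding P U_def Y_def .
  with 1 2 show "(LINT q|lborel. r * D q * pd \<omega> 1 q)
    = - (LINT q|lborel. (F q \<bullet> tens (\<lambda>x. \<phi> (x - r *\<^sub>R axis k 1) - \<phi> x) (0, \<zeta>)) * \<omega> q)"
    unfolding \<psi>_def[abs_def] by simp
qed

text \<open>The identity of \<open>translation_derivative\<close> is divided by the step length,
  which then tends to 0: on the left the averaged translates converge to the test state, on the
  right the quotients converge to minus the derivative of \<open>\<phi>\<close>. The damping form
  vanishes because the test state has no second component.\<close>

lemma defect_fst:
  assumes \<phi>: "test_fun \<phi>" and st: "s \<le> t"
  shows "defect s t (tens \<phi> (axis k \<zeta>, 0), wave_gen \<phi> (axis k \<zeta>, 0)) = 0"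
proof -
  define e :: "(complex^'n) \<times> complex" where "e = (axis k \<zeta>, 0)"
  define D where "D m q = (LINT \<sigma>:{0..1}|lborel. F q \<bullet> tens (\<lambda>x. \<phi> (x - \<sigma> *\<^sub>R step m *\<^sub>R axis k 1)) e)" for m q
  have D: "(\<lambda>m. D m q) \<longlonglongrightarrow> F q \<bullet> tens \<phi> e" for q
  proof -
    have "(\<lambda>m. D m q) \<longlonglongrightarrow> (LINT \<sigma>:{0..1::real}|lborel. F q \<bullet> tens \<phi> e)" unfolding D_def
    proof (rule set_integral_Icc_tendsto)
      show "continuous_on {0..1} (\<lambda>\<sigma>. F q \<bullet> tens (\<lambda>x. \<phi> (x - \<sigma> *\<^sub>R step m *\<^sub>R axis k 1)) e)" for m
        by (intro continuous_intros continuous_on_subset[OF tens_shift_continuous[OF \<phi>]]) auto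
      show "\<bar>F q \<bullet> tens (\<lambda>x. \<phi> (x - \<sigma> *\<^sub>R step m *\<^sub>R axis k 1)) e\<bar> \<le> norm (F q) * norm (tens \<phi> e)" for m \<sigma>
        using Cauchy_Schwarz_ineq2[of "F q" "tens (\<lambda>x. \<phi> (x - \<sigma> *\<^sub>R step m *\<^sub>R axis k 1)) e"] by (simp add: norm_tens_shift[OF \<phi>])
      fix \<sigma> :: real
      have "isCont (\<lambda>\<tau>. tens (\<lambda>x. \<phi> (x - \<tau> *\<^sub>R axis k 1)) e) 0"
        using tens_shift_continuous[OF \<phi>, of "axis k 1" e] by (simp add: continuous_on_eq_continuous_at)
      moreover have "(\<lambda>m. \<sigma> * step m) \<longlonglongrightarrow> 0" using tendsto_mult_left[OF step(3), of \<sigma>] by simp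
      ultimately have "(\<lambda>m. tens (\<lambda>x. \<phi> (x - (\<sigma> * step m) *\<^sub>R axis k 1)) e) \<longlonglongrightarrow> tens (\<lambda>x. \<phi> (x - 0 *\<^sub>R axis k 1)) e"
        by (rule isCont_tendsto_compose)
      then show "(\<lambda>m. F q \<bullet> tens (\<lambda>x. \<phi> (x - \<sigma> *\<^sub>R step m *\<^sub>R axis k 1)) e) \<longlonglongrightarrow> F q \<bullet> tens \<phi> e"
        by (intro tendsto_intros) simp
    qed
    then show ?thesis by (simp add: set_lebesgue_integral_def)
  qed
  define Q where "Q m = (1 / step m) *\<^sub>R tens (\<lambda>x. \<phi> (x - step m *\<^sub>R axis k 1) - \<phi> x) (0 :: complex^'n, \<zeta>)" for m
  have Qlim: "Q \<longlonglongrightarrow> - tens (pd \<phi> (axis k 1)) (0, \<zeta>)"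
  proof -
    have t: "test_fun (\<lambda>x. \<phi> (x - step m *\<^sub>R axis k 1))" for m
      using test_fun_translate(1)[OF \<phi>, of "- (step m *\<^sub>R axis k 1)"] by simp
    have "tens (\<lambda>x. \<phi> (x - step m *\<^sub>R axis k 1) - \<phi> x) (0, \<zeta>)
      = tens (\<lambda>x. \<phi> (x + (- step m) *\<^sub>R axis k 1)) (0, \<zeta>) - tens \<phi> (0 :: complex^'n, \<zeta>)" for m
      using cls_diff[OF sqint_test[OF t[of m]] sqint_test[OF \<phi>], of "(0, \<zeta>)" "(0, \<zeta>)"]
      by (simp add: tens_def scaleR_left_diff_distrib)
    then have Q: "Q = (\<lambda>m. - ((1 / - step m) *\<^sub>R (tens (\<lambda>x. \<phi> (x + (- step m) *\<^sub>R axis k 1)) (0, \<zeta>) - tens \<phi> (0, \<zeta>))))"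
      unfolding Q_def by (simp add: fun_eq_iff)
    have e: "\<bar>- step m\<bar> \<le> 1" "- step m \<noteq> 0" for m using step(1,2)[of m] by auto
    have "(\<lambda>m. - step m) \<longlonglongrightarrow> 0" using tendsto_minus[OF step(3)] by simp
    then show ?thesis unfolding Q
      by (intro tendsto_minus tens_quotient_tendsto[OF \<phi>] e)
  qed
  have "D m t - D m s = (LINT q:{s..t}|lborel. F q \<bullet> Q m)" for m
  proof -
    have "(LINT q:{s..t}|lborel. F q \<bullet> Q m)
      = 1 / step m * (LINT q:{s..t}|lborel. F q \<bullet> tens (\<lambda>x. \<phi> (x - step m *\<^sub>R axis k 1) - \<phi> x) (0, \<zeta>))"
      unfolding Q_def inner_scaleR_right by (rule set_integral_mult_right)
    also have "\<dots> = 1 / step m * (step m * D m t - step m * D m s)"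
      unfolding D_def e_def translation_derivative[OF \<phi> st, symmetric] ..
    finally show ?thesis using step(1)[of m] by (simp add: right_diff_distrib)
  qed
  moreover have "(\<lambda>m. LINT q:{s..t}|lborel. F q \<bullet> Q m) \<longlonglongrightarrow> (LINT q:{s..t}|lborel. F q \<bullet> - tens (pd \<phi> (axis k 1)) (0, \<zeta>))"
  proof -
    obtain m where m: "0 \<le> m" "\<And>r. r \<in> {s..t} \<Longrightarrow> norm (F r) \<le> m" by (rule bounded_on_Icc[OF F_cont, of s t]) blast
    obtain B where B: "\<And>n. norm (Q n) \<le> B" using convergent_imp_Bseq[OF convergentI[OF Qlim]] by (auto simp: Bseq_def)
    show ?thesis
    proof (rule set_integral_Icc_tendsto)
      show "continuous_on {s..t} (\<lambda>q. F q \<bullet> Q n)" for n by (intro continuous_intros continuous_on_subset[OF F_cont]) auto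
      show "(\<lambda>n. F q \<bullet> Q n) \<longlonglongrightarrow> F q \<bullet> - tens (pd \<phi> (axis k 1)) (0, \<zeta>)" for q by (intro tendsto_intros Qlim)
      show "\<bar>F q \<bullet> Q n\<bar> \<le> m * B" if "q \<in> {s..t}" for n q
        by (rule order_trans[OF Cauchy_Schwarz_ineq2 mult_mono]) (use m that B in auto)
    qed
  qed
  ultimately have "(\<lambda>m. D m t - D m s) \<longlonglongrightarrow> (LINT q:{s..t}|lborel. F q \<bullet> - tens (pd \<phi> (axis k 1)) (0, \<zeta>))" by simp
  then have "F t \<bullet> tens \<phi> e - F s \<bullet> tens \<phi> e = (LINT q:{s..t}|lborel. F q \<bullet> - tens (pd \<phi> (axis k 1)) (0, \<zeta>))"
    by (rule LIMSEQ_unique[OF tendsto_diff[OF D D]])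
  moreover have "damping b q (F q) (tens \<phi> e) = 0" for q
    unfolding F_cls tens_def damping_cls[OF sqint_H sqint_test[OF \<phi>]] by (simp add: e_def)
  ultimately show ?thesis unfolding e_def[symmetric] defect_def
    by (simp add: inner_diff_left wave_gen_fst[folded e_def] e_def)
qed

text \<open>Every vector e is a sum of vectors \<open>(axis j \<zeta>, 0)\<close> and one vector
  \<open>(0, \<zeta>)\<close>, the defect is additive in e, and the two kinds of vectors are covered
  by \<open>defect_fst\<close> and \<open>defect_snd\<close>.\<close>

sublocale wave_path F "damping b" \<beta>
proof unfold_locales
  fix \<phi> :: "real^'n \<Rightarrow> real" and e :: "(complex^'n) \<times> complex" and s t assume \<phi>: "test_fun \<phi>" and st: "s \<le> (t::real)"
  define \<Lambda> where "\<Lambda> e = defect s t (tens \<phi> e, wave_gen \<phi> e)" for e :: "(complex^'n) \<times> complex"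
  note lin = bounded_linear.linear[OF bounded_linear_defect[OF st]]
  have ta: "tens f (x + y) = tens f x + tens f y" if "\<And>z :: (complex^'n) \<times> complex. sqint (\<lambda>v. f v *\<^sub>R z)" for f :: "real^'n \<Rightarrow> real" and x y :: "(complex^'n) \<times> complex"
    unfolding tens_def scaleR_add_right by (intro cls_add that)
  have add: "\<Lambda> (x + y) = \<Lambda> x + \<Lambda> y" for x y
  proof -
    have "wave_gen \<phi> (x + y) = wave_gen \<phi> x + wave_gen \<phi> y"
      unfolding wave_gen_def by (simp add: linear_add[OF linear_coupling] ta sqint_test_pd[OF \<phi>] sum.distrib)
    then show ?thesis unfolding \<Lambda>_def using linear_add[OF lin, of "(tens \<phi> x, wave_gen \<phi> x)" "(tens \<phi> y, wave_gen \<phi> y)"]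
      by (simp add: ta sqint_test[OF \<phi>])
  qed
  have sum: "\<Lambda> (\<Sum>j\<in>J. x j) = (\<Sum>j\<in>J. \<Lambda> (x j))" if "finite J" "J \<noteq> {}" for J :: "'n set" and x
    using that by (induction rule: finite_ne_induct) (simp_all add: add)
  have "(\<Sum>j\<in>UNIV. (axis j (fst e $ j), 0 :: complex)) = (\<Sum>j\<in>UNIV. axis j (fst e $ j), 0)"
    by (simp add: prod_eq_iff fst_sum snd_sum)
  moreover have "(\<Sum>j\<in>UNIV. axis j (fst e $ j)) = fst e" by (simp add: vec_eq_iff axis_def if_distrib cong: if_cong)
  ultimately have "e = (\<Sum>j\<in>UNIV. (axis j (fst e $ j), 0)) + (0, snd e)" by (simp add: prod_eq_iff)
  then have "\<Lambda> e = \<Lambda> ((\<Sum>j\<in>UNIV. (axis j (fst e $ j), 0)) + (0, snd e))" by (rule arg_cong)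
  also have "\<dots> = (\<Sum>j\<in>UNIV. \<Lambda> (axis j (fst e $ j), 0)) + \<Lambda> (0, snd e)" by (simp only: add sum[OF finite UNIV_not_empty])
  also have "\<dots> = 0" using defect_fst[OF \<phi> st] defect_snd[OF \<phi> st] by (simp add: \<Lambda>_def)
  finally show "(F t - F s) \<bullet> tens \<phi> e = (LINT r:{s..t}|lborel. damping b r (F r) (tens \<phi> e) - F r \<bullet> wave_gen \<phi> e)"
    by (simp add: \<Lambda>_def defect_def)
qed

end

subsection \<open>Wave operators\<close>

lemma damping_zero:
  fixes F :: "('n::finite) state"
  shows "damping (\<lambda>_. 0) s F G = 0"
proof -
  have "cls (\<lambda>x :: real^'n. 0 :: (complex^'n) \<times> complex) = 0" by (rule cls_zero)
  then show ?thesis by (simp add: damping_def mulop_def zero_prod_def)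
qed

text \<open>The coefficient enters the notion of solution only under one integral over space-time,
  where null sets do not matter.\<close>

lemma energy_sol_cong:
  assumes sol: "energy_sol b u w p" and b: "b \<in> borel_measurable borel" "b' \<in> borel_measurable borel"
    and eq: "AE z in lborel. b z = b' z"
  shows "energy_sol b' u w p"
proof -
  have *: "(\<integral>z. - \<i> * w (fst z) (snd z) * complex_of_real (pd \<psi> (1, 0) z)
             + (\<Sum>j\<in>UNIV. G (fst z) (snd z) $ j * complex_of_real (pd \<psi> (0, axis j 1) z))
             + \<i> * b z * w (fst z) (snd z) * complex_of_real (\<psi> z) \<partial>lborel)
       = (\<integral>z. - \<i> * w (fst z) (snd z) * complex_of_real (pd \<psi> (1, 0) z)
             + (\<Sum>j\<in>UNIV. G (fst z) (snd z) $ j * complex_of_real (pd \<psi> (0, axis j 1) z))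
             + \<i> * b' z * w (fst z) (snd z) * complex_of_real (\<psi> z) \<partial>lborel)"
    if \<psi>: "test_fun \<psi>" and wm: "(\<lambda>z. w (fst z) (snd z)) \<in> borel_measurable lborel"
      and Gm: "(\<lambda>z. G (fst z) (snd z)) \<in> borel_measurable lborel"
    for \<psi> and G :: "real \<Rightarrow> real^'a \<Rightarrow> complex^'a"
  proof -
    have Gj: "(\<lambda>z. G (fst z) (snd z) $ j) \<in> borel_measurable borel" for j
      using measurable_compose[OF Gm borel_measurable_continuous_onI[OF continuous_on_component[OF continuous_on_id]]] by simp
    have wm': "(\<lambda>z. w (fst z) (snd z)) \<in> borel_measurable borel" using wm by simp
    have m: "(\<lambda>z. - \<i> * w (fst z) (snd z) * complex_of_real (pd \<psi> (1, 0) z)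
             + (\<Sum>j\<in>UNIV. G (fst z) (snd z) $ j * complex_of_real (pd \<psi> (0, axis j 1) z))
             + \<i> * c z * w (fst z) (snd z) * complex_of_real (\<psi> z)) \<in> borel_measurable borel"
      if "c \<in> borel_measurable borel" for c
      using test_fun_measurable[OF \<psi>] test_fun_pd_measurable[OF \<psi>] wm' Gj that by measurable
    show ?thesis
    proof (rule integral_cong_AE)
      show "AE z in lborel. - \<i> * w (fst z) (snd z) * complex_of_real (pd \<psi> (1, 0) z)
             + (\<Sum>j\<in>UNIV. G (fst z) (snd z) $ j * complex_of_real (pd \<psi> (0, axis j 1) z))
             + \<i> * b z * w (fst z) (snd z) * complex_of_real (\<psi> z)
         = - \<i> * w (fst z) (snd z) * complex_of_real (pd \<psi> (1, 0) z)
             + (\<Sum>j\<in>UNIV. G (fst z) (snd z) $ j * complex_of_real (pd \<psi> (0, axis j 1) z))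
             + \<i> * b' z * w (fst z) (snd z) * complex_of_real (\<psi> z)"
        using eq by (rule eventually_mono) simp
    qed (simp_all only: measurable_lborel1 measurable_lborel2 m b)
  qed
  show ?thesis
    using sol unfolding energy_sol_def
    by (rule ex_forward) (elim conjE, intro conjI;
        (assumption | (intro allI impI, rule trans[OF *[symmetric]], assumption, assumption, assumption, blast)))
qed

lemma (in damped) energy_solD:
  assumes "energy_sol b u w p"
  obtains G where "energy_curve b \<beta> u w G" "enorm (ediff (u 0, w 0) p) = 0"
proof -
  obtain G where G: "(\<lambda>z. w (fst z) (snd z)) \<in> borel_measurable lborel"
    "(\<lambda>z. G (fst z) (snd z)) \<in> borel_measurable lborel" "locally_integrable (\<lambda>z. u (fst z) (snd z))"
    "\<forall>t. in_E (u t, w t) \<and> weak_grad (u t) (G t) \<and> (\<forall>j. L2fun (\<lambda>x. G t x $ j))"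
    "\<forall>t0. ((\<lambda>t. enorm (ediff (u t, w t) (u t0, w t0))) \<longlongrightarrow> 0) (at t0)"
    "\<forall>\<psi>. test_fun \<psi> \<longrightarrow>
        (\<integral>z. u (fst z) (snd z) * complex_of_real (pd \<psi> (1, 0) z) \<partial>lborel)
        = - (\<integral>z. \<i> * w (fst z) (snd z) * complex_of_real (\<psi> z) \<partial>lborel)"
    "\<forall>\<psi>. test_fun \<psi> \<longrightarrow>
        (\<integral>z. - \<i> * w (fst z) (snd z) * complex_of_real (pd \<psi> (1, 0) z)
             + (\<Sum>j\<in>UNIV. G (fst z) (snd z) $ j * complex_of_real (pd \<psi> (0, axis j 1) z))
             + \<i> * b z * w (fst z) (snd z) * complex_of_real (\<psi> z) \<partial>lborel) = 0"
    "enorm (ediff (u 0, w 0) p) = 0"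
    using assms unfolding energy_sol_def by (elim exE conjE) (rule that)
  have "energy_curve b \<beta> u w G"
    by unfold_locales (use G(1-7) in \<open>auto simp: L2fun_iff\<close>)
  then show ?thesis using G(8) by (rule that)
qed

text \<open>Continuity of each single orbit suffices because the group is isometric: the error
  caused by the moving argument has norm \<open>norm (g t - g s)\<close>, whatever the time.\<close>

lemma continuous_wave_group_compose:
  fixes f :: "real \<Rightarrow> real"
  assumes "continuous_on UNIV f" "continuous_on UNIV g"
  shows "continuous_on UNIV (\<lambda>t. wave_group (f t) (g t))"
proof -
  have "isCont (\<lambda>t. wave_group (f t) (g t)) s" for s
  proof -
    have f: "isCont f s" and g: "isCont g s" using assms by (auto simp: continuous_on_eq_continuous_at)
    have "isCont (\<lambda>r. wave_group r (g s)) (f s)"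
      using continuous_wave_group by (auto simp: continuous_on_eq_continuous_at)
    then have "((\<lambda>t. wave_group (f t) (g s)) \<longlongrightarrow> wave_group (f s) (g s)) (at s)"
      using f unfolding isCont_def by (rule isCont_tendsto_compose[unfolded isCont_def])
    moreover have "((\<lambda>t. wave_group (f t) (g t - g s)) \<longlongrightarrow> 0) (at s)"
    proof (rule tendsto_norm_zero_cancel)
      have "((\<lambda>t. norm (g t - g s)) \<longlongrightarrow> 0) (at s)"
        using g unfolding isCont_def by (intro tendsto_norm_zero LIM_zero)
      then show "((\<lambda>t. norm (wave_group (f t) (g t - g s))) \<longlongrightarrow> 0) (at s)" by simp
    qed
    ultimately have "((\<lambda>t. wave_group (f t) (g s) + wave_group (f t) (g t - g s)) \<longlongrightarrow> wave_group (f s) (g s) + 0) (at s)"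
      by (rule tendsto_add)
    then show ?thesis unfolding isCont_def by (simp add: wave_group_add[symmetric])
  qed
  then show ?thesis by (simp add: continuous_at_imp_continuous_on)
qed

section \<open>Asymptotic profiles in both time directions\<close>

text \<open>The state at time 0 from which the free group reaches the state of (u, w) at time
  t.\<close>

definition profile :: "(real \<Rightarrow> real^'n \<Rightarrow> complex) \<Rightarrow> (real \<Rightarrow> real^'n \<Rightarrow> complex) \<Rightarrow> real \<Rightarrow> ('n::finite) state" where
  "profile u w t = wave_group (- t) (state_of (u t, w t))"

lemma profile_0: "profile u w 0 = state_of (u 0, w 0)"
  by (simp add: profile_def wave_group_0)

context damped
begin

text \<open>The form of the generator in the interaction picture. The group acts on y as well, since
  its adjoint on the left factor is the inverse.\<close>

definition k :: "real \<Rightarrow> 'n state \<Rightarrow> 'n state \<Rightarrow> real" where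
  "k r x y = damping b r (wave_group r x) (wave_group r y)"

lemma k_bilinear: "bounded_bilinear (k r)"
  unfolding k_def[abs_def]
  by (rule bounded_bilinear.comp[OF damping_bilinear bounded_linear_wave_group bounded_linear_wave_group])

lemma k_measurable: "(\<lambda>r. k r x y) \<in> borel_measurable borel"
  unfolding k_def
  by (rule bilinear_measurable_compose[OF damping_bilinear damping_measurable continuous_wave_group continuous_wave_group])

lemma k_bound: "\<bar>k r x y\<bar> \<le> \<beta> r * norm x * norm y"
  using damping_bound[of r "wave_group r x" "wave_group r y"] by (simp add: k_def)

lemma k_Imul: "k r (Imul x) y = - k r x (Imul y)"
  by (simp add: k_def Imul_wave_group[symmetric] damping_Imul)

lemma forward: "bilinear_flow gradient_states Imul k \<beta>"
  by (rule bilinear_flow.intro[OF subspace_gradient_states closed_gradient_states skew_Imul Imul_gradient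
      k_bilinear k_measurable k_bound k_Imul \<beta>_int \<beta>_nonneg])

text \<open>Time reversal: if V solves the equation with form k, then \<open>V (- t)\<close> solves
  it with the form reflected in time and negated. Reflection preserves integrability of
  \<open>\<beta>\<close>, so the behaviour at minus infinity is an instance of the forward
  result.\<close>

lemma backward: "bilinear_flow gradient_states Imul (\<lambda>r x y. - k (- r) x y) (\<lambda>r. \<beta> (- r))"
proof (rule bilinear_flow.intro[OF subspace_gradient_states closed_gradient_states skew_Imul Imul_gradient])
  show "bounded_bilinear (\<lambda>x y. - k (- r) x y)" for r
    using bounded_bilinear.comp[OF k_bilinear bounded_linear_minus[OF bounded_linear_ident] bounded_linear_ident, of "- r"]
    unfolding bounded_bilinear.minus_left[OF k_bilinear] .
  have "uminus \<in> borel_measurable (borel :: real measure)" by measurable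
  from measurable_compose[OF this k_measurable]
  show "(\<lambda>r. - k (- r) x y) \<in> borel_measurable borel" for x y by (rule borel_measurable_uminus)
  show "\<bar>- k (- r) x y\<bar> \<le> \<beta> (- r) * norm x * norm y" for r x y using k_bound[of "- r" x y] by simp
  show "- k (- r) (Imul x) y = - (- k (- r) x (Imul y))" for r x y by (simp add: k_Imul)
  show "integrable lborel (\<lambda>r. \<beta> (- r))" using lborel_integrable_real_affine[OF \<beta>_int, of "-1" 0] by simp
  show "0 \<le> \<beta> (- r)" for r by (rule \<beta>_nonneg)
qed

end

context energy_curve
begin

lemma profile_F: "profile u w t = wave_group (- t) (F t)" "wave_group t (profile u w t) = F t"
  using wave_group_inverse[of "- t" "F t"] by (simp_all add: profile_def F_def)

lemma profile_props:
  "continuous_on UNIV (profile u w)" "profile u w t \<in> gradient_states"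
  "s \<le> t \<Longrightarrow> (profile u w t - profile u w s) \<bullet> q = (LINT r:{s..t}|lborel. k r (profile u w r) q)"
proof -
  show "continuous_on UNIV (profile u w)"
    unfolding profile_F(1)[abs_def] by (intro continuous_wave_group_compose continuous_intros F_cont)
  show "profile u w t \<in> gradient_states"
    unfolding profile_def by (intro wave_group_gradient state_of_gradient uw)
  show "(profile u w t - profile u w s) \<bullet> q = (LINT r:{s..t}|lborel. k r (profile u w r) q)" if "s \<le> t"
    using interaction[OF that] unfolding profile_F(1)[symmetric] k_def profile_F(2) .
qed

lemma profile_forward: "bilinear_flow.sol gradient_states k (profile u w)"
  unfolding bilinear_flow.sol_def[OF forward] using profile_props by blast

lemma profile_backward: "bilinear_flow.sol gradient_states (\<lambda>r x y. - k (- r) x y) (\<lambda>t. profile u w (- t))"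
  unfolding bilinear_flow.sol_def[OF backward]
proof (intro conjI allI impI)
  show "continuous_on UNIV (\<lambda>t. profile u w (- t))"
    by (rule continuous_on_compose2[OF profile_props(1)]) (auto intro!: continuous_on_minus continuous_on_id)
  show "profile u w (- t) \<in> gradient_states" for t by (rule profile_props(2))
  fix s t :: real and q :: "'n state" assume st: "s \<le> t"
  have "(profile u w (- t) - profile u w (- s)) \<bullet> q = - ((profile u w (- s) - profile u w (- t)) \<bullet> q)"
    by (simp add: inner_diff_left)
  also have "\<dots> = - (LINT r|lborel. indicat_real {-t..-s} r *\<^sub>R k r (profile u w r) q)"
    using profile_props(3)[of "- t" "- s" q] st by (simp add: set_lebesgue_integral_def)
  also have "\<dots> = - (LINT r|lborel. indicat_real {-t..-s} (- r) *\<^sub>R k (- r) (profile u w (- r)) q)"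
    using lborel_integral_real_affine[of "-1" "\<lambda>r. indicat_real {-t..-s} r *\<^sub>R k r (profile u w r) q" 0] by simp
  also have "\<dots> = (LINT r:{s..t}|lborel. - k (- r) (profile u w (- r)) q)"
  proof -
    have "indicat_real {-t..-s} (- r) = indicat_real {s..t} r" for r by (auto simp: indicator_def)
    then show ?thesis unfolding set_lebesgue_integral_def by simp
  qed
  finally show "(profile u w (- t) - profile u w (- s)) \<bullet> q = \<dots>" .
qed

end

lemma (in damped) asymptotic_profiles:
  "\<exists>W. hiso gradient_states Imul W \<and> (\<forall>u w G. energy_curve b \<beta> u w G \<longrightarrow> (profile u w \<longlongrightarrow> W (state_of (u 0, w 0))) at_top)"
  "\<exists>W. hiso gradient_states Imul W \<and> (\<forall>u w G. energy_curve b \<beta> u w G \<longrightarrow> (profile u w \<longlongrightarrow> W (state_of (u 0, w 0))) at_bot)"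
proof -
  obtain W where "hiso gradient_states Imul W" and W: "\<And>V. bilinear_flow.sol gradient_states k V \<Longrightarrow> (V \<longlongrightarrow> W (V 0)) at_top"
    using bilinear_flow.scattering_operator[OF forward] by blast
  moreover have "(profile u w \<longlongrightarrow> W (state_of (u 0, w 0))) at_top" if "energy_curve b \<beta> u w G" for u w G
    using W[OF energy_curve.profile_forward[OF that]] by (simp add: profile_0)
  ultimately show "\<exists>W. hiso gradient_states Imul W \<and> (\<forall>u w G. energy_curve b \<beta> u w G \<longrightarrow> (profile u w \<longlongrightarrow> W (state_of (u 0, w 0))) at_top)"
    by blast
  obtain W where "hiso gradient_states Imul W" and W: "\<And>V. bilinear_flow.sol gradient_states (\<lambda>r x y. - k (- r) x y) V \<Longrightarrow> (V \<longlongrightarrow> W (V 0)) at_top"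
    using bilinear_flow.scattering_operator[OF backward] by blast
  moreover have "(profile u w \<longlongrightarrow> W (state_of (u 0, w 0))) at_bot" if "energy_curve b \<beta> u w G" for u w G
    using W[OF energy_curve.profile_backward[OF that]] by (simp add: profile_0 filterlim_at_bot_mirror)
  ultimately show "\<exists>W. hiso gradient_states Imul W \<and> (\<forall>u w G. energy_curve b \<beta> u w G \<longrightarrow> (profile u w \<longlongrightarrow> W (state_of (u 0, w 0))) at_bot)"
    by blast
qed

lemma free_profile:
  assumes "energy_sol (\<lambda>_. 0) v y q" and q: "in_E q"
  shows "in_E (v t, y t)" "profile v y t = state_of q"
proof -
  interpret D: damped "\<lambda>_. 0 :: complex" "\<lambda>_. 0" by unfold_locales auto
  obtain G where G: "energy_curve (\<lambda>_. 0) (\<lambda>_. 0) v y G" and 0: "enorm (ediff (v 0, y 0) q) = 0"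
    by (rule D.energy_solD[OF assms(1)])
  interpret energy_curve "\<lambda>_. 0" "\<lambda>_. 0" v y G by (rule G)
  show "in_E (v t, y t)" by (rule uw)
  have eq: "profile v y t = profile v y s" if "s \<le> t" for s t
  proof -
    have "(profile v y t - profile v y s) \<bullet> (profile v y t - profile v y s) = 0"
      using profile_props(3)[OF that] by (simp add: D.k_def damping_zero)
    then show ?thesis by simp
  qed
  have "profile v y t = profile v y 0" using eq[of 0 t] eq[of t 0] by (cases "0 \<le> t") auto
  also have "\<dots> = state_of q" using 0 by (simp add: profile_0 ediff_state uw q)
  finally show "profile v y t = state_of q" .
qed

section \<open>From states back to energy pairs\<close>

text \<open>A state has many energy pairs above it, for instance because a constant may be added to
  the potential. The arbitrary choice makes the lift linear only up to energy distance 0, which is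
  the sense in which \<open>E_iso\<close> understands linearity.\<close>

definition lift_E :: "('n state \<Rightarrow> 'n state) \<Rightarrow> ('n::finite) epair \<Rightarrow> 'n epair" where
  "lift_E W p = (SOME r. in_E r \<and> state_of r = W (state_of p))"

lemma lift_E:
  assumes W: "hiso gradient_states Imul W" and p: "in_E p"
  shows "in_E (lift_E W p)" "state_of (lift_E W p) = W (state_of p)"
proof -
  have "W (state_of p) \<in> gradient_states" using W state_of_gradient[OF p] by (simp add: hiso_def)
  then have "in_E (lift_E W p) \<and> state_of (lift_E W p) = W (state_of p)"
    unfolding lift_E_def by (rule someI_ex[OF state_of_surj])
  then show "in_E (lift_E W p)" "state_of (lift_E W p) = W (state_of p)" by auto
qed

lemma E_iso_lift:
  assumes W: "hiso (gradient_states :: ('n::finite) state set) Imul W" shows "E_iso (lift_E W)"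
proof -
  note L = lift_E[OF W]
  let ?X = "gradient_states :: 'n state set"
  have cX: "cmul a x \<in> ?X" if "x \<in> ?X" for a x
    unfolding cmul_def by (intro subspace_add[OF subspace_gradient_states] subspace_scale[OF subspace_gradient_states] that Imul_gradient)
  have c: "W (cmul a x) = cmul a (W x)" if "x \<in> ?X" for a x
    using W that subspace_scale[OF subspace_gradient_states that] subspace_scale[OF subspace_gradient_states Imul_gradient[OF that]] Imul_gradient[OF that]
    by (simp add: hiso_def cmul_def)
  have add: "W (x + y) = W x + W y" if "x \<in> ?X" "y \<in> ?X" for x y using W that by (simp add: hiso_def)
  show ?thesis unfolding E_iso_def
  proof (intro conjI allI impI)
    show "in_E (lift_E W p)" if "in_E p" for p by (rule L(1)[OF that])
    show "enorm (ediff (lift_E W (elin a p c q)) (elin a (lift_E W p) c (lift_E W q))) = 0" if "in_E p" "in_E q" for p q a c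
      by (simp add: ediff_state elin_state L that add c cX state_of_gradient)
    obtain C where C: "\<And>x. x \<in> ?X \<Longrightarrow> norm (W x) \<le> C * norm x" using W unfolding hiso_def by blast
    show "\<exists>C. \<forall>p. in_E p \<longrightarrow> enorm (lift_E W p) \<le> C * enorm p"
      by (rule exI[of _ C]) (simp add: enorm_eq_norm L C state_of_gradient)
    obtain c where c: "c > 0" "\<And>x. x \<in> ?X \<Longrightarrow> c * norm x \<le> norm (W x)" using W unfolding hiso_def by blast
    show "\<exists>c>0. \<forall>p. in_E p \<longrightarrow> c * enorm p \<le> enorm (lift_E W p)"
      by (rule exI[of _ c]) (simp add: enorm_eq_norm L c state_of_gradient)
    show "\<exists>p. in_E p \<and> enorm (ediff (lift_E W p) q) = 0" if q: "in_E q" for q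
    proof -
      obtain x where x: "x \<in> ?X" "W x = state_of q" using W state_of_gradient[OF q] unfolding hiso_def by blast
      obtain p where p: "in_E p" "state_of p = x" using state_of_surj[OF x(1)] by blast
      have "enorm (ediff (lift_E W p) q) = 0" using p x q by (simp add: ediff_state L)
      then show ?thesis using p(1) by blast
    qed
  qed
qed

text \<open>The free group is isometric, so the energy distance of the two solutions at time t
  equals the distance of their profiles; that of the free solution is constantly the limit of the
  other.\<close>

lemma scattering:
  assumes W: "hiso gradient_states Imul W" and p: "in_E p" and uw: "\<And>t. in_E (u t, w t)"
    and 0: "enorm (ediff (u 0, w 0) p) = 0"
    and lim: "(profile u w \<longlongrightarrow> W (state_of (u 0, w 0))) A"
    and free: "energy_sol (\<lambda>_. 0) v y (lift_E W p)"
  shows "((\<lambda>t. enorm (ediff (u t, w t) (v t, y t))) \<longlongrightarrow> 0) A"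
proof -
  note f = free_profile[OF free lift_E(1)[OF W p]]
  have "state_of (u 0, w 0) = state_of p" using 0 by (simp add: ediff_state uw p)
  then have "(profile u w \<longlongrightarrow> state_of (lift_E W p)) A" using lim lift_E(2)[OF W p] by simp
  then have "((\<lambda>t. norm (profile u w t - state_of (lift_E W p))) \<longlongrightarrow> 0) A"
    by (intro tendsto_norm_zero LIM_zero)
  moreover have "norm (profile u w t - state_of (lift_E W p)) = enorm (ediff (u t, w t) (v t, y t))" for t
  proof -
    have "profile u w t - state_of (lift_E W p) = wave_group (- t) (state_of (u t, w t) - state_of (v t, y t))"
      unfolding f(2)[of t, symmetric] profile_def
      by (rule linear_diff[OF bounded_linear.linear[OF bounded_linear_wave_group], symmetric])
    then show ?thesis by (simp add: ediff_state uw f)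
  qed
  ultimately show ?thesis by simp
qed

theorem theorem1:
  fixes b :: "real \<times> (real^'n) \<Rightarrow> complex"
  assumes "CARD('n) \<ge> 2"
    and "b \<in> borel_measurable lborel"
    and "\<exists>M. AE z in lborel. cmod (b z) \<le> M"
    and "\<exists>\<beta>::real \<Rightarrow> real. integrable lborel \<beta> \<and> (AE z in lborel. cmod (b z) \<le> \<beta> (fst z))"
  shows "\<exists>Wp Wm :: 'n epair \<Rightarrow> 'n epair. E_iso Wp \<and> E_iso Wm
    \<and> (\<forall>p u w. in_E p \<longrightarrow> energy_sol b u w p \<longrightarrow>
         (\<forall>v y. energy_sol (\<lambda>_. 0) v y (Wp p) \<longrightarrow>
            ((\<lambda>t. enorm (ediff (u t, w t) (v t, y t))) \<longlongrightarrow> 0) at_top)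
       \<and> (\<forall>v y. energy_sol (\<lambda>_. 0) v y (Wm p) \<longrightarrow>
            ((\<lambda>t. enorm (ediff (u t, w t) (v t, y t))) \<longlongrightarrow> 0) at_bot))"
proof -
  obtain \<beta> :: "real \<Rightarrow> real" where \<beta>: "integrable lborel \<beta>" "AE z in lborel. cmod (b z) \<le> \<beta> (fst z)"
    using assms(4) by blast
  have b [measurable]: "b \<in> borel_measurable borel" using assms(2) by simp
  \<comment> \<open>Setting the coefficient to 0 on the null set where the bound fails makes the
    bound hold at every point, as \<open>damped\<close> demands, and leaves the solutions unchanged.
    The absolute value makes the dominating function nonnegative everywhere.\<close>
  define b' where "b' z = (if cmod (b z) \<le> \<bar>\<beta> (fst z)\<bar> then b z else 0)" for z
  have "\<beta> \<in> borel_measurable borel" using borel_measurable_integrable[OF \<beta>(1)] by simp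
  then have [measurable]: "(\<lambda>z :: real \<times> (real^'n). \<beta> (fst z)) \<in> borel_measurable borel"
    by (rule measurable_compose[OF borel_measurable_continuous_onI[OF continuous_on_fst[OF continuous_on_id]]])
  have b': "b' \<in> borel_measurable borel" unfolding b'_def[abs_def] by measurable
  have eq: "AE z in lborel. b z = b' z" using \<beta>(2) by (auto simp: b'_def elim: eventually_mono)
  interpret damped b' "\<lambda>s. \<bar>\<beta> s\<bar>"
    by unfold_locales (use b' \<beta>(1) in \<open>auto simp: b'_def\<close>)
  obtain Wp :: "'n state \<Rightarrow> 'n state" where Wp: "hiso gradient_states Imul Wp"
    "\<And>u w G. energy_curve b' (\<lambda>s. \<bar>\<beta> s\<bar>) u w G \<Longrightarrow> (profile u w \<longlongrightarrow> Wp (state_of (u 0, w 0))) at_top"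
    using asymptotic_profiles(1) by blast
  obtain Wm :: "'n state \<Rightarrow> 'n state" where Wm: "hiso gradient_states Imul Wm"
    "\<And>u w G. energy_curve b' (\<lambda>s. \<bar>\<beta> s\<bar>) u w G \<Longrightarrow> (profile u w \<longlongrightarrow> Wm (state_of (u 0, w 0))) at_bot"
    using asymptotic_profiles(2) by blast
  show ?thesis
  proof (rule exI[of _ "lift_E Wp"], rule exI[of _ "lift_E Wm"], intro conjI allI impI)
    show "E_iso (lift_E Wp)" "E_iso (lift_E Wm)" by (rule E_iso_lift[OF Wp(1)], rule E_iso_lift[OF Wm(1)])
    fix p :: "'n epair" and u w v y assume p: "in_E p" and sol: "energy_sol b u w p"
    obtain G where G: "energy_curve b' (\<lambda>s. \<bar>\<beta> s\<bar>) u w G" and 0: "enorm (ediff (u 0, w 0) p) = 0"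
      by (rule energy_solD[OF energy_sol_cong[OF sol b b' eq]])
    note uw = energy_curve.uw[OF G]
    show "((\<lambda>t. enorm (ediff (u t, w t) (v t, y t))) \<longlongrightarrow> 0) at_top" if "energy_sol (\<lambda>_. 0) v y (lift_E Wp p)"
      by (rule scattering[OF Wp(1) p uw 0 Wp(2)[OF G] that])
    show "((\<lambda>t. enorm (ediff (u t, w t) (v t, y t))) \<longlongrightarrow> 0) at_bot" if "energy_sol (\<lambda>_. 0) v y (lift_E Wm p)"
      by (rule scattering[OF Wm(1) p uw 0 Wm(2)[OF G] that])
  qed
qed

end
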